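(* Let $f\in\mathcal{P}_n$ and set $g=\|f\|_\infty\chi_{rB_2^n}$ where $r>0$ is such that $\int g=1$. Suppose that either $p\in[0,1]$, or $p\in[-1,0)$ and $n/|p|\in\mathbb{N}$. Let $C$ be an unconditional convex body in $\mathbb{R}^m$, $m\ge1$. (i) If $p>-1$, then $|Z^\diamondsuit_{p,C}(f)|\le|Z^\diamondsuit_{p,C}(g)|$. (ii) If $p\in[-1,0)$ (with $n/|p|\in\mathbb{N}$), $\alpha>0$ and $N\ge n+1$, then $\mathbb{E}|\mathcal{I}^\alpha_{|p|,N}(f)|\le\mathbb{E}|\mathcal{I}^\alpha_{|p|,N}(g)|$. (iii) Let $N>n$, $\mathcal{F}=(f_{ij})_{i\in[N],j\in[m_i]}\subseteq\mathcal{P}_n$ and $\mathcal{G}=(g_{ij})$ with $g_{ij}=\|f_{ij}\|_\infty\chi_{r_{ij}B_2^n}$, $r_{ij}>0$ chosen so that $\int g_{ij}=1$. Let $\mathcal{C}=(C_1,\dots,C_N)$ where each $C_i$ is an unconditional convex body in $\mathbb{R}^{m_i}$, $m_i\ge1$, and in the case $p<0$ assume $m_i\ge n+1$ for all $i$. Then $\mathbb{E}|\mathcal{Z}^\diamondsuit_{p,\mathcal{C}}(\mathcal{F})|\le\mathbb{E}|\mathcal{Z}^\diamondsuit_{p,\mathcal{C}}(\mathcal{G})|$.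
   Context: $\mathcal{P}_n$ is the set of measurable $f:\mathbb{R}^n\to[0,\infty)$ with $\int f=1$ and $\|f\|_\infty<\infty$ (essential supremum). A convex body $C\subseteq\mathbb{R}^m$ (compact convex with nonempty interior) is unconditional if it is invariant under each reflection $(y_1,\dots,y_k,\dots,y_m)\mapsto(y_1,\dots,-y_k,\dots,y_m)$. Star-shaped sets are given by radial functions $\rho(K,u)\in[0,\infty]$ on $S^{n-1}$, with volume $|K|=\omega_n\int_{S^{n-1}}\rho(K,u)^nd\sigma(u)$. $h(C,y)=\sup_{c\in C}\langle c,y\rangle$; convention $0^q=+\infty$ for $q<0$. For $p\ne0$: $\rho^{-p}(Z^\diamondsuit_{p,C}(f),u)=\int_{(\mathbb{R}^n)^m}h^p(C,(\langle x_i,u\rangle)_{i=1}^m)\prod_{i=1}^mf(x_i)\,d\overline{x}$; for $p=0$: $\log\rho(Z^\diamondsuit_{0,C}(f),u)=-\int_{(\mathbb{R}^n)^m}\log h(C,(\langle x_i,u\rangle)_{i=1}^m)\prod_{i=1}^mf(x_i)\,d\overline{x}$. $\rho^{|p|}(\mathcal{I}^\alpha_{|p|,N}(f),u)=\frac1N\sum_{i=1}^N(\langle X_i,u\rangle^2+\alpha^2\|u\|_2^2)^{-|p|/2}$ with $X_1,\dots,X_N$ i.i.d. with density $f$. For $\mathcal{C}=(C_1,\dots,C_N)$ and a family $\mathcal{F}=(f_{ij})$, let $X_{ij}$ be independent with densities $f_{ij}$ and ${\bf X}_i^Tu=(\langle X_{ij},u\rangle)_{j=1}^{m_i}$; for $p\ne0$,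 $\rho^{-p}(\mathcal{Z}^\diamondsuit_{p,\mathcal{C}}(\mathcal{F}),u)=\frac1N\sum_{i=1}^Nh^p(C_i,{\bf X}_i^Tu)$, and for $p=0$, $\rho^{-N}(\mathcal{Z}^\diamondsuit_{0,\mathcal{C}}(\mathcal{F}),u)=\prod_{i=1}^Nh(C_i,{\bf X}_i^Tu)$. *)

theory Defs
  imports "HOL-Analysis.Analysis" "HOL-Probability.Essential_Supremum"
begin

(* R^n is modelled by a Euclidean space type 'a with n = DIM('a).
   R^m (m a natural number, possibly varying with an index) is modelled by
   functions  nat => real  vanishing at coordinates k >= m. *)

definition in_Pn :: "('a::euclidean_space \<Rightarrow> real) \<Rightarrow> bool" where
  "in_Pn f \<longleftrightarrow> f \<in> borel_measurable lebesgue \<and> (\<forall>x. 0 \<le> f x) \<and>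
     (\<integral>\<^sup>+x. ennreal (f x) \<partial>lebesgue) = 1 \<and>
     esssup lebesgue (\<lambda>x. ereal (f x)) < \<infinity>"

definition linf_norm :: "('a::euclidean_space \<Rightarrow> real) \<Rightarrow> real" where
  "linf_norm f = real_of_ereal (esssup lebesgue (\<lambda>x. ereal (f x)))"

definition ball_rearr :: "('a::euclidean_space \<Rightarrow> real) \<Rightarrow> real \<Rightarrow> 'a \<Rightarrow> real" where
  "ball_rearr f r = (\<lambda>x. linf_norm f * indicator (cball 0 r) x)"

definition in_Rm :: "nat \<Rightarrow> (nat \<Rightarrow> real) \<Rightarrow> bool" where
  "in_Rm m y \<longleftrightarrow> (\<forall>k\<ge>m. y k = 0)"

definition convex_body_Rm :: "nat \<Rightarrow> (nat \<Rightarrow> real) set \<Rightarrow> bool" where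
  "convex_body_Rm m C \<longleftrightarrow>
     (\<forall>y\<in>C. in_Rm m y) \<and> compact C \<and>
     (\<forall>x\<in>C. \<forall>y\<in>C. \<forall>t\<in>{0..1}. (\<lambda>k. (1 - t) * x k + t * y k) \<in> C) \<and>
     (\<exists>x e. in_Rm m x \<and> 0 < e \<and>
        (\<forall>y. in_Rm m y \<and> (\<Sum>k<m. (y k - x k)\<^sup>2) < e\<^sup>2 \<longrightarrow> y \<in> C))"

definition unconditional_body :: "nat \<Rightarrow> (nat \<Rightarrow> real) set \<Rightarrow> bool" where
  "unconditional_body m C \<longleftrightarrow> convex_body_Rm m C \<and>
     (\<forall>y\<in>C. \<forall>k<m. y(k := - y k) \<in> C)"

definition supp_fun :: "nat \<Rightarrow> (nat \<Rightarrow> real) set \<Rightarrow> (nat \<Rightarrow> real) \<Rightarrow> real" where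
  "supp_fun m C y = Sup ((\<lambda>c. \<Sum>k<m. c k * y k) ` C)"

definition epow :: "ennreal \<Rightarrow> real \<Rightarrow> ennreal" where
  "epow x q =
    (if x = \<infinity> then (if 0 < q then \<infinity> else if q < 0 then 0 else 1)
     else if x = 0 then (if q < 0 then \<infinity> else if 0 < q then 0 else 1)
     else ennreal (enn2real x powr q))"

definition star_set :: "('a::euclidean_space \<Rightarrow> ennreal) \<Rightarrow> 'a set" where
  "star_set \<rho> = {t *\<^sub>R u | t u. u \<in> sphere 0 1 \<and> 0 \<le> t \<and> ennreal t \<le> \<rho> u}"

definition star_vol :: "('a::euclidean_space \<Rightarrow> ennreal) \<Rightarrow> ennreal" where
  "star_vol \<rho> = emeasure lebesgue (star_set \<rho>)"

definition Z_rad :: "real \<Rightarrow> nat \<Rightarrow> (nat \<Rightarrow> real) set \<Rightarrow> ('a::euclidean_space \<Rightarrow> real) \<Rightarrow> 'a \<Rightarrow> ennreal" where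
  "Z_rad p m C f u =
    (let h = (\<lambda>x::nat \<Rightarrow> 'a. supp_fun m C (\<lambda>k. x k \<bullet> u));
         dens = (\<lambda>x::nat \<Rightarrow> 'a. \<Prod>k<m. ennreal (f (x k)));
         M = PiM {..<m} (\<lambda>_. lebesgue)
     in if p \<noteq> 0 then
          epow (\<integral>\<^sup>+x. epow (ennreal (h x)) p * dens x \<partial>M) (- 1 / p)
        else
          (let P = (\<integral>\<^sup>+x. ennreal (max 0 (ln (h x))) * dens x \<partial>M);
               Q = (\<integral>\<^sup>+x. (if h x = 0 then \<infinity> else ennreal (max 0 (- ln (h x)))) * dens x \<partial>M)
           in if P = \<infinity> \<and> Q = \<infinity> then 1
              else if P = \<infinity> then 0
              else if Q = \<infinity> then \<infinity>
              else ennreal (exp (enn2real Q - enn2real P))))"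

definition Z_vol :: "real \<Rightarrow> nat \<Rightarrow> (nat \<Rightarrow> real) set \<Rightarrow> ('a::euclidean_space \<Rightarrow> real) \<Rightarrow> ennreal" where
  "Z_vol p m C f = star_vol (Z_rad p m C f)"

definition I_rad :: "real \<Rightarrow> real \<Rightarrow> nat \<Rightarrow> (nat \<Rightarrow> 'a::euclidean_space) \<Rightarrow> 'a \<Rightarrow> ennreal" where
  "I_rad q \<alpha> N X u =
     epow (ennreal (1 / real N) *
           (\<Sum>i<N. epow (ennreal ((X i \<bullet> u)\<^sup>2 + \<alpha>\<^sup>2 * (norm u)\<^sup>2)) (- q / 2))) (1 / q)"

definition I_exp_vol :: "real \<Rightarrow> real \<Rightarrow> nat \<Rightarrow> ('a::euclidean_space \<Rightarrow> real) \<Rightarrow> ennreal" where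
  "I_exp_vol q \<alpha> N f =
     (\<integral>\<^sup>+X. star_vol (I_rad q \<alpha> N X) * (\<Prod>i<N. ennreal (f (X i)))
        \<partial>PiM {..<N} (\<lambda>_. lebesgue))"

definition idx :: "nat \<Rightarrow> (nat \<Rightarrow> nat) \<Rightarrow> (nat \<times> nat) set" where
  "idx N m = (SIGMA i:{..<N}. {..<m i})"

definition ZZ_rad :: "real \<Rightarrow> nat \<Rightarrow> (nat \<Rightarrow> nat) \<Rightarrow> (nat \<Rightarrow> (nat \<Rightarrow> real) set)
    \<Rightarrow> (nat \<times> nat \<Rightarrow> 'a::euclidean_space) \<Rightarrow> 'a \<Rightarrow> ennreal" where
  "ZZ_rad p N m Cs X u =
    (let h = (\<lambda>i. supp_fun (m i) (Cs i) (\<lambda>j. X (i, j) \<bullet> u))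
     in if p \<noteq> 0 then
          epow (ennreal (1 / real N) * (\<Sum>i<N. epow (ennreal (h i)) p)) (- 1 / p)
        else epow (\<Prod>i<N. ennreal (h i)) (- 1 / real N))"

definition ZZ_exp_vol :: "real \<Rightarrow> nat \<Rightarrow> (nat \<Rightarrow> nat) \<Rightarrow> (nat \<Rightarrow> (nat \<Rightarrow> real) set)
    \<Rightarrow> (nat \<Rightarrow> nat \<Rightarrow> 'a::euclidean_space \<Rightarrow> real) \<Rightarrow> ennreal" where
  "ZZ_exp_vol p N m Cs F =
     (\<integral>\<^sup>+X. star_vol (ZZ_rad p N m Cs X) * (\<Prod>ij\<in>idx N m. ennreal (F (fst ij) (snd ij) (X ij)))
        \<partial>PiM (idx N m) (\<lambda>_. lebesgue))"

end

theory Submission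
  imports Defs "HOL-Probability.Probability_Measure" "HOL-Complex_Analysis.Great_Picard"
begin

text \<open>
  The heart is a rearrangement inequality: if \<open>g\<^sub>l\<close> are positively homogeneous convex functions of
  \<open>(norm u, x\<^sub>j \<bullet> u)\<close> that are monotone in the moduli of their arguments, and \<open>\<phi>\<^sub>l\<close> are decreasing, then
  \<open>\<integral>\<Prod>\<^sub>l \<phi>\<^sub>l(g\<^sub>l) du\<close>, integrated against \<open>\<Prod>\<^sub>j f\<^sub>j(x\<^sub>j)\<close>, is largest when each density \<open>f\<^sub>j\<close> is replaced
  by the uniform density on a ball with the same supremum. By layer cake it suffices to treat volumes of
  sets \<open>{u. g\<^sub>l \<le> s\<^sub>l}\<close>. As a function of the coordinates of the \<open>x\<^sub>j\<close> in a fixed direction, the volume is even and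
  log-concave by Prekopa-Leindler, so sliding intervals to the centre shows that Steiner symmetrization
  increases the functional. Minimising second moments over the closure of the orbit under symmetrizations
  (Arzela-Ascoli) gives radial densities, and a bathtub argument replaces those by balls.

  The volumes in the theorem reduce to this inequality as follows. For \<open>p < 0\<close> with \<open>k = n / |p|\<close> integral,
  \<open>\<rho>\<^sup>n\<close> is the \<open>k\<close>-th power of a sum or an integral of \<open>h\<^sup>p\<close>, which expands into products over
  independent copies. For \<open>p > 0\<close>, \<open>|K|\<close> is a multiple of \<open>\<integral>exp(-\<rho>\<^sup>-\<^sup>p)\<close>; when \<open>\<rho>\<^sup>-\<^sup>p\<close> is itself an expectation,
  \<open>exp(-E h\<^sup>p)\<close> is the limit of \<open>(E exp(-h\<^sup>p/N))\<^sup>N\<close>. For \<open>p = 0\<close> the empirical body is covered by the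
  same expansion with \<open>p = -n/N\<close>, and \<open>Z\<^sub>0\<close> is the limit of \<open>Z\<^sub>p\<close> as \<open>p = -n/k\<close> tends to 0.
\<close>


text \<open>The obstacle is that the volume, as a function of the coordinates \<open>t j\<close> of
  the points in direction b, is not visibly log-concave: \<open>x j \<bullet> u\<close> is bilinear
  in the point and in u. In the chart u = s (b + w), with w orthogonal to b, it becomes s (t j + y j
  \<bullet> w). For fixed s this is affine in (t, w) jointly, so Prekopa-Leindler applies to each
  slice of constant s. Iterated symmetrizations need not converge, hence the minimisation: a
  symmetrization never raises the second moment and keeps it only on functions that it fixes. Moduli
  of continuity survive symmetrization, so the orbit of a continuous, compactly supported family is
  equicontinuous. Where the radial function is itself an expectation, Jensen's inequality gives one
  direction for an arbitrary density. The opposite direction, up to a factor tending to 1, is proved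
  for the uniform density on a ball alone, where the support function is bounded on bounded sets of
  u.\<close>

interpretation lborel_PiM: product_sigma_finite "\<lambda>_. lborel"
  by (simp add: product_sigma_finite_def sigma_finite_lborel)

lemma sigma_finite_PiM_lborel:
  "finite I \<Longrightarrow> sigma_finite_measure (PiM I (\<lambda>_. lborel))"
  by (rule lborel_PiM.sigma_finite)

abbreviation (input) lborel_integral :: "('a::euclidean_space \<Rightarrow> ennreal) \<Rightarrow> ennreal" (binder "lint " 10)
  where "lborel_integral \<equiv> nn_integral lborel"

lemma cball_sets_borel[measurable]: "cball (a::'a::euclidean_space) r \<in> sets borel"
  by (rule borel_closed) simp

lemma le_enn2real: "ennreal x \<le> H \<Longrightarrow> H < \<infinity> \<Longrightarrow> x \<le> enn2real H"
  by (cases H) auto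

section \<open>Layer cake formulas and changes of variables in product measures\<close>

lemma ennreal_eq_layer_cake:
  "(a::ennreal) = (lint c. (if 0 < c \<and> ennreal c < a then 1 else 0))"
proof (cases a)
  case (real r)
  have "(lint c. (if 0 < c \<and> ennreal c < a then 1 else 0)) = (lint c. indicator {0<..<r} c)"
    using real by (intro nn_integral_cong) (auto simp: ennreal_less_iff indicator_def)
  then show ?thesis using real by simp
next
  case top
  have "of_nat n \<le> (lint c. (if 0 < c \<and> ennreal c < a then 1 else 0))" for n
  proof -
    have "of_nat n = (lint c. indicator {0<..<real n} c)"
      by (simp add: ennreal_of_nat_eq_real_of_nat)
    also have "\<dots> \<le> (lint c. (if 0 < c \<and> ennreal c < a then 1 else 0))"
      using top by (intro nn_integral_mono) (auto simp: indicator_def)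
    finally show ?thesis .
  qed
  then show ?thesis using top
    by (metis ennreal_Ex_less_of_nat leD top.not_eq_extremum)
qed

text \<open>Each factor gets its own level \<open>c l\<close>, so a product of different functions
  becomes an integral of products of indicators. Tonelli then moves the levels outside, where they
  are parameters.\<close>

lemma nn_integral_layer_cake_prod:
  fixes a :: "'l \<Rightarrow> 'x \<Rightarrow> ennreal"
  assumes L: "finite L" and N: "sigma_finite_measure N"
    and k[measurable]: "k \<in> borel_measurable N"
    and a[measurable]: "\<And>l. l \<in> L \<Longrightarrow> a l \<in> borel_measurable N"
  shows "(\<integral>\<^sup>+x. k x * (\<Prod>l\<in>L. a l x) \<partial>N) =
    (\<integral>\<^sup>+c. \<integral>\<^sup>+x. k x * (\<Prod>l\<in>L. if 0 < c l \<and> ennreal (c l) < a l x then 1 else 0) \<partial>N \<partial>PiM L (\<lambda>_. lborel))"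
proof -
  interpret N: sigma_finite_measure N by fact
  interpret P: sigma_finite_measure "PiM L (\<lambda>_. lborel :: real measure)"
    by (rule sigma_finite_PiM_lborel) fact
  interpret NP: pair_sigma_finite N "PiM L (\<lambda>_. lborel :: real measure)" ..
  have "(\<integral>\<^sup>+x. k x * (\<Prod>l\<in>L. a l x) \<partial>N) =
    (\<integral>\<^sup>+x. \<integral>\<^sup>+c. k x * (\<Prod>l\<in>L. if 0 < c l \<and> ennreal (c l) < a l x then 1 else 0) \<partial>PiM L (\<lambda>_. lborel) \<partial>N)"
  proof (rule nn_integral_cong)
    fix x assume "x \<in> space N"
    have "(\<Prod>l\<in>L. a l x) = (\<Prod>l\<in>L. \<integral>\<^sup>+c. (if 0 < c \<and> ennreal c < a l x then 1 else 0) \<partial>lborel)"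
      using ennreal_eq_layer_cake by (intro prod.cong refl)
    also have "\<dots> = (\<integral>\<^sup>+c. (\<Prod>l\<in>L. if 0 < c l \<and> ennreal (c l) < a l x then 1 else 0) \<partial>PiM L (\<lambda>_. lborel))"
      by (rule lborel_PiM.product_nn_integral_prod[symmetric]) (use L in simp_all)
    finally show "k x * (\<Prod>l\<in>L. a l x) = (\<integral>\<^sup>+c. k x * (\<Prod>l\<in>L. if 0 < c l \<and> ennreal (c l) < a l x then 1 else 0) \<partial>PiM L (\<lambda>_. lborel))"
      by (simp add: nn_integral_cmult)
  qed
  also have "\<dots> = (\<integral>\<^sup>+c. \<integral>\<^sup>+x. k x * (\<Prod>l\<in>L. if 0 < c l \<and> ennreal (c l) < a l x then 1 else 0) \<partial>N \<partial>PiM L (\<lambda>_. lborel))"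
    by (rule NP.Fubini'[symmetric]) measurable
  finally show ?thesis .
qed

text \<open>Only superlevel sets remain to be compared, for one vector of levels at a time. It
  serves twice: in \<open>rearrange_functions\<close> for the densities on a fibre, and in
  \<open>integral_gauges_le_ball\<close> for the decreasing functions of the gauges, where
  \<open>k\<close> carries the densities.\<close>

lemma nn_integral_layer_cake_prod_mono:
  fixes a :: "'l \<Rightarrow> 'x \<Rightarrow> ennreal" and a' :: "'l \<Rightarrow> 'y \<Rightarrow> ennreal"
  assumes L: "finite L" and N: "sigma_finite_measure N" and N': "sigma_finite_measure N'"
    and k: "k \<in> borel_measurable N" and a: "\<And>l. l \<in> L \<Longrightarrow> a l \<in> borel_measurable N"
    and k': "k' \<in> borel_measurable N'" and a': "\<And>l. l \<in> L \<Longrightarrow> a' l \<in> borel_measurable N'"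
    and le: "\<And>c. (\<And>l. l \<in> L \<Longrightarrow> 0 < c l) \<Longrightarrow>
      (\<integral>\<^sup>+x. k x * (\<Prod>l\<in>L. if ennreal (c l) < a l x then 1 else 0) \<partial>N)
      \<le> (\<integral>\<^sup>+x. k' x * (\<Prod>l\<in>L. if ennreal (c l) < a' l x then 1 else 0) \<partial>N')"
  shows "(\<integral>\<^sup>+x. k x * (\<Prod>l\<in>L. a l x) \<partial>N) \<le> (\<integral>\<^sup>+x. k' x * (\<Prod>l\<in>L. a' l x) \<partial>N')"
proof (subst nn_integral_layer_cake_prod[OF L N k], erule a, subst nn_integral_layer_cake_prod[OF L N' k'], erule a', rule nn_integral_mono)
  fix c :: "'l \<Rightarrow> real"
  show "(\<integral>\<^sup>+x. k x * (\<Prod>l\<in>L. if 0 < c l \<and> ennreal (c l) < a l x then 1 else 0) \<partial>N)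
      \<le> (\<integral>\<^sup>+x. k' x * (\<Prod>l\<in>L. if 0 < c l \<and> ennreal (c l) < a' l x then 1 else 0) \<partial>N')"
  proof (cases "\<forall>l\<in>L. 0 < c l")
    case True
    then have "(\<Prod>l\<in>L. if 0 < c l \<and> ennreal (c l) < a l x then 1 else 0) = (\<Prod>l\<in>L. if ennreal (c l) < a l x then 1 else (0::ennreal))"
      "(\<Prod>l\<in>L. if 0 < c l \<and> ennreal (c l) < a' l y then 1 else 0) = (\<Prod>l\<in>L. if ennreal (c l) < a' l y then 1 else (0::ennreal))" for x y
      by (auto intro!: prod.cong)
    then show ?thesis using le[of c] True by simp
  next
    case False
    then obtain i where i: "i \<in> L" "\<not> 0 < c i" by auto
    have "(\<Prod>l\<in>L. if 0 < c l \<and> ennreal (c l) < a l x then 1 else 0) = (0::ennreal)" for x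
      using L i by (intro prod_zero bexI[of _ i]) auto
    then show ?thesis by (simp only: mult_zero_right nn_integral_const) simp
  qed
qed

text \<open>The exceptional set lies in a cylinder whose measure is a product with one factor 0, and
  0 * \<infinity> = 0 even when other factors are infinite.\<close>

lemma AE_PiM_component_sigma_finite:
  assumes "product_sigma_finite M" "finite I" "i \<in> I" "AE x in M i. P x"
  shows "AE x in PiM I M. P (x i)"
proof -
  interpret product_sigma_finite M by fact
  obtain N where N: "{x\<in>space (M i). \<not> P x} \<subseteq> N" "emeasure (M i) N = 0" "N \<in> sets (M i)"
    using assms(4) by (rule AE_E)
  let ?A = "PiE I (\<lambda>j. if j = i then N else space (M j))"
  have "emeasure (PiM I M) ?A = (\<Prod>j\<in>I. emeasure (M j) (if j = i then N else space (M j)))"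
    using assms N by (intro emeasure_PiM) auto
  also have "\<dots> = 0" using assms N by (auto intro!: prod_zero bexI[of _ i])
  finally have "?A \<in> null_sets (PiM I M)"
    using assms N by (auto intro!: null_setsI sets_PiM_I_finite)
  moreover have "{x\<in>space (PiM I M). \<not> P (x i)} \<subseteq> ?A"
    using N assms(3) by (auto simp: space_PiM PiE_iff extensional_def)
  ultimately show ?thesis by (rule AE_I')
qed

text \<open>Changes of variables in single coordinates combine by induction on I. The factors
  \<open>k i\<close> are Jacobians; scalings, translations and reflections are the cases that
  occur.\<close>

lemma nn_integral_PiM_transform:
  fixes T :: "'i \<Rightarrow> 'x \<Rightarrow> 'x"
  assumes M: "product_sigma_finite M" and "finite I"
    and T[measurable]: "\<And>i. i \<in> I \<Longrightarrow> T i \<in> M i \<rightarrow>\<^sub>M M i"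
    and eq: "\<And>i g. i \<in> I \<Longrightarrow> g \<in> borel_measurable (M i) \<Longrightarrow> (\<integral>\<^sup>+x. g x \<partial>M i) = k i * (\<integral>\<^sup>+x. g (T i x) \<partial>M i)"
    and F: "F \<in> borel_measurable (PiM I M)"
  shows "(\<integral>\<^sup>+x. F x \<partial>PiM I M) = (\<Prod>i\<in>I. k i) * (\<integral>\<^sup>+x. F (\<lambda>i\<in>I. T i (x i)) \<partial>PiM I M)"
  using \<open>finite I\<close> T eq F
proof (induction I arbitrary: F)
  case empty
  interpret product_sigma_finite M by fact
  show ?case by (simp add: PiM_empty nn_integral_count_space_finite restrict_def)
next
  case (insert j I)
  interpret product_sigma_finite M by fact
  interpret P: sigma_finite_measure "PiM I M" by (rule sigma_finite) fact
  note [measurable] = insert.prems(1,3)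
  have TI: "(\<lambda>x. \<lambda>i\<in>I. T i (x i)) \<in> PiM I M \<rightarrow>\<^sub>M PiM I M"
    by (rule measurable_restrict) (use insert.prems(1) in \<open>auto intro: measurable_compose[OF measurable_component_singleton]\<close>)
  have TI2: "(\<lambda>x. \<lambda>i\<in>insert j I. T i (x i)) \<in> PiM (insert j I) M \<rightarrow>\<^sub>M PiM (insert j I) M"
    by (rule measurable_restrict) (use insert.prems(1) in \<open>auto intro: measurable_compose[OF measurable_component_singleton]\<close>)
  have Tj[measurable]: "T j \<in> M j \<rightarrow>\<^sub>M M j" using insert.prems(1) by auto
  have m3: "(\<lambda>y. F (x(j := y))) \<in> borel_measurable (M j)" if "x \<in> space (PiM I M)" for x
    by (rule measurable_compose[OF _ insert.prems(3)], rule measurable_component_update) (use that insert.hyps in auto)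
  have m4: "(\<lambda>(x,y). F (x(j := T j y))) \<in> borel_measurable (PiM I M \<Otimes>\<^sub>M M j)"
    using measurable_compose[OF _ insert.prems(3), of "\<lambda>(x,y). x(j := T j y)"]
      measurable_compose[OF _ measurable_add_dim, of "\<lambda>(x,y). (x, T j y)" "PiM I M \<Otimes>\<^sub>M M j" I M j]
    by (auto simp: case_prod_beta')
  have m5: "(\<lambda>(x,y). F ((\<lambda>i\<in>I. T i (x i))(j := T j y))) \<in> borel_measurable (PiM I M \<Otimes>\<^sub>M M j)"
  proof -
    define G where "G = (\<lambda>x. \<lambda>i\<in>I. T i (x i))"
    have [measurable]: "G \<in> PiM I M \<rightarrow>\<^sub>M PiM I M" unfolding G_def by (rule TI)
    have "(\<lambda>p. (G (fst p), snd p)) \<in> (PiM I M \<Otimes>\<^sub>M M j) \<rightarrow>\<^sub>M (PiM I M \<Otimes>\<^sub>M M j)"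
      by measurable
    from measurable_compose[OF this m4] show ?thesis by (simp add: case_prod_beta' G_def)
  qed
  have "(\<integral>\<^sup>+x. F x \<partial>PiM (insert j I) M) = (\<integral>\<^sup>+x. \<integral>\<^sup>+y. F (x(j := y)) \<partial>M j \<partial>PiM I M)"
    by (intro product_nn_integral_insert insert.hyps insert.prems(3))
  also have "\<dots> = (\<integral>\<^sup>+x. k j * (\<integral>\<^sup>+y. F (x(j := T j y)) \<partial>M j) \<partial>PiM I M)"
    by (intro nn_integral_cong insert.prems(2) m3) auto
  also have "\<dots> = (\<Prod>i\<in>I. k i) * (\<integral>\<^sup>+x. k j * (\<integral>\<^sup>+y. F ((\<lambda>i\<in>I. T i (x i))(j := T j y)) \<partial>M j) \<partial>PiM I M)"
  proof (rule insert.IH)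
    show "(\<lambda>x. k j * (\<integral>\<^sup>+y. F (x(j := T j y)) \<partial>M j)) \<in> borel_measurable (PiM I M)"
      using m4 by (intro borel_measurable_times_ennreal measurable_const sigma_finite_measure.borel_measurable_nn_integral) (auto simp: sigma_finite_measures)
    show "T i \<in> M i \<rightarrow>\<^sub>M M i" if "i \<in> I" for i using insert.prems(1) that by blast
    show "(\<integral>\<^sup>+x. g x \<partial>M i) = k i * (\<integral>\<^sup>+x. g (T i x) \<partial>M i)" if "i \<in> I" "g \<in> borel_measurable (M i)" for i g
      by (rule insert.prems(2)) (use that in auto)
  qed
  also have "\<dots> = (\<Prod>i\<in>I. k i) * (k j * (\<integral>\<^sup>+x. (\<integral>\<^sup>+y. F ((\<lambda>i\<in>I. T i (x i))(j := T j y)) \<partial>M j) \<partial>PiM I M))"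
    using m5 by (subst nn_integral_cmult) (auto intro!: sigma_finite_measure.borel_measurable_nn_integral simp: sigma_finite_measures)
  also have "(\<integral>\<^sup>+x. (\<integral>\<^sup>+y. F ((\<lambda>i\<in>I. T i (x i))(j := T j y)) \<partial>M j) \<partial>PiM I M)
     = (\<integral>\<^sup>+x. (\<integral>\<^sup>+y. F (\<lambda>i\<in>insert j I. T i ((x(j := y)) i)) \<partial>M j) \<partial>PiM I M)"
    using insert.hyps by (intro nn_integral_cong arg_cong[of _ _ F]) (auto simp: fun_eq_iff)
  also have "\<dots> = (\<integral>\<^sup>+x. F (\<lambda>i\<in>insert j I. T i (x i)) \<partial>PiM (insert j I) M)"
    using insert.hyps TI2 by (intro product_nn_integral_insert[symmetric]) (auto intro: measurable_compose)
  finally show ?case by (simp only: prod.insert[OF insert.hyps] mult_ac)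
qed

lemma nn_integral_PiM_scale:
  assumes "finite I" "s \<noteq> 0" "F \<in> borel_measurable (PiM I (\<lambda>_. lborel :: real measure))"
  shows "(\<integral>\<^sup>+x. F x \<partial>PiM I (\<lambda>_. lborel)) = ennreal (\<bar>s\<bar> ^ card I) * (\<integral>\<^sup>+x. F (\<lambda>i\<in>I. s * x i) \<partial>PiM I (\<lambda>_. lborel))"
proof -
  have "(\<integral>\<^sup>+x. F x \<partial>PiM I (\<lambda>_. lborel)) = (\<Prod>i\<in>I. ennreal \<bar>s\<bar>) * (\<integral>\<^sup>+x. F (\<lambda>i\<in>I. s * x i) \<partial>PiM I (\<lambda>_. lborel))"
  proof (intro nn_integral_PiM_transform lborel_PiM.product_sigma_finite_axioms)
    show "(lint x. g x) = ennreal \<bar>s\<bar> * (lint x. g (s * x))"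
      if "g \<in> borel_measurable lborel" for g
      using that nn_integral_real_affine[of g s 0] assms by simp
  qed (use assms in auto)
  then show ?thesis by (simp add: ennreal_power)
qed

lemma nn_integral_PiM_translate:
  fixes v :: "'i \<Rightarrow> 'a::euclidean_space"
  assumes "finite I" "F \<in> borel_measurable (PiM I (\<lambda>_. lborel :: 'a measure))"
  shows "(\<integral>\<^sup>+x. F x \<partial>PiM I (\<lambda>_. lborel)) = (\<integral>\<^sup>+x. F (\<lambda>i\<in>I. x i + v i) \<partial>PiM I (\<lambda>_. lborel))"
proof -
  have *: "(lint x. g x) = 1 * (lint x. g (x + c))" if [measurable]: "g \<in> borel_measurable lborel" for c :: 'a and g
    by (subst lborel_distr_plus[of c, symmetric]) (simp add: nn_integral_distr add.commute)
  have "(\<integral>\<^sup>+x. F x \<partial>PiM I (\<lambda>_. lborel)) = (\<Prod>i\<in>I. 1) * (\<integral>\<^sup>+x. F (\<lambda>i\<in>I. x i + v i) \<partial>PiM I (\<lambda>_. lborel))"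
    by (intro nn_integral_PiM_transform lborel_PiM.product_sigma_finite_axioms *) (use assms in auto)
  then show ?thesis by simp
qed

subsection \<open>The Prekopa-Leindler inequality\<close>

text \<open>Compact K in A and J in B of almost full measure are scaled and moved so that the
  largest point of the first copy meets the smallest point of the second. The copies overlap in one
  point at most, so their measures add, and both lie in C.\<close>

lemma brunn_minkowski_real:
  fixes A B C :: "real set"
  assumes A: "A \<in> sets borel" "bounded A" "A \<noteq> {}" and B: "B \<in> sets borel" "bounded B" "B \<noteq> {}"
    and C: "C \<in> sets borel" and l: "0 < l" "l < 1"
    and sub: "\<And>x y. x \<in> A \<Longrightarrow> y \<in> B \<Longrightarrow> (1 - l) * x + l * y \<in> C"
  shows "ennreal (1 - l) * emeasure lborel A + ennreal l * emeasure lborel B \<le> emeasure lborel C"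
proof (rule ennreal_le_epsilon)
  fix e :: real assume e: "0 < e"
  have inner: "\<exists>K. compact K \<and> K \<noteq> {} \<and> K \<subseteq> X \<and> emeasure lborel X \<le> emeasure lborel K + ennreal e"
    if X: "X \<in> sets borel" "bounded X" "X \<noteq> {}" for X :: "real set"
  proof -
    obtain T where T: "closed T" "T \<subseteq> X" "X - T \<in> lmeasurable" "emeasure lebesgue (X - T) < ennreal e"
      using sets_lebesgue_inner_closed[of X e] X e by (auto simp: sets_completionI_sets)
    obtain x where x: "x \<in> X" using X by auto
    \<comment> \<open>T may be empty; the extra point x keeps the compact set nonempty, so that its
      extreme points exist.\<close>
    have "compact (insert x T)" using T X by (auto intro!: compact_insert simp: compact_eq_bounded_closed bounded_subset)
    moreover have "emeasure lborel X \<le> emeasure lborel (insert x T \<union> (X - T))"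
      using X T x by (intro emeasure_mono) auto
    moreover have "\<dots> \<le> emeasure lborel (insert x T) + emeasure lborel (X - T)"
      using X T by (intro emeasure_subadditive) auto
    moreover have "emeasure lborel (X - T) = emeasure lebesgue (X - T)"
      using X T by simp
    ultimately have "emeasure lborel X \<le> emeasure lborel (insert x T) + ennreal e"
      using T(4) by (metis add_left_mono order_trans less_imp_le)
    then show ?thesis using T x \<open>compact (insert x T)\<close> by (intro exI[of _ "insert x T"]) auto
  qed
  obtain K where K: "compact K" "K \<noteq> {}" "K \<subseteq> A" "emeasure lborel A \<le> emeasure lborel K + ennreal e"
    using inner[OF A] by auto
  obtain J where J: "compact J" "J \<noteq> {}" "J \<subseteq> B" "emeasure lborel B \<le> emeasure lborel J + ennreal e"
    using inner[OF B] by auto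
  obtain a where a: "a \<in> K" "\<And>x. x \<in> K \<Longrightarrow> x \<le> a" using compact_attains_sup[OF K(1,2)] by auto
  obtain b where b: "b \<in> J" "\<And>x. x \<in> J \<Longrightarrow> b \<le> x" using compact_attains_inf[OF J(1,2)] by auto
  \<comment> \<open>P lets x run through K with y = b fixed, Q lets y run through J with x = a
    fixed; hence both consist of points (1 - l) x + l y.\<close>
  define P where "P = (\<lambda>x. (1 - l) *\<^sub>R x + l * b) ` K"
  define Q where "Q = (\<lambda>y. l *\<^sub>R y + (1 - l) * a) ` J"
  have cP: "compact P" unfolding P_def by (intro compact_continuous_image continuous_intros K)
  have cQ: "compact Q" unfolding Q_def by (intro compact_continuous_image continuous_intros J)
  have eP: "emeasure lborel P = ennreal (1 - l) * emeasure lborel K"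
    using emeasure_lebesgue_affine[of "1 - l" "l * b" K] l cP K borel_compact[of P] borel_compact[of K]
    by (simp add: P_def emeasure_completion)
  have eQ: "emeasure lborel Q = ennreal l * emeasure lborel J"
    using emeasure_lebesgue_affine[of l "(1 - l) * a" J] l cQ J borel_compact[of Q] borel_compact[of J]
    by (simp add: Q_def)
  let ?c = "(1 - l) * a + l * b"
  have PQ: "P \<inter> Q \<subseteq> {?c}"
  proof
    fix z assume z: "z \<in> P \<inter> Q"
    then have "z \<le> ?c" unfolding P_def using a l by (auto intro!: mult_left_mono)
    moreover have "?c \<le> z" using z unfolding Q_def using b l by (auto intro!: mult_left_mono)
    ultimately show "z \<in> {?c}" by auto
  qed
  have "emeasure lborel P + emeasure lborel Q = emeasure lborel P + emeasure lborel (Q - {?c})"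
    using cQ by (subst emeasure_Diff_null_set) (auto simp: borel_compact null_setsI)
  also have "\<dots> = emeasure lborel (P \<union> (Q - {?c}))"
    using cP cQ PQ by (intro plus_emeasure) (auto simp: borel_compact)
  also have "\<dots> \<le> emeasure lborel C"
  proof (rule emeasure_mono)
    show "P \<union> (Q - {?c}) \<subseteq> C"
      using sub[OF subsetD[OF K(3)] subsetD[OF J(3)]] a b unfolding P_def Q_def
      by (auto simp: add.commute)
  qed (use C in auto)
  finally have PQC: "emeasure lborel P + emeasure lborel Q \<le> emeasure lborel C" .
  have "ennreal (1 - l) * emeasure lborel A + ennreal l * emeasure lborel B
      \<le> ennreal (1 - l) * (emeasure lborel K + ennreal e) + ennreal l * (emeasure lborel J + ennreal e)"
    using K J by (intro add_mono mult_left_mono) auto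
  also have "\<dots> = emeasure lborel P + emeasure lborel Q + (ennreal (1 - l) + ennreal l) * ennreal e"
    by (simp add: eP eQ distrib_left distrib_right add_ac)
  also have "ennreal (1 - l) + ennreal l = 1" using l by (simp flip: ennreal_plus)
  also have "emeasure lborel P + emeasure lborel Q + 1 * ennreal e \<le> emeasure lborel C + ennreal e"
    using PQC by (simp add: add_right_mono)
  finally show "ennreal (1 - l) * emeasure lborel A + ennreal l * emeasure lborel B \<le> emeasure lborel C + ennreal e" .
qed


text \<open>The level is written as c t, so that functions with different suprema can be compared at
  the same relative level t.\<close>

lemma nn_integral_layer_cake_scaled:
  fixes h :: "real \<Rightarrow> real"
  assumes [measurable]: "h \<in> borel_measurable lborel" and c: "0 < c"
  shows "(lint x. ennreal (h x)) = ennreal c * (lint t. indicator {0<..} t * emeasure lborel {x. c * t < h x})"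
proof -
  have "(lint x. ennreal (h x)) = (lint x. \<integral>\<^sup>+t. (if 0 < t \<and> ennreal t < ennreal (h x) then 1 else 0) \<partial>lborel)"
    by (intro nn_integral_cong ennreal_eq_layer_cake)
  also have "\<dots> = (lint t. \<integral>\<^sup>+x. (if 0 < t \<and> ennreal t < ennreal (h x) then 1 else 0) \<partial>lborel)"
    by (rule lborel_pair.Fubini'[symmetric]) measurable
  also have "\<dots> = (lint t. indicator {0<..} t * emeasure lborel {x. t < h x})"
  proof (rule nn_integral_cong)
    fix t :: real
    have "(lint x. (if 0 < t \<and> ennreal t < ennreal (h x) then 1 else 0)) = (lint x. indicator {0<..} t * indicator {x. t < h x} x)"
      by (intro nn_integral_cong) (auto simp: ennreal_less_iff indicator_def)
    also have "\<dots> = indicator {0<..} t * emeasure lborel {x. t < h x}"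
      by (subst nn_integral_cmult) auto
    finally show "(lint x. (if 0 < t \<and> ennreal t < ennreal (h x) then 1 else 0)) = indicator {0<..} t * emeasure lborel {x. t < h x}" .
  qed
  also have "\<dots> = ennreal \<bar>c\<bar> * (lint t. indicator {0<..} (0 + c * t) * emeasure lborel {x. 0 + c * t < h x})"
    by (rule nn_integral_real_affine) (use c in auto)
  also have "\<dots> = ennreal c * (lint t. indicator {0<..} t * emeasure lborel {x. c * t < h x})"
    using c by (auto intro!: arg_cong2[where f="(*)"] nn_integral_cong simp: indicator_def zero_less_mult_iff)
  finally show ?thesis .
qed

text \<open>After division by the suprema a and b, the superlevel sets of f and g at a relative
  level t in (0,1) are both nonempty, as the one-dimensional Brunn-Minkowski inequality demands.
  Integration over t gives an arithmetic mean of the normalised integrals, which dominates their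
  geometric mean.\<close>

lemma prekopa_leindler_real:
  fixes f g h :: "real \<Rightarrow> real"
  assumes [measurable]: "f \<in> borel_measurable lborel" "g \<in> borel_measurable lborel" "h \<in> borel_measurable lborel"
    and f: "\<And>x. 0 \<le> f x" "\<And>x. f x \<le> B" "\<And>x. f x \<noteq> 0 \<Longrightarrow> \<bar>x\<bar> \<le> R"
    and g: "\<And>x. 0 \<le> g x" "\<And>x. g x \<le> B" "\<And>x. g x \<noteq> 0 \<Longrightarrow> \<bar>x\<bar> \<le> R"
    and h: "\<And>x. 0 \<le> h x" "(lint x. ennreal (h x)) < \<infinity>"
    and l: "0 < l" "l < 1"
    and fgh: "\<And>x y. f x powr (1 - l) * g y powr l \<le> h ((1 - l) * x + l * y)"
  shows "enn2real (lint x. ennreal (f x)) powr (1 - l) * enn2real (lint x. ennreal (g x)) powr l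
    \<le> enn2real (lint x. ennreal (h x))"
proof -
  let ?F = "\<integral>\<^sup>+x. ennreal (f x) \<partial>lborel" and ?G = "\<integral>\<^sup>+x. ennreal (g x) \<partial>lborel" and ?H = "\<integral>\<^sup>+x. ennreal (h x) \<partial>lborel"
  define a b where "a = Sup (range f)" and "b = Sup (range g)"
  have bf: "bdd_above (range f)" and bg: "bdd_above (range g)" using f g by (auto simp: bdd_above_def)
  have fa: "f x \<le> a" and gb: "g x \<le> b" for x
    unfolding a_def b_def using bf bg by (auto intro: cSup_upper)
  have a0: "0 \<le> a" "0 \<le> b" using fa[of 0] gb[of 0] f(1)[of 0] g(1)[of 0] by auto
  show ?thesis
  proof (cases "a = 0 \<or> b = 0")
    case True
    then have "(\<forall>x. f x = 0) \<or> (\<forall>x. g x = 0)" using fa gb f(1) g(1) by (metis order_antisym)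
    then show ?thesis by auto
  next
    case False
    then have ab: "0 < a" "0 < b" using a0 by auto
    \<comment> \<open>The level of h that matches relative level t of f and g: (a t)^(1 - l) (b t)^l
      = c t.\<close>
    define c where "c = a powr (1 - l) * b powr l"
    have c: "0 < c" using ab by (simp add: c_def)
    have fin: "(lint x. ennreal (k x)) < \<infinity>" if k: "\<And>x. 0 \<le> k x" "\<And>x. k x \<le> B" "\<And>x. k x \<noteq> 0 \<Longrightarrow> \<bar>x\<bar> \<le> R" for k :: "real \<Rightarrow> real"
    proof -
      have "(lint x. ennreal (k x)) \<le> (lint x. ennreal B * indicator {-R..R} x)"
        using k by (intro nn_integral_mono) (force simp: indicator_def ennreal_leI abs_le_iff)
      also have "\<dots> < \<infinity>" by (simp add: nn_integral_cmult_indicator ennreal_mult_less_top emeasure_lborel_Icc_eq)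
      finally show ?thesis .
    qed
    have bm: "ennreal (1 - l) * emeasure lborel {x. a * t < f x} + ennreal l * emeasure lborel {x. b * t < g x} \<le> emeasure lborel {x. c * t < h x}"
      if t: "0 < t" "t < 1" for t
    proof (rule brunn_minkowski_real)
      have "a * t < a" "b * t < b" using ab t by auto
      then show "{x. a * t < f x} \<noteq> {}" "{x. b * t < g x} \<noteq> {}"
        using less_cSup_iff[OF _ bf, of "a * t"] less_cSup_iff[OF _ bg, of "b * t"] by (auto simp: a_def b_def)
      have "{x. a * t < f x} \<subseteq> {-R..R}" "{x. b * t < g x} \<subseteq> {-R..R}"
      proof safe
        have at: "0 < a * t" "0 < b * t" using ab t by auto
        show "x \<in> {-R..R}" if "a * t < f x" for x using f(3)[of x] that at by (auto simp: abs_le_iff)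
        show "x \<in> {-R..R}" if "b * t < g x" for x using g(3)[of x] that at by (auto simp: abs_le_iff)
      qed
      then show "bounded {x. a * t < f x}" "bounded {x. b * t < g x}"
        using bounded_closed_interval bounded_subset by blast+
      show "(1 - l) * x + l * y \<in> {x. c * t < h x}" if "x \<in> {x. a * t < f x}" "y \<in> {x. b * t < g x}" for x y
      proof -
        have "c * t = (a * t) powr (1 - l) * (b * t) powr l"
          using ab t l by (simp add: c_def powr_mult powr_add[symmetric] mult_ac)
        also have "\<dots> < f x powr (1 - l) * g y powr l"
        proof (rule mult_strict_mono)
          have at: "0 < a * t" "0 < b * t" using ab t by auto
          then show "(a * t) powr (1 - l) < f x powr (1 - l)" "(b * t) powr l < g y powr l"
            using that l by (auto intro!: powr_less_mono2)
          show "0 < f x powr (1 - l)" using at that by auto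
        qed simp
        also have "\<dots> \<le> h ((1 - l) * x + l * y)" by (rule fgh)
        finally show ?thesis by simp
      qed
    qed (use l in auto)
    let ?a = "\<lambda>t. indicator {0<..<1} t * emeasure lborel {x. a * t < f x}"
    let ?b = "\<lambda>t. indicator {0<..<1} t * emeasure lborel {x. b * t < g x}"
    have Fa: "?F = ennreal a * (lint t. ?a t)"
    proof -
      have *: "{x. a * t < f x} = {}" if "1 \<le> t" for t
        using fa ab that by (smt (verit) Collect_empty_eq mult_le_cancel_left1)
      have "(lint t. indicator {0<..} t * emeasure lborel {x. a * t < f x}) = (lint t. ?a t)"
        by (intro nn_integral_cong) (auto simp: indicator_def *)
      then show ?thesis using nn_integral_layer_cake_scaled[OF _ ab(1), of f] by simp
    qed
    have Gb: "?G = ennreal b * (lint t. ?b t)"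
    proof -
      have *: "{x. b * t < g x} = {}" if "1 \<le> t" for t
        using gb ab that by (smt (verit) Collect_empty_eq mult_le_cancel_left1)
      have "(lint t. indicator {0<..} t * emeasure lborel {x. b * t < g x}) = (lint t. ?b t)"
        by (intro nn_integral_cong) (auto simp: indicator_def *)
      then show ?thesis using nn_integral_layer_cake_scaled[OF _ ab(2), of g] by simp
    qed
    define p q where "p = enn2real ?F / a" and "q = enn2real ?G / b"
    have pq0: "0 \<le> p" "0 \<le> q" using ab by (auto simp: p_def q_def)
    have Ip: "(lint t. ?a t) = ennreal p"
    proof -
      have "ennreal a * ennreal p = ?F" using fin[of f] f ab by (simp add: p_def flip: ennreal_mult)
      then show ?thesis using Fa ab ennreal_mult_cancel_left[of "ennreal a"] by auto
    qed
    have Iq: "(lint t. ?b t) = ennreal q"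
    proof -
      have "ennreal b * ennreal q = ?G" using fin[of g] g ab by (simp add: q_def flip: ennreal_mult)
      then show ?thesis using Gb ab ennreal_mult_cancel_left[of "ennreal b"] by auto
    qed
    have m: "?a \<in> borel_measurable lborel" "?b \<in> borel_measurable lborel" by measurable
    have "ennreal (c * ((1 - l) * p + l * q)) = ennreal c * (ennreal (1 - l) * (lint t. ?a t) + ennreal l * (lint t. ?b t))"
      using c l pq0 by (simp add: Ip Iq ennreal_mult ennreal_plus)
    also have "\<dots> = ennreal c * (lint t. ennreal (1 - l) * ?a t + ennreal l * ?b t)"
      using m by (subst nn_integral_add) (auto simp: nn_integral_cmult)
    also have "\<dots> \<le> ennreal c * (lint t. indicator {0<..} t * emeasure lborel {x. c * t < h x})"
      using bm by (intro mult_left_mono nn_integral_mono) (auto simp: indicator_def)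
    also have "\<dots> = ?H" using nn_integral_layer_cake_scaled[OF _ c, of h] by simp
    finally have "ennreal (c * ((1 - l) * p + l * q)) \<le> ?H" .
    then have 1: "c * ((1 - l) * p + l * q) \<le> enn2real ?H"
      using h(2) by (rule le_enn2real)
    have "p powr (1 - l) * q powr l \<le> (1 - l) * p + l * q"
    proof (cases "p = 0 \<or> q = 0")
      case True then show ?thesis using pq0 l by auto
    next
      case False then show ?thesis using pq0 l by (intro Youngs_inequality_0) auto
    qed
    then have "c * (p powr (1 - l) * q powr l) \<le> enn2real ?H" using 1 c by (smt (verit) mult_left_mono)
    moreover have "enn2real ?F powr (1 - l) * enn2real ?G powr l = c * (p powr (1 - l) * q powr l)"
      using ab by (simp add: p_def q_def c_def powr_divide)
    ultimately show ?thesis by simp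
  qed
qed

text \<open>This class is closed under integrating out one coordinate, which the induction over
  dimensions requires, and its integrals are finite, so that \<open>enn2real\<close> loses
  nothing.\<close>

definition bounded_box_support :: "'i set \<Rightarrow> (('i \<Rightarrow> real) \<Rightarrow> real) \<Rightarrow> bool" where
  "bounded_box_support J f \<longleftrightarrow> f \<in> borel_measurable (PiM J (\<lambda>_. lborel)) \<and>
     (\<exists>B R. \<forall>x\<in>space (PiM J (\<lambda>_. lborel :: real measure)). 0 \<le> f x \<and> f x \<le> B \<and> (f x \<noteq> 0 \<longrightarrow> (\<forall>j\<in>J. \<bar>x j\<bar> \<le> R)))"

lemma bounded_box_support_finite:
  assumes "finite J" "bounded_box_support J f"
  shows "(\<integral>\<^sup>+x. ennreal (f x) \<partial>PiM J (\<lambda>_. lborel)) < \<infinity>"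
proof -
  obtain B R where BR: "\<And>x. x\<in>space (PiM J (\<lambda>_. lborel :: real measure)) \<Longrightarrow> 0 \<le> f x \<and> f x \<le> B \<and> (f x \<noteq> 0 \<longrightarrow> (\<forall>j\<in>J. \<bar>x j\<bar> \<le> R))"
    using assms unfolding bounded_box_support_def by blast
  have "(\<integral>\<^sup>+x. ennreal (f x) \<partial>PiM J (\<lambda>_. lborel)) \<le> (\<integral>\<^sup>+x. ennreal B * indicator (PiE J (\<lambda>_. {-R..R})) x \<partial>PiM J (\<lambda>_. lborel))"
  proof (rule nn_integral_mono)
    fix x assume x: "x \<in> space (PiM J (\<lambda>_. lborel :: real measure))"
    show "ennreal (f x) \<le> ennreal B * indicator (PiE J (\<lambda>_. {-R..R})) x"
      using BR[OF x] x by (cases "f x = 0") (auto simp: indicator_def space_PiM PiE_iff abs_le_iff minus_le_iff intro!: ennreal_leI)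
  qed
  also have "\<dots> = ennreal B * (\<Prod>j\<in>J. emeasure lborel {-R..R})"
    using assms by (subst nn_integral_cmult_indicator) (auto simp: lborel_PiM.emeasure_PiM intro!: sets_PiM_I_finite)
  also have "\<dots> < \<infinity>" by (auto simp: ennreal_mult_less_top emeasure_lborel_Icc_eq power_less_top_ennreal)
  finally show ?thesis .
qed

text \<open>Tensorization: after integrating out the coordinate j, the marginals satisfy the
  hypothesis in the remaining coordinates, by the one-dimensional case on the lines over x, y and
  the intermediate point.\<close>

theorem prekopa_leindler:
  fixes f g h :: "('i \<Rightarrow> real) \<Rightarrow> real"
  assumes "finite J" and "bounded_box_support J f" "bounded_box_support J g" "bounded_box_support J h"
    and l: "0 < l" "l < 1"
    and fgh: "\<And>x y. x \<in> PiE J (\<lambda>_. UNIV) \<Longrightarrow> y \<in> PiE J (\<lambda>_. UNIV) \<Longrightarrow> f x powr (1 - l) * g y powr l \<le> h (\<lambda>j\<in>J. (1 - l) * x j + l * y j)"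
  shows "enn2real (\<integral>\<^sup>+x. ennreal (f x) \<partial>PiM J (\<lambda>_. lborel)) powr (1 - l) * enn2real (\<integral>\<^sup>+x. ennreal (g x) \<partial>PiM J (\<lambda>_. lborel)) powr l
    \<le> enn2real (\<integral>\<^sup>+x. ennreal (h x) \<partial>PiM J (\<lambda>_. lborel))"
  using assms(1-4) fgh
proof (induction J arbitrary: f g h)
  case empty
  have e: "(\<integral>\<^sup>+x. ennreal (k x) \<partial>PiM {} (\<lambda>_. lborel)) = ennreal (k (\<lambda>_. undefined))" for k :: "('i \<Rightarrow> real) \<Rightarrow> real"
    by (simp add: PiM_empty nn_integral_count_space_finite)
  have "0 \<le> k (\<lambda>_. undefined)" if "bounded_box_support {} k" for k :: "('i \<Rightarrow> real) \<Rightarrow> real"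
    using that by (auto simp: bounded_box_support_def space_PiM)
  then show ?case using empty.prems(1-3) empty.prems(4)[of "\<lambda>_. undefined" "\<lambda>_. undefined"]
    by (simp add: e restrict_def)
next
  case (insert j J)
  define marg where "marg k x = enn2real (lint y. ennreal (k (x(j := y))))" for k :: "('i \<Rightarrow> real) \<Rightarrow> real" and x
  let ?M = "PiM J (\<lambda>_. lborel :: real measure)" and ?M' = "PiM (insert j J) (\<lambda>_. lborel :: real measure)"
  have upd: "x(j := y) \<in> space ?M'" if "x \<in> space ?M" for x y
    using that by (auto simp: space_PiM PiE_iff extensional_def)
  have fib: "(\<lambda>y. k (x(j := y))) \<in> borel_measurable lborel" if "bounded_box_support (insert j J) k" "x \<in> space ?M" for k x
  proof -
    have "k \<in> borel_measurable ?M'" using that by (simp add: bounded_box_support_def)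
    from measurable_compose[OF measurable_component_update[OF that(2) insert.hyps(2)] this] show ?thesis by simp
  qed
  have A: "bounded_box_support J (marg k) \<and>
      (\<integral>\<^sup>+x. ennreal (k x) \<partial>?M') = (\<integral>\<^sup>+x. ennreal (marg k x) \<partial>?M) \<and>
      (\<forall>x\<in>space ?M. (lint y. ennreal (k (x(j := y)))) < \<infinity>)"
    if k: "bounded_box_support (insert j J) k" for k
  proof -
    obtain B R where BR: "\<And>x. x\<in>space ?M' \<Longrightarrow> 0 \<le> k x \<and> k x \<le> B \<and> (k x \<noteq> 0 \<longrightarrow> (\<forall>j\<in>insert j J. \<bar>x j\<bar> \<le> R))"
      using k unfolding bounded_box_support_def by blast
    have [measurable]: "k \<in> borel_measurable ?M'" using k by (simp add: bounded_box_support_def)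
    have m: "(\<lambda>(x, y). ennreal (k (x(j := y)))) \<in> borel_measurable (?M \<Otimes>\<^sub>M lborel)"
      using measurable_compose[OF measurable_add_dim, of "\<lambda>x. ennreal (k x)" j J "\<lambda>_. lborel" borel]
      by (simp add: case_prod_beta')
    have bd: "(lint y. ennreal (k (x(j := y)))) \<le> ennreal B * emeasure lborel {-R..R}" if "x \<in> space ?M" for x
    proof -
      have "(lint y. ennreal (k (x(j := y)))) \<le> (lint y. ennreal B * indicator {-R..R} y)"
      proof (rule nn_integral_mono)
        fix y show "ennreal (k (x(j := y))) \<le> ennreal B * indicator {-R..R} y"
          using BR[OF upd[OF that, of y]] by (cases "k (x(j := y)) = 0") (auto simp: indicator_def abs_le_iff intro!: ennreal_leI)
      qed
      then show ?thesis by (simp add: nn_integral_cmult_indicator)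
    qed
    have top: "ennreal B * emeasure lborel {-R..R} < top" by (simp add: ennreal_mult_less_top emeasure_lborel_Icc_eq)
    have fin: "(lint y. ennreal (k (x(j := y)))) < top" if "x \<in> space ?M" for x
      using bd[OF that] top by (rule le_less_trans)
    have [measurable]: "(\<lambda>x. \<integral>\<^sup>+y. ennreal (k (x(j := y))) \<partial>lborel) \<in> borel_measurable ?M"
      using m by (intro lborel.borel_measurable_nn_integral) auto
    have "marg k \<in> borel_measurable ?M"
      unfolding marg_def by measurable
    moreover have "0 \<le> marg k x \<and> marg k x \<le> enn2real (ennreal B * emeasure lborel {-R..R}) \<and> (marg k x \<noteq> 0 \<longrightarrow> (\<forall>j\<in>J. \<bar>x j\<bar> \<le> R))"
      if x: "x \<in> space ?M" for x
    proof (intro conjI impI ballI)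
      show "marg k x \<le> enn2real (ennreal B * emeasure lborel {-R..R})"
        unfolding marg_def using bd[OF x] top by (intro enn2real_mono) auto
      show "\<bar>x i\<bar> \<le> R" if "marg k x \<noteq> 0" "i \<in> J" for i
      proof (rule ccontr)
        assume "\<not> \<bar>x i\<bar> \<le> R"
        then have "k (x(j := y)) = 0" for y
          using BR[OF upd[OF x, of y]] that insert.hyps by (metis fun_upd_other insertI2)
        then show False using that by (simp add: marg_def)
      qed
    qed (simp add: marg_def)
    ultimately have "bounded_box_support J (marg k)" unfolding bounded_box_support_def by blast
    moreover have "(\<integral>\<^sup>+x. ennreal (k x) \<partial>?M') = (\<integral>\<^sup>+x. ennreal (marg k x) \<partial>?M)"
      using insert.hyps fin by (subst lborel_PiM.product_nn_integral_insert) (auto simp: marg_def intro!: nn_integral_cong)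
    ultimately show ?thesis using fin by auto
  qed
  note A' = A[THEN conjunct1] A[THEN conjunct2, THEN conjunct1] A[THEN conjunct2, THEN conjunct2, rule_format]
  have "enn2real (\<integral>\<^sup>+x. ennreal (marg f x) \<partial>?M) powr (1 - l) * enn2real (\<integral>\<^sup>+x. ennreal (marg g x) \<partial>?M) powr l
    \<le> enn2real (\<integral>\<^sup>+x. ennreal (marg h x) \<partial>?M)"
  proof (rule insert.IH)
    fix x y :: "'i \<Rightarrow> real" assume xy: "x \<in> PiE J (\<lambda>_. UNIV)" "y \<in> PiE J (\<lambda>_. UNIV)"
    then have sp: "x \<in> space ?M" "y \<in> space ?M" by (auto simp: space_PiM)
    let ?z = "\<lambda>i\<in>J. (1 - l) * x i + l * y i"
    have z: "?z \<in> space ?M" by (auto simp: space_PiM)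
    obtain B1 R1 where 1: "\<And>x. x\<in>space ?M' \<Longrightarrow> 0 \<le> f x \<and> f x \<le> B1 \<and> (f x \<noteq> 0 \<longrightarrow> (\<forall>j\<in>insert j J. \<bar>x j\<bar> \<le> R1))"
      using insert.prems(1) unfolding bounded_box_support_def by blast
    obtain B2 R2 where 2: "\<And>x. x\<in>space ?M' \<Longrightarrow> 0 \<le> g x \<and> g x \<le> B2 \<and> (g x \<noteq> 0 \<longrightarrow> (\<forall>j\<in>insert j J. \<bar>x j\<bar> \<le> R2))"
      using insert.prems(2) unfolding bounded_box_support_def by blast
    obtain B3 R3 where 3: "\<And>x. x\<in>space ?M' \<Longrightarrow> 0 \<le> h x \<and> h x \<le> B3 \<and> (h x \<noteq> 0 \<longrightarrow> (\<forall>j\<in>insert j J. \<bar>x j\<bar> \<le> R3))"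
      using insert.prems(3) unfolding bounded_box_support_def by blast
    show "marg f x powr (1 - l) * marg g y powr l \<le> marg h ?z"
      unfolding marg_def
    proof (rule prekopa_leindler_real[where B="max B1 B2" and R="max R1 R2"])
      fix s t :: real
      have "f (x(j := s)) powr (1 - l) * g (y(j := t)) powr l \<le> h (\<lambda>i\<in>insert j J. (1 - l) * (x(j := s)) i + l * (y(j := t)) i)"
        using xy by (intro insert.prems(4)) (auto simp: PiE_iff extensional_def)
      also have "(\<lambda>i\<in>insert j J. (1 - l) * (x(j := s)) i + l * (y(j := t)) i) = ?z(j := (1 - l) * s + l * t)"
        using insert.hyps by (auto simp: fun_eq_iff)
      finally show "f (x(j := s)) powr (1 - l) * g (y(j := t)) powr l \<le> h (?z(j := (1 - l) * s + l * t))" .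
      show "0 \<le> f (x(j := s))" "f (x(j := s)) \<le> max B1 B2" using 1[OF upd[OF sp(1), of s]] by auto
      show "\<bar>s\<bar> \<le> max R1 R2" if "f (x(j := s)) \<noteq> 0" using that 1[OF upd[OF sp(1), of s]] by (metis fun_upd_same insertI1 le_max_iff_disj)
      show "0 \<le> g (y(j := s))" "g (y(j := s)) \<le> max B1 B2" using 2[OF upd[OF sp(2), of s]] by auto
      show "\<bar>s\<bar> \<le> max R1 R2" if "g (y(j := s)) \<noteq> 0" using that 2[OF upd[OF sp(2), of s]] by (metis fun_upd_same insertI1 le_max_iff_disj)
      show "0 \<le> h (?z(j := s))" using 3[OF upd[OF z, of s]] by auto
    qed (rule fib[OF insert.prems(1) sp(1)] fib[OF insert.prems(2) sp(2)] fib[OF insert.prems(3) z] A'(3)[OF insert.prems(3) z] l)+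
  qed (use A' insert.prems in auto)
  then show ?case using A'(2) insert.prems by simp
qed

subsection \<open>Sliding intervals under an even log-concave weight\<close>

lemma prod_of_bool:
  "finite I \<Longrightarrow> (\<Prod>j\<in>I. if Q j then 1 else 0) = (if \<forall>j\<in>I. Q j then 1 else (0::'a::comm_semiring_1))"
  by (induction I rule: finite_induct) auto

text \<open>The instance in mind is \<open>slice_vol s\<close>, the volume of a slice of the region
  as a function of the coordinates of all points in one direction.\<close>

locale even_log_concave =
  fixes I :: "'i set" and V :: "('i \<Rightarrow> real) \<Rightarrow> real"
  assumes fin: "finite I"
    and meas[measurable]: "V \<in> borel_measurable (PiM I (\<lambda>_. lborel))"
    and bdd: "\<exists>B. \<forall>t \<in> PiE I (\<lambda>_. UNIV). 0 \<le> V t \<and> V t \<le> B"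
    and even: "t \<in> PiE I (\<lambda>_. UNIV) \<Longrightarrow> V (\<lambda>j\<in>I. - t j) = V t"
    and log_concave: "t \<in> PiE I (\<lambda>_. UNIV) \<Longrightarrow> t' \<in> PiE I (\<lambda>_. UNIV) \<Longrightarrow> 0 < l \<Longrightarrow> l < 1 \<Longrightarrow>
      V t powr (1 - l) * V t' powr l \<le> V (\<lambda>j\<in>I. (1 - l) * t j + l * t' j)"
begin

abbreviation "LI \<equiv> PiM I (\<lambda>_. lborel :: real measure)"

text \<open>The box with centre s c is the combination, with l = (1 - s) / 2, of the boxes with
  centres c and -c, because (1 - l) c - l c = s c. Prekopa-Leindler bounds its integral below by the
  geometric mean of the integrals over those two boxes, and evenness makes these equal.\<close>

lemma slide_box:
  assumes s: "0 \<le> s" "s \<le> 1"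
  shows "(\<integral>\<^sup>+t. ennreal (V t) * (\<Prod>j\<in>I. if \<bar>t j - c j\<bar> < r j then 1 else 0) \<partial>LI)
     \<le> (\<integral>\<^sup>+t. ennreal (V t) * (\<Prod>j\<in>I. if \<bar>t j - s * c j\<bar> < r j then 1 else 0) \<partial>LI)"
proof (cases "s = 1")
  case True then show ?thesis by simp
next
  case False
  define l where "l = (1 - s) / 2"
  have l: "0 < l" "l < 1" "s = 1 - 2 * l" using s False by (auto simp: l_def field_simps)
  define f where "f d t = (if \<forall>j\<in>I. \<bar>t j - d j\<bar> < r j then V t else 0)" for d t
  have fin_eq: "(\<integral>\<^sup>+t. ennreal (V t) * (\<Prod>j\<in>I. if \<bar>t j - d j\<bar> < r j then 1 else 0) \<partial>LI) = (\<integral>\<^sup>+t. ennreal (f d t) \<partial>LI)" for d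
    by (intro nn_integral_cong) (simp add: prod_of_bool fin f_def)
  have fm[measurable]: "f d \<in> borel_measurable LI" for d
    unfolding f_def using fin by measurable
  obtain B where B: "\<And>t. t \<in> PiE I (\<lambda>_. UNIV) \<Longrightarrow> 0 \<le> V t \<and> V t \<le> B" using bdd by blast
  have bbs: "bounded_box_support I (f d)" for d
    unfolding bounded_box_support_def
  proof (intro conjI fm exI ballI impI)
    fix t assume t: "t \<in> space LI"
    then have t': "t \<in> PiE I (\<lambda>_. UNIV)" by (simp add: space_PiM)
    have "0 \<le> B" using B[OF t'] by auto
    then show "0 \<le> f d t" "f d t \<le> B" using B[OF t'] by (auto simp: f_def)
    fix j assume j: "j \<in> I" "f d t \<noteq> 0"
    then have "\<bar>t j\<bar> \<le> \<bar>d j\<bar> + \<bar>r j\<bar>" by (force simp: f_def split: if_splits)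
    also have "\<dots> \<le> (\<Sum>j\<in>I. \<bar>d j\<bar> + \<bar>r j\<bar>)" using j fin by (intro member_le_sum) auto
    finally show "\<bar>t j\<bar> \<le> (\<Sum>j\<in>I. \<bar>d j\<bar> + \<bar>r j\<bar>)" .
  qed
  let ?E = "\<lambda>d. enn2real (\<integral>\<^sup>+t. ennreal (f d t) \<partial>LI)"
  have "?E c powr (1 - l) * ?E (\<lambda>j. - c j) powr l \<le> ?E (\<lambda>j. s * c j)"
  proof (rule prekopa_leindler[OF fin bbs bbs bbs l(1,2)])
    fix x y :: "'i \<Rightarrow> real" assume xy: "x \<in> PiE I (\<lambda>_. UNIV)" "y \<in> PiE I (\<lambda>_. UNIV)"
    let ?z = "\<lambda>j\<in>I. (1 - l) * x j + l * y j"
    have z: "?z \<in> PiE I (\<lambda>_. UNIV)" by auto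
    show "f c x powr (1 - l) * f (\<lambda>j. - c j) y powr l \<le> f (\<lambda>j. s * c j) ?z"
    proof (cases "(\<forall>j\<in>I. \<bar>x j - c j\<bar> < r j) \<and> (\<forall>j\<in>I. \<bar>y j - (- c j)\<bar> < r j)")
      case True
      have "\<bar>?z j - s * c j\<bar> < r j" if j: "j \<in> I" for j
      proof -
        have "?z j - s * c j = (1 - l) * (x j - c j) + l * (y j + c j)"
          using j unfolding l(3) by (simp add: algebra_simps)
        also have "\<bar>\<dots>\<bar> \<le> (1 - l) * \<bar>x j - c j\<bar> + l * \<bar>y j + c j\<bar>"
          using l by (intro order_trans[OF abs_triangle_ineq]) (simp add: abs_mult)
        also have "\<dots> < (1 - l) * r j + l * r j"
          using True j l by (intro add_strict_mono mult_strict_left_mono) auto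
        finally show ?thesis by (simp add: algebra_simps)
      qed
      then show ?thesis using True log_concave[OF xy l(1,2)] by (simp add: f_def)
    next
      case False
      then have "f c x powr (1 - l) * f (\<lambda>j. - c j) y powr l = 0" unfolding f_def by auto
      moreover have "0 \<le> f (\<lambda>j. s * c j) ?z" using B[OF z] by (simp add: f_def)
      ultimately show ?thesis by linarith
    qed
  qed
  moreover have "(\<integral>\<^sup>+t. ennreal (f (\<lambda>j. - c j) t) \<partial>LI) = (\<integral>\<^sup>+t. ennreal (f c t) \<partial>LI)"
  proof -
    have "(\<integral>\<^sup>+t. ennreal (f (\<lambda>j. - c j) t) \<partial>LI) = ennreal (\<bar>-1\<bar> ^ card I) * (\<integral>\<^sup>+t. ennreal (f (\<lambda>j. - c j) (\<lambda>j\<in>I. (-1) * t j)) \<partial>LI)"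
      by (rule nn_integral_PiM_scale) (use fin in auto)
    also have "\<dots> = (\<integral>\<^sup>+t. ennreal (f c t) \<partial>LI)"
    proof -
      have "f (\<lambda>j. - c j) (\<lambda>j\<in>I. (-1) * t j) = f c t" if "t \<in> space LI" for t
        using even[of t] that by (auto simp: f_def space_PiM abs_minus_commute)
      then show ?thesis by (auto intro!: nn_integral_cong)
    qed
    finally show ?thesis .
  qed
  ultimately have "?E c powr (1 - l) * ?E c powr l \<le> ?E (\<lambda>j. s * c j)" by simp
  moreover have "?E c powr (1 - l) * ?E c powr l = ?E c" by (simp flip: powr_add)
  ultimately have "?E c \<le> ?E (\<lambda>j. s * c j)" by linarith
  then have "(\<integral>\<^sup>+t. ennreal (f c t) \<partial>LI) \<le> (\<integral>\<^sup>+t. ennreal (f (\<lambda>j. s * c j) t) \<partial>LI)"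
    using bounded_box_support_finite[OF fin bbs]
    by (metis enn2real_nonneg ennreal_enn2real ennreal_leI infinity_ennreal_def)
  then show ?thesis unfolding fin_eq .
qed

text \<open>Expanding the product of sums leaves one box for each choice of an interval per
  coordinate. All these boxes slide by the same factor s.\<close>

lemma slide_boxes:
  assumes s: "0 \<le> s" "s \<le> 1" and K: "\<And>j. j \<in> I \<Longrightarrow> finite (K j)"
  shows "(\<integral>\<^sup>+t. ennreal (V t) * (\<Prod>j\<in>I. \<Sum>k\<in>K j. if \<bar>t j - c j k\<bar> < r j k then 1 else 0) \<partial>LI)
     \<le> (\<integral>\<^sup>+t. ennreal (V t) * (\<Prod>j\<in>I. \<Sum>k\<in>K j. if \<bar>t j - s * c j k\<bar> < r j k then 1 else 0) \<partial>LI)"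
proof -
  have eq: "(\<integral>\<^sup>+t. ennreal (V t) * (\<Prod>j\<in>I. \<Sum>k\<in>K j. if \<bar>t j - d j k\<bar> < r j k then 1 else 0) \<partial>LI)
     = (\<Sum>\<sigma>\<in>PiE I K. \<integral>\<^sup>+t. ennreal (V t) * (\<Prod>j\<in>I. if \<bar>t j - d j (\<sigma> j)\<bar> < r j (\<sigma> j) then 1 else 0) \<partial>LI)" for d
    using fin K by (subst prod_sum_PiE) (auto simp: sum_distrib_left intro!: nn_integral_sum)
  show ?thesis unfolding eq by (intro sum_mono slide_box s)
qed

text \<open>All centres, in all coordinates, are contracted by a common factor until two intervals
  of some coordinate touch. These are merged into one, so the number of intervals drops while the
  total length in each coordinate is kept. The induction ends with at most one interval per
  coordinate, which is then centred.\<close>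

lemma slide_intervals:
  assumes "\<And>j. j \<in> I \<Longrightarrow> finite (K j)" "\<And>j k. j \<in> I \<Longrightarrow> k \<in> K j \<Longrightarrow> 0 < r j k"
    "\<And>j k l. j \<in> I \<Longrightarrow> k \<in> K j \<Longrightarrow> l \<in> K j \<Longrightarrow> k \<noteq> l \<Longrightarrow> r j k + r j l \<le> \<bar>c j k - c j l\<bar>"
  shows "(\<integral>\<^sup>+t. ennreal (V t) * (\<Prod>j\<in>I. \<Sum>k\<in>K j. if \<bar>t j - c j k\<bar> < r j k then 1 else 0) \<partial>LI)
     \<le> (\<integral>\<^sup>+t. ennreal (V t) * (\<Prod>j\<in>I. if \<bar>t j\<bar> < (\<Sum>k\<in>K j. r j k) then 1 else 0) \<partial>LI)"
  using assms
proof (induction "\<Sum>j\<in>I. card (K j)" arbitrary: K c r rule: less_induct)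
  case less
  note K = less.prems(1) and r = less.prems(2) and sep = less.prems(3)
  show ?case
  proof (cases "\<forall>j\<in>I. card (K j) \<le> 1")
    case True
    \<comment> \<open>With at most one interval per coordinate nothing can collide, so the centres
      may move all the way to 0.\<close>
    have "(\<integral>\<^sup>+t. ennreal (V t) * (\<Prod>j\<in>I. \<Sum>k\<in>K j. if \<bar>t j - c j k\<bar> < r j k then 1 else 0) \<partial>LI)
       \<le> (\<integral>\<^sup>+t. ennreal (V t) * (\<Prod>j\<in>I. \<Sum>k\<in>K j. if \<bar>t j - 0 * c j k\<bar> < r j k then 1 else 0) \<partial>LI)"
      by (rule slide_boxes) (use K in auto)
    also have "\<dots> \<le> (\<integral>\<^sup>+t. ennreal (V t) * (\<Prod>j\<in>I. if \<bar>t j\<bar> < (\<Sum>k\<in>K j. r j k) then 1 else 0) \<partial>LI)"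
    proof (intro nn_integral_mono mult_left_mono prod_mono_ennreal)
      fix t j assume j: "j \<in> I"
      from True K j have "K j = {} \<or> (\<exists>k. K j = {k})"
        by (metis card_0_eq card_1_singletonE le_SucE le_zero_eq One_nat_def)
      then show "(\<Sum>k\<in>K j. if \<bar>t j - 0 * c j k\<bar> < r j k then 1 else 0) \<le> (if \<bar>t j\<bar> < (\<Sum>k\<in>K j. r j k) then 1 else (0::ennreal))"
        by auto
    qed auto
    finally show ?thesis .
  next
    case False
    \<comment> \<open>The contraction factor at which the intervals k and l of coordinate j touch.
      Going down from 1, the first contact occurs at the largest ratio; \<open>sep\<close> makes it
      at most 1.\<close>
    define ratio where "ratio = (\<lambda>(j, k, l). (r j k + r j l) / \<bar>c j k - c j l\<bar>)"
    define Ps where "Ps = (SIGMA j:I. {(k, l). k \<in> K j \<and> l \<in> K j \<and> k \<noteq> l})"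
    have "finite Ps" unfolding Ps_def
      using fin K by (intro finite_SigmaI finite_subset[of "{(k, l). k \<in> K j \<and> l \<in> K j \<and> k \<noteq> l}" "K j \<times> K j" for j]) auto
    obtain j0 where "j0 \<in> I" "1 < card (K j0)" using False by auto
    then obtain k0 l0 where "(j0, k0, l0) \<in> Ps"
      unfolding Ps_def using K by (auto simp: card_le_Suc0_iff_eq not_le[symmetric])
    then have ne: "Ps \<noteq> {}" by auto
    define s where "s = Max (ratio ` Ps)"
    have "s \<in> ratio ` Ps" unfolding s_def using \<open>finite Ps\<close> ne by (intro Max_in) auto
    then obtain j k' l' where jkl': "j \<in> I" "k' \<in> K j" "l' \<in> K j" "k' \<noteq> l'" "s = ratio (j, k', l')"
      unfolding Ps_def by auto
    have cne: "0 < \<bar>c j k - c j l\<bar>" if "j \<in> I" "k \<in> K j" "l \<in> K j" "k \<noteq> l" for j k l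
      using sep[OF that] r[OF that(1,2)] r[OF that(1,3)] by linarith
    have "s * \<bar>c j k' - c j l'\<bar> = r j k' + r j l'"
      using cne[OF jkl'(1-4)] jkl'(5) by (auto simp: ratio_def)
    then obtain k l where kl: "k \<in> K j" "l \<in> K j" "k \<noteq> l" "c j k < c j l" "s * (c j l - c j k) = r j k + r j l"
    proof (cases "c j k' < c j l'")
      case True then show ?thesis using that[of k' l'] jkl' \<open>s * \<bar>_\<bar> = _\<close> by auto
    next
      case False then show ?thesis using that[of l' k'] jkl' cne[OF jkl'(1-4)] \<open>s * \<bar>_\<bar> = _\<close> by auto
    qed
    have j: "j \<in> I" by fact
    have s1: "s \<le> 1"
      using jkl' sep[OF jkl'(1-4)] cne[OF jkl'(1-4)] by (simp add: ratio_def)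
    have s0: "0 < s"
      using jkl' r[OF jkl'(1,2)] r[OF jkl'(1,3)] cne[OF jkl'(1-4)] by (simp add: ratio_def)
    have sep': "r i a + r i b \<le> \<bar>s * c i a - s * c i b\<bar>" if iab: "i \<in> I" "a \<in> K i" "b \<in> K i" "a \<noteq> b" for i a b
    proof -
      have "ratio (i, a, b) \<le> s" unfolding s_def using \<open>finite Ps\<close> iab by (intro Max_ge) (auto simp: Ps_def)
      then have "r i a + r i b \<le> s * \<bar>c i a - c i b\<bar>"
        using cne[OF iab] by (simp add: ratio_def divide_le_eq)
      also have "\<dots> = \<bar>s * c i a - s * c i b\<bar>" using s0 by (simp add: abs_mult flip: right_diff_distrib)
      finally show ?thesis .
    qed
    \<comment> \<open>Interval l is absorbed by k. As s (c l - c k) = r k + r l, the union runs from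
      s c k - r k to s c k + r k + 2 r l, which gives the new centre and radius.\<close>
    define K' where "K' = K(j := K j - {l})"
    define c' where "c' = (\<lambda>i a. if i = j \<and> a = k then s * c j k + r j l else s * c i a)"
    define r' where "r' = (\<lambda>i a. if i = j \<and> a = k then r j k + r j l else r i a)"
    have sums: "(\<Sum>a\<in>K' i. r' i a) = (\<Sum>a\<in>K i. r i a)" if "i \<in> I" for i
    proof (cases "i = j")
      case False then show ?thesis by (simp add: K'_def r'_def)
    next
      case True
      have "(\<Sum>a\<in>K' j. r' j a) = r' j k + (\<Sum>a\<in>K j - {k, l}. r' j a)"
        using kl K[OF j] by (subst sum.remove[of "K' j" k]) (auto simp: K'_def intro!: sum.cong)
      also have "(\<Sum>a\<in>K j - {k, l}. r' j a) = (\<Sum>a\<in>K j - {k, l}. r j a)"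
        by (intro sum.cong) (auto simp: r'_def)
      also have "r' j k + \<dots> = (\<Sum>a\<in>K j. r j a)"
        using kl K[OF j] by (subst (2) sum.remove[of _ k], simp, simp, subst (2) sum.remove[of _ l], auto simp: r'_def Diff_insert2[symmetric] insert_commute intro!: sum.cong)
      finally show ?thesis using True by simp
    qed
    have "(\<integral>\<^sup>+t. ennreal (V t) * (\<Prod>i\<in>I. \<Sum>a\<in>K i. if \<bar>t i - c i a\<bar> < r i a then 1 else 0) \<partial>LI)
       \<le> (\<integral>\<^sup>+t. ennreal (V t) * (\<Prod>i\<in>I. \<Sum>a\<in>K i. if \<bar>t i - s * c i a\<bar> < r i a then 1 else 0) \<partial>LI)"
      by (rule slide_boxes) (use K s0 s1 in auto)
    also have "\<dots> \<le> (\<integral>\<^sup>+t. ennreal (V t) * (\<Prod>i\<in>I. \<Sum>a\<in>K' i. if \<bar>t i - c' i a\<bar> < r' i a then 1 else 0) \<partial>LI)"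
    proof (intro nn_integral_mono mult_left_mono prod_mono_ennreal)
      fix t i assume i: "i \<in> I"
      show "(\<Sum>a\<in>K i. if \<bar>t i - s * c i a\<bar> < r i a then 1 else 0) \<le> (\<Sum>a\<in>K' i. if \<bar>t i - c' i a\<bar> < r' i a then 1 else (0::ennreal))"
      proof (cases "i = j")
        case False then show ?thesis by (simp add: K'_def c'_def r'_def)
      next
        case True
        let ?g = "\<lambda>a. if \<bar>t j - s * c j a\<bar> < r j a then 1 else (0::ennreal)"
        have "(\<Sum>a\<in>K j. ?g a) = ?g k + ?g l + (\<Sum>a\<in>K j - {k, l}. ?g a)"
          using kl K[OF j] by (subst sum.remove[of _ k], simp, simp, subst sum.remove[of _ l], auto simp: Diff_insert2[symmetric] insert_commute add_ac intro!: sum.cong)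
        \<comment> \<open>The two touching open intervals are disjoint, and the merged interval
          contains both of them and the point of contact.\<close>
        also have "?g k + ?g l \<le> (if \<bar>t j - c' j k\<bar> < r' j k then 1 else 0)"
          using kl(5) r[OF j kl(1)] r[OF j kl(2)] unfolding c'_def r'_def by (auto simp: algebra_simps)
        also have "(\<Sum>a\<in>K j - {k, l}. ?g a) = (\<Sum>a\<in>K j - {k, l}. if \<bar>t j - c' j a\<bar> < r' j a then 1 else 0)"
          by (intro sum.cong) (auto simp: c'_def r'_def)
        also have "(if \<bar>t j - c' j k\<bar> < r' j k then 1 else 0) + (\<Sum>a\<in>K j - {k, l}. if \<bar>t j - c' j a\<bar> < r' j a then 1 else 0)
            = (\<Sum>a\<in>K' j. if \<bar>t j - c' j a\<bar> < r' j a then 1 else (0::ennreal))"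
          using kl K[OF j] by (subst sum.remove[of "K' j" k]) (auto simp: K'_def intro!: sum.cong)
        finally show ?thesis using True by (simp add: add_right_mono)
      qed
    qed auto
    also have "\<dots> \<le> (\<integral>\<^sup>+t. ennreal (V t) * (\<Prod>i\<in>I. if \<bar>t i\<bar> < (\<Sum>a\<in>K' i. r' i a) then 1 else 0) \<partial>LI)"
    proof (rule less.hyps)
      show "(\<Sum>i\<in>I. card (K' i)) < (\<Sum>i\<in>I. card (K i))"
      proof -
        have "0 < card (K j)" using kl K[OF j] by (auto simp: card_gt_0_iff)
        then show ?thesis
          using fin j K kl by (intro sum_strict_mono_ex1) (auto simp: K'_def intro: card_Diff1_le)
      qed
      show "finite (K' i)" if "i \<in> I" for i using K that j by (auto simp: K'_def)
      show "0 < r' i a" if "i \<in> I" "a \<in> K' i" for i a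
        using r that kl j by (auto simp: r'_def K'_def add_pos_pos split: if_splits)
      show "r' i a + r' i b \<le> \<bar>c' i a - c' i b\<bar>" if iab: "i \<in> I" "a \<in> K' i" "b \<in> K' i" "a \<noteq> b" for i a b
      proof -
        have main: "r j k + r j l + r j b \<le> \<bar>s * c j k + r j l - s * c j b\<bar>" if "b \<in> K j" "b \<noteq> k" "b \<noteq> l" for b
          using sep'[OF j kl(1) that(1)] sep'[OF j kl(2) that(1)] that r[OF j kl(1)] r[OF j kl(2)] r[OF j that(1)] kl(5)
          by (auto simp: right_diff_distrib abs_if split: if_splits)
        have iab': "a \<in> K i" "b \<in> K i" using iab by (auto simp: K'_def split: if_splits)
        consider "i = j" "a = k" | "i = j" "b = k" | "i \<noteq> j \<or> (a \<noteq> k \<and> b \<noteq> k)" by blast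
        then show ?thesis
        proof cases
          case 1 then show ?thesis using main[of b] iab by (auto simp: c'_def r'_def K'_def)
        next
          case 2 then show ?thesis using main[of a] iab by (auto simp: c'_def r'_def K'_def abs_minus_commute)
        next
          case 3 then show ?thesis using sep'[OF iab(1) iab' iab(4)] by (auto simp: c'_def r'_def)
        qed
      qed
    qed
    also have "\<dots> = (\<integral>\<^sup>+t. ennreal (V t) * (\<Prod>i\<in>I. if \<bar>t i\<bar> < (\<Sum>a\<in>K i. r i a) then 1 else 0) \<partial>LI)"
      by (intro nn_integral_cong arg_cong2[where f="(*)"] prod.cong refl) (simp add: sums)
    finally show ?thesis .
  qed
qed

text \<open>Closed dyadic cells inside the open set U exhaust U up to dyadic points. Each cell is
  recorded by its centre and its radius, half of 2^(-n), as \<open>slide_intervals\<close> expects;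
  the sum of the radii is then to be compared with half the measure of U, the half-length of the
  centred interval.\<close>

lemma dyadic_intervals_subset:
  fixes U :: "real set"
  assumes U: "open U" "bounded U"
  defines "K \<equiv> \<lambda>n. {z::int. {of_int z / 2 ^ n .. (of_int z + 1) / 2 ^ n} \<subseteq> U}"
  shows "finite (K n)" and "(\<Sum>z\<in>K n. 1 / 2 ^ Suc n) \<le> measure lborel U / 2"
    and "x \<in> U \<Longrightarrow> (\<And>n z. x \<noteq> of_int z / 2 ^ n) \<Longrightarrow>
      \<forall>\<^sub>F n in sequentially. 1 \<le> (\<Sum>z\<in>K n. if \<bar>x - (of_int z + 1 / 2) / 2 ^ n\<bar> < 1 / 2 ^ Suc n then 1 else (0::ennreal))"
proof -
  obtain R where R: "\<And>x. x \<in> U \<Longrightarrow> \<bar>x\<bar> \<le> R" using U(2) by (auto simp: bounded_iff)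
  have fin: "finite (K n)" for n
  proof (rule finite_subset)
    show "K n \<subseteq> {\<lfloor>- R * 2 ^ n\<rfloor> .. \<lceil>R * 2 ^ n\<rceil>}"
    proof
      fix z assume "z \<in> K n"
      then have "of_int z / 2 ^ n \<in> U" unfolding K_def by (auto simp: divide_right_mono)
      from R[OF this] have "\<bar>of_int z\<bar> \<le> R * 2 ^ n" by (simp add: abs_divide divide_le_eq)
      then have "- (R * 2 ^ n) \<le> of_int z" "of_int z \<le> R * 2 ^ n" by (auto simp: abs_le_iff)
      then show "z \<in> {\<lfloor>- R * 2 ^ n\<rfloor> .. \<lceil>R * 2 ^ n\<rceil>}" by (auto simp: floor_le_iff le_ceiling_iff)
    qed
  qed simp
  then show "finite (K n)" .
  show "(\<Sum>z\<in>K n. 1 / 2 ^ Suc n) \<le> measure lborel U / 2"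
  proof -
    let ?C = "\<lambda>z::int. {of_int z / 2 ^ n <..< (of_int z + 1) / 2 ^ n} :: real set"
    have "emeasure lborel U < \<infinity>" using emeasure_bounded_finite[OF U(2)] by simp
    have "(\<Sum>z\<in>K n. emeasure lborel (?C z)) = emeasure lborel (\<Union>z\<in>K n. ?C z)"
    proof (rule sum_emeasure)
      show "disjoint_family_on ?C (K n)"
      proof (unfold disjoint_family_on_def, intro ballI impI)
        fix m m' :: int assume "m \<noteq> m'"
        show "?C m \<inter> ?C m' = {}"
        proof (rule ccontr)
          assume "?C m \<inter> ?C m' \<noteq> {}"
          then obtain x where x: "x \<in> ?C m" "x \<in> ?C m'" by blast
          have "of_int m < x * 2 ^ n" "x * 2 ^ n < of_int m + 1" "of_int m' < x * 2 ^ n" "x * 2 ^ n < of_int m' + 1"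
            using x by (auto simp: field_simps)
          then have "of_int m < (of_int m' + 1 :: real)" "of_int m' < (of_int m + 1 :: real)" by linarith+
          then have "m = m'" by linarith
          then show False using \<open>m \<noteq> m'\<close> by simp
        qed
      qed
    qed (use fin in auto)
    also have "\<dots> \<le> emeasure lborel U"
      using U fin by (intro emeasure_mono) (auto simp: K_def subset_iff)
    finally have "(\<Sum>z\<in>K n. emeasure lborel (?C z)) \<le> emeasure lborel U" .
    moreover have "emeasure lborel (?C z) = ennreal (1 / 2 ^ n)" for z
      by (simp add: divide_right_mono flip: diff_divide_distrib)
    ultimately have "ennreal (\<Sum>z\<in>K n. 1 / 2 ^ n) \<le> emeasure lborel U" by (simp del: sum_constant)
    then have "(\<Sum>z\<in>K n. 1 / 2 ^ n) \<le> measure lborel U"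
      unfolding measure_def using \<open>emeasure lborel U < \<infinity>\<close> by (rule le_enn2real)
    then show ?thesis by simp
  qed
  assume x: "x \<in> U" "\<And>n z. x \<noteq> of_int z / 2 ^ n"
  obtain e where e: "0 < e" "\<And>y. \<bar>y - x\<bar> < e \<Longrightarrow> y \<in> U"
    using U(1) x(1) by (auto simp: open_dist dist_real_def)
  have "(\<lambda>n. (1/2::real) ^ n) \<longlonglongrightarrow> 0" by (rule LIMSEQ_power_zero) simp
  then have "\<forall>\<^sub>F n in sequentially. (1/2::real) ^ n < e" using e by (auto dest: order_tendstoD)
  then show "\<forall>\<^sub>F n in sequentially. 1 \<le> (\<Sum>z\<in>K n. if \<bar>x - (of_int z + 1 / 2) / 2 ^ n\<bar> < 1 / 2 ^ Suc n then 1 else (0::ennreal))"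
  proof eventually_elim
    case (elim n)
    define z where "z = \<lfloor>x * 2 ^ n\<rfloor>"
    have z: "of_int z \<le> x * 2 ^ n" "x * 2 ^ n < of_int z + 1" by (auto simp: z_def)
    have "x * 2 ^ n \<noteq> of_int z" using x(2)[of z n] by (auto simp: field_simps)
    then have z': "of_int z / 2 ^ n < x" "x < (of_int z + 1) / 2 ^ n" using z by (auto simp: field_simps)
    have w: "(of_int z + 1) / 2 ^ n = of_int z / 2 ^ n + (1/2::real) ^ n" by (simp add: add_divide_distrib power_one_over)
    have "z \<in> K n" unfolding K_def using z' w elim e(2) by (auto simp: abs_if)
    moreover have "\<bar>x - (of_int z + 1 / 2) / 2 ^ n\<bar> < 1 / 2 ^ Suc n"
      using z' by (auto simp: abs_less_iff add_divide_distrib)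
    ultimately show ?case
      using member_le_sum[of z "K n" "\<lambda>z. if \<bar>x - (of_int z + 1 / 2) / 2 ^ n\<bar> < 1 / 2 ^ Suc n then 1 else (0::ennreal)"] fin
      by auto
  qed
qed

text \<open>Finite unions of dyadic cells approximate the sets U j from inside. Away from the null
  set of points with a dyadic coordinate the approximating products eventually dominate the
  indicator, and Fatou's lemma passes to the limit.\<close>

lemma rearrange_open:
  assumes U: "\<And>j. j \<in> I \<Longrightarrow> open (U j)" "\<And>j. j \<in> I \<Longrightarrow> bounded (U j)"
  shows "(\<integral>\<^sup>+t. ennreal (V t) * (\<Prod>j\<in>I. if t j \<in> U j then 1 else 0) \<partial>LI)
     \<le> (\<integral>\<^sup>+t. ennreal (V t) * (\<Prod>j\<in>I. if \<bar>t j\<bar> < measure lborel (U j) / 2 then 1 else 0) \<partial>LI)" (is "?L \<le> ?R")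
proof -
  define K where "K n j = {z::int. {of_int z / 2 ^ n .. (of_int z + 1) / 2 ^ n} \<subseteq> U j}" for n :: nat and j
  note dy = dyadic_intervals_subset[OF U, folded K_def]
  define g where "g n t = ennreal (V t) * (\<Prod>j\<in>I. \<Sum>z\<in>K n j. if \<bar>t j - (of_int z + 1 / 2) / 2 ^ n\<bar> < 1 / 2 ^ Suc n then 1 else 0)" for n t
  have gm[measurable]: "g n \<in> borel_measurable LI" for n
    unfolding g_def using fin by measurable
  have "countable (\<Union>n. range (\<lambda>z::int. real_of_int z / 2 ^ n))" by auto
  then have "AE x in lborel. \<forall>n. \<forall>z::int. x \<noteq> real_of_int z / 2 ^ n"
    by (rule AE_I'[OF countable_imp_null_set_lborel]) auto
  then have "AE t in LI. \<forall>n. \<forall>z::int. t j \<noteq> real_of_int z / 2 ^ n" if "j \<in> I" for j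
    by (intro AE_PiM_component_sigma_finite[OF lborel_PiM.product_sigma_finite_axioms fin that,
          where P="\<lambda>x. \<forall>n. \<forall>z::int. x \<noteq> real_of_int z / 2 ^ n"])
  then have "AE t in LI. \<forall>j\<in>I. \<forall>n. \<forall>z::int. t j \<noteq> real_of_int z / 2 ^ n"
    using fin by (intro AE_finite_allI) auto
  then have "AE t in LI. ennreal (V t) * (\<Prod>j\<in>I. if t j \<in> U j then 1 else 0) \<le> liminf (\<lambda>n. g n t)"
  proof eventually_elim
    case (elim t)
    show ?case
    proof (cases "\<forall>j\<in>I. t j \<in> U j")
      case True
      have "\<forall>\<^sub>F n in sequentially. \<forall>j\<in>I. 1 \<le> (\<Sum>z\<in>K n j. if \<bar>t j - (of_int z + 1 / 2) / 2 ^ n\<bar> < 1 / 2 ^ Suc n then 1 else (0::ennreal))"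
        using True elim dy(3) fin by (intro eventually_ball_finite) blast+
      then have "\<forall>\<^sub>F n in sequentially. ennreal (V t) * (\<Prod>j\<in>I. if t j \<in> U j then 1 else 0) \<le> g n t"
      proof eventually_elim
        case (elim n)
        then have "(\<Prod>j\<in>I. if t j \<in> U j then 1 else 0) \<le> (\<Prod>j\<in>I. \<Sum>z\<in>K n j. if \<bar>t j - (of_int z + 1 / 2) / 2 ^ n\<bar> < 1 / 2 ^ Suc n then 1 else (0::ennreal))"
          by (intro prod_mono_ennreal) auto
        then show ?case unfolding g_def by (rule mult_left_mono) simp
      qed
      then show ?thesis by (rule Liminf_bounded)
    next
      case False
      then have "(\<Prod>j\<in>I. if t j \<in> U j then 1 else (0::ennreal)) = 0" using fin by (auto simp: prod_of_bool)
      then show ?thesis by (simp only: mult_zero_right zero_le)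
    qed
  qed
  then have "?L \<le> (\<integral>\<^sup>+t. liminf (\<lambda>n. g n t) \<partial>LI)" by (rule nn_integral_mono_AE)
  also have "\<dots> \<le> liminf (\<lambda>n. \<integral>\<^sup>+t. g n t \<partial>LI)" by (rule nn_integral_liminf) measurable
  also have "\<dots> \<le> ?R"
  proof (intro Liminf_le always_eventually allI)
    fix n
    have "(\<integral>\<^sup>+t. g n t \<partial>LI) \<le> (\<integral>\<^sup>+t. ennreal (V t) * (\<Prod>j\<in>I. if \<bar>t j\<bar> < (\<Sum>z\<in>K n j. 1 / 2 ^ Suc n) then 1 else 0) \<partial>LI)"
      unfolding g_def
    proof (rule slide_intervals)
      fix j and k l :: int assume "k \<noteq> l"
      then have "1 \<le> \<bar>real_of_int k - real_of_int l\<bar>" by linarith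
      then have "1 / 2 ^ n \<le> \<bar>real_of_int k - real_of_int l\<bar> / 2 ^ n" by (simp add: divide_right_mono)
      also have "\<dots> = \<bar>(real_of_int k + 1 / 2) / 2 ^ n - (real_of_int l + 1 / 2) / 2 ^ n\<bar>"
        by (simp add: abs_divide flip: diff_divide_distrib)
      finally show "1 / 2 ^ Suc n + 1 / 2 ^ Suc n \<le> \<bar>(real_of_int k + 1 / 2) / 2 ^ n - (real_of_int l + 1 / 2) / 2 ^ n\<bar>"
        by simp
    qed (use dy in auto)
    also have "\<dots> \<le> ?R"
    proof (intro nn_integral_mono mult_left_mono prod_mono_ennreal)
      fix t j assume "j \<in> I"
      then show "(if \<bar>t j\<bar> < (\<Sum>z\<in>K n j. 1 / 2 ^ Suc n) then 1 else 0) \<le> (if \<bar>t j\<bar> < measure lborel (U j) / 2 then 1 else (0::ennreal))"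
        using dy(2)[of j n] by (auto simp del: sum_constant)
    qed simp
    finally show "(\<integral>\<^sup>+t. g n t \<partial>LI) \<le> ?R" .
  qed simp
  finally show ?thesis .
qed

text \<open>The rearrangement f' enters only through its superlevel sets, so that the lemma fits
  \<open>steiner\<close> on a fibre by way of \<open>less_steiner_iff\<close>.\<close>

lemma rearrange_functions:
  fixes f f' :: "'i \<Rightarrow> real \<Rightarrow> real"
  assumes [measurable]: "\<And>j. j \<in> I \<Longrightarrow> f j \<in> borel_measurable borel" "\<And>j. j \<in> I \<Longrightarrow> f' j \<in> borel_measurable borel"
    and f: "\<And>j c. j \<in> I \<Longrightarrow> 0 < c \<Longrightarrow> open {t. c < f j t}" "\<And>j c. j \<in> I \<Longrightarrow> 0 < c \<Longrightarrow> bounded {t. c < f j t}"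
    and f': "\<And>j c t. j \<in> I \<Longrightarrow> 0 < c \<Longrightarrow> c < f' j t \<longleftrightarrow> \<bar>t\<bar> < measure lborel {t. c < f j t} / 2"
  shows "(\<integral>\<^sup>+t. ennreal (V t) * (\<Prod>j\<in>I. ennreal (f j (t j))) \<partial>LI) \<le> (\<integral>\<^sup>+t. ennreal (V t) * (\<Prod>j\<in>I. ennreal (f' j (t j))) \<partial>LI)"
proof (rule nn_integral_layer_cake_prod_mono[OF fin sigma_finite_PiM_lborel[OF fin] sigma_finite_PiM_lborel[OF fin]])
  fix c :: "'i \<Rightarrow> real" assume c: "\<And>j. j \<in> I \<Longrightarrow> 0 < c j"
  have "(\<integral>\<^sup>+t. ennreal (V t) * (\<Prod>j\<in>I. if t j \<in> {s. c j < f j s} then 1 else 0) \<partial>LI)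
    \<le> (\<integral>\<^sup>+t. ennreal (V t) * (\<Prod>j\<in>I. if \<bar>t j\<bar> < measure lborel {s. c j < f j s} / 2 then 1 else 0) \<partial>LI)"
    using f c by (intro rearrange_open) auto
  moreover have "(\<Prod>j\<in>I. if t j \<in> {s. c j < f j s} then 1 else 0) = (\<Prod>j\<in>I. if ennreal (c j) < ennreal (f j (t j)) then 1 else (0::ennreal))" for t
    using c by (intro prod.cong) (auto simp: ennreal_less_iff less_imp_le)
  moreover have "(\<Prod>j\<in>I. if \<bar>t j\<bar> < measure lborel {s. c j < f j s} / 2 then 1 else 0) = (\<Prod>j\<in>I. if ennreal (c j) < ennreal (f' j (t j)) then 1 else (0::ennreal))" for t
    using c f' by (intro prod.cong) (auto simp: ennreal_less_iff less_imp_le)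
  ultimately show "(\<integral>\<^sup>+t. ennreal (V t) * (\<Prod>j\<in>I. if ennreal (c j) < ennreal (f j (t j)) then 1 else 0) \<partial>LI)
    \<le> (\<integral>\<^sup>+t. ennreal (V t) * (\<Prod>j\<in>I. if ennreal (c j) < ennreal (f' j (t j)) then 1 else 0) \<partial>LI)"
    by simp
qed auto

end

subsection \<open>Steiner symmetrization of continuous functions\<close>

text \<open>Symmetrizations and reflections preserve this class with the same R and A.\<close>

definition cont_supp :: "real \<Rightarrow> real \<Rightarrow> ('a::euclidean_space \<Rightarrow> real) \<Rightarrow> bool" where
  "cont_supp R A f \<longleftrightarrow> continuous_on UNIV f \<and> (\<forall>x. 0 \<le> f x \<and> f x \<le> A) \<and> (\<forall>x. R < norm x \<longrightarrow> f x = 0)"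

definition hproj :: "'a::euclidean_space \<Rightarrow> 'a \<Rightarrow> 'a" where
  "hproj b x = x - (x \<bullet> b) *\<^sub>R b"

definition fiber :: "'a::euclidean_space \<Rightarrow> ('a \<Rightarrow> real) \<Rightarrow> 'a \<Rightarrow> real \<Rightarrow> real set" where
  "fiber b f x c = {s. c < f (hproj b x + s *\<^sub>R b)}"

text \<open>The symmetric decreasing rearrangement of f on the line through x in direction b, read
  off from the lengths of its superlevel sets. Inserting 0 keeps the supremum meaningful when no
  level qualifies.\<close>

definition steiner :: "'a::euclidean_space \<Rightarrow> ('a \<Rightarrow> real) \<Rightarrow> 'a \<Rightarrow> real" where
  "steiner b f x = Sup (insert 0 {c. 0 \<le> c \<and> 2 * \<bar>x \<bullet> b\<bar> < measure lborel (fiber b f x c)})"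

lemma cont_suppD:
  assumes "cont_supp R A f"
  shows "continuous_on UNIV f" "0 \<le> f x" "f x \<le> A" "R < norm x \<Longrightarrow> f x = 0" "f \<in> borel_measurable borel"
    "0 < f x \<Longrightarrow> norm x \<le> R"
  using assms by (auto simp: cont_supp_def borel_measurable_continuous_onI not_less[symmetric])

lemma cont_supp_modulus:
  fixes f :: "'a::euclidean_space \<Rightarrow> real"
  assumes f: "cont_supp R A f" and e: "0 < e"
  obtains d where "0 < d" "\<And>u v. norm (u - v) \<le> d \<Longrightarrow> \<bar>f u - f v\<bar> \<le> e"
proof -
  have cpt: "compact (cball 0 (R + 1) :: 'a set)" by simp
  have "uniformly_continuous_on (cball 0 (R + 1)) f"
    using cont_suppD(1)[OF f] by (intro compact_uniformly_continuous cpt) (auto intro: continuous_on_subset)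
  then obtain d where d: "0 < d" "\<And>u v. u \<in> cball 0 (R + 1) \<Longrightarrow> v \<in> cball 0 (R + 1) \<Longrightarrow> dist v u < d \<Longrightarrow> dist (f v) (f u) < e"
    using e unfolding uniformly_continuous_on_def by meson
  \<comment> \<open>The cap 1 on the distance ensures that if one of the points leaves the ball of
    radius R + 1, both lie beyond R, where f vanishes.\<close>
  have mod: "\<bar>f u - f v\<bar> \<le> e" if uv: "norm (u - v) \<le> min (d / 2) 1" for u v
  proof (cases "norm u \<le> R + 1 \<and> norm v \<le> R + 1")
    case True
    then show ?thesis using d(2)[of v u] uv d(1) by (auto simp: dist_norm)
  next
    case False
    then have "R < norm u" "R < norm v" using uv norm_triangle_ineq2[of u v] norm_triangle_ineq2[of v u] by (auto simp: norm_minus_commute)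
    then show ?thesis using cont_suppD(4)[OF f] e by simp
  qed
  show ?thesis by (rule that[of "min (d / 2) 1"]) (use d mod in auto)
qed

lemma emeasure_translate_real:
  assumes [measurable]: "E \<in> sets (borel :: real measure)"
  shows "emeasure lborel {s. s + h \<in> E} = emeasure lborel E"
proof -
  have "emeasure lborel E = emeasure (distr lborel borel ((+) h)) E" by (simp add: lborel_distr_plus)
  also have "\<dots> = emeasure lborel {s. s + h \<in> E}"
    by (subst emeasure_distr) (auto simp: vimage_def add.commute)
  finally show ?thesis by simp
qed

text \<open>With m the supremum of E, the translate E - h lies in E' and does not pass m - h, and
  the interval (m - h, m + h) lies in E' as well. They are disjoint, so the interval contributes the
  extra 2 h.\<close>

lemma measure_thicken_real:
  fixes E E' :: "real set"
  assumes E: "E \<in> sets borel" "bounded E" "E \<noteq> {}" and E': "E' \<in> sets borel" "bounded E'"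
    and h: "0 \<le> h" and sub: "\<And>s s'. s \<in> E \<Longrightarrow> \<bar>s' - s\<bar> \<le> h \<Longrightarrow> s' \<in> E'"
  shows "measure lborel E + 2 * h \<le> measure lborel E'"
proof -
  define m where "m = Sup E"
  have m: "s \<le> m" if "s \<in> E" for s unfolding m_def using E that by (intro cSup_upper bounded_imp_bdd_above)
  let ?S = "{s. s + h \<in> E}" and ?T = "{m - h<..<m + h}"
  have [measurable]: "?S \<in> sets borel" using E(1) by measurable
  have "?S \<inter> ?T = {}" using m by fastforce
  have "?S \<union> ?T \<subseteq> E'"
  proof
    fix z assume "z \<in> ?S \<union> ?T"
    then show "z \<in> E'"
    proof
      assume "z \<in> ?S" then show ?thesis using sub[of "z + h" z] h by auto
    next
      assume z: "z \<in> ?T"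
      then have "z - h < m" by auto
      then obtain s where s: "s \<in> E" "z - h < s"
        unfolding m_def using less_cSup_iff[OF E(3) bounded_imp_bdd_above[OF E(2)]] by auto
      then show ?thesis using sub[of s z] m[of s] z by auto
    qed
  qed
  have finE: "emeasure lborel E < \<infinity>" "emeasure lborel E' < \<infinity>" using E E' emeasure_bounded_finite by auto
  have "emeasure lborel E + ennreal (2 * h) = emeasure lborel ?S + emeasure lborel ?T"
    using h E by (simp add: emeasure_translate_real)
  also have "\<dots> = emeasure lborel (?S \<union> ?T)" using \<open>?S \<inter> ?T = {}\<close> by (intro plus_emeasure) auto
  also have "\<dots> \<le> emeasure lborel E'" using \<open>?S \<union> ?T \<subseteq> E'\<close> E' by (intro emeasure_mono) auto
  finally have "ennreal (measure lborel E + 2 * h) \<le> ennreal (measure lborel E')"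
    using finE h by (simp add: emeasure_eq_ennreal_measure less_top[symmetric])
  then show ?thesis by simp
qed

context
  fixes b :: "'a::euclidean_space"
  assumes b1: "norm b = 1"
begin

lemma bb: "b \<bullet> b = 1" using b1 by (simp add: norm_eq_1)

lemma hproj_inner: "hproj b x \<bullet> b = 0"
  by (simp add: hproj_def inner_diff_left bb)

lemma hproj_fiber: "hproj b (hproj b x + s *\<^sub>R b) = hproj b x" "(hproj b x + s *\<^sub>R b) \<bullet> b = s"
  by (simp_all add: hproj_def inner_diff_left inner_add_left bb)

lemma hproj_add: "hproj b x + (x \<bullet> b) *\<^sub>R b = x"
  by (simp add: hproj_def)

lemma hproj_shift: "hproj b (x + s *\<^sub>R b) = hproj b x"
  by (simp add: hproj_def inner_diff_left inner_add_left bb scaleR_add_left)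

lemma norm_fiber: "(norm (hproj b x + s *\<^sub>R b))\<^sup>2 = (norm (hproj b x))\<^sup>2 + s\<^sup>2"
proof -
  have "b \<bullet> hproj b x = 0" using hproj_inner[of x] by (simp add: inner_commute)
  then show ?thesis unfolding power2_norm_eq_inner
    by (simp add: inner_add_left inner_add_right bb hproj_inner power2_eq_square)
qed

lemma norm_fiber_diff:
  "(norm ((hproj b x + s *\<^sub>R b) - (hproj b x' + s' *\<^sub>R b)))\<^sup>2 = (norm (hproj b x - hproj b x'))\<^sup>2 + (s - s')\<^sup>2"
proof -
  have 1: "(hproj b x + s *\<^sub>R b) - (hproj b x' + s' *\<^sub>R b) = hproj b (x - x') + (s - s') *\<^sub>R b"
    by (simp add: hproj_def inner_diff_left algebra_simps)
  have 2: "hproj b (x - x') = hproj b x - hproj b x'"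
    by (simp add: hproj_def inner_diff_left algebra_simps)
  show ?thesis unfolding 1 norm_fiber unfolding 2 ..
qed

lemma fiber_open: "continuous_on UNIV f \<Longrightarrow> open (fiber b f x c)"
  unfolding fiber_def
  by (rule open_Collect_less) (auto intro!: continuous_intros continuous_on_compose2[of UNIV f])

lemma fiber_subset:
  assumes "cont_supp R A f" "0 \<le> c"
  shows "fiber b f x c \<subseteq> {s. (norm (hproj b x))\<^sup>2 + s\<^sup>2 \<le> R\<^sup>2}"
proof
  fix s assume "s \<in> fiber b f x c"
  then have "0 < f (hproj b x + s *\<^sub>R b)" using assms by (auto simp: fiber_def)
  then have "norm (hproj b x + s *\<^sub>R b) \<le> R" using cont_suppD(6)[OF assms(1)] by blast
  then have "(norm (hproj b x + s *\<^sub>R b))\<^sup>2 \<le> R\<^sup>2" by (rule power_mono) simp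
  then show "s \<in> {s. (norm (hproj b x))\<^sup>2 + s\<^sup>2 \<le> R\<^sup>2}" by (simp add: norm_fiber)
qed

lemma fiber_bounded:
  assumes "cont_supp R A f" "0 \<le> c"
  shows "bounded (fiber b f x c)" "fiber b f x c \<in> sets borel" "emeasure lborel (fiber b f x c) < \<infinity>"
    "emeasure lborel (fiber b f x c) = ennreal (measure lborel (fiber b f x c))"
proof -
  have "fiber b f x c \<subseteq> {-\<bar>R\<bar>..\<bar>R\<bar>}"
  proof
    fix s assume "s \<in> fiber b f x c"
    then have "s\<^sup>2 \<le> \<bar>R\<bar>\<^sup>2" using fiber_subset[OF assms, of x] by (auto intro: order_trans[rotated])
    then have "\<bar>s\<bar> \<le> \<bar>R\<bar>" by (simp add: abs_le_square_iff)
    then show "s \<in> {-\<bar>R\<bar>..\<bar>R\<bar>}" by auto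
  qed
  then show "bounded (fiber b f x c)" using bounded_closed_interval bounded_subset by blast
  then show *: "emeasure lborel (fiber b f x c) < \<infinity>" using emeasure_bounded_finite by auto
  then show "emeasure lborel (fiber b f x c) = ennreal (measure lborel (fiber b f x c))"
    by (simp add: emeasure_eq_ennreal_measure less_top[symmetric])
  show "fiber b f x c \<in> sets borel" using fiber_open[of f x c] cont_suppD(1)[OF assms(1)] by auto
qed

lemma fiber_antimono:
  assumes "cont_supp R A f" "0 \<le> c" "fiber b g y c' \<subseteq> fiber b f x c" "fiber b g y c' \<in> sets borel"
  shows "measure lborel (fiber b g y c') \<le> measure lborel (fiber b f x c)"
  using assms fiber_bounded[OF assms(1,2), of x] by (intro measure_mono_fmeasurable) (auto simp: fmeasurable_def)

lemma steiner_bdd: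
  assumes "cont_supp R A f"
  shows "c \<in> insert 0 {c. 0 \<le> c \<and> 2 * \<bar>x \<bullet> b\<bar> < measure lborel (fiber b f x c)} \<Longrightarrow> c \<le> A"
proof -
  have "0 \<le> A" using cont_suppD(2,3)[OF assms, of 0] by linarith
  moreover have "fiber b f x c = {}" if "A \<le> c"
    using cont_suppD(3)[OF assms] that by (auto simp: fiber_def not_less intro: order_trans)
  ultimately show "c \<in> insert 0 {c. 0 \<le> c \<and> 2 * \<bar>x \<bullet> b\<bar> < measure lborel (fiber b f x c)} \<Longrightarrow> c \<le> A"
    by (cases "A \<le> c") (auto simp: zero_less_mult_iff)
qed

lemma steiner_range:
  assumes "cont_supp R A f"
  shows "0 \<le> steiner b f x" "steiner b f x \<le> A"
proof -
  show "0 \<le> steiner b f x" unfolding steiner_def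
    using steiner_bdd[OF assms, of _ x] by (intro cSup_upper) (auto intro!: bdd_aboveI[of _ A])
  show "steiner b f x \<le> A" unfolding steiner_def
    using steiner_bdd[OF assms, of _ x] by (intro cSup_least) auto
qed

text \<open>The strict inequality passes through the supremum because the superlevel set at c is the
  increasing union of those at c + 1 / Suc n: by continuity of measure a slightly higher level still
  qualifies.\<close>

lemma less_steiner_iff:
  assumes f: "cont_supp R A f" and c: "0 \<le> c"
  shows "c < steiner b f x \<longleftrightarrow> 2 * \<bar>x \<bullet> b\<bar> < measure lborel (fiber b f x c)"
proof -
  let ?S = "insert 0 {c. 0 \<le> c \<and> 2 * \<bar>x \<bullet> b\<bar> < measure lborel (fiber b f x c)}"
  have bdd: "bdd_above ?S" using steiner_bdd[OF f, of _ x] by (intro bdd_aboveI[of _ A]) auto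
  show ?thesis
  proof
    assume "c < steiner b f x"
    then obtain c' where c': "c' \<in> ?S" "c < c'"
      unfolding steiner_def using less_cSup_iff[OF _ bdd] by auto
    then have "0 \<le> c'" "2 * \<bar>x \<bullet> b\<bar> < measure lborel (fiber b f x c')" using c by auto
    moreover have "measure lborel (fiber b f x c') \<le> measure lborel (fiber b f x c)"
      using c' c fiber_bounded[OF f \<open>0 \<le> c'\<close>] by (intro fiber_antimono[OF f]) (auto simp: fiber_def)
    ultimately show "2 * \<bar>x \<bullet> b\<bar> < measure lborel (fiber b f x c)" by linarith
  next
    assume *: "2 * \<bar>x \<bullet> b\<bar> < measure lborel (fiber b f x c)"
    let ?F = "\<lambda>n. fiber b f x (c + 1 / Suc n)"
    have U: "(\<Union>n. ?F n) = fiber b f x c"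
    proof (intro equalityI subsetI)
      fix s assume "s \<in> fiber b f x c"
      then have "0 < f (hproj b x + s *\<^sub>R b) - c" by (simp add: fiber_def)
      then obtain n where "1 / Suc n < f (hproj b x + s *\<^sub>R b) - c" using nat_approx_posE by blast
      then show "s \<in> (\<Union>n. ?F n)" by (auto simp: fiber_def intro!: exI[of _ n])
    next
      fix s assume "s \<in> (\<Union>n. ?F n)"
      then obtain n where "c + 1 / Suc n < f (hproj b x + s *\<^sub>R b)" by (auto simp: fiber_def)
      moreover have "0 < 1 / real (Suc n)" by simp
      ultimately show "s \<in> fiber b f x c" unfolding fiber_def mem_Collect_eq by linarith
    qed
    have "(\<lambda>n. measure lborel (?F n)) \<longlonglongrightarrow> measure lborel (\<Union>n. ?F n)"
    proof (rule Lim_measure_incseq)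
      show "range ?F \<subseteq> sets lborel" using fiber_bounded[OF f] c by auto
      show "incseq ?F"
      proof (rule incseq_SucI, rule subsetI)
        fix n s assume "s \<in> ?F n"
        moreover have "1 / real (Suc (Suc n)) \<le> 1 / real (Suc n)" by (rule divide_left_mono) auto
        ultimately show "s \<in> ?F (Suc n)" unfolding fiber_def mem_Collect_eq by linarith
      qed
      show "emeasure lborel (\<Union>n. ?F n) \<noteq> \<infinity>" unfolding U using fiber_bounded[OF f c] by auto
    qed
    then have "\<forall>\<^sub>F n in sequentially. 2 * \<bar>x \<bullet> b\<bar> < measure lborel (?F n)"
      unfolding U using * by (rule order_tendstoD)
    then obtain n where "2 * \<bar>x \<bullet> b\<bar> < measure lborel (?F n)" by (auto simp: eventually_sequentially)
    then have "c + 1 / Suc n \<in> ?S" using c by auto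
    then have "c + 1 / Suc n \<le> steiner b f x" unfolding steiner_def using bdd by (rule cSup_upper)
    moreover have "0 < 1 / real (Suc n)" by simp
    ultimately show "c < steiner b f x" by linarith
  qed
qed

text \<open>If the value at x exceeded the value c at x' by more than e, the superlevel set at c + e
  over x, thickened by the difference h of the coordinates along b, would lie in the superlevel set
  at c over x'. Its length grows by 2 h, enough to push the value at x' above c. Every modulus of
  continuity is thus inherited.\<close>

lemma steiner_modulus:
  assumes f: "cont_supp R A f" and e: "0 \<le> e"
    and mod: "\<And>x y. norm (x - y) \<le> d \<Longrightarrow> \<bar>f x - f y\<bar> \<le> e" and d: "norm (x - y) \<le> d"
  shows "\<bar>steiner b f x - steiner b f y\<bar> \<le> e"
proof -
  have main: "steiner b f x \<le> steiner b f x' + e" if d: "norm (x - x') \<le> d" for x x'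
  proof (rule ccontr)
    define c where "c = steiner b f x'"
    assume "\<not> steiner b f x \<le> steiner b f x' + e"
    then have "c + e < steiner b f x" by (simp add: c_def)
    moreover have c: "0 \<le> c" unfolding c_def by (rule steiner_range[OF f])
    ultimately have 1: "2 * \<bar>x \<bullet> b\<bar> < measure lborel (fiber b f x (c + e))"
      using e by (subst (asm) less_steiner_iff[OF f]) auto
    define h where "h = \<bar>x \<bullet> b - x' \<bullet> b\<bar>"
    have "measure lborel (fiber b f x (c + e)) + 2 * h \<le> measure lborel (fiber b f x' c)"
    proof (rule measure_thicken_real)
      show "fiber b f x (c + e) \<noteq> {}" using 1 by auto
      fix s s' assume s: "s \<in> fiber b f x (c + e)" "\<bar>s' - s\<bar> \<le> h"
      have "(norm ((hproj b x + s *\<^sub>R b) - (hproj b x' + s' *\<^sub>R b)))\<^sup>2 \<le> (norm (hproj b x - hproj b x'))\<^sup>2 + h\<^sup>2"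
        unfolding norm_fiber_diff using s by (intro add_mono order_refl) (simp add: abs_le_square_iff[symmetric] h_def abs_minus_commute)
      also have "\<dots> = (norm ((hproj b x + (x \<bullet> b) *\<^sub>R b) - (hproj b x' + (x' \<bullet> b) *\<^sub>R b)))\<^sup>2"
        unfolding norm_fiber_diff h_def by simp
      also have "\<dots> = (norm (x - x'))\<^sup>2" by (simp add: hproj_add)
      finally have "norm ((hproj b x + s *\<^sub>R b) - (hproj b x' + s' *\<^sub>R b)) \<le> d"
        using d by (meson norm_ge_zero order_trans power2_le_imp_le)
      then show "s' \<in> fiber b f x' c" using mod[of "hproj b x + s *\<^sub>R b" "hproj b x' + s' *\<^sub>R b"] s by (auto simp: fiber_def)
    qed (use fiber_bounded[OF f] c e h_def in auto)
    then have "2 * \<bar>x' \<bullet> b\<bar> < measure lborel (fiber b f x' c)" using 1 h_def by linarith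
    then have "c < steiner b f x'" using less_steiner_iff[OF f c] by simp
    then show False by (simp add: c_def)
  qed
  have "norm (y - x) \<le> d" using d by (simp add: norm_minus_commute)
  then show ?thesis using main[OF d] main[of y x] by linarith
qed

text \<open>Raising the level by e puts the superlevel sets of f inside those of g. Symmetrization
  is therefore continuous for uniform convergence, on which the limit of the minimising sequence
  relies.\<close>

lemma steiner_contraction:
  assumes f: "cont_supp R A f" and g: "cont_supp R' A' g" and e: "\<And>x. \<bar>f x - g x\<bar> \<le> e"
  shows "\<bar>steiner b f x - steiner b g x\<bar> \<le> e"
proof -
  have e0: "0 \<le> e" using e[of 0] by linarith
  have main: "steiner b f x \<le> steiner b g x + e"
    if f: "cont_supp R A f" and g: "cont_supp R' A' g" and e: "\<And>x. \<bar>f x - g x\<bar> \<le> e" for f g R A R' A'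
  proof (rule ccontr)
    define c where "c = steiner b g x"
    assume "\<not> steiner b f x \<le> steiner b g x + e"
    then have "c + e < steiner b f x" by (simp add: c_def)
    moreover have c: "0 \<le> c" unfolding c_def by (rule steiner_range[OF g])
    ultimately have "2 * \<bar>x \<bullet> b\<bar> < measure lborel (fiber b f x (c + e))"
      using e0 by (subst (asm) less_steiner_iff[OF f]) auto
    also have "\<dots> \<le> measure lborel (fiber b g x c)"
    proof (rule fiber_antimono[OF g c])
      show "fiber b f x (c + e) \<subseteq> fiber b g x c"
      proof
        fix s assume "s \<in> fiber b f x (c + e)"
        then show "s \<in> fiber b g x c" using e[of "hproj b x + s *\<^sub>R b"] by (auto simp: fiber_def abs_le_iff)
      qed
    qed (use fiber_bounded[OF f] c e0 in auto)
    finally have "c < steiner b g x" using less_steiner_iff[OF g c] by simp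
    then show False by (simp add: c_def)
  qed
  have e': "\<bar>g x - f x\<bar> \<le> e" for x using e[of x] by (simp add: abs_minus_commute)
  show ?thesis using main[OF f g e] main[OF g f e'] by linarith
qed

lemma steiner_cont_supp:
  assumes f: "cont_supp R A f" shows "cont_supp R A (steiner b f)"
  unfolding cont_supp_def
proof (intro conjI allI impI)
  show "0 \<le> steiner b f x" "steiner b f x \<le> A" for x using steiner_range[OF f] by auto
  show "steiner b f x = 0" if "R < norm x" for x
  proof (rule ccontr)
    assume "steiner b f x \<noteq> 0"
    then have "0 < steiner b f x" using steiner_range(1)[OF f, of x] by linarith
    then have 1: "2 * \<bar>x \<bullet> b\<bar> < measure lborel (fiber b f x 0)" by (simp add: less_steiner_iff[OF f])
    let ?n = "norm (hproj b x)"
    have R: "?n\<^sup>2 \<le> R\<^sup>2"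
    proof -
      have "fiber b f x 0 \<noteq> {}" using 1 by auto
      then obtain s where "s \<in> fiber b f x 0" by auto
      then have "?n\<^sup>2 + s\<^sup>2 \<le> R\<^sup>2" using fiber_subset[OF f, of 0 x] by auto
      then show ?thesis using zero_le_power2[of s] by linarith
    qed
    \<comment> \<open>Half the chord that the line through x in direction b cuts from the ball of
      radius R.\<close>
    define q where "q = sqrt (R\<^sup>2 - ?n\<^sup>2)"
    have q: "0 \<le> q" "q\<^sup>2 = R\<^sup>2 - ?n\<^sup>2" using R by (auto simp: q_def)
    have "fiber b f x 0 \<subseteq> {-q..q}"
    proof
      fix s assume "s \<in> fiber b f x 0"
      then have "s\<^sup>2 \<le> q\<^sup>2" using fiber_subset[OF f, of 0 x] q by auto
      then have "\<bar>s\<bar> \<le> \<bar>q\<bar>" by (simp add: abs_le_square_iff)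
      then show "s \<in> {-q..q}" using q by auto
    qed
    then have "measure lborel (fiber b f x 0) \<le> measure lborel {-q..q}"
      using fiber_bounded[OF f, of 0] by (intro measure_mono_fmeasurable) (auto simp: fmeasurable_def emeasure_lborel_Icc_eq)
    then have "\<bar>x \<bullet> b\<bar> < \<bar>q\<bar>" using 1 q by simp
    then have "(x \<bullet> b)\<^sup>2 < q\<^sup>2" using abs_le_square_iff[of q "x \<bullet> b"] by linarith
    then have "(norm x)\<^sup>2 < R\<^sup>2" using norm_fiber[of x "x \<bullet> b"] q by (simp add: hproj_add)
    moreover have "0 \<le> R"
    proof (rule ccontr)
      assume "\<not> 0 \<le> R"
      then have "f y = 0" for y using cont_suppD(4)[OF f, of y] norm_ge_zero[of y] by linarith
      then show False using 1 by (simp add: fiber_def)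
    qed
    ultimately show False using that by (meson norm_ge_zero power_mono less_imp_le not_le)
  qed
  show "continuous_on UNIV (steiner b f)"
  proof (rule continuous_on_iff[THEN iffD2], intro ballI allI impI)
    fix x :: 'a and e :: real assume e: "0 < e"
    obtain d where d: "0 < d" and mod: "\<And>u v. norm (u - v) \<le> d \<Longrightarrow> \<bar>f u - f v\<bar> \<le> e / 2"
      using cont_supp_modulus[OF f, of "e / 2"] e by auto
    show "\<exists>d>0. \<forall>x'\<in>UNIV. dist x' x < d \<longrightarrow> dist (steiner b f x') (steiner b f x) < e"
    proof (intro exI conjI ballI impI)
      show "0 < d" by (rule d)
      fix x' assume "dist x' x < d"
      then have "norm (x' - x) \<le> d" by (simp add: dist_norm)
      from steiner_modulus[OF f _ mod this] have "\<bar>steiner b f x' - steiner b f x\<bar> \<le> e / 2" using e by simp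
      then show "dist (steiner b f x') (steiner b f x) < e" using e by (simp add: dist_real_def)
    qed
  qed
qed

lemma steiner_reflect: "steiner b f (x - (2 * (x \<bullet> b)) *\<^sub>R b) = steiner b f x"
proof -
  have 1: "x - (2 * (x \<bullet> b)) *\<^sub>R b = x + (- 2 * (x \<bullet> b)) *\<^sub>R b" by simp
  have "hproj b (x - (2 * (x \<bullet> b)) *\<^sub>R b) = hproj b x" unfolding 1 by (rule hproj_shift)
  moreover have "(x - (2 * (x \<bullet> b)) *\<^sub>R b) \<bullet> b = - (x \<bullet> b)" by (simp add: inner_diff_left bb)
  ultimately show ?thesis by (simp add: steiner_def fiber_def)
qed

lemma hproj_measurable[measurable]: "hproj b \<in> borel_measurable borel"
  unfolding hproj_def by measurable

text \<open>Tonelli along the lines in direction b for an arbitrary unit vector, without a basis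
  adapted to b: the slab 0 \<le> x \<bullet> b < 1 meets each line in length 1, so integration over
  it stands for integration over the orthogonal complement.\<close>

lemma nn_integral_fibers:
  fixes F :: "'a \<Rightarrow> ennreal"
  assumes [measurable]: "F \<in> borel_measurable borel"
  shows "(lint x. F x) = (lint x. (if 0 \<le> x \<bullet> b \<and> x \<bullet> b < 1 then 1 else 0) * (lint t. F (hproj b x + t *\<^sub>R b)))"
proof -
  have tr: "(lint x. g x) = (lint x. g (x + c))" if [measurable]: "g \<in> borel_measurable lborel" for c :: 'a and g
    by (subst lborel_distr_plus[of c, symmetric]) (simp add: nn_integral_distr add.commute)
  let ?e = "\<lambda>x. if 0 \<le> x \<bullet> b \<and> x \<bullet> b < 1 then 1 else (0::ennreal)"
  have shift: "(lint t. F (hproj b x + t *\<^sub>R b)) = (lint t. F (x + t *\<^sub>R b))" for x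
  proof -
    have "(lint t. F (hproj b x + t *\<^sub>R b)) = (lint t. F (hproj b x + (x \<bullet> b + 1 * t) *\<^sub>R b))"
      using nn_integral_real_affine[of "\<lambda>t. F (hproj b x + t *\<^sub>R b)" 1 "x \<bullet> b"] by simp
    also have "\<dots> = (lint t. F (x + t *\<^sub>R b))"
      by (simp add: hproj_def algebra_simps)
    finally show ?thesis .
  qed
  have "(lint x. ?e x * (lint t. F (hproj b x + t *\<^sub>R b))) = (lint x. \<integral>\<^sup>+t. ?e x * F (x + t *\<^sub>R b) \<partial>lborel)"
    unfolding shift by (simp add: nn_integral_cmult)
  also have "\<dots> = (lint t. \<integral>\<^sup>+x. ?e x * F (x + t *\<^sub>R b) \<partial>lborel)"
    by (rule lborel_pair.Fubini'[symmetric]) measurable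
  also have "\<dots> = (lint t. \<integral>\<^sup>+x. ?e (x + (- t) *\<^sub>R b) * F x \<partial>lborel)"
  proof (rule nn_integral_cong)
    fix t :: real
    show "(lint x. ?e x * F (x + t *\<^sub>R b)) = (lint x. ?e (x + (- t) *\<^sub>R b) * F x)"
      by (subst tr[of _ "(- t) *\<^sub>R b"]) (simp_all add: algebra_simps)
  qed
  also have "\<dots> = (lint x. \<integral>\<^sup>+t. ?e (x + (- t) *\<^sub>R b) * F x \<partial>lborel)"
    by (rule lborel_pair.Fubini') measurable
  also have "\<dots> = (lint x. F x)"
  proof (rule nn_integral_cong)
    fix x :: 'a
    have "(lint t. ?e (x + (- t) *\<^sub>R b)) = (lint t. indicator {x \<bullet> b - 1 <.. x \<bullet> b} t)"
      by (intro nn_integral_cong) (auto simp: indicator_def inner_diff_left bb)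
    then show "(lint t. ?e (x + (- t) *\<^sub>R b) * F x) = F x"
      by (subst nn_integral_multc) auto
  qed
  finally show ?thesis by simp
qed

lemma fiber_steiner:
  assumes f: "cont_supp R A f" and c: "0 \<le> c"
  shows "fiber b (steiner b f) x c = {- (measure lborel (fiber b f x c) / 2) <..< measure lborel (fiber b f x c) / 2}"
proof -
  have "s \<in> fiber b (steiner b f) x c \<longleftrightarrow> 2 * \<bar>s\<bar> < measure lborel (fiber b f x c)" for s
  proof -
    have "fiber b f (hproj b x + s *\<^sub>R b) c = fiber b f x c" by (simp add: fiber_def hproj_fiber)
    then show ?thesis
      using less_steiner_iff[OF f c, of "hproj b x + s *\<^sub>R b"] by (simp add: fiber_def hproj_fiber)
  qed
  then have "fiber b (steiner b f) x c = {s. 2 * \<bar>s\<bar> < measure lborel (fiber b f x c)}" by blast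
  also have "\<dots> = {- (measure lborel (fiber b f x c) / 2) <..< measure lborel (fiber b f x c) / 2}" (is "?L = ?R")
  proof (rule set_eqI)
    fix s show "s \<in> ?L \<longleftrightarrow> s \<in> ?R"
      unfolding mem_Collect_eq greaterThanLessThan_iff by linarith
  qed
  finally show ?thesis .
qed

lemma emeasure_fiber_steiner:
  assumes f: "cont_supp R A f" and c: "0 \<le> c"
  shows "emeasure lborel (fiber b (steiner b f) x c) = emeasure lborel (fiber b f x c)"
  unfolding fiber_steiner[OF f c] fiber_bounded(4)[OF f c] by simp

lemma fiber_integral_steiner:
  assumes f: "cont_supp R A f"
  shows "(lint t. ennreal (steiner b f (hproj b x + t *\<^sub>R b))) = (lint t. ennreal (f (hproj b x + t *\<^sub>R b)))"
proof -
  have [measurable]: "f \<in> borel_measurable borel" "steiner b f \<in> borel_measurable borel"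
    using cont_suppD(5) f steiner_cont_supp[OF f] by auto
  have eq: "(lint t. ennreal (g (hproj b x + t *\<^sub>R b))) = (lint c. indicator {0<..} c * emeasure lborel (fiber b g x c))"
    if [measurable]: "g \<in> borel_measurable borel" for g
    using nn_integral_layer_cake_scaled[of "\<lambda>t. g (hproj b x + t *\<^sub>R b)" 1] by (simp add: fiber_def)
  show ?thesis
    unfolding eq[OF cont_suppD(5)[OF f]] eq[OF cont_suppD(5)[OF steiner_cont_supp[OF f]]]
    by (intro nn_integral_cong) (auto simp: indicator_def emeasure_fiber_steiner[OF f])
qed

lemma nn_integral_steiner:
  assumes f: "cont_supp R A f"
  shows "(lint x. ennreal (steiner b f x)) = (lint x. ennreal (f x))"
  using cont_suppD(5)[OF f] cont_suppD(5)[OF steiner_cont_supp[OF f]]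
  by (subst (1 2) nn_integral_fibers) (auto simp: fiber_integral_steiner[OF f])

lemma measure_fiber_measurable[measurable]:
  assumes [measurable]: "f \<in> borel_measurable borel"
  shows "(\<lambda>(x, c). measure lborel (fiber b f x c)) \<in> borel_measurable (borel \<Otimes>\<^sub>M borel)"
proof -
  have eq: "measure lborel (fiber b f x c) = enn2real (lint s. (if c < f (hproj b x + s *\<^sub>R b) then 1 else 0))" for x c
  proof -
    have [measurable]: "fiber b f x c \<in> sets borel" unfolding fiber_def by measurable
    have "(lint s. (if c < f (hproj b x + s *\<^sub>R b) then 1 else 0)) = (lint s. indicator (fiber b f x c) s)"
      by (intro nn_integral_cong) (auto simp: fiber_def indicator_def)
    then show ?thesis by (simp add: measure_def)
  qed
  show ?thesis unfolding eq by measurable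
qed

end

section \<open>Second moments and the equality case of symmetrization\<close>

definition moment2 :: "('a::euclidean_space \<Rightarrow> real) \<Rightarrow> ennreal" where
  "moment2 f = (lint x. ennreal ((norm x)\<^sup>2 * f x))"

text \<open>As E and the interval have the same length, t^2 may be replaced by t^2 - l^2 in the
  difference of the moments. This is nonnegative outside the interval and nonpositive inside, so all
  exchanged points contribute with the same sign.\<close>

lemma second_moment_interval:
  fixes E :: "real set"
  assumes [measurable]: "E \<in> sets borel" and E: "emeasure lborel E = ennreal (2 * l)" and l: "0 \<le> l"
  shows "(lint t. ennreal (t\<^sup>2) * indicator E t) = (lint t. ennreal (t\<^sup>2) * indicator {-l<..<l} t)
     + (lint t. ennreal \<bar>t\<^sup>2 - l\<^sup>2\<bar> * (if t \<in> E \<longleftrightarrow> t \<in> {-l<..<l} then 0 else 1))"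
proof -
  let ?S = "{-l<..<l}"
  \<comment> \<open>Multiples of l^2 are added on both sides because subtraction in
    \<open>ennreal\<close> is truncated; being finite, they cancel after integration.\<close>
  have pt: "ennreal (t\<^sup>2) * indicator E t + ennreal (l\<^sup>2) * indicator ?S t
    = ennreal (t\<^sup>2) * indicator ?S t + ennreal \<bar>t\<^sup>2 - l\<^sup>2\<bar> * (if t \<in> E \<longleftrightarrow> t \<in> ?S then 0 else 1) + ennreal (l\<^sup>2) * indicator E t" for t
  proof (cases "t \<in> ?S")
    case True
    then have "\<bar>t\<bar> < \<bar>l\<bar>" by auto
    then have "t\<^sup>2 \<le> l\<^sup>2" using abs_le_square_iff[of t l] by auto
    then show ?thesis using True by (auto simp: indicator_def simp flip: ennreal_plus)
  next
    case False
    then have "\<bar>l\<bar> \<le> \<bar>t\<bar>" using l by auto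
    then have "l\<^sup>2 \<le> t\<^sup>2" by (simp add: abs_le_square_iff)
    then show ?thesis using False by (auto simp: indicator_def simp flip: ennreal_plus)
  qed
  have "(lint t. ennreal (t\<^sup>2) * indicator E t) + ennreal (l\<^sup>2) * emeasure lborel ?S
    = (lint t. ennreal (t\<^sup>2) * indicator E t + ennreal (l\<^sup>2) * indicator ?S t)"
    by (subst nn_integral_add) (auto simp: nn_integral_cmult_indicator)
  also have "\<dots> = (lint t. ennreal (t\<^sup>2) * indicator ?S t) + (lint t. ennreal \<bar>t\<^sup>2 - l\<^sup>2\<bar> * (if t \<in> E \<longleftrightarrow> t \<in> ?S then 0 else 1))
     + ennreal (l\<^sup>2) * emeasure lborel E"
    unfolding pt by (subst nn_integral_add, measurable, subst nn_integral_add) (auto simp: nn_integral_cmult_indicator)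
  also have "emeasure lborel E = emeasure lborel ?S" using l E by simp
  finally show ?thesis
    using l ennreal_add_left_cancel[of "ennreal (l\<^sup>2) * emeasure lborel ?S"]
    by (auto simp: ennreal_mult_eq_top_iff add.commute[of _ "ennreal (l\<^sup>2) * _"])
qed

lemma AE_lborel_open_ex:
  fixes U :: "'a::euclidean_space set"
  assumes "AE x in lborel. P x" "open U" "U \<noteq> {}"
  shows "\<exists>x\<in>U. P x"
proof (rule ccontr)
  assume n: "\<not> (\<exists>x\<in>U. P x)"
  obtain N where N0: "{x\<in>space lborel. \<not> P x} \<subseteq> N" "emeasure lborel N = 0" "N \<in> sets lborel"
    using assms(1) by (rule AE_E)
  then have N: "{x\<in>space lborel. \<not> P x} \<subseteq> N" "N \<in> null_sets lborel" by (auto intro: null_setsI)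
  then have "negligible N" by (simp add: negligible_iff_null_sets null_sets_completionI)
  moreover have "U \<subseteq> N" using n N by auto
  ultimately have "negligible U" by (rule negligible_subset)
  then show False using open_not_negligible[OF assms(2,3)] by simp
qed

context
  fixes b :: "'a::euclidean_space"
  assumes b1: "norm b = 1"
begin

text \<open>By Pythagoras |y + t b|^2 = |y|^2 + t^2. The first part sees only the integral over the
  line, which symmetrization preserves; the second is a layer cake of second moments of superlevel
  sets.\<close>

lemma fiber_moment:
  assumes g: "cont_supp R A g"
  shows "(lint t. ennreal ((norm (hproj b x + t *\<^sub>R b))\<^sup>2 * g (hproj b x + t *\<^sub>R b))) =
      ennreal ((norm (hproj b x))\<^sup>2) * (lint t. ennreal (g (hproj b x + t *\<^sub>R b)))
      + (lint c. indicator {0<..} c * (lint t. ennreal (t\<^sup>2) * indicator (fiber b g x c) t))"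
proof -
  note [measurable] = cont_suppD(5)[OF g]
  have "(lint t. ennreal ((norm (hproj b x + t *\<^sub>R b))\<^sup>2 * g (hproj b x + t *\<^sub>R b)))
    = (lint t. ennreal ((norm (hproj b x))\<^sup>2) * ennreal (g (hproj b x + t *\<^sub>R b)) + ennreal (t\<^sup>2) * ennreal (g (hproj b x + t *\<^sub>R b)))"
    using cont_suppD(2)[OF g] by (simp add: norm_fiber[OF b1] distrib_right ennreal_mult ennreal_plus)
  also have "\<dots> = ennreal ((norm (hproj b x))\<^sup>2) * (lint t. ennreal (g (hproj b x + t *\<^sub>R b)))
     + (lint t. ennreal (t\<^sup>2) * ennreal (g (hproj b x + t *\<^sub>R b)))"
    by (subst nn_integral_add) (auto simp: nn_integral_cmult)
  also have "(lint t. ennreal (t\<^sup>2) * ennreal (g (hproj b x + t *\<^sub>R b)))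
    = (lint t. \<integral>\<^sup>+c. ennreal (t\<^sup>2) * (if 0 < c \<and> ennreal c < ennreal (g (hproj b x + t *\<^sub>R b)) then 1 else 0) \<partial>lborel)"
  proof (rule nn_integral_cong)
    fix t :: real
    show "ennreal (t\<^sup>2) * ennreal (g (hproj b x + t *\<^sub>R b)) = (lint c. ennreal (t\<^sup>2) * (if 0 < c \<and> ennreal c < ennreal (g (hproj b x + t *\<^sub>R b)) then 1 else 0))"
      by (subst nn_integral_cmult) (auto intro: arg_cong2[where f="(*)", OF refl ennreal_eq_layer_cake])
  qed
  also have "\<dots> = (lint c. \<integral>\<^sup>+t. ennreal (t\<^sup>2) * (if 0 < c \<and> ennreal c < ennreal (g (hproj b x + t *\<^sub>R b)) then 1 else 0) \<partial>lborel)"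
    by (rule lborel_pair.Fubini'[symmetric]) measurable
  also have "\<dots> = (lint c. indicator {0<..} c * (lint t. ennreal (t\<^sup>2) * indicator (fiber b g x c) t))"
    by (intro nn_integral_cong) (auto simp: indicator_def fiber_def ennreal_less_iff less_imp_le intro!: nn_integral_cong)
  finally show ?thesis .
qed

text \<open>An identity rather than an inequality: the explicit defect is what settles the case of
  equality in \<open>steiner_eq_if_moment2\<close>.\<close>

lemma moment2_steiner:
  assumes f: "cont_supp R A f"
  shows "moment2 f = moment2 (steiner b f) + (lint x. (if 0 \<le> x \<bullet> b \<and> x \<bullet> b < 1 then 1 else 0) *
    (lint c. indicator {0<..} c * (lint t. ennreal \<bar>t\<^sup>2 - (measure lborel (fiber b f x c) / 2)\<^sup>2\<bar> *
        (if c < f (hproj b x + t *\<^sub>R b) \<longleftrightarrow> c < steiner b f (hproj b x + t *\<^sub>R b) then 0 else 1))))"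
proof -
  let ?g = "steiner b f"
  note g = steiner_cont_supp[OF b1 f]
  note [measurable] = cont_suppD(5)[OF f] cont_suppD(5)[OF g] measure_fiber_measurable[OF b1] hproj_measurable[OF b1]
  let ?e = "\<lambda>x. if 0 \<le> x \<bullet> b \<and> x \<bullet> b < 1 then 1 else (0::ennreal)"
  let ?D = "\<lambda>x c t. ennreal \<bar>t\<^sup>2 - (measure lborel (fiber b f x c) / 2)\<^sup>2\<bar> *
        (if c < f (hproj b x + t *\<^sub>R b) \<longleftrightarrow> c < ?g (hproj b x + t *\<^sub>R b) then 0 else 1)"
  have Dm[measurable]: "(\<lambda>(x,c,t). ?D x c t) \<in> borel_measurable (borel \<Otimes>\<^sub>M borel \<Otimes>\<^sub>M borel)"
  proof -
    have [measurable]: "(\<lambda>p::'a \<times> real \<times> real. measure lborel (fiber b f (fst p) (fst (snd p)))) \<in> borel_measurable (borel \<Otimes>\<^sub>M borel \<Otimes>\<^sub>M borel)"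
      using measurable_compose[OF _ measure_fiber_measurable[OF b1 cont_suppD(5)[OF f]], of "\<lambda>p::'a \<times> real \<times> real. (fst p, fst (snd p))"] by simp
    show ?thesis unfolding case_prod_beta' by measurable
  qed
  have fibD[measurable]: "(\<lambda>t. ?D x c t) \<in> borel_measurable borel" for x c by measurable
  have fibD2[measurable]: "(\<lambda>(c, t). ?D x c t) \<in> borel_measurable (borel \<Otimes>\<^sub>M borel)" for x
    using measurable_compose[OF _ Dm, of "\<lambda>(c,t). (x,c,t)"] by (simp add: case_prod_beta')
  have fib: "(lint t. ennreal ((norm (hproj b x + t *\<^sub>R b))\<^sup>2 * f (hproj b x + t *\<^sub>R b))) =
     (lint t. ennreal ((norm (hproj b x + t *\<^sub>R b))\<^sup>2 * ?g (hproj b x + t *\<^sub>R b)))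
     + (lint c. indicator {0<..} c * (lint t. ?D x c t))" for x
  proof -
    have "(lint c. indicator {0<..} c * (lint t. ennreal (t\<^sup>2) * indicator (fiber b f x c) t))
      = (lint c. indicator {0<..} c * (lint t. ennreal (t\<^sup>2) * indicator (fiber b ?g x c) t) + indicator {0<..} c * (lint t. ?D x c t))"
    proof (rule nn_integral_cong)
      fix c :: real
      show "indicator {0<..} c * (lint t. ennreal (t\<^sup>2) * indicator (fiber b f x c) t) =
        indicator {0<..} c * (lint t. ennreal (t\<^sup>2) * indicator (fiber b ?g x c) t) + indicator {0<..} c * (lint t. ?D x c t)"
      proof (cases "0 < c")
        case True
        then have c: "0 \<le> c" by simp
        let ?l = "measure lborel (fiber b f x c) / 2"
        have "(lint t. ennreal (t\<^sup>2) * indicator (fiber b f x c) t) = (lint t. ennreal (t\<^sup>2) * indicator {-?l<..<?l} t)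
          + (lint t. ennreal \<bar>t\<^sup>2 - ?l\<^sup>2\<bar> * (if t \<in> fiber b f x c \<longleftrightarrow> t \<in> {-?l<..<?l} then 0 else 1))"
          using fiber_bounded[OF b1 f c, of x] by (intro second_moment_interval) auto
        also have "\<dots> = (lint t. ennreal (t\<^sup>2) * indicator (fiber b ?g x c) t) + (lint t. ?D x c t)"
          unfolding fiber_steiner[OF b1 f c, symmetric] by (simp add: fiber_def)
        finally show ?thesis using True by simp
      qed simp
    qed
    also have "\<dots> = (lint c. indicator {0<..} c * (lint t. ennreal (t\<^sup>2) * indicator (fiber b ?g x c) t))
       + (lint c. indicator {0<..} c * (lint t. ?D x c t))"
    proof (rule nn_integral_add)
      have "(\<lambda>(c, t). ennreal (t\<^sup>2) * indicator (fiber b ?g x c) t) \<in> borel_measurable (lborel \<Otimes>\<^sub>M lborel)"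
        unfolding fiber_def indicator_def mem_Collect_eq by measurable
      then show "(\<lambda>c. indicator {0<..} c * (lint t. ennreal (t\<^sup>2) * indicator (fiber b ?g x c) t)) \<in> borel_measurable lborel"
        by (intro borel_measurable_times_ennreal lborel.borel_measurable_nn_integral) auto
      show "(\<lambda>c. indicator {0<..} c * (lint t. ?D x c t)) \<in> borel_measurable lborel"
        using fibD2[of x] by (intro borel_measurable_times_ennreal lborel.borel_measurable_nn_integral) auto
    qed
    finally show ?thesis
      unfolding fiber_moment[OF f] fiber_moment[OF g] fiber_integral_steiner[OF b1 f] by (simp add: add_ac)
  qed
  have m1: "(\<lambda>x. \<integral>\<^sup>+c. indicator {0<..} c * (lint t. ?D x c t) \<partial>lborel) \<in> borel_measurable lborel"
  proof -
    have "(\<lambda>((x,c),t). ?D x c t) \<in> borel_measurable ((lborel \<Otimes>\<^sub>M lborel) \<Otimes>\<^sub>M lborel)"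
      using measurable_compose[OF _ Dm, of "\<lambda>((x,c),t). (x,c,t)"] by (simp add: case_prod_beta')
    then have "(\<lambda>(x,c). \<integral>\<^sup>+t. ?D x c t \<partial>lborel) \<in> borel_measurable (lborel \<Otimes>\<^sub>M lborel)"
      using lborel.borel_measurable_nn_integral[of "\<lambda>p t. ?D (fst p) (snd p) t" "lborel \<Otimes>\<^sub>M lborel"] by (simp add: case_prod_beta')
    then have "(\<lambda>(x,c). indicator {0<..} c * (lint t. ?D x c t)) \<in> borel_measurable (lborel \<Otimes>\<^sub>M lborel)"
      unfolding case_prod_beta' by measurable
    then show ?thesis by (rule lborel.borel_measurable_nn_integral)
  qed
  have m2: "(\<lambda>x. \<integral>\<^sup>+t. ennreal ((norm (hproj b x + t *\<^sub>R b))\<^sup>2 * ?g (hproj b x + t *\<^sub>R b)) \<partial>lborel) \<in> borel_measurable lborel"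
    by measurable
  have "moment2 f = (lint x. ?e x * (lint t. ennreal ((norm (hproj b x + t *\<^sub>R b))\<^sup>2 * ?g (hproj b x + t *\<^sub>R b)))
     + ?e x * (lint c. indicator {0<..} c * (lint t. ?D x c t)))"
    unfolding moment2_def by (subst nn_integral_fibers[OF b1]) (simp_all add: fib distrib_left)
  also have "\<dots> = (lint x. ?e x * (lint t. ennreal ((norm (hproj b x + t *\<^sub>R b))\<^sup>2 * ?g (hproj b x + t *\<^sub>R b))))
     + (lint x. ?e x * (lint c. indicator {0<..} c * (lint t. ?D x c t)))"
    using m1 m2 by (intro nn_integral_add borel_measurable_times_ennreal) auto
  also have "(lint x. ?e x * (lint t. ennreal ((norm (hproj b x + t *\<^sub>R b))\<^sup>2 * ?g (hproj b x + t *\<^sub>R b)))) = moment2 ?g"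
    unfolding moment2_def by (rule nn_integral_fibers[OF b1, symmetric]) measurable
  finally show ?thesis .
qed

lemma moment2_finite:
  fixes f :: "'a \<Rightarrow> real"
  assumes f: "cont_supp R A f"
  shows "moment2 f < \<infinity>"
proof -
  have "moment2 f \<le> (lint x. ennreal (R\<^sup>2 * A) * indicator (cball 0 R) (x::'a))"
    unfolding moment2_def
  proof (rule nn_integral_mono)
    fix x :: 'a
    show "ennreal ((norm x)\<^sup>2 * f x) \<le> ennreal (R\<^sup>2 * A) * indicator (cball 0 R) x"
    proof (cases "norm x \<le> R")
      case True
      then have "(norm x)\<^sup>2 * f x \<le> R\<^sup>2 * A"
        using cont_suppD(2,3)[OF f, of x] by (intro mult_mono power_mono) auto
      then show ?thesis using True by (simp add: ennreal_leI)
    next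
      case False then show ?thesis using cont_suppD(4)[OF f, of x] by simp
    qed
  qed
  also have "\<dots> < \<infinity>" using emeasure_bounded_finite[of "cball (0::'a) R"]
    by (simp add: nn_integral_cmult_indicator ennreal_mult_less_top)
  finally show ?thesis .
qed

lemma moment2_steiner_le: "cont_supp R A f \<Longrightarrow> moment2 (steiner b f) \<le> moment2 f"
  by (subst (2) moment2_steiner) auto

text \<open>If f and its symmetrization differ somewhere, continuity gives an open set of (x, c, t)
  on which exactly one of them exceeds c, so the defect in \<open>moment2_steiner\<close> cannot
  vanish. Points x, c, t are picked in turn from three nested almost-everywhere statements.\<close>

lemma steiner_eq_if_moment2:
  assumes f: "cont_supp R A f" and le: "moment2 f \<le> moment2 (steiner b f)"
  shows "steiner b f = f"
proof (rule ccontr)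
  assume "steiner b f \<noteq> f"
  then obtain x0 where x0: "f x0 \<noteq> steiner b f x0" by fastforce
  let ?g = "steiner b f"
  note g = steiner_cont_supp[OF b1 f]
  note [measurable] = cont_suppD(5)[OF f] cont_suppD(5)[OF g] hproj_measurable[OF b1]
  have [measurable]: "(\<lambda>p::'a \<times> real. measure lborel (fiber b f (fst p) (snd p))) \<in> borel_measurable (borel \<Otimes>\<^sub>M borel)"
    using measure_fiber_measurable[OF b1 cont_suppD(5)[OF f]] by (simp add: case_prod_beta')
  let ?e = "\<lambda>x. if 0 \<le> x \<bullet> b \<and> x \<bullet> b < 1 then 1 else (0::ennreal)"
  let ?D = "\<lambda>x c t. ennreal \<bar>t\<^sup>2 - (measure lborel (fiber b f x c) / 2)\<^sup>2\<bar> *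
        (if c < f (hproj b x + t *\<^sub>R b) \<longleftrightarrow> c < ?g (hproj b x + t *\<^sub>R b) then 0 else 1)"
  have Dm: "(\<lambda>p. ?D (fst (fst p)) (snd (fst p)) (snd p)) \<in> borel_measurable ((lborel \<Otimes>\<^sub>M lborel) \<Otimes>\<^sub>M lborel)"
    by measurable
  then have Dm2: "(\<lambda>p. \<integral>\<^sup>+t. ?D (fst p) (snd p) t \<partial>lborel) \<in> borel_measurable (lborel \<Otimes>\<^sub>M lborel)"
    using lborel.borel_measurable_nn_integral[of "\<lambda>p t. ?D (fst p) (snd p) t" "lborel \<Otimes>\<^sub>M lborel"] by (simp add: case_prod_beta')
  have Dmc: "(\<lambda>c. \<integral>\<^sup>+t. ?D x c t \<partial>lborel) \<in> borel_measurable lborel" for x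
    using measurable_compose[OF _ Dm2, of "\<lambda>c. (x, c)" lborel] by simp
  have Dmt: "(\<lambda>t. ?D x c t) \<in> borel_measurable lborel" for x c by measurable
  have Dmx: "(\<lambda>x. \<integral>\<^sup>+c. indicator {0<..} c * (lint t. ?D x c t) \<partial>lborel) \<in> borel_measurable lborel"
  proof -
    have "(\<lambda>p. indicator {0<..} (snd p) * (lint t. ?D (fst p) (snd p) t)) \<in> borel_measurable (lborel \<Otimes>\<^sub>M lborel)"
      using Dm2 by (intro borel_measurable_times_ennreal) auto
    then show ?thesis using lborel.borel_measurable_nn_integral[of "\<lambda>x c. indicator {0<..} c * (lint t. ?D x c t)" lborel]
      by (simp add: case_prod_beta')
  qed
  let ?T = "\<integral>\<^sup>+x. ?e x * (lint c. indicator {0<..} c * (lint t. ?D x c t)) \<partial>lborel"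
  have "moment2 ?g + ?T \<le> moment2 ?g + 0" using le moment2_steiner[OF f] by simp
  then have "?T = 0" using moment2_finite[OF g] ennreal_add_left_cancel_le[of "moment2 ?g" ?T 0] by auto
  then have ae: "AE x in lborel. ?e x * (lint c. indicator {0<..} c * (lint t. ?D x c t)) = 0"
    using Dmx by (subst (asm) nn_integral_0_iff_AE) (auto intro!: borel_measurable_times_ennreal)
  define p q where "p = min (f x0) (?g x0)" and "q = max (f x0) (?g x0)"
  have pq: "p < q" "0 \<le> p" using x0 cont_suppD(2)[OF f, of x0] cont_suppD(2)[OF g, of x0] by (auto simp: p_def q_def)
  \<comment> \<open>A third of the gap: for c in the middle third and points near x0 the two values
    stay on opposite sides of c.\<close>
  define h where "h = (q - p) / 3"
  have h: "0 < h" using pq by (simp add: h_def)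
  have "isCont f x0" "isCont ?g x0"
    using cont_suppD(1)[OF f] cont_suppD(1)[OF g] by (auto simp: continuous_on_eq_continuous_at)
  then obtain d1 d2 where d: "0 < d1" "\<And>x. dist x x0 < d1 \<Longrightarrow> dist (f x) (f x0) < h"
    "0 < d2" "\<And>x. dist x x0 < d2 \<Longrightarrow> dist (?g x) (?g x0) < h"
    using h unfolding continuous_at_eps_delta by (metis dist_commute)
  define d where "d = min d1 d2"
  have d0: "0 < d" using d by (simp add: d_def)
  have sep: "(c < f x) \<noteq> (c < ?g x)" if "dist x x0 < d" "p + h < c" "c < q - h" for x c
    using d(2)[of x] d(4)[of x] that by (auto simp: d_def p_def q_def dist_real_def min_def max_def split: if_splits)
  \<comment> \<open>The defect sees only the fibre of x, so x is sought near the projection of x0;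
    the shift by 1/2 along b puts it inside the slab.\<close>
  obtain x where x: "x \<in> ball (hproj b x0 + (1/2) *\<^sub>R b) (min (d / 2) (1 / 2))"
    "?e x * (lint c. indicator {0<..} c * (lint t. ?D x c t)) = 0"
  proof -
    have "ball (hproj b x0 + (1/2) *\<^sub>R b) (min (d / 2) (1 / 2)) \<noteq> {}" using d0 by (simp del: mem_ball)
    from AE_lborel_open_ex[OF ae open_ball this] show ?thesis using that by blast
  qed
  have nx: "norm (x - (hproj b x0 + (1/2) *\<^sub>R b)) < min (d / 2) (1 / 2)" using x(1) by (simp add: dist_norm norm_minus_commute)
  have "\<bar>(x - (hproj b x0 + (1/2) *\<^sub>R b)) \<bullet> b\<bar> < 1 / 2"
    using Cauchy_Schwarz_ineq2[of "x - (hproj b x0 + (1/2) *\<^sub>R b)" b] nx b1 by simp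
  then have xb: "0 \<le> x \<bullet> b" "x \<bullet> b < 1" unfolding inner_diff_left hproj_fiber[OF b1] by linarith+
  have hx: "norm (hproj b x - hproj b x0) < d / 2"
  proof -
    have "(norm (hproj b x - hproj b x0))\<^sup>2 \<le> (norm ((hproj b x + (x \<bullet> b) *\<^sub>R b) - (hproj b x0 + (1/2) *\<^sub>R b)))\<^sup>2"
      unfolding norm_fiber_diff[OF b1] by simp
    then have "norm (hproj b x - hproj b x0) \<le> norm (x - (hproj b x0 + (1/2) *\<^sub>R b))"
      unfolding hproj_add[OF b1] by (rule power2_le_imp_le) simp
    then show ?thesis using nx by simp
  qed
  have "(lint c. indicator {0<..} c * (lint t. ?D x c t)) = 0" using x(2) xb by simp
  then have aec: "AE c in lborel. indicator {0<..} c * (lint t. ?D x c t) = 0"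
    using Dmc by (subst (asm) nn_integral_0_iff_AE) (auto intro!: borel_measurable_times_ennreal)
  obtain c where c: "c \<in> {p + h <..< q - h}" "indicator {0<..} c * (lint t. ?D x c t) = 0"
  proof -
    have "{p + h <..< q - h} \<noteq> {}" using pq by (simp add: h_def field_simps)
    from AE_lborel_open_ex[OF aec open_greaterThanLessThan this] show ?thesis using that by blast
  qed
  have "0 < c" using c pq h by auto
  then have "(lint t. ?D x c t) = 0" using c(2) by simp
  then have ae: "AE t in lborel. ?D x c t = 0" using Dmt by (subst (asm) nn_integral_0_iff_AE) auto
  define l where "l = measure lborel (fiber b f x c) / 2"
  let ?t0 = "x0 \<bullet> b"
  \<comment> \<open>At t = l and t = -l the weight of the defect vanishes, so these two points are
    removed.\<close>
  have "\<exists>t\<in>{?t0 - d / 2 <..< ?t0 + d / 2} - {l, -l}. ?D x c t = 0"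
  proof (rule AE_lborel_open_ex[OF ae])
    show "open ({?t0 - d / 2 <..< ?t0 + d / 2} - {l, -l})" by (intro open_Diff) auto
    have "infinite {?t0 - d / 2 <..< ?t0 + d / 2}" using d0 by simp
    then show "{?t0 - d / 2 <..< ?t0 + d / 2} - {l, -l} \<noteq> {}"
      by (metis Diff_eq_empty_iff finite.emptyI finite_insert finite_subset)
  qed
  then obtain t where t: "t \<in> {?t0 - d / 2 <..< ?t0 + d / 2}" "t \<noteq> l" "t \<noteq> -l" "?D x c t = 0" by blast
  have "dist (hproj b x + t *\<^sub>R b) x0 < d"
  proof -
    have "dist (hproj b x + t *\<^sub>R b) x0 = norm ((hproj b x + t *\<^sub>R b) - (hproj b x0 + ?t0 *\<^sub>R b))"
      by (simp add: hproj_add[OF b1] dist_norm)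
    also have "\<dots> = norm ((hproj b x - hproj b x0) + (t - ?t0) *\<^sub>R b)" by (simp add: algebra_simps)
    also have "\<dots> \<le> norm (hproj b x - hproj b x0) + \<bar>t - ?t0\<bar>" using norm_triangle_ineq[of "hproj b x - hproj b x0" "(t - ?t0) *\<^sub>R b"] b1 by simp
    also have "\<dots> < d" using hx t(1) by (auto simp: abs_if)
    finally show ?thesis .
  qed
  from sep[OF this, of c] c(1) have "(c < f (hproj b x + t *\<^sub>R b)) \<noteq> (c < ?g (hproj b x + t *\<^sub>R b))" by auto
  then have "ennreal \<bar>t\<^sup>2 - l\<^sup>2\<bar> = 0" using t(4) by (auto simp: l_def)
  then have "t\<^sup>2 = l\<^sup>2" by (simp add: ennreal_eq_0_iff)
  then show False using t(2,3) by (simp add: power2_eq_iff)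
qed

end

subsection \<open>The functional increases under Steiner symmetrization\<close>

text \<open>Here \<open>\<beta>\<close> stands for norm u and \<open>y j\<close> for x j \<bullet>
  u, so that D cuts out a set of vectors u. The norm of a convex combination is only bounded by the
  combination of the norms, and \<open>anti\<close> absorbs this difference.\<close>

locale region =
  fixes I :: "'i set" and D :: "real \<Rightarrow> ('i \<Rightarrow> real) \<Rightarrow> bool" and \<rho> :: real
  assumes fin: "finite I"
    and conv: "0 \<le> \<beta> \<Longrightarrow> 0 \<le> \<beta>' \<Longrightarrow> D \<beta> y \<Longrightarrow> D \<beta>' y' \<Longrightarrow> 0 \<le> l \<Longrightarrow> l \<le> 1 \<Longrightarrow>
      D ((1 - l) * \<beta> + l * \<beta>') (\<lambda>j. (1 - l) * y j + l * y' j)"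
    and anti: "D \<beta> y \<Longrightarrow> 0 \<le> \<beta>' \<Longrightarrow> \<beta>' \<le> \<beta> \<Longrightarrow> (\<And>j. j \<in> I \<Longrightarrow> \<bar>y' j\<bar> \<le> \<bar>y j\<bar>) \<Longrightarrow> D \<beta>' y'"
    and bdd: "D \<beta> y \<Longrightarrow> \<beta> \<le> \<rho>"
    and meas: "Measurable.pred (borel \<Otimes>\<^sub>M PiM I (\<lambda>_. borel)) (\<lambda>p. D (fst p) (snd p))"
begin

definition ker :: "('i \<Rightarrow> 'a::euclidean_space) \<Rightarrow> 'a \<Rightarrow> ennreal" where
  "ker x u = (if D (norm u) (\<lambda>j. x j \<bullet> u) then 1 else 0)"

definition vol :: "('i \<Rightarrow> 'a::euclidean_space) \<Rightarrow> ennreal" where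
  "vol x = (lint u. ker x u)"

definition func :: "('i \<Rightarrow> 'a::euclidean_space \<Rightarrow> real) \<Rightarrow> ennreal" where
  "func f = (\<integral>\<^sup>+x. (\<Prod>j\<in>I. ennreal (f j (x j))) * vol x \<partial>PiM I (\<lambda>_. lborel))"

lemma D_cong: "0 \<le> \<beta> \<Longrightarrow> (\<And>j. j \<in> I \<Longrightarrow> \<bar>y j\<bar> = \<bar>y' j\<bar>) \<Longrightarrow> D \<beta> y \<longleftrightarrow> D \<beta> y'"
  using anti[of \<beta> y \<beta> y'] anti[of \<beta> y' \<beta> y] by auto

lemma D_measurable:
  assumes [measurable]: "g \<in> borel_measurable M" "\<And>j. j \<in> I \<Longrightarrow> (\<lambda>p. h p j) \<in> borel_measurable M" and "\<And>p. 0 \<le> g p"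
  shows "Measurable.pred M (\<lambda>p. D (g p) (h p))"
proof -
  have "(\<lambda>p. (g p, \<lambda>j\<in>I. h p j)) \<in> M \<rightarrow>\<^sub>M (borel \<Otimes>\<^sub>M PiM I (\<lambda>_. borel))"
    by (intro measurable_Pair measurable_restrict) auto
  from measurable_compose[OF this meas] have "Measurable.pred M (\<lambda>p. D (g p) (\<lambda>j\<in>I. h p j))" by simp
  moreover have "D (g p) (\<lambda>j\<in>I. h p j) \<longleftrightarrow> D (g p) (h p)" for p using assms(3) by (intro D_cong) auto
  ultimately show ?thesis by simp
qed

lemma ker_measurable:
  assumes [measurable]: "\<And>j. j \<in> I \<Longrightarrow> (\<lambda>p. h p j) \<in> borel_measurable M" "g \<in> borel_measurable M"
  shows "(\<lambda>p. ker (h p) (g p :: 'a::euclidean_space)) \<in> borel_measurable M"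
proof -
  have [measurable]: "Measurable.pred M (\<lambda>p. D (norm (g p)) (\<lambda>j. h p j \<bullet> g p))"
    by (rule D_measurable) auto
  show ?thesis unfolding ker_def by measurable
qed

lemma ker_measurable'[measurable]:
  "(\<lambda>(x, u). ker x (u :: 'a::euclidean_space)) \<in> borel_measurable (PiM I (\<lambda>_. lborel) \<Otimes>\<^sub>M lborel)"
  unfolding case_prod_beta' by (rule ker_measurable) auto

lemma vol_measurable[measurable]:
  "(vol :: ('i \<Rightarrow> 'a::euclidean_space) \<Rightarrow> ennreal) \<in> borel_measurable (PiM I (\<lambda>_. lborel))"
  unfolding vol_def using lborel.borel_measurable_nn_integral[OF ker_measurable'] .

lemma vol_le: "vol (x :: 'i \<Rightarrow> 'a::euclidean_space) \<le> emeasure lborel (cball (0::'a) \<rho>)"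
proof -
  have "vol x \<le> (lint u. indicator (cball (0::'a) \<rho>) u)"
    unfolding vol_def using bdd by (intro nn_integral_mono) (auto simp: ker_def indicator_def)
  then show ?thesis by simp
qed

lemma vol_finite: "vol (x :: 'i \<Rightarrow> 'a::euclidean_space) < \<infinity>"
  using vol_le[of x] emeasure_bounded_finite[of "cball (0::'a) \<rho>"] by (auto intro: le_less_trans)

end

section \<open>Cone coordinates, slices and fibres in the product space\<close>

definition emb :: "'a::euclidean_space \<Rightarrow> ('a \<Rightarrow> real) \<Rightarrow> 'a" where
  "emb b w = (\<Sum>e\<in>Basis - {b}. w e *\<^sub>R e)"

lemma emb_measurable[measurable]: "emb b \<in> borel_measurable (PiM (Basis - {b}) (\<lambda>_. lborel))"
  unfolding emb_def by measurable

context
  fixes b :: "'a::euclidean_space"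
  assumes b: "b \<in> Basis"
begin

lemma emb_inner: "emb b w \<bullet> b = 0" "b \<bullet> emb b w = 0"
  using b by (auto simp: emb_def inner_sum_left inner_sum_right inner_Basis intro!: sum.neutral split: if_splits)

lemma emb_component: "e \<in> Basis - {b} \<Longrightarrow> (b + emb b w) \<bullet> e = w e"
  using b by (auto simp: emb_def inner_sum_left inner_add_left inner_Basis if_distrib cong: if_cong)

lemma emb_scale: "emb b (\<lambda>e\<in>Basis - {b}. s * w e) = s *\<^sub>R emb b w"
  by (simp add: emb_def scaleR_sum_right)

lemma emb_convex: "emb b (\<lambda>e\<in>Basis - {b}. (1 - l) * w e + l * w' e) = (1 - l) *\<^sub>R emb b w + l *\<^sub>R emb b w'"
  by (simp add: emb_def scaleR_sum_right scaleR_add_left sum.distrib)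

lemma norm_emb_minus: "norm (b + emb b (\<lambda>e\<in>Basis - {b}. - w e)) = norm (b + emb b w)"
proof -
  have 1: "emb b (\<lambda>e\<in>Basis - {b}. - w e) = - emb b w" using emb_scale[of "-1" w] by simp
  have "(norm (b + - emb b w))\<^sup>2 = (norm (b + emb b w))\<^sup>2"
    by (simp only: power2_norm_eq_inner inner_add_left inner_add_right inner_minus_left inner_minus_right emb_inner)
  then show ?thesis unfolding 1 by simp
qed

text \<open>The chart u = s (b + w) with w orthogonal to b, whose Jacobian is |s|^(n - 1). For x j =
  y j + t j b with y j orthogonal to b it gives x j \<bullet> u = s (t j + y j \<bullet> w): for
  fixed s the unknowns t and w enter affinely.\<close>

lemma nn_integral_cone:
  fixes F :: "'a \<Rightarrow> ennreal"
  assumes [measurable]: "F \<in> borel_measurable borel"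
  shows "(lint u. F u) = (lint s. ennreal (\<bar>s\<bar> ^ card (Basis - {b})) * (\<integral>\<^sup>+w. F (s *\<^sub>R (b + emb b w)) \<partial>PiM (Basis - {b}) (\<lambda>_. lborel)))"
proof -
  let ?B = "Basis - {b}" and ?M = "PiM (Basis - {b}) (\<lambda>_. lborel :: real measure)"
  have B: "insert b ?B = Basis" using b by auto
  have "(lint u. F u) = (\<integral>\<^sup>+z. F (\<Sum>e\<in>Basis. z e *\<^sub>R e) \<partial>PiM (insert b ?B) (\<lambda>_. lborel))"
    unfolding B by (subst lborel_eq) (simp add: nn_integral_distr)
  also have "\<dots> = (lint s. \<integral>\<^sup>+z. F (\<Sum>e\<in>Basis. (z(b := s)) e *\<^sub>R e) \<partial>?M)"
  proof (rule lborel_PiM.product_nn_integral_insert_rev)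
    have "(\<lambda>z. F (\<Sum>e\<in>Basis. z e *\<^sub>R e)) \<in> borel_measurable (PiM Basis (\<lambda>_. lborel))" by measurable
    then show "(\<lambda>z. F (\<Sum>e\<in>Basis. z e *\<^sub>R e)) \<in> borel_measurable (PiM (insert b ?B) (\<lambda>_. lborel))" unfolding B .
  qed auto
  also have "\<dots> = (lint s. \<integral>\<^sup>+z. F (s *\<^sub>R b + emb b z) \<partial>?M)"
  proof (intro nn_integral_cong arg_cong[of _ _ F])
    fix s :: real and z :: "'a \<Rightarrow> real"
    show "(\<Sum>e\<in>Basis. (z(b := s)) e *\<^sub>R e) = s *\<^sub>R b + emb b z"
      using b by (subst sum.remove[of _ b]) (auto simp: emb_def intro!: sum.cong)
  qed
  also have "\<dots> = (lint s. ennreal (\<bar>s\<bar> ^ card ?B) * (\<integral>\<^sup>+w. F (s *\<^sub>R (b + emb b w)) \<partial>?M))"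
  proof (rule nn_integral_cong_AE)
    have "AE s in lborel. s \<noteq> (0::real)" by (rule AE_lborel_singleton)
    then show "AE s in lborel. (\<integral>\<^sup>+z. F (s *\<^sub>R b + emb b z) \<partial>?M) = ennreal (\<bar>s\<bar> ^ card ?B) * (\<integral>\<^sup>+w. F (s *\<^sub>R (b + emb b w)) \<partial>?M)"
    proof eventually_elim
      case (elim s)
      have "(\<integral>\<^sup>+z. F (s *\<^sub>R b + emb b z) \<partial>?M) = ennreal (\<bar>s\<bar> ^ card ?B) * (\<integral>\<^sup>+w. F (s *\<^sub>R b + emb b (\<lambda>e\<in>?B. s * w e)) \<partial>?M)"
        by (rule nn_integral_PiM_scale) (use elim in auto)
      then show ?case by (simp only: emb_scale scaleR_add_right)
    qed
  qed
  finally show ?thesis .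
qed

end

lemma measurable_PiM_fibers:
  fixes b :: "'a::euclidean_space"
  assumes [measurable]: "\<And>j. j \<in> I \<Longrightarrow> (\<lambda>p. g p j) \<in> borel_measurable M" "\<And>j. j \<in> I \<Longrightarrow> (\<lambda>p. h p j) \<in> borel_measurable M"
  shows "(\<lambda>p. \<lambda>j\<in>I. g p j + h p j *\<^sub>R b) \<in> M \<rightarrow>\<^sub>M PiM I (\<lambda>_. lborel)"
  by (intro measurable_restrict) auto

text \<open>The slab argument of \<open>nn_integral_fibers\<close> for all points at once: a product
  of slabs in x, hence a box of unit sides in the coordinates t.\<close>

lemma nn_integral_PiM_fibers:
  fixes F :: "('i \<Rightarrow> 'a::euclidean_space) \<Rightarrow> ennreal" and b :: 'a
  assumes b1: "norm b = 1" and I: "finite I" and F[measurable]: "F \<in> borel_measurable (PiM I (\<lambda>_. lborel))"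
  shows "(\<integral>\<^sup>+x. F x \<partial>PiM I (\<lambda>_. lborel)) =
    (\<integral>\<^sup>+x. (\<Prod>j\<in>I. if 0 \<le> x j \<bullet> b \<and> x j \<bullet> b < 1 then 1 else 0) *
       (\<integral>\<^sup>+t. F (\<lambda>j\<in>I. hproj b (x j) + t j *\<^sub>R b) \<partial>PiM I (\<lambda>_. lborel)) \<partial>PiM I (\<lambda>_. lborel))"
proof -
  let ?X = "PiM I (\<lambda>_. lborel :: 'a measure)" and ?T = "PiM I (\<lambda>_. lborel :: real measure)"
  interpret X: sigma_finite_measure ?X by (rule sigma_finite_PiM_lborel[OF I])
  interpret T: sigma_finite_measure ?T by (rule sigma_finite_PiM_lborel[OF I])
  interpret XT: pair_sigma_finite ?X ?T ..
  note [measurable] = hproj_measurable[OF b1]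
  let ?e = "\<lambda>x. (\<Prod>j\<in>I. if 0 \<le> x j \<bullet> b \<and> x j \<bullet> b < 1 then 1 else (0::ennreal))"
  have em[measurable]: "?e \<in> borel_measurable ?X" by measurable
  have Fm1: "(\<lambda>p. F (\<lambda>j\<in>I. fst p j + snd p j *\<^sub>R b)) \<in> borel_measurable (?X \<Otimes>\<^sub>M ?T)"
    by (rule measurable_compose[OF measurable_PiM_fibers F]) auto
  have Fm2: "(\<lambda>t. F (\<lambda>j\<in>I. v j + t j *\<^sub>R b)) \<in> borel_measurable ?T" for v
    by (rule measurable_compose[OF measurable_PiM_fibers F]) auto
  have Fm3: "(\<lambda>x. F (\<lambda>j\<in>I. x j + s j *\<^sub>R b)) \<in> borel_measurable ?X" for s
    by (rule measurable_compose[OF measurable_PiM_fibers F]) auto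
  have shift: "(\<integral>\<^sup>+t. F (\<lambda>j\<in>I. hproj b (x j) + t j *\<^sub>R b) \<partial>?T) = (\<integral>\<^sup>+t. F (\<lambda>j\<in>I. x j + t j *\<^sub>R b) \<partial>?T)" for x
  proof -
    have "(\<integral>\<^sup>+t. F (\<lambda>j\<in>I. hproj b (x j) + t j *\<^sub>R b) \<partial>?T) = (\<integral>\<^sup>+t. F (\<lambda>j\<in>I. hproj b (x j) + (\<lambda>j\<in>I. t j + x j \<bullet> b) j *\<^sub>R b) \<partial>?T)"
      by (rule nn_integral_PiM_translate[OF I Fm2])
    also have "\<dots> = (\<integral>\<^sup>+t. F (\<lambda>j\<in>I. x j + t j *\<^sub>R b) \<partial>?T)"
      by (intro nn_integral_cong arg_cong[of _ _ F]) (auto simp: hproj_def algebra_simps fun_eq_iff)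
    finally show ?thesis .
  qed
  have "(\<integral>\<^sup>+x. ?e x * (\<integral>\<^sup>+t. F (\<lambda>j\<in>I. hproj b (x j) + t j *\<^sub>R b) \<partial>?T) \<partial>?X) = (\<integral>\<^sup>+x. \<integral>\<^sup>+t. ?e x * F (\<lambda>j\<in>I. x j + t j *\<^sub>R b) \<partial>?T \<partial>?X)"
    unfolding shift using Fm2 by (simp add: nn_integral_cmult)
  also have "\<dots> = (\<integral>\<^sup>+t. \<integral>\<^sup>+x. ?e x * F (\<lambda>j\<in>I. x j + t j *\<^sub>R b) \<partial>?X \<partial>?T)"
  proof (rule XT.Fubini'[symmetric])
    show "(\<lambda>(x, t). ?e x * F (\<lambda>j\<in>I. x j + t j *\<^sub>R b)) \<in> borel_measurable (?X \<Otimes>\<^sub>M ?T)"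
      using Fm1 unfolding case_prod_beta' by (intro borel_measurable_times_ennreal measurable_compose[OF measurable_fst em])
  qed
  also have "\<dots> = (\<integral>\<^sup>+t. \<integral>\<^sup>+x. ?e (\<lambda>j\<in>I. x j + (- t j) *\<^sub>R b) * F x \<partial>?X \<partial>?T)"
  proof (rule nn_integral_cong)
    fix t :: "'i \<Rightarrow> real"
    have "(\<integral>\<^sup>+x. ?e x * F (\<lambda>j\<in>I. x j + t j *\<^sub>R b) \<partial>?X)
      = (\<integral>\<^sup>+x. ?e (\<lambda>j\<in>I. x j + (- t j) *\<^sub>R b) * F (\<lambda>j\<in>I. (\<lambda>j\<in>I. x j + (- t j) *\<^sub>R b) j + t j *\<^sub>R b) \<partial>?X)"
      by (rule nn_integral_PiM_translate[OF I]) (use em Fm3 in auto)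
    also have "\<dots> = (\<integral>\<^sup>+x. ?e (\<lambda>j\<in>I. x j + (- t j) *\<^sub>R b) * F x \<partial>?X)"
    proof (rule nn_integral_cong)
      fix x assume "x \<in> space ?X"
      then have "(\<lambda>j\<in>I. (\<lambda>j\<in>I. x j + (- t j) *\<^sub>R b) j + t j *\<^sub>R b) = x"
        by (auto simp: fun_eq_iff space_PiM PiE_iff extensional_def)
      then show "?e (\<lambda>j\<in>I. x j + (- t j) *\<^sub>R b) * F (\<lambda>j\<in>I. (\<lambda>j\<in>I. x j + (- t j) *\<^sub>R b) j + t j *\<^sub>R b) = ?e (\<lambda>j\<in>I. x j + (- t j) *\<^sub>R b) * F x" by simp
    qed
    finally show "(\<integral>\<^sup>+x. ?e x * F (\<lambda>j\<in>I. x j + t j *\<^sub>R b) \<partial>?X) = (\<integral>\<^sup>+x. ?e (\<lambda>j\<in>I. x j + (- t j) *\<^sub>R b) * F x \<partial>?X)" .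
  qed
  also have "\<dots> = (\<integral>\<^sup>+x. \<integral>\<^sup>+t. ?e (\<lambda>j\<in>I. x j + (- t j) *\<^sub>R b) * F x \<partial>?T \<partial>?X)"
  proof (rule XT.Fubini')
    have "(\<lambda>p. ?e (\<lambda>j\<in>I. fst p j + (- snd p j) *\<^sub>R b)) \<in> borel_measurable (?X \<Otimes>\<^sub>M ?T)"
      by (rule measurable_compose[OF measurable_PiM_fibers em]) auto
    then show "(\<lambda>(x, t). ?e (\<lambda>j\<in>I. x j + (- t j) *\<^sub>R b) * F x) \<in> borel_measurable (?X \<Otimes>\<^sub>M ?T)"
      unfolding case_prod_beta' by (intro borel_measurable_times_ennreal measurable_compose[OF measurable_fst F])
  qed
  also have "\<dots> = (\<integral>\<^sup>+x. F x \<partial>?X)"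
  proof (rule nn_integral_cong)
    fix x :: "'i \<Rightarrow> 'a"
    have bb: "b \<bullet> b = 1" using b1 by (simp add: norm_eq_1)
    have *: "?e (\<lambda>j\<in>I. x j + (- t j) *\<^sub>R b) = (\<Prod>j\<in>I. indicator {x j \<bullet> b - 1 <.. x j \<bullet> b} (t j))" for t
      by (intro prod.cong) (auto simp: indicator_def inner_diff_left bb)
    have "(\<integral>\<^sup>+t. ?e (\<lambda>j\<in>I. x j + (- t j) *\<^sub>R b) \<partial>?T) = (\<Prod>j\<in>I. \<integral>\<^sup>+s. indicator {x j \<bullet> b - 1 <.. x j \<bullet> b} s \<partial>lborel)"
      unfolding * by (rule lborel_PiM.product_nn_integral_prod) (use I in auto)
    also have "\<dots> = 1" by simp
    finally have "(\<integral>\<^sup>+t. ?e (\<lambda>j\<in>I. x j + (- t j) *\<^sub>R b) \<partial>?T) = 1" .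
    moreover have "(\<lambda>t. ?e (\<lambda>j\<in>I. x j + (- t j) *\<^sub>R b)) \<in> borel_measurable ?T" unfolding * by measurable
    ultimately show "(\<integral>\<^sup>+t. ?e (\<lambda>j\<in>I. x j + (- t j) *\<^sub>R b) * F x \<partial>?T) = F x" by (subst nn_integral_multc) auto
  qed
  finally show ?thesis by simp
qed

context region
begin

context
  fixes b :: "'a::euclidean_space" and y :: "'i \<Rightarrow> 'a"
  assumes b: "b \<in> Basis" and y: "\<And>j. j \<in> I \<Longrightarrow> y j \<bullet> b = 0"
begin

text \<open>Indicator of those w for which u = s (b + w) lies in the region belonging to the points
  y j + t j b.\<close>

definition slice :: "real \<Rightarrow> ('i \<Rightarrow> real) \<Rightarrow> ('a \<Rightarrow> real) \<Rightarrow> real" where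
  "slice s t w = (if D (\<bar>s\<bar> * norm (b + emb b w)) (\<lambda>j. s * (t j + y j \<bullet> emb b w)) then 1 else 0)"

lemma slice_measurable:
  assumes "g \<in> borel_measurable M" "\<And>j. j \<in> I \<Longrightarrow> (\<lambda>p. h p j) \<in> borel_measurable M" "k \<in> M \<rightarrow>\<^sub>M PiM (Basis - {b}) (\<lambda>_. lborel)"
  shows "(\<lambda>p. slice (g p) (h p) (k p)) \<in> borel_measurable M"
proof -
  note [measurable] = assms
  have [measurable]: "(\<lambda>p. emb b (k p)) \<in> borel_measurable M"
    by (rule measurable_compose[OF assms(3) emb_measurable])
  have [measurable]: "Measurable.pred M (\<lambda>p. D (\<bar>g p\<bar> * norm (b + emb b (k p))) (\<lambda>j. g p * (h p j + y j \<bullet> emb b (k p))))"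
    by (rule D_measurable) auto
  show ?thesis unfolding slice_def by measurable
qed

lemma slice_box:
  assumes "s \<noteq> 0" "slice s t w \<noteq> 0" "e \<in> Basis - {b}"
  shows "\<bar>w e\<bar> \<le> \<rho> / \<bar>s\<bar>"
proof -
  have "\<bar>s\<bar> * norm (b + emb b w) \<le> \<rho>" using assms bdd by (auto simp: slice_def split: if_splits)
  then have "norm (b + emb b w) \<le> \<rho> / \<bar>s\<bar>" using assms by (simp add: field_simps)
  moreover have "\<bar>w e\<bar> \<le> norm (b + emb b w)"
    using Basis_le_norm[of e "b + emb b w"] emb_component[OF b assms(3)] assms(3) by simp
  ultimately show ?thesis by linarith
qed

lemma slice_bbs: "s \<noteq> 0 \<Longrightarrow> bounded_box_support (Basis - {b}) (slice s t)"
  unfolding bounded_box_support_def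
proof (intro conjI exI ballI)
  show "slice s t \<in> borel_measurable (PiM (Basis - {b}) (\<lambda>_. lborel))"
    using slice_measurable[of "\<lambda>_. s" _ "\<lambda>_. t" "\<lambda>w. w"] by simp
  fix w assume "s \<noteq> 0"
  then show "slice s t w \<noteq> 0 \<longrightarrow> (\<forall>e\<in>Basis - {b}. \<bar>w e\<bar> \<le> \<rho> / \<bar>s\<bar>)" using slice_box by blast
qed (auto simp: slice_def)

definition slice_vol :: "real \<Rightarrow> ('i \<Rightarrow> real) \<Rightarrow> real" where
  "slice_vol s t = enn2real (\<integral>\<^sup>+w. ennreal (slice s t w) \<partial>PiM (Basis - {b}) (\<lambda>_. lborel))"

lemma slice_even:
  assumes "t \<in> PiE I (\<lambda>_. UNIV)"
  shows "slice s (\<lambda>j\<in>I. - t j) w = slice s t (\<lambda>e\<in>Basis - {b}. (-1) * w e)"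
proof -
  have e: "emb b (\<lambda>e\<in>Basis - {b}. (-1) * w e) = - emb b w" using emb_scale[OF b, of "-1" w] by simp
  have n: "norm (b + - emb b w) = norm (b + emb b w)"
    using norm_emb_minus[OF b, of w] e by simp
  have "D (\<bar>s\<bar> * norm (b + emb b w)) (\<lambda>j. s * ((\<lambda>j\<in>I. - t j) j + y j \<bullet> emb b w))
    \<longleftrightarrow> D (\<bar>s\<bar> * norm (b + emb b w)) (\<lambda>j. s * (t j + y j \<bullet> (- emb b w)))"
    by (rule D_cong) (auto simp: abs_mult abs_minus_commute)
  then show ?thesis unfolding slice_def e n by simp
qed

text \<open>For fixed s the region is convex in (t, w) jointly, so its w-sections have log-concave
  volume, by Prekopa-Leindler for indicators. Replacing (t, w) by (-t, -w) changes only signs in D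
  and keeps the norm, since w is orthogonal to b; this gives evenness.\<close>

lemma even_log_concave_slice_vol:
  assumes s: "s \<noteq> 0" shows "even_log_concave I (slice_vol s)"
proof
  let ?W = "PiM (Basis - {b}) (\<lambda>_. lborel :: real measure)"
  have finB: "finite (Basis - {b})" by simp
  interpret W: sigma_finite_measure ?W by (rule sigma_finite_PiM_lborel[OF finB])
  show "finite I" by (rule fin)
  have m: "(\<lambda>p. ennreal (slice s (fst p) (snd p))) \<in> borel_measurable (PiM I (\<lambda>_. lborel) \<Otimes>\<^sub>M ?W)"
    by (rule measurable_compose[OF slice_measurable measurable_ennreal]) auto
  show "slice_vol s \<in> borel_measurable (PiM I (\<lambda>_. lborel))"
  proof -
    have [measurable]: "(\<lambda>t. \<integral>\<^sup>+w. ennreal (slice s t w) \<partial>?W) \<in> borel_measurable (PiM I (\<lambda>_. lborel))"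
      using m by (intro W.borel_measurable_nn_integral) (simp add: case_prod_beta')
    show ?thesis unfolding slice_vol_def by measurable
  qed
  show "\<exists>B. \<forall>t\<in>PiE I (\<lambda>_. UNIV). 0 \<le> slice_vol s t \<and> slice_vol s t \<le> B"
  proof (intro exI ballI conjI)
    fix t
    show "0 \<le> slice_vol s t" by (simp add: slice_vol_def)
    let ?Q = "PiE (Basis - {b}) (\<lambda>_. {-(\<rho> / \<bar>s\<bar>)..\<rho> / \<bar>s\<bar>})"
    have "(\<integral>\<^sup>+w. ennreal (slice s t w) \<partial>?W) \<le> (\<integral>\<^sup>+w. indicator ?Q w \<partial>?W)"
    proof (rule nn_integral_mono)
      fix w assume "w \<in> space ?W"
      then show "ennreal (slice s t w) \<le> indicator ?Q w"
        using slice_box[OF s, of t w] by (cases "slice s t w = 0") (auto simp: space_PiM PiE_iff indicator_def slice_def abs_le_iff minus_le_iff)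
    qed
    also have "\<dots> = emeasure ?W ?Q" by (rule nn_integral_indicator) (auto intro!: sets_PiM_I_finite)
    finally have le: "(\<integral>\<^sup>+w. ennreal (slice s t w) \<partial>?W) \<le> emeasure ?W ?Q" .
    have "emeasure ?W ?Q < \<infinity>" by (subst lborel_PiM.emeasure_PiM) (auto simp: emeasure_lborel_Icc_eq power_less_top_ennreal)
    with le show "slice_vol s t \<le> enn2real (emeasure ?W ?Q)"
      unfolding slice_vol_def by (intro enn2real_mono) auto
  qed
  show "slice_vol s (\<lambda>j\<in>I. - t j) = slice_vol s t" if t: "t \<in> PiE I (\<lambda>_. UNIV)" for t
  proof -
    have "(\<integral>\<^sup>+w. ennreal (slice s t w) \<partial>?W) = ennreal (\<bar>-1\<bar> ^ card (Basis - {b})) * (\<integral>\<^sup>+w. ennreal (slice s t (\<lambda>e\<in>Basis - {b}. (-1) * w e)) \<partial>?W)"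
      using slice_bbs[OF s, of t] by (intro nn_integral_PiM_scale) (auto simp: bounded_box_support_def)
    then show ?thesis unfolding slice_vol_def slice_even[OF t] by simp
  qed
  fix t t' :: "'i \<Rightarrow> real" and l :: real
  assume l: "0 < l" "l < 1"
  let ?t = "\<lambda>j\<in>I. (1 - l) * t j + l * t' j"
  show "slice_vol s t powr (1 - l) * slice_vol s t' powr l \<le> slice_vol s ?t"
    unfolding slice_vol_def
  proof (rule prekopa_leindler[OF finB slice_bbs[OF s] slice_bbs[OF s] slice_bbs[OF s] l])
    fix w w' :: "'a \<Rightarrow> real"
    let ?w = "\<lambda>e\<in>Basis - {b}. (1 - l) * w e + l * w' e"
    show "slice s t w powr (1 - l) * slice s t' w' powr l \<le> slice s ?t ?w"
    proof (cases "slice s t w = 0 \<or> slice s t' w' = 0")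
      case True then show ?thesis by (auto simp: slice_def)
    next
      case False
      then have D: "D (\<bar>s\<bar> * norm (b + emb b w)) (\<lambda>j. s * (t j + y j \<bullet> emb b w))"
        "D (\<bar>s\<bar> * norm (b + emb b w')) (\<lambda>j. s * (t' j + y j \<bullet> emb b w'))"
        by (auto simp: slice_def split: if_splits)
      have "D (\<bar>s\<bar> * norm (b + emb b ?w)) (\<lambda>j. s * (?t j + y j \<bullet> emb b ?w))"
      \<comment> \<open>\<open>conv\<close> yields the point with the averaged norms; the true norm
        is at most that, and \<open>anti\<close> moves down to it.\<close>
      proof (rule anti[OF conv[OF _ _ D, of l]])
        have "b + emb b ?w = (1 - l) *\<^sub>R (b + emb b w) + l *\<^sub>R (b + emb b w')"
          unfolding emb_convex[OF b] by (simp add: algebra_simps)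
        then have "norm (b + emb b ?w) \<le> (1 - l) * norm (b + emb b w) + l * norm (b + emb b w')"
          using norm_triangle_ineq[of "(1 - l) *\<^sub>R (b + emb b w)" "l *\<^sub>R (b + emb b w')"] l by simp
        then have "\<bar>s\<bar> * norm (b + emb b ?w) \<le> \<bar>s\<bar> * ((1 - l) * norm (b + emb b w) + l * norm (b + emb b w'))"
          by (rule mult_left_mono) simp
        then show "\<bar>s\<bar> * norm (b + emb b ?w) \<le> (1 - l) * (\<bar>s\<bar> * norm (b + emb b w)) + l * (\<bar>s\<bar> * norm (b + emb b w'))"
          by (simp add: algebra_simps)
        fix j assume "j \<in> I"
        then show "\<bar>s * (?t j + y j \<bullet> emb b ?w)\<bar> \<le> \<bar>(1 - l) * (s * (t j + y j \<bullet> emb b w)) + l * (s * (t' j + y j \<bullet> emb b w'))\<bar>"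
          unfolding emb_convex[OF b] by (simp add: inner_add_right algebra_simps)
      qed (use l in auto)
      then show ?thesis by (auto simp: slice_def)
    qed
  qed
qed

lemma vol_slices:
  "vol (\<lambda>j\<in>I. y j + t j *\<^sub>R b) = (lint s. ennreal (\<bar>s\<bar> ^ card (Basis - {b})) * ennreal (slice_vol s t))"
proof -
  let ?W = "PiM (Basis - {b}) (\<lambda>_. lborel :: real measure)"
  let ?x = "\<lambda>j\<in>I. y j + t j *\<^sub>R b"
  have bb: "b \<bullet> b = 1" using b by (simp add: inner_Basis)
  have k: "ker ?x (s *\<^sub>R (b + emb b w)) = ennreal (slice s t w)" for s w
  proof -
    have "D (norm (s *\<^sub>R (b + emb b w))) (\<lambda>j. ?x j \<bullet> (s *\<^sub>R (b + emb b w))) \<longleftrightarrow> D (\<bar>s\<bar> * norm (b + emb b w)) (\<lambda>j. s * (t j + y j \<bullet> emb b w))"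
      unfolding norm_scaleR by (rule D_cong) (auto simp: inner_add_left inner_add_right bb y emb_inner[OF b] algebra_simps)
    then show ?thesis by (simp add: ker_def slice_def)
  qed
  have "vol ?x = (lint s. ennreal (\<bar>s\<bar> ^ card (Basis - {b})) * (\<integral>\<^sup>+w. ker ?x (s *\<^sub>R (b + emb b w)) \<partial>?W))"
    unfolding vol_def by (rule nn_integral_cone[OF b]) (rule ker_measurable, auto)
  also have "\<dots> = (lint s. ennreal (\<bar>s\<bar> ^ card (Basis - {b})) * ennreal (slice_vol s t))"
    unfolding k
  proof (rule nn_integral_cong_AE)
    have "AE s in lborel. s \<noteq> (0::real)" by (rule AE_lborel_singleton)
    then show "AE s in lborel. ennreal (\<bar>s\<bar> ^ card (Basis - {b})) * (\<integral>\<^sup>+w. ennreal (slice s t w) \<partial>?W) = ennreal (\<bar>s\<bar> ^ card (Basis - {b})) * ennreal (slice_vol s t)"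
    proof eventually_elim
      case (elim s)
      have "(\<integral>\<^sup>+w. ennreal (slice s t w) \<partial>?W) < \<infinity>" by (rule bounded_box_support_finite[OF _ slice_bbs[OF elim]]) simp
      then show ?case by (simp add: slice_vol_def)
    qed
  qed
  finally show ?thesis .
qed

text \<open>Along the fibre \<open>vol\<close> is a mixture of the weights
  \<open>slice_vol s\<close>. Each of them is even and log-concave for s other than 0, so the
  comparison is made for each s and then integrated.\<close>

lemma fiber_func_le:
  fixes f f' :: "'i \<Rightarrow> real \<Rightarrow> real"
  assumes [measurable]: "\<And>j. j \<in> I \<Longrightarrow> f j \<in> borel_measurable borel" "\<And>j. j \<in> I \<Longrightarrow> f' j \<in> borel_measurable borel"
    and f: "\<And>j c. j \<in> I \<Longrightarrow> 0 < c \<Longrightarrow> open {t. c < f j t}" "\<And>j c. j \<in> I \<Longrightarrow> 0 < c \<Longrightarrow> bounded {t. c < f j t}"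
    and f': "\<And>j c t. j \<in> I \<Longrightarrow> 0 < c \<Longrightarrow> c < f' j t \<longleftrightarrow> \<bar>t\<bar> < measure lborel {t. c < f j t} / 2"
  shows "(\<integral>\<^sup>+t. (\<Prod>j\<in>I. ennreal (f j (t j))) * vol (\<lambda>j\<in>I. y j + t j *\<^sub>R b) \<partial>PiM I (\<lambda>_. lborel))
     \<le> (\<integral>\<^sup>+t. (\<Prod>j\<in>I. ennreal (f' j (t j))) * vol (\<lambda>j\<in>I. y j + t j *\<^sub>R b) \<partial>PiM I (\<lambda>_. lborel))"
proof -
  let ?T = "PiM I (\<lambda>_. lborel :: real measure)" and ?W = "PiM (Basis - {b}) (\<lambda>_. lborel :: real measure)"
  interpret T: sigma_finite_measure ?T by (rule sigma_finite_PiM_lborel[OF fin])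
  have finB: "finite (Basis - {b})" by simp
  interpret W: sigma_finite_measure ?W by (rule sigma_finite_PiM_lborel[OF finB])
  interpret LT: pair_sigma_finite "lborel :: real measure" ?T ..
  have sv[measurable]: "(\<lambda>(s, t). slice_vol s t) \<in> borel_measurable (lborel \<Otimes>\<^sub>M ?T)"
  proof -
    have m: "(\<lambda>p. ennreal (slice (fst (fst p)) (snd (fst p)) (snd p))) \<in> borel_measurable ((lborel \<Otimes>\<^sub>M ?T) \<Otimes>\<^sub>M ?W)"
      by (rule measurable_compose[OF slice_measurable measurable_ennreal]) auto
    have [measurable]: "(\<lambda>p. \<integral>\<^sup>+w. ennreal (slice (fst p) (snd p) w) \<partial>?W) \<in> borel_measurable (lborel \<Otimes>\<^sub>M ?T)"
      using m by (intro W.borel_measurable_nn_integral) (simp add: case_prod_beta')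
    show ?thesis unfolding slice_vol_def case_prod_beta' by measurable
  qed
  have svt[measurable]: "(\<lambda>s. slice_vol s t) \<in> borel_measurable lborel" if "t \<in> space ?T" for t
    using measurable_compose[OF _ sv, of "\<lambda>s. (s, t)" lborel] that by simp
  have eq: "(\<integral>\<^sup>+t. (\<Prod>j\<in>I. ennreal (g j (t j))) * vol (\<lambda>j\<in>I. y j + t j *\<^sub>R b) \<partial>?T)
     = (lint s. ennreal (\<bar>s\<bar> ^ card (Basis - {b})) * (\<integral>\<^sup>+t. ennreal (slice_vol s t) * (\<Prod>j\<in>I. ennreal (g j (t j))) \<partial>?T))"
    if g[measurable]: "\<And>j. j \<in> I \<Longrightarrow> g j \<in> borel_measurable borel" for g :: "'i \<Rightarrow> real \<Rightarrow> real"
  proof -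
    have gm[measurable]: "(\<lambda>t. \<Prod>j\<in>I. ennreal (g j (t j))) \<in> borel_measurable ?T" by measurable
    have "(\<integral>\<^sup>+t. (\<Prod>j\<in>I. ennreal (g j (t j))) * vol (\<lambda>j\<in>I. y j + t j *\<^sub>R b) \<partial>?T)
       = (\<integral>\<^sup>+t. \<integral>\<^sup>+s. ennreal (\<bar>s\<bar> ^ card (Basis - {b})) * (ennreal (slice_vol s t) * (\<Prod>j\<in>I. ennreal (g j (t j)))) \<partial>lborel \<partial>?T)"
      unfolding vol_slices
      by (intro nn_integral_cong) (subst nn_integral_cmult[symmetric], measurable, auto simp: mult_ac intro!: nn_integral_cong)
    also have "\<dots> = (lint s. \<integral>\<^sup>+t. ennreal (\<bar>s\<bar> ^ card (Basis - {b})) * (ennreal (slice_vol s t) * (\<Prod>j\<in>I. ennreal (g j (t j)))) \<partial>?T)"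
      by (rule LT.Fubini') measurable
    also have "\<dots> = (lint s. ennreal (\<bar>s\<bar> ^ card (Basis - {b})) * (\<integral>\<^sup>+t. ennreal (slice_vol s t) * (\<Prod>j\<in>I. ennreal (g j (t j))) \<partial>?T))"
      by (intro nn_integral_cong nn_integral_cmult) measurable
    finally show ?thesis .
  qed
  show ?thesis
  proof (subst eq[of f], erule assms(1), subst eq[of f'], erule assms(2), rule nn_integral_mono_AE)
    have "AE s in lborel. s \<noteq> (0::real)" by (rule AE_lborel_singleton)
    then show "AE s in lborel. ennreal (\<bar>s\<bar> ^ card (Basis - {b})) * (\<integral>\<^sup>+t. ennreal (slice_vol s t) * (\<Prod>j\<in>I. ennreal (f j (t j))) \<partial>?T)
      \<le> ennreal (\<bar>s\<bar> ^ card (Basis - {b})) * (\<integral>\<^sup>+t. ennreal (slice_vol s t) * (\<Prod>j\<in>I. ennreal (f' j (t j))) \<partial>?T)"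
    proof eventually_elim
      case (elim s)
      interpret even_log_concave I "slice_vol s" by (rule even_log_concave_slice_vol[OF elim])
      show ?case using assms by (intro mult_left_mono rearrange_functions) auto
    qed
  qed
qed

end

text \<open>The chart of \<open>nn_integral_cone\<close> uses a basis vector, so only basis
  directions occur here; the reflections in the orbit later provide all others.\<close>

theorem func_steiner_le:
  fixes f :: "'i \<Rightarrow> 'a::euclidean_space \<Rightarrow> real"
  assumes b: "b \<in> Basis" and f: "\<And>j. j \<in> I \<Longrightarrow> cont_supp R (A j) (f j)"
  shows "func f \<le> func (\<lambda>j. steiner b (f j))"
proof -
  have b1: "norm b = 1" using b by simp
  note g = steiner_cont_supp[OF b1 f]
  have fm[measurable]: "f j \<in> borel_measurable borel" "steiner b (f j) \<in> borel_measurable borel" if "j \<in> I" for j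
    using cont_suppD(5)[OF f[OF that]] cont_suppD(5)[OF g[OF that]] by auto
  have Fm: "(\<lambda>x. (\<Prod>j\<in>I. ennreal (k j (x j))) * vol x) \<in> borel_measurable (PiM I (\<lambda>_. lborel))"
    if [measurable]: "\<And>j. j \<in> I \<Longrightarrow> k j \<in> borel_measurable borel" for k :: "'i \<Rightarrow> 'a \<Rightarrow> real"
    by measurable
  let ?e = "\<lambda>x. (\<Prod>j\<in>I. if 0 \<le> x j \<bullet> b \<and> x j \<bullet> b < 1 then 1 else (0::ennreal))"
  have eq: "func k = (\<integral>\<^sup>+x. ?e x * (\<integral>\<^sup>+t. (\<Prod>j\<in>I. ennreal (k j ((\<lambda>j\<in>I. hproj b (x j) + t j *\<^sub>R b) j))) *
      vol (\<lambda>j\<in>I. hproj b (x j) + t j *\<^sub>R b) \<partial>PiM I (\<lambda>_. lborel)) \<partial>PiM I (\<lambda>_. lborel))"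
    if "\<And>j. j \<in> I \<Longrightarrow> k j \<in> borel_measurable borel" for k :: "'i \<Rightarrow> 'a \<Rightarrow> real"
    unfolding func_def by (rule nn_integral_PiM_fibers[OF b1 fin Fm]) (rule that)
  show ?thesis
  proof (subst eq[of f], erule fm(1), subst eq[of "\<lambda>j. steiner b (f j)"], erule fm(2), rule nn_integral_mono, rule mult_left_mono)
    fix x :: "'i \<Rightarrow> 'a"
    let ?y = "\<lambda>j. hproj b (x j)"
    have e: "(\<Prod>j\<in>I. ennreal (f j ((\<lambda>j\<in>I. ?y j + t j *\<^sub>R b) j))) = (\<Prod>j\<in>I. ennreal (f j (?y j + t j *\<^sub>R b)))"
      "(\<Prod>j\<in>I. ennreal (steiner b (f j) ((\<lambda>j\<in>I. ?y j + t j *\<^sub>R b) j))) = (\<Prod>j\<in>I. ennreal (steiner b (f j) (?y j + t j *\<^sub>R b)))" for t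
      by (auto intro!: prod.cong)
    show "(\<integral>\<^sup>+t. (\<Prod>j\<in>I. ennreal (f j ((\<lambda>j\<in>I. ?y j + t j *\<^sub>R b) j))) * vol (\<lambda>j\<in>I. ?y j + t j *\<^sub>R b) \<partial>PiM I (\<lambda>_. lborel))
      \<le> (\<integral>\<^sup>+t. (\<Prod>j\<in>I. ennreal (steiner b (f j) ((\<lambda>j\<in>I. ?y j + t j *\<^sub>R b) j))) * vol (\<lambda>j\<in>I. ?y j + t j *\<^sub>R b) \<partial>PiM I (\<lambda>_. lborel))"
      unfolding e
    proof (rule fiber_func_le[where b=b and y="?y" and f="\<lambda>j t. f j (?y j + t *\<^sub>R b)" and f'="\<lambda>j t. steiner b (f j) (?y j + t *\<^sub>R b)", OF b])
      fix j assume j: "j \<in> I"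
      show "hproj b (x j) \<bullet> b = 0" by (rule hproj_inner[OF b1])
      show "(\<lambda>t. f j (hproj b (x j) + t *\<^sub>R b)) \<in> borel_measurable borel" "(\<lambda>t. steiner b (f j) (hproj b (x j) + t *\<^sub>R b)) \<in> borel_measurable borel"
        using j by measurable
      fix c :: real assume c: "0 < c"
      have fib: "{t. c < f j (hproj b (x j) + t *\<^sub>R b)} = fiber b (f j) (x j) c" by (simp add: fiber_def)
      show "open {t. c < f j (hproj b (x j) + t *\<^sub>R b)}" unfolding fib by (rule fiber_open[OF b1 cont_suppD(1)[OF f[OF j]]])
      show "bounded {t. c < f j (hproj b (x j) + t *\<^sub>R b)}" unfolding fib using fiber_bounded(1)[OF b1 f[OF j]] c by simp
      fix t
      show "c < steiner b (f j) (hproj b (x j) + t *\<^sub>R b) \<longleftrightarrow> \<bar>t\<bar> < measure lborel {t. c < f j (hproj b (x j) + t *\<^sub>R b)} / 2"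
        using less_steiner_iff[OF b1 f[OF j], of c "hproj b (x j) + t *\<^sub>R b"] c unfolding fib
        by (simp add: hproj_fiber[OF b1] fiber_def mult.commute)
    qed
  qed simp
qed

end

subsection \<open>Reflections\<close>

text \<open>The vector a need not be normalised, and \<open>reflect 0\<close> is the identity, so
  rules such as \<open>reflect_reflect\<close> hold for every a.\<close>

definition reflect :: "'a::euclidean_space \<Rightarrow> 'a \<Rightarrow> 'a" where
  "reflect a x = x - (2 * (x \<bullet> a) / (a \<bullet> a)) *\<^sub>R a"

lemma reflect_scaleR: "reflect a (c *\<^sub>R x) = c *\<^sub>R reflect a x"
  by (simp add: reflect_def algebra_simps)

lemma reflect_diff: "reflect a (x - y) = reflect a x - reflect a y"
  by (simp add: reflect_def inner_diff_left algebra_simps diff_divide_distrib)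

lemma reflect_inner: "reflect a x \<bullet> reflect a y = x \<bullet> y"
  by (cases "a = 0") (simp_all add: reflect_def inner_diff_left inner_diff_right inner_commute)

lemma norm_reflect: "norm (reflect a x) = norm x"
  by (simp add: norm_eq_sqrt_inner reflect_inner)

lemma reflect_reflect: "reflect a (reflect a x) = x"
  by (cases "a = 0") (simp_all add: reflect_def inner_diff_left algebra_simps)

lemma continuous_on_reflect: "continuous_on S (reflect a)"
  by (cases "a = 0") (auto simp: reflect_def[abs_def] intro!: continuous_intros)

lemma reflect_measurable[measurable]: "reflect a \<in> borel_measurable borel"
  by (intro borel_measurable_continuous_onI continuous_on_reflect)

lemma reflect_swap:
  assumes "norm v = norm v'"
  shows "reflect (v - v') v = v'"
proof (cases "v = v'")
  case False
  have vv: "v \<bullet> v = v' \<bullet> v'" using assms by (simp add: norm_eq)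
  have h: "2 * (v \<bullet> (v - v')) = (v - v') \<bullet> (v - v')"
    using vv by (simp add: inner_diff_left inner_diff_right inner_commute)
  have "(v - v') \<bullet> (v - v') \<noteq> 0" using False by simp
  note 1 = divide_self[OF this]
  show ?thesis unfolding reflect_def h 1 by simp
qed (simp add: reflect_def)

text \<open>Two translation-invariant functionals are proportional, and a reflection preserves the unit ball.\<close>

lemma nn_integral_reflect:
  fixes g :: "'a::euclidean_space \<Rightarrow> ennreal"
  assumes [measurable]: "g \<in> borel_measurable borel"
  shows "(lint x. g (reflect a x)) = (lint x. g x)"
proof -
  have tr: "(lint x. h x) = (lint x. h (x + c))" if [measurable]: "h \<in> borel_measurable lborel" for c :: 'a and h
    by (subst lborel_distr_plus[of c, symmetric]) (simp add: nn_integral_distr add.commute)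
  have neg: "(lint y. g (c - y)) = (lint y. g y)" for c
  proof -
    have "(lint y. g y) = (\<integral>\<^sup>+y. g y \<partial>density (distr lborel borel (\<lambda>x. c + (-1) *\<^sub>R x)) (\<lambda>_. ennreal (\<bar>-1\<bar> ^ DIM('a))))"
      by (subst lborel_affine[of "-1" c]) auto
    also have "\<dots> = (lint y. g (c - y))"
      by (simp add: nn_integral_density nn_integral_distr)
    finally show ?thesis by simp
  qed
  define h where "h = (indicator (ball 0 1) :: 'a \<Rightarrow> ennreal)"
  have [measurable]: "h \<in> borel_measurable borel" unfolding h_def by (intro borel_measurable_indicator) simp
  let ?R = "reflect a"
  have "(lint x. g (?R x)) * (lint y. h y) = (lint x. \<integral>\<^sup>+y. g (?R x) * h y \<partial>lborel)"
    by (simp add: nn_integral_cmult nn_integral_multc)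
  also have "\<dots> = (lint x. \<integral>\<^sup>+y. g (?R x) * h (y + ?R x) \<partial>lborel)"
  proof (rule nn_integral_cong)
    fix x show "(lint y. g (?R x) * h y) = (lint y. g (?R x) * h (y + ?R x))"
      by (rule tr) measurable
  qed
  also have "\<dots> = (lint y. \<integral>\<^sup>+x. g (?R x) * h (y + ?R x) \<partial>lborel)"
    by (rule lborel_pair.Fubini'[symmetric]) measurable
  also have "\<dots> = (lint y. \<integral>\<^sup>+x. g (?R x - y) * h (?R x) \<partial>lborel)"
  proof (rule nn_integral_cong)
    fix y
    have "(lint x. g (?R x) * h (y + ?R x)) = (lint x. g (?R (x + - ?R y)) * h (y + ?R (x + - ?R y)))"
      by (rule tr) measurable
    also have "\<dots> = (lint x. g (?R x - y) * h (?R x))"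
      by (simp add: reflect_diff reflect_reflect)
    finally show "(lint x. g (?R x) * h (y + ?R x)) = (lint x. g (?R x - y) * h (?R x))" .
  qed
  also have "\<dots> = (lint x. \<integral>\<^sup>+y. g (?R x - y) * h (?R x) \<partial>lborel)"
    by (rule lborel_pair.Fubini') measurable
  also have "\<dots> = (lint x. (lint y. g y) * h (?R x))"
    by (simp add: nn_integral_multc neg)
  also have "\<dots> = (lint y. g y) * (lint y. h y)"
    by (simp add: nn_integral_cmult h_def indicator_def norm_reflect dist_norm)
  finally have eq: "(lint y. h y) * (lint x. g (?R x)) = (lint y. h y) * (lint y. g y)"
    by (simp add: mult.commute)
  have "emeasure lborel (ball (0::'a) 1) < \<infinity>" using emeasure_bounded_finite[of "ball (0::'a) 1"] by simp
  moreover have "emeasure lborel (ball (0::'a) 1) \<noteq> 0"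
    using open_not_negligible[of "ball (0::'a) 1"] by (auto simp: negligible_iff_null_sets null_setsI null_sets_completionI)
  moreover have "(lint y. h y) = emeasure lborel (ball (0::'a) 1)" by (simp add: h_def)
  ultimately show ?thesis using eq ennreal_mult_cancel_left[of "\<integral>\<^sup>+y. h y \<partial>lborel"] by auto
qed

lemma moment2_reflect:
  assumes [measurable]: "f \<in> borel_measurable borel"
  shows "moment2 (f \<circ> reflect a) = moment2 f"
proof -
  have "moment2 f = (lint x. ennreal ((norm (reflect a x))\<^sup>2 * f (reflect a x)))"
    unfolding moment2_def by (rule nn_integral_reflect[symmetric]) measurable
  then show ?thesis by (simp add: moment2_def norm_reflect)
qed

lemma cont_supp_reflect: "cont_supp R A f \<Longrightarrow> cont_supp R A (f \<circ> reflect a)"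
  by (auto simp: cont_supp_def norm_reflect intro: continuous_on_compose2[of UNIV f, OF _ continuous_on_reflect])

context region
begin

lemma vol_reflect: "vol (\<lambda>j. reflect a (x j)) = vol (x :: 'i \<Rightarrow> 'a::euclidean_space)"
proof -
  have "vol (\<lambda>j. reflect a (x j)) = (lint u. ker (\<lambda>j. reflect a (x j)) (reflect a u))"
    unfolding vol_def by (rule nn_integral_reflect[symmetric]) (rule ker_measurable, auto)
  then show ?thesis by (simp add: vol_def ker_def norm_reflect reflect_inner)
qed

lemma vol_cong: "(\<And>j. j \<in> I \<Longrightarrow> x j = x' j) \<Longrightarrow> vol x = vol x'"
  unfolding vol_def ker_def by (intro nn_integral_cong if_cong D_cong refl) auto

lemma func_reflect:
  fixes f :: "'i \<Rightarrow> 'a::euclidean_space \<Rightarrow> real"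
  assumes [measurable]: "\<And>j. j \<in> I \<Longrightarrow> f j \<in> borel_measurable borel"
  shows "func (\<lambda>j. f j \<circ> reflect a) = func f"
proof -
  have "func f = (\<Prod>i\<in>I. 1) * (\<integral>\<^sup>+x. (\<Prod>j\<in>I. ennreal (f j ((\<lambda>j\<in>I. reflect a (x j)) j))) * vol (\<lambda>j\<in>I. reflect a (x j)) \<partial>PiM I (\<lambda>_. lborel))"
    unfolding func_def
  proof (rule nn_integral_PiM_transform[OF lborel_PiM.product_sigma_finite_axioms fin])
    show "(lint x. g x) = 1 * (lint x. g (reflect a x))" if "g \<in> borel_measurable lborel" for g
      using nn_integral_reflect[of g a] that by simp
    show "(\<lambda>x. (\<Prod>j\<in>I. ennreal (f j (x j))) * vol x) \<in> borel_measurable (PiM I (\<lambda>_. lborel))" by measurable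
  qed auto
  also have "\<dots> = func (\<lambda>j. f j \<circ> reflect a)"
  proof -
    have "vol (\<lambda>j\<in>I. reflect a (x j)) = vol x" for x
      using vol_cong[of "\<lambda>j\<in>I. reflect a (x j)" "\<lambda>j. reflect a (x j)"] vol_reflect[of a x] by simp
    moreover have "(\<Prod>j\<in>I. ennreal (f j ((\<lambda>j\<in>I. reflect a (x j)) j))) = (\<Prod>j\<in>I. ennreal ((f j \<circ> reflect a) (x j)))" for x
      by (intro prod.cong) auto
    ultimately show ?thesis by (simp only: func_def prod.neutral_const mult_1)
  qed
  finally show ?thesis by simp
qed

end

subsection \<open>Minimising the second moment along the orbit\<close>

lemma prod_less_top:
  "finite I \<Longrightarrow> (\<And>i. i \<in> I \<Longrightarrow> f i < top) \<Longrightarrow> (\<Prod>i\<in>I. f i) < (top::ennreal)"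
  by (induction I rule: finite_induct) (auto simp: ennreal_mult_less_top)

lemma moment2_tendsto:
  fixes F :: "nat \<Rightarrow> 'a::euclidean_space \<Rightarrow> real"
  assumes F: "\<And>n. cont_supp R A (F n)" and g: "cont_supp R A g" and lim: "\<And>x. (\<lambda>n. F n x) \<longlonglongrightarrow> g x"
  shows "(\<lambda>n. enn2real (moment2 (F n))) \<longlonglongrightarrow> enn2real (moment2 g)"
proof -
  note [measurable] = cont_suppD(5)[OF F] cont_suppD(5)[OF g]
  have "(\<lambda>n. moment2 (F n)) \<longlonglongrightarrow> moment2 g"
    unfolding moment2_def
  proof (rule nn_integral_dominated_convergence[where w="\<lambda>x. ennreal (R\<^sup>2 * A) * indicator (cball 0 R) x"])
    show "AE x in lborel. ennreal ((norm x)\<^sup>2 * F n x) \<le> ennreal (R\<^sup>2 * A) * indicator (cball 0 R) x" for n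
    proof (intro always_eventually allI)
      fix x :: 'a
      show "ennreal ((norm x)\<^sup>2 * F n x) \<le> ennreal (R\<^sup>2 * A) * indicator (cball 0 R) x"
      proof (cases "norm x \<le> R")
        case True
        then have "(norm x)\<^sup>2 * F n x \<le> R\<^sup>2 * A"
          using cont_suppD(2,3)[OF F, of n x] by (intro mult_mono power_mono) auto
        then show ?thesis using True by (simp add: ennreal_leI)
      next
        case False then show ?thesis using cont_suppD(4)[OF F, of x] by simp
      qed
    qed
    show "(lint x. ennreal (R\<^sup>2 * A) * indicator (cball (0::'a) R) x) < \<infinity>"
      using emeasure_bounded_finite[of "cball (0::'a) R"] by (simp add: nn_integral_cmult_indicator ennreal_mult_less_top)
    show "AE x in lborel. (\<lambda>n. ennreal ((norm x)\<^sup>2 * F n x)) \<longlonglongrightarrow> ennreal ((norm x)\<^sup>2 * g x)"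
      using lim by (intro always_eventually allI tendsto_ennrealI tendsto_mult_left) auto
  qed measurable
  moreover have "moment2 g \<noteq> top"
  proof -
    obtain b :: 'a where "b \<in> Basis" using SOME_Basis by blast
    then show ?thesis using moment2_finite[of b R A g] g by auto
  qed
  ultimately show ?thesis by (intro tendsto_enn2real) (auto simp: less_top)
qed

lemma cont_supp_limit:
  fixes F :: "nat \<Rightarrow> 'a::euclidean_space \<Rightarrow> real"
  assumes F: "\<And>n. cont_supp R A (F n)" and lim: "\<And>x. (\<lambda>n. F n x) \<longlonglongrightarrow> g x"
    and mod: "\<And>e. 0 < e \<Longrightarrow> \<exists>d>0. \<forall>n x y. norm (x - y) \<le> d \<longrightarrow> \<bar>F n x - F n y\<bar> \<le> e"
  shows "cont_supp R A g"
  unfolding cont_supp_def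
proof (intro conjI allI impI)
  show "0 \<le> g x" for x using cont_suppD(2)[OF F] by (intro LIMSEQ_le_const[OF lim]) auto
  show "g x \<le> A" for x using cont_suppD(3)[OF F] by (intro LIMSEQ_le_const2[OF lim]) auto
  show "g x = 0" if "R < norm x" for x
    using lim[of x] cont_suppD(4)[OF F that] by (simp add: LIMSEQ_const_iff)
  show "continuous_on UNIV g"
  proof (rule continuous_on_iff[THEN iffD2], intro ballI allI impI)
    fix x :: 'a and e :: real assume e: "0 < e"
    obtain d where d: "0 < d" "\<And>n x y. norm (x - y) \<le> d \<Longrightarrow> \<bar>F n x - F n y\<bar> \<le> e / 2" using mod[of "e / 2"] e by auto
    have "dist (g x') (g x) < e" if "dist x' x < d" for x'
    proof -
      have "\<bar>g x' - g x\<bar> \<le> e / 2"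
        using d(2)[of x' x] that by (intro LIMSEQ_le_const2[OF tendsto_rabs[OF tendsto_diff[OF lim lim]]]) (auto simp: dist_norm)
      then show ?thesis using e by (simp add: dist_real_def)
    qed
    then show "\<exists>d>0. \<forall>x'\<in>UNIV. dist x' x < d \<longrightarrow> dist (g x') (g x) < e" using d(1) by blast
  qed
qed

text \<open>Arzela-Ascoli is applied to one index after another, each time along a further
  subsequence. Convergence is uniform on the whole space because all functions vanish outside the
  ball of radius R.\<close>

lemma finite_family_convergent_subsequence:
  fixes F :: "nat \<Rightarrow> 'i \<Rightarrow> 'a::euclidean_space \<Rightarrow> real"
  assumes "finite J" and F: "\<And>n j. j \<in> J \<Longrightarrow> cont_supp R (A j) (F n j)"
    and mod: "\<And>j e. j \<in> J \<Longrightarrow> 0 < e \<Longrightarrow> \<exists>d>0. \<forall>n x y. norm (x - y) \<le> d \<longrightarrow> \<bar>F n j x - F n j y\<bar> \<le> e"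
  shows "\<exists>k g. strict_mono (k :: nat \<Rightarrow> nat) \<and> (\<forall>j\<in>J. \<forall>e>0. \<exists>N. \<forall>n\<ge>N. \<forall>x. \<bar>F (k n) j x - g j x\<bar> < e)"
  using assms
proof (induction J rule: finite_induct)
  case empty
  then show ?case by (auto intro!: exI[of _ "\<lambda>n::nat. n"] simp: strict_mono_def)
next
  case (insert i J)
  have "\<exists>k g. strict_mono (k :: nat \<Rightarrow> nat) \<and> (\<forall>j\<in>J. \<forall>e>0. \<exists>N. \<forall>n\<ge>N. \<forall>x. \<bar>F (k n) j x - g j x\<bar> < e)"
    using insert.prems by (intro insert.IH) auto
  then obtain k g where k: "strict_mono (k :: nat \<Rightarrow> nat)" and g: "\<And>j e. j \<in> J \<Longrightarrow> 0 < e \<Longrightarrow> \<exists>N. \<forall>n\<ge>N. \<forall>x. \<bar>F (k n) j x - g j x\<bar> < e"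
    by blast
  have Fi: "cont_supp R (A i) (F n i)" for n using insert.prems by auto
  have "\<exists>h k'. strict_mono (k' :: nat \<Rightarrow> nat) \<and> (\<forall>e>0. \<exists>N. \<forall>n x. n \<ge> N \<and> x \<in> cball 0 R \<longrightarrow> norm (F (k (k' n)) i x - h x) < e)"
  proof (rule Arzela_Ascoli[of "cball 0 R" "\<lambda>n. F (k n) i" "A i"])
    show "norm (F (k n) i x) \<le> A i" for n x using cont_suppD(2,3)[OF Fi, of "k n" x] by auto
    show "\<exists>d. 0 < d \<and> (\<forall>n y. y \<in> cball 0 R \<and> norm (x - y) < d \<longrightarrow> norm (F (k n) i x - F (k n) i y) < e)" if "0 < e" for x e
    proof -
      have "0 < e / 2" using that by simp
      then obtain d where d: "0 < d" "\<forall>n x y. norm (x - y) \<le> d \<longrightarrow> \<bar>F n i x - F n i y\<bar> \<le> e / 2"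
        using insert.prems(2)[of i "e / 2"] by auto
      then have "norm (F (k n) i x - F (k n) i y) < e" if "norm (x - y) < d" for n y
      proof -
        have "\<bar>F (k n) i x - F (k n) i y\<bar> \<le> e / 2" using d(2) that by (simp add: less_imp_le)
        then show ?thesis using \<open>0 < e\<close> by simp
      qed
      then show ?thesis using d(1) by blast
    qed
    fix h :: "'a \<Rightarrow> real" and k' :: "nat \<Rightarrow> nat"
    assume "strict_mono k'" "\<And>e. 0 < e \<Longrightarrow> \<exists>N. \<forall>n x. n \<ge> N \<and> x \<in> cball 0 R \<longrightarrow> norm (F (k (k' n)) i x - h x) < e"
    then show ?thesis by blast
  qed auto
  then obtain h k' where k': "strict_mono (k' :: nat \<Rightarrow> nat)"
    and h: "\<And>e. 0 < e \<Longrightarrow> \<exists>N. \<forall>n x. n \<ge> N \<and> x \<in> cball 0 R \<longrightarrow> norm (F (k (k' n)) i x - h x) < e" by blast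
  \<comment> \<open>Arzela-Ascoli controls its limit on the ball only, so the limit is set to 0
    outside.\<close>
  let ?g = "g(i := (\<lambda>x. if norm x \<le> R then h x else 0))"
  have "\<exists>N. \<forall>n\<ge>N. \<forall>x. \<bar>F ((k \<circ> k') n) j x - ?g j x\<bar> < e" if j: "j \<in> insert i J" and e: "0 < e" for j e
  proof (cases "j = i")
    case True
    obtain N where N: "\<And>n x. n \<ge> N \<Longrightarrow> x \<in> cball 0 R \<Longrightarrow> norm (F (k (k' n)) i x - h x) < e" using h[OF e] by blast
    have "\<bar>F ((k \<circ> k') n) i x - ?g i x\<bar> < e" if "n \<ge> N" for n x
      using N[OF that, of x] cont_suppD(4)[OF Fi, of x] e by (auto simp: not_le)
    then show ?thesis using True by blast
  next
    case False
    then obtain N where N: "\<And>n x. n \<ge> N \<Longrightarrow> \<bar>F (k n) j x - g j x\<bar> < e" using g[of j e] j e by blast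
    have "\<bar>F ((k \<circ> k') n) j x - ?g j x\<bar> < e" if "n \<ge> N" for n x
      using N[of "k' n" x] that seq_suble[OF k', of n] False by (simp add: fun_upd_def)
    then show ?thesis by blast
  qed
  moreover have "strict_mono (k \<circ> k')" using k k' by (rule strict_mono_o)
  ultimately show ?case by blast
qed

text \<open>All members of the family undergo the same reflection or symmetrization simultaneously,
  because \<open>func\<close> couples them through u.\<close>

inductive orbit :: "'a::euclidean_space \<Rightarrow> ('i \<Rightarrow> 'a \<Rightarrow> real) \<Rightarrow> ('i \<Rightarrow> 'a \<Rightarrow> real) \<Rightarrow> bool" for b f0 where
  orbit_base: "orbit b f0 f0"
| orbit_reflect: "orbit b f0 f \<Longrightarrow> orbit b f0 (\<lambda>j. f j \<circ> reflect a)"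
| orbit_steiner: "orbit b f0 f \<Longrightarrow> orbit b f0 (\<lambda>j. steiner b (f j))"

context region
begin

text \<open>The third invariant passes every modulus of continuity of \<open>f0\<close> to the whole
  orbit: this is the equicontinuity for Arzela-Ascoli. The others keep the common support and
  bounds, the masses, and the direction of the final inequality.\<close>

lemma orbit_invariant:
  fixes f f0 :: "'i \<Rightarrow> 'a::euclidean_space \<Rightarrow> real"
  assumes "orbit b f0 f" and b: "b \<in> Basis" and f0: "\<And>j. j \<in> I \<Longrightarrow> cont_supp R (A j) (f0 j)"
  shows "(\<forall>j\<in>I. cont_supp R (A j) (f j)) \<and> (\<forall>j\<in>I. (lint x. ennreal (f j x)) = (lint x. ennreal (f0 j x))) \<and>
    (\<forall>j\<in>I. \<forall>d e. 0 \<le> e \<longrightarrow> (\<forall>x y. norm (x - y) \<le> d \<longrightarrow> \<bar>f0 j x - f0 j y\<bar> \<le> e) \<longrightarrow> (\<forall>x y. norm (x - y) \<le> d \<longrightarrow> \<bar>f j x - f j y\<bar> \<le> e)) \<and>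
    func f0 \<le> func f"
  using assms(1)
proof induction
  case orbit_base
  then show ?case using f0 by blast
next
  case (orbit_reflect f a)
  have c: "cont_supp R (A j) (f j)" if "j \<in> I" for j using orbit_reflect.IH that by blast
  have m: "f j \<in> borel_measurable borel" if "j \<in> I" for j using cont_suppD(5)[OF c[OF that]] .
  show ?case
  proof (intro conjI ballI allI impI)
    fix j assume j: "j \<in> I"
    show "cont_supp R (A j) (f j \<circ> reflect a)" by (rule cont_supp_reflect[OF c[OF j]])
    show "(lint x. ennreal ((f j \<circ> reflect a) x)) = (lint x. ennreal (f0 j x))"
      using nn_integral_reflect[of "\<lambda>x. ennreal (f j x)" a] m[OF j] orbit_reflect.IH j by simp
    fix d e :: real and x y :: 'a
    assume "0 \<le> e" "\<forall>x y. norm (x - y) \<le> d \<longrightarrow> \<bar>f0 j x - f0 j y\<bar> \<le> e" "norm (x - y) \<le> d"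
    moreover have "norm (reflect a x - reflect a y) = norm (x - y)" by (simp add: norm_reflect flip: reflect_diff)
    ultimately show "\<bar>(f j \<circ> reflect a) x - (f j \<circ> reflect a) y\<bar> \<le> e"
      using orbit_reflect.IH j by simp
  next
    show "func f0 \<le> func (\<lambda>j. f j \<circ> reflect a)" using orbit_reflect.IH func_reflect[OF m] by simp
  qed
next
  case (orbit_steiner f)
  have b1: "norm b = 1" using b by simp
  have c: "cont_supp R (A j) (f j)" if "j \<in> I" for j using orbit_steiner.IH that by blast
  show ?case
  proof (intro conjI ballI allI impI)
    fix j assume j: "j \<in> I"
    show "cont_supp R (A j) (steiner b (f j))" by (rule steiner_cont_supp[OF b1 c[OF j]])
    show "(lint x. ennreal (steiner b (f j) x)) = (lint x. ennreal (f0 j x))"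
      using nn_integral_steiner[OF b1 c[OF j]] orbit_steiner.IH j by simp
    fix d e :: real and x y :: 'a
    assume "0 \<le> e" "\<forall>x y. norm (x - y) \<le> d \<longrightarrow> \<bar>f0 j x - f0 j y\<bar> \<le> e" "norm (x - y) \<le> d"
    then show "\<bar>steiner b (f j) x - steiner b (f j) y\<bar> \<le> e"
      using orbit_steiner.IH j by (intro steiner_modulus[OF b1 c[OF j], of e d]) blast+
  next
    show "func f0 \<le> func (\<lambda>j. steiner b (f j))" using orbit_steiner.IH func_steiner_le[OF b c] by (auto intro: order_trans)
  qed
qed

lemma func_tendsto:
  fixes F :: "nat \<Rightarrow> 'i \<Rightarrow> 'a::euclidean_space \<Rightarrow> real"
  assumes F: "\<And>n j. j \<in> I \<Longrightarrow> cont_supp R (A j) (F n j)" and g: "\<And>j. j \<in> I \<Longrightarrow> cont_supp R (A j) (g j)"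
    and lim: "\<And>j x. j \<in> I \<Longrightarrow> (\<lambda>n. F n j x) \<longlonglongrightarrow> g j x"
  shows "(\<lambda>n. func (F n)) \<longlonglongrightarrow> func g"
proof -
  have [measurable]: "F n j \<in> borel_measurable borel" "g j \<in> borel_measurable borel" if "j \<in> I" for n j
    using cont_suppD(5)[OF F[OF that]] cont_suppD(5)[OF g[OF that]] by auto
  let ?c = "emeasure lborel (cball (0::'a) \<rho>)"
  have c: "?c < \<infinity>" using emeasure_bounded_finite[of "cball (0::'a) \<rho>"] by simp
  show ?thesis unfolding func_def
  proof (rule nn_integral_dominated_convergence[where w="\<lambda>x. (\<Prod>j\<in>I. ennreal (A j) * indicator (cball 0 R) (x j)) * ?c"])
    show "AE x in PiM I (\<lambda>_. lborel). (\<Prod>j\<in>I. ennreal (F n j (x j))) * vol x \<le> (\<Prod>j\<in>I. ennreal (A j) * indicator (cball 0 R) (x j)) * ?c" for n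
    proof (intro always_eventually allI mult_mono prod_mono_ennreal vol_le)
      fix x :: "'i \<Rightarrow> 'a" and j assume j: "j \<in> I"
      show "ennreal (F n j (x j)) \<le> ennreal (A j) * indicator (cball 0 R) (x j)"
        using cont_suppD(3)[OF F[OF j, of n], of "x j"] cont_suppD(4)[OF F[OF j, of n], of "x j"] by (cases "norm (x j) \<le> R") (auto simp: ennreal_leI)
    qed auto
    show "AE x in PiM I (\<lambda>_. lborel). (\<lambda>n. (\<Prod>j\<in>I. ennreal (F n j (x j))) * vol x) \<longlonglongrightarrow> (\<Prod>j\<in>I. ennreal (g j (x j))) * vol x"
    proof (intro always_eventually allI)
      fix x :: "'i \<Rightarrow> 'a"
      have "(\<lambda>n. \<Prod>j\<in>I. F n j (x j)) \<longlonglongrightarrow> (\<Prod>j\<in>I. g j (x j))" by (intro tendsto_prod lim)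
      then have "(\<lambda>n. vol x * ennreal (\<Prod>j\<in>I. F n j (x j))) \<longlonglongrightarrow> vol x * ennreal (\<Prod>j\<in>I. g j (x j))"
        using vol_finite[of x] by (intro ennreal_tendsto_cmult tendsto_ennrealI) auto
      moreover have "ennreal (\<Prod>j\<in>I. F n j (x j)) = (\<Prod>j\<in>I. ennreal (F n j (x j)))" for n
        using cont_suppD(2)[OF F] by (intro prod_ennreal[symmetric]) auto
      moreover have "ennreal (\<Prod>j\<in>I. g j (x j)) = (\<Prod>j\<in>I. ennreal (g j (x j)))"
        using cont_suppD(2)[OF g] by (intro prod_ennreal[symmetric]) auto
      ultimately show "(\<lambda>n. (\<Prod>j\<in>I. ennreal (F n j (x j))) * vol x) \<longlonglongrightarrow> (\<Prod>j\<in>I. ennreal (g j (x j))) * vol x"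
        by (simp add: mult.commute)
    qed
    have "(\<integral>\<^sup>+x. (\<Prod>j\<in>I. ennreal (A j) * indicator (cball (0::'a) R) (x j)) * ?c \<partial>PiM I (\<lambda>_. lborel))
       = (\<Prod>j\<in>I. \<integral>\<^sup>+x. ennreal (A j) * indicator (cball (0::'a) R) x \<partial>lborel) * ?c"
      using fin by (subst nn_integral_multc) (auto intro!: lborel_PiM.product_nn_integral_prod arg_cong2[where f="(*)"])
    also have "\<dots> < \<infinity>"
    proof -
      have "(lint x. ennreal (A j) * indicator (cball (0::'a) R) x) < \<infinity>" for j
        using emeasure_bounded_finite[of "cball (0::'a) R"] by (simp add: nn_integral_cmult_indicator ennreal_mult_less_top)
      then have "(\<Prod>j\<in>I. \<integral>\<^sup>+x. ennreal (A j) * indicator (cball (0::'a) R) x \<partial>lborel) < top" using fin by (intro prod_less_top) auto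
      then show ?thesis using c by (simp add: ennreal_mult_less_top)
    qed
    finally show "(\<integral>\<^sup>+x. (\<Prod>j\<in>I. ennreal (A j) * indicator (cball (0::'a) R) (x j)) * ?c \<partial>PiM I (\<lambda>_. lborel)) < \<infinity>" .
  qed auto
qed

text \<open>Along a subsequence, a sequence minimising the total second moment converges uniformly
  to some g. Symmetrizing any reflected copy of g gives a limit of orbit members, so its moment is
  not smaller, and the equality case shows that nothing has changed. So g is symmetric in every
  hyperplane through 0, which makes it radial.\<close>

theorem radial_improvement:
  fixes f0 :: "'i \<Rightarrow> 'a::euclidean_space \<Rightarrow> real"
  assumes f0: "\<And>j. j \<in> I \<Longrightarrow> cont_supp R (A j) (f0 j)"
  obtains g :: "'i \<Rightarrow> 'a \<Rightarrow> real" where "\<And>j. j \<in> I \<Longrightarrow> cont_supp R (A j) (g j)" "\<And>j x y. j \<in> I \<Longrightarrow> norm x = norm y \<Longrightarrow> g j x = g j y"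
    "\<And>j. j \<in> I \<Longrightarrow> (lint x. ennreal (g j x)) \<le> (lint x. ennreal (f0 j x))" "func f0 \<le> func g"
proof -
  obtain b :: 'a where b: "b \<in> Basis" using SOME_Basis by blast
  have b1: "norm b = 1" using b by simp
  define mom where "mom f = (\<Sum>j\<in>I. enn2real (moment2 (f j)))" for f :: "'i \<Rightarrow> 'a \<Rightarrow> real"
  have inv_cont: "cont_supp R (A j) (f j)" if "orbit b f0 f" "j \<in> I" for f j
    using orbit_invariant[OF that(1) b f0] that(2) by blast
  have inv_int: "(lint x. ennreal (f j x)) = (lint x. ennreal (f0 j x))" if "orbit b f0 f" "j \<in> I" for f j
    using orbit_invariant[OF that(1) b f0] that(2) by blast
  have inv_mod: "\<bar>f j x - f j y\<bar> \<le> e" if "orbit b f0 f" "j \<in> I" "0 \<le> e" "\<forall>x y. norm (x - y) \<le> d \<longrightarrow> \<bar>f0 j x - f0 j y\<bar> \<le> e" "norm (x - y) \<le> d" for f j e d x y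
    using orbit_invariant[OF that(1) b f0] that(2-) by blast
  have inv_func: "func f0 \<le> func f" if "orbit b f0 f" for f
    using orbit_invariant[OF that(1) b f0] by blast
  define m where "m = Inf (mom ` {f. orbit b f0 f})"
  have bdd: "bdd_below (mom ` {f. orbit b f0 f})" by (intro bdd_belowI[of _ 0]) (auto simp: mom_def intro!: sum_nonneg)
  have m_le: "m \<le> mom f" if "orbit b f0 f" for f
    unfolding m_def using that bdd by (intro cInf_lower) auto
  have "\<exists>f. orbit b f0 f \<and> mom f < m + 1 / Suc n" for n
  proof -
    have "Inf (mom ` {f. orbit b f0 f}) < m + 1 / Suc n" by (simp add: m_def)
    then show ?thesis using cInf_less_iff[OF _ bdd] orbit_base by fastforce
  qed
  then obtain F where F: "\<And>n. orbit b f0 (F n)" "\<And>n. mom (F n) < m + 1 / Suc n" by metis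
  have Fmod: "\<exists>d>0. \<forall>n x y. norm (x - y) \<le> d \<longrightarrow> \<bar>F n j x - F n j y\<bar> \<le> e" if j: "j \<in> I" and e: "0 < e" for j e
  proof -
    obtain d where d: "0 < d" "\<And>x y. norm (x - y) \<le> d \<Longrightarrow> \<bar>f0 j x - f0 j y\<bar> \<le> e"
      using cont_supp_modulus[OF f0[OF j] e] by blast
    have "\<bar>F n j x - F n j y\<bar> \<le> e" if "norm (x - y) \<le> d" for n x y
      using d that \<open>0 < e\<close> by (intro inv_mod[OF F(1) \<open>j \<in> I\<close>, of e d]) auto
    then show ?thesis using d(1) by blast
  qed
  obtain k g where k: "strict_mono (k :: nat \<Rightarrow> nat)" and unif: "\<And>j e. j \<in> I \<Longrightarrow> 0 < e \<Longrightarrow> \<exists>N. \<forall>n\<ge>N. \<forall>x. \<bar>F (k n) j x - g j x\<bar> < e"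
    using finite_family_convergent_subsequence[of I R A F, OF fin inv_cont[OF F(1)] Fmod] by blast
  let ?G = "\<lambda>n. F (k n)"
  have lim: "(\<lambda>n. ?G n j x) \<longlonglongrightarrow> g j x" if "j \<in> I" for j x
  proof (rule LIMSEQ_I)
    fix e :: real assume "0 < e"
    from unif[OF that this] show "\<exists>N. \<forall>n\<ge>N. norm (?G n j x - g j x) < e" unfolding real_norm_def by blast
  qed
  have G: "cont_supp R (A j) (?G n j)" if "j \<in> I" for n j using inv_cont[OF F(1) that] by blast
  have g: "cont_supp R (A j) (g j)" if j: "j \<in> I" for j
  proof (rule cont_supp_limit[OF G[OF j] lim[OF j]])
    fix e :: real assume "0 < e"
    from Fmod[OF j this] show "\<exists>d>0. \<forall>n x y. norm (x - y) \<le> d \<longrightarrow> \<bar>?G n j x - ?G n j y\<bar> \<le> e" by blast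
  qed
  have "func f0 \<le> func g"
  proof (rule LIMSEQ_le_const)
    show "(\<lambda>n. func (?G n)) \<longlonglongrightarrow> func g" by (rule func_tendsto[of R A]) (use G g lim in auto)
  qed (use inv_func[OF F(1)] in auto)
  \<comment> \<open>Fatou gives an inequality of masses, which suits the bathtub argument: it asks
    for mass at most 1.\<close>
  have int: "(lint x. ennreal (g j x)) \<le> (lint x. ennreal (f0 j x))" if j: "j \<in> I" for j
  proof -
    have [measurable]: "?G n j \<in> borel_measurable borel" for n using cont_suppD(5)[OF G[OF j]] .
    have "(lint x. ennreal (g j x)) = (lint x. liminf (\<lambda>n. ennreal (?G n j x)))"
      using lim[OF j] by (intro nn_integral_cong lim_imp_Liminf[symmetric] tendsto_ennrealI) auto
    also have "\<dots> \<le> liminf (\<lambda>n. \<integral>\<^sup>+x. ennreal (?G n j x) \<partial>lborel)" by (rule nn_integral_liminf) measurable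
    also have "\<dots> \<le> (lint x. ennreal (f0 j x))" using inv_int[OF F(1) j] by (intro Liminf_le) auto
    finally show ?thesis .
  qed
  have momg: "mom g = m"
  proof (rule LIMSEQ_unique)
    show "(\<lambda>n. mom (?G n)) \<longlonglongrightarrow> mom g" unfolding mom_def
      by (intro tendsto_sum moment2_tendsto[OF G g lim])
    show "(\<lambda>n. mom (?G n)) \<longlonglongrightarrow> m"
    proof (rule real_tendsto_sandwich)
      show "\<forall>\<^sub>F n in sequentially. m \<le> mom (?G n)" using m_le[OF F(1)] by simp
      show "\<forall>\<^sub>F n in sequentially. mom (?G n) \<le> m + 1 / Suc (k n)" using F(2) by (simp add: less_imp_le)
      have "(\<lambda>n. 1 / real (Suc n)) \<longlonglongrightarrow> 0" using LIMSEQ_inverse_real_of_nat by (simp add: inverse_eq_divide)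
      from LIMSEQ_subseq_LIMSEQ[OF this k] have "(\<lambda>n. 1 / real (Suc (k n))) \<longlonglongrightarrow> 0" by (simp add: o_def)
      then show "(\<lambda>n. m + 1 / real (Suc (k n))) \<longlonglongrightarrow> m" using tendsto_add[OF tendsto_const[of m]] by fastforce
    qed simp
  qed
  have sym: "steiner b (g j \<circ> reflect a) = g j \<circ> reflect a" if j: "j \<in> I" for j a
  proof (rule steiner_eq_if_moment2[OF b1 cont_supp_reflect[OF g[OF j]]])
    let ?H = "\<lambda>n j. steiner b (?G n j \<circ> reflect a)" and ?h = "\<lambda>j. steiner b (g j \<circ> reflect a)"
    have H: "cont_supp R (A j) (?H n j)" "cont_supp R (A j) (?h j)" if "j \<in> I" for n j
      using G g that by (auto intro!: steiner_cont_supp[OF b1] cont_supp_reflect)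
    have Hlim: "(\<lambda>n. ?H n j x) \<longlonglongrightarrow> ?h j x" if j: "j \<in> I" for j x
    proof (rule LIMSEQ_I)
      fix e :: real assume "0 < e"
      then have "0 < e / 2" by simp
      from unif[OF j this] obtain N where N: "\<And>n x. n \<ge> N \<Longrightarrow> \<bar>?G n j x - g j x\<bar> < e / 2" by blast
      have "norm (?H n j x - ?h j x) < e" if "n \<ge> N" for n
      proof -
        have "\<bar>?H n j x - ?h j x\<bar> \<le> e / 2"
          using N[OF that] by (intro steiner_contraction[OF b1 cont_supp_reflect[OF G[OF j]] cont_supp_reflect[OF g[OF j]]]) (auto intro: less_imp_le)
        then show ?thesis using \<open>0 < e\<close> by simp
      qed
      then show "\<exists>N. \<forall>n\<ge>N. norm (?H n j x - ?h j x) < e" by blast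
    qed
    have "(\<lambda>n. mom (?H n)) \<longlonglongrightarrow> mom ?h" unfolding mom_def
      by (intro tendsto_sum moment2_tendsto[OF H Hlim])
    \<comment> \<open>Reflecting and symmetrizing a member of the orbit stays in the orbit, so the
      infimum bounds these moments too.\<close>
    moreover have "m \<le> mom (?H n)" for n
      using orbit_steiner[OF orbit_reflect[OF F(1)]] by (intro m_le)
    ultimately have "m \<le> mom ?h" by (intro LIMSEQ_le_const) auto
    also have "m = (\<Sum>j\<in>I. enn2real (moment2 (g j \<circ> reflect a)))"
      unfolding momg[symmetric] mom_def using cont_suppD(5)[OF g] by (intro sum.cong) (auto simp: moment2_reflect)
    finally have le: "(\<Sum>j\<in>I. enn2real (moment2 (g j \<circ> reflect a))) \<le> (\<Sum>j\<in>I. enn2real (moment2 (?h j)))" by (simp only: mom_def)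
    have fins: "moment2 (g j \<circ> reflect a) < \<infinity>" "moment2 (?h j) < \<infinity>" if "j \<in> I" for j
      using moment2_finite[OF b1] H(2)[OF that] cont_supp_reflect[OF g[OF that]] by blast+
    have ge: "enn2real (moment2 (?h j)) \<le> enn2real (moment2 (g j \<circ> reflect a))" if "j \<in> I" for j
      using moment2_steiner_le[OF b1 cont_supp_reflect[OF g[OF that]]] fins[OF that] by (intro enn2real_mono) auto
    \<comment> \<open>The sums compare one way and the single terms the other way, so equality holds
      term by term.\<close>
    have "enn2real (moment2 (g j \<circ> reflect a)) \<le> enn2real (moment2 (?h j))"
    proof (rule ccontr)
      assume "\<not> ?thesis"
      then have "(\<Sum>j\<in>I. enn2real (moment2 (?h j))) < (\<Sum>j\<in>I. enn2real (moment2 (g j \<circ> reflect a)))"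
        using ge j fin by (intro sum_strict_mono_ex1 ballI bexI[of _ j]) (auto simp: not_le)
      then show False using le by simp
    qed
    then show "moment2 (g j \<circ> reflect a) \<le> moment2 (?h j)"
      using fins[OF j] by (metis ennreal_enn2real ennreal_leI infinity_ennreal_def)
  qed
  have radial: "g j v = g j v'" if j: "j \<in> I" and vv: "norm v = norm v'" for j v v'
  proof (cases "v = v'")
    case False
    define e where "e = (1 / norm (v - v')) *\<^sub>R (v - v')"
    have e1: "norm e = 1" using False by (simp add: e_def)
    \<comment> \<open>Reflection in a swaps b and the direction e of v - v'. Symmetry of the
      reflected function along b is therefore symmetry of g in the hyperplane that exchanges v and
      v'.\<close>
    define a where "a = b - e"
    have ab: "reflect a b = e" unfolding a_def using b1 e1 by (intro reflect_swap) simp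
    define x where "x = reflect a v"
    have xb: "x \<bullet> b = v \<bullet> e"
      unfolding x_def using reflect_inner[of a v "reflect a b"] by (simp add: ab reflect_reflect flip: reflect_inner[of a v e])
        (metis ab reflect_inner reflect_reflect)
    have "(g j \<circ> reflect a) (x - (2 * (x \<bullet> b)) *\<^sub>R b) = (g j \<circ> reflect a) x"
      using steiner_reflect[OF b1, of "g j \<circ> reflect a" x] sym[OF j, of a] by simp
    moreover have "reflect a (x - (2 * (x \<bullet> b)) *\<^sub>R b) = v'"
    proof -
      have "reflect a (x - (2 * (x \<bullet> b)) *\<^sub>R b) = v - (2 * (v \<bullet> e)) *\<^sub>R e"
        unfolding reflect_diff reflect_scaleR ab xb by (simp add: x_def reflect_reflect)
      also have "\<dots> = reflect (v - v') v"
        by (simp add: reflect_def e_def power2_norm_eq_inner[symmetric] power2_eq_square)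
      also have "\<dots> = v'" by (rule reflect_swap[OF vv])
      finally show ?thesis .
    qed
    ultimately show ?thesis by (simp add: x_def reflect_reflect)
  qed simp
  show ?thesis using that[of g] g radial int \<open>func f0 \<le> func g\<close> by blast
qed

section \<open>The bathtub principle and the passage from radial densities to balls\<close>

lemma vol_shrink:
  assumes "0 \<le> s" "s \<le> 1"
  shows "vol (x(i := v)) \<le> vol (x(i := s *\<^sub>R (v::'a::euclidean_space)))"
  unfolding vol_def
proof (rule nn_integral_mono)
  fix u :: 'a
  have "D (norm u) (\<lambda>j. (x(i := s *\<^sub>R v)) j \<bullet> u)" if "D (norm u) (\<lambda>j. (x(i := v)) j \<bullet> u)"
    using assms by (intro anti[OF that]) (auto simp: abs_mult mult_left_le_one_le)
  then show "ker (x(i := v)) u \<le> ker (x(i := s *\<^sub>R v)) u" by (auto simp: ker_def)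
qed

end

text \<open>With c the value of G on the sphere of radius r, G is at least c in the ball and at most
  c outside. The mass of f outside the ball is at most the deficit A - f inside, so moving it inward
  cannot lose.\<close>

lemma bathtub:
  fixes G :: "'a::euclidean_space \<Rightarrow> ennreal"
  assumes [measurable]: "f \<in> borel_measurable borel" "G \<in> borel_measurable borel"
    and f: "\<And>x. 0 \<le> f x" "\<And>x. f x \<le> A" "(lint x. ennreal (f x)) \<le> 1"
    and G: "\<And>x y. norm x \<le> norm y \<Longrightarrow> G y \<le> G x"
    and A: "ennreal A * emeasure lborel (cball (0::'a) r) = 1" and r: "0 \<le> r"
  shows "(lint x. ennreal (f x) * G x) \<le> (lint x. ennreal (A * indicator (cball 0 r) x) * G x)"
proof -
  let ?B = "cball (0::'a) r"
  have [measurable]: "?B \<in> sets borel" by (rule borel_closed) simp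
  obtain b :: 'a where "b \<in> Basis" using SOME_Basis by blast
  then have nb: "norm (r *\<^sub>R b) = r" using r by simp
  define c where "c = G (r *\<^sub>R b)"
  have c_le: "c \<le> G x" if "x \<in> ?B" for x unfolding c_def using G[of x "r *\<^sub>R b"] that nb by simp
  have c_ge: "G x \<le> c" if "x \<notin> ?B" for x unfolding c_def using G[of "r *\<^sub>R b" x] that nb by simp
  have split: "(lint x. h x) = (lint x. h x * indicator ?B x) + (lint x. h x * indicator (- ?B) x)"
    if [measurable]: "h \<in> borel_measurable borel" for h :: "'a \<Rightarrow> ennreal"
    by (subst nn_integral_add[symmetric]) (auto intro!: nn_integral_cong simp: indicator_def)
  let ?I = "\<integral>\<^sup>+x. ennreal (f x) * indicator ?B x \<partial>lborel" and ?J = "\<integral>\<^sup>+x. ennreal (f x) * indicator (- ?B) x \<partial>lborel"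
    and ?K = "\<integral>\<^sup>+x. ennreal (A - f x) * indicator ?B x \<partial>lborel"
  have sumA: "ennreal (f x) + ennreal (A - f x) = ennreal A" for x
    using f(1,2)[of x] by (simp flip: ennreal_plus)
  have "?I + ?J \<le> 1" using f(3) split[of "\<lambda>x. ennreal (f x)"] by simp
  also have "1 = (lint x. ennreal A * indicator ?B x)" using A by (simp add: nn_integral_cmult_indicator)
  also have "\<dots> = (lint x. ennreal (f x) * indicator ?B x + ennreal (A - f x) * indicator ?B x)"
    by (simp only: sumA flip: distrib_right)
  also have "\<dots> = ?I + ?K" by (rule nn_integral_add) measurable
  finally have "?I + ?J \<le> ?I + ?K" .
  moreover have "?I \<noteq> top"
  proof (rule neq_top_trans[OF ennreal_one_neq_top])
    show "?I \<le> 1" using \<open>?I + ?J \<le> 1\<close> by (rule order_trans[rotated]) simp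
  qed
  ultimately have JK: "?J \<le> ?K" by (auto simp: ennreal_add_left_cancel_le)
  have "(lint x. ennreal (f x) * G x)
     = (lint x. ennreal (f x) * G x * indicator ?B x) + (lint x. ennreal (f x) * G x * indicator (- ?B) x)"
    by (rule split) measurable
  also have "(lint x. ennreal (f x) * G x * indicator (- ?B) x) \<le> (lint x. c * (ennreal (f x) * indicator (- ?B) x))"
    using c_ge by (intro nn_integral_mono) (auto simp: indicator_def mult.commute intro!: mult_mono)
  also have "\<dots> = c * ?J" by (rule nn_integral_cmult) measurable
  also have "\<dots> \<le> c * ?K" using JK by (rule mult_left_mono) simp
  also have "\<dots> = (lint x. c * (ennreal (A - f x) * indicator ?B x))" by (rule nn_integral_cmult[symmetric]) measurable
  also have "\<dots> \<le> (lint x. ennreal (A - f x) * G x * indicator ?B x)"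
    using c_le by (intro nn_integral_mono) (auto simp: indicator_def mult.commute intro!: mult_mono)
  also have "(lint x. ennreal (f x) * G x * indicator ?B x) + (lint x. ennreal (A - f x) * G x * indicator ?B x)
     = (lint x. ennreal (f x) * G x * indicator ?B x + ennreal (A - f x) * G x * indicator ?B x)"
    by (rule nn_integral_add[symmetric]) measurable
  also have "\<dots> = (lint x. ennreal A * G x * indicator ?B x)"
    by (simp only: sumA flip: distrib_right)
  also have "\<dots> = (lint x. ennreal (A * indicator ?B x) * G x)"
    by (intro nn_integral_cong) (auto simp: indicator_def)
  finally show ?thesis by (simp add: add_left_mono)
qed

context region
begin

lemma func_coordinate:
  fixes h :: "'i \<Rightarrow> 'a::euclidean_space \<Rightarrow> real"
  assumes i: "i \<in> I" and h[measurable]: "\<And>j. j \<in> I \<Longrightarrow> h j \<in> borel_measurable borel"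
  shows "func h = (lint v. ennreal (h i v) * (\<integral>\<^sup>+x. (\<Prod>j\<in>I - {i}. ennreal (h j (x j))) * vol (x(i := v)) \<partial>PiM (I - {i}) (\<lambda>_. lborel)))"
    and "(\<lambda>v. \<integral>\<^sup>+x. (\<Prod>j\<in>I - {i}. ennreal (h j (x j))) * vol (x(i := v)) \<partial>PiM (I - {i}) (\<lambda>_. lborel)) \<in> borel_measurable borel"
proof -
  let ?J = "I - {i}" and ?M = "PiM (I - {i}) (\<lambda>_. lborel :: 'a measure)"
  have J: "insert i ?J = I" "finite ?J" "i \<notin> ?J" using i fin by auto
  interpret M: sigma_finite_measure ?M by (rule sigma_finite_PiM_lborel[OF J(2)])
  have volm: "(\<lambda>p. vol ((snd p)(i := fst p))) \<in> borel_measurable (lborel \<Otimes>\<^sub>M ?M)"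
  proof -
    have "(\<lambda>p. (snd p)(i := fst p)) \<in> (lborel \<Otimes>\<^sub>M ?M) \<rightarrow>\<^sub>M PiM I (\<lambda>_. lborel)"
      by (rule measurable_fun_upd[where J="?J"]) (use i in auto)
    from measurable_compose[OF this vol_measurable] show ?thesis .
  qed
  have pm: "(\<lambda>x. \<Prod>j\<in>?J. ennreal (h j (x j))) \<in> borel_measurable ?M" by measurable
  have vm: "(\<lambda>p. (\<Prod>j\<in>?J. ennreal (h j (snd p j))) * vol ((snd p)(i := fst p))) \<in> borel_measurable (lborel \<Otimes>\<^sub>M ?M)"
    using volm measurable_compose[OF measurable_snd pm] by (intro borel_measurable_times_ennreal) auto
  show "(\<lambda>v. \<integral>\<^sup>+x. (\<Prod>j\<in>?J. ennreal (h j (x j))) * vol (x(i := v)) \<partial>?M) \<in> borel_measurable borel"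
    using M.borel_measurable_nn_integral[of "\<lambda>v x. (\<Prod>j\<in>?J. ennreal (h j (x j))) * vol (x(i := v))" lborel] vm by (simp add: case_prod_beta')
  have "func h = (\<integral>\<^sup>+x. (\<Prod>j\<in>I. ennreal (h j (x j))) * vol x \<partial>PiM (insert i ?J) (\<lambda>_. lborel))"
    unfolding func_def J(1) ..
  also have "\<dots> = (lint v. \<integral>\<^sup>+x. (\<Prod>j\<in>I. ennreal (h j ((x(i := v)) j))) * vol (x(i := v)) \<partial>?M)"
  proof (rule lborel_PiM.product_nn_integral_insert_rev[OF J(2,3)])
    have "(\<lambda>x. (\<Prod>j\<in>I. ennreal (h j (x j))) * vol x) \<in> borel_measurable (PiM I (\<lambda>_. lborel))" by measurable
    then show "(\<lambda>x. (\<Prod>j\<in>I. ennreal (h j (x j))) * vol x) \<in> borel_measurable (PiM (insert i ?J) (\<lambda>_. lborel))" unfolding J(1) .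
  qed
  also have "\<dots> = (lint v. \<integral>\<^sup>+x. ennreal (h i v) * ((\<Prod>j\<in>?J. ennreal (h j (x j))) * vol (x(i := v))) \<partial>?M)"
  proof (intro nn_integral_cong)
    fix v x
    have "(\<Prod>j\<in>I. ennreal (h j ((x(i := v)) j))) = ennreal (h i v) * (\<Prod>j\<in>?J. ennreal (h j (x j)))"
      using i fin by (subst prod.remove[of _ i]) (auto intro!: prod.cong arg_cong2[where f="(*)"])
    then show "(\<Prod>j\<in>I. ennreal (h j ((x(i := v)) j))) * vol (x(i := v)) = ennreal (h i v) * ((\<Prod>j\<in>?J. ennreal (h j (x j))) * vol (x(i := v)))"
      by (simp add: mult.assoc)
  qed
  also have "\<dots> = (lint v. ennreal (h i v) * (\<integral>\<^sup>+x. (\<Prod>j\<in>?J. ennreal (h j (x j))) * vol (x(i := v)) \<partial>?M))"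
  proof (intro nn_integral_cong nn_integral_cmult)
    fix v :: 'a
    show "(\<lambda>x. (\<Prod>j\<in>?J. ennreal (h j (x j))) * vol (x(i := v))) \<in> borel_measurable ?M"
      using measurable_compose[OF _ vm, of "\<lambda>x. (v, x)" ?M] by simp
  qed
  finally show "func h = (lint v. ennreal (h i v) * (\<integral>\<^sup>+x. (\<Prod>j\<in>?J. ennreal (h j (x j))) * vol (x(i := v)) \<partial>?M))" .
qed

text \<open>With the other densities radial, the integral over the remaining points is a radial
  function G of v, by reflecting all points at once, and it decreases with norm v because shrinking
  v enlarges the region. The bathtub lemma applies to G.\<close>

lemma func_replace_ball:
  fixes h :: "'i \<Rightarrow> 'a::euclidean_space \<Rightarrow> real"
  assumes i: "i \<in> I" and hm: "\<And>j. j \<in> I \<Longrightarrow> h j \<in> borel_measurable borel"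
    and radial: "\<And>j x y. j \<in> I \<Longrightarrow> norm x = norm y \<Longrightarrow> h j x = h j y"
    and f: "\<And>x. 0 \<le> h i x" "\<And>x. h i x \<le> A" "(lint x. ennreal (h i x)) \<le> 1"
    and A: "ennreal A * emeasure lborel (cball (0::'a) r) = 1" and r: "0 \<le> r"
  shows "func h \<le> func (h(i := (\<lambda>x. A * indicator (cball 0 r) x)))"
proof -
  let ?J = "I - {i}" and ?M = "PiM (I - {i}) (\<lambda>_. lborel :: 'a measure)"
  let ?h = "h(i := (\<lambda>x. A * indicator (cball 0 r) x))"
  define G where "G v = (\<integral>\<^sup>+x. (\<Prod>j\<in>?J. ennreal (h j (x j))) * vol (x(i := v)) \<partial>?M)" for v
  have J: "insert i ?J = I" "finite ?J" "i \<notin> ?J" using i fin by auto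
  have hm': "?h j \<in> borel_measurable borel" if "j \<in> I" for j
    using hm[OF that] by (cases "j = i") simp_all
  have "func ?h = (lint v. ennreal (?h i v) * (\<integral>\<^sup>+x. (\<Prod>j\<in>?J. ennreal (?h j (x j))) * vol (x(i := v)) \<partial>?M))"
    by (rule func_coordinate(1)[OF i hm'])
  also have "\<dots> = (lint v. ennreal (A * indicator (cball 0 r) v) * G v)"
    unfolding G_def by (simp cong: prod.cong_simp)
  finally have 2: "func ?h = (lint v. ennreal (A * indicator (cball 0 r) v) * G v)" .
  have 1: "func h = (lint v. ennreal (h i v) * G v)" unfolding G_def by (rule func_coordinate(1)[OF i hm])
  have Gm: "G \<in> borel_measurable borel" unfolding G_def by (rule func_coordinate(2)[OF i hm])
  have rad: "G v = G v'" if "norm v = norm v'" for v v'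
  proof -
    let ?a = "v - v'"
    have av: "reflect ?a v' = v" using reflect_swap[OF that] reflect_reflect[of ?a v] by simp
    have "G v = (\<Prod>j\<in>?J. 1) * (\<integral>\<^sup>+x. (\<Prod>j\<in>?J. ennreal (h j ((\<lambda>j\<in>?J. reflect ?a (x j)) j))) * vol ((\<lambda>j\<in>?J. reflect ?a (x j))(i := v)) \<partial>?M)"
      unfolding G_def
    proof (rule nn_integral_PiM_transform[OF lborel_PiM.product_sigma_finite_axioms J(2)])
      show "(lint x. g x) = 1 * (lint x. g (reflect ?a x))" if "g \<in> borel_measurable lborel" for g
        using nn_integral_reflect[of g ?a] that by simp
      have [measurable]: "(\<lambda>x. x(i := v)) \<in> ?M \<rightarrow>\<^sub>M PiM I (\<lambda>_. lborel)"
        by (rule measurable_fun_upd[where J="?J"]) (use i in auto)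
      have [measurable]: "h j \<in> borel_measurable borel" if "j \<in> ?J" for j using hm that by auto
      show "(\<lambda>x. (\<Prod>j\<in>?J. ennreal (h j (x j))) * vol (x(i := v))) \<in> borel_measurable ?M" by measurable
    qed auto
    also have "\<dots> = G v'"
    proof -
      have "vol ((\<lambda>j\<in>?J. reflect ?a (x j))(i := v)) = vol (x(i := v'))" for x
      proof -
        have "vol ((\<lambda>j\<in>?J. reflect ?a (x j))(i := v)) = vol (\<lambda>j. reflect ?a ((x(i := v')) j))"
          by (rule vol_cong) (use av in auto)
        then show ?thesis by (simp only: vol_reflect)
      qed
      moreover have "(\<Prod>j\<in>?J. ennreal (h j ((\<lambda>j\<in>?J. reflect ?a (x j)) j))) = (\<Prod>j\<in>?J. ennreal (h j (x j)))" for x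
        by (intro prod.cong refl arg_cong[of _ _ ennreal]) (auto intro!: radial simp: norm_reflect)
      ultimately show ?thesis unfolding G_def by (simp only: prod.neutral_const mult_1)
    qed
    finally show ?thesis .
  qed
  have anti: "G v' \<le> G v" if "norm v \<le> norm v'" for v v'
  proof (cases "v' = 0")
    case True then show ?thesis using that by simp
  next
    case False
    define s where "s = norm v / norm v'"
    have s: "0 \<le> s" "s \<le> 1" using that False by (auto simp: s_def divide_le_eq_1)
    have "G v' \<le> G (s *\<^sub>R v')"
      unfolding G_def by (intro nn_integral_mono mult_left_mono vol_shrink s) auto
    also have "\<dots> = G v" by (rule rad) (use False in \<open>simp add: s_def\<close>)
    finally show ?thesis .
  qed
  show ?thesis unfolding 1 2
    by (rule bathtub) (use hm[OF i] Gm f anti A r in auto)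
qed

text \<open>After \<open>radial_improvement\<close> the densities are replaced one after another.
  Ball densities are radial themselves, so the hypothesis of \<open>func_replace_ball\<close>
  persists.\<close>

lemma func_cont_supp_le_ball:
  fixes f :: "'i \<Rightarrow> 'a::euclidean_space \<Rightarrow> real"
  assumes f: "\<And>j. j \<in> I \<Longrightarrow> cont_supp R (A j) (f j)" and int: "\<And>j. j \<in> I \<Longrightarrow> (lint x. ennreal (f j x)) \<le> 1"
    and A: "\<And>j. j \<in> I \<Longrightarrow> ennreal (A j) * emeasure lborel (cball (0::'a) (r j)) = 1" and r: "\<And>j. j \<in> I \<Longrightarrow> 0 \<le> r j"
  shows "func f \<le> func (\<lambda>j x. A j * indicator (cball (0::'a) (r j)) x)"
proof -
  obtain g :: "'i \<Rightarrow> 'a \<Rightarrow> real" where g: "\<And>j. j \<in> I \<Longrightarrow> cont_supp R (A j) (g j)" "\<And>j x y. j \<in> I \<Longrightarrow> norm x = norm y \<Longrightarrow> g j x = g j y"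
    "\<And>j. j \<in> I \<Longrightarrow> (lint x. ennreal (g j x)) \<le> (lint x. ennreal (f j x))" "func f \<le> func g"
    by (rule radial_improvement[of R A f]) (use f in blast)+
  define b where "b j x = A j * indicator (cball (0::'a) (r j)) x" for j x
  have bm: "b j \<in> borel_measurable borel" for j
  proof -
    show ?thesis unfolding b_def by measurable
  qed
  have "func g \<le> func (\<lambda>j. if j \<in> J then b j else g j)" if "J \<subseteq> I" for J
    using finite_subset[OF that fin] that
  proof (induction J rule: finite_induct)
    case empty then show ?case by simp
  next
    case (insert i J)
    let ?h = "\<lambda>j. if j \<in> J then b j else g j"
    have i: "i \<in> I" using insert.prems by auto
    have "func g \<le> func ?h" using insert by auto
    also have "\<dots> \<le> func (?h(i := (\<lambda>x. A i * indicator (cball 0 (r i)) x)))"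
    proof (rule func_replace_ball[OF i])
      show "?h j \<in> borel_measurable borel" if "j \<in> I" for j using bm cont_suppD(5)[OF g(1)[OF that]] by auto
      show "?h j x = ?h j y" if "j \<in> I" "norm x = norm y" for j x y
        using g(2)[OF that] that by (auto simp: b_def indicator_def)
      show "0 \<le> ?h i x" "?h i x \<le> A i" for x using insert.hyps cont_suppD(2,3)[OF g(1)[OF i]] by auto
      show "(lint x. ennreal (?h i x)) \<le> 1" using insert.hyps g(3)[OF i] int[OF i] by (auto intro: order_trans)
    qed (use A r i in auto)
    also have "?h(i := (\<lambda>x. A i * indicator (cball 0 (r i)) x)) = (\<lambda>j. if j \<in> insert i J then b j else g j)"
      by (auto simp: fun_eq_iff b_def)
    finally show ?case .
  qed
  from this[of I] have "func g \<le> func (\<lambda>j. if j \<in> I then b j else g j)" by simp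
  also have "\<dots> = func b" unfolding func_def by (intro nn_integral_cong arg_cong2[where f="(*)"] prod.cong) auto
  finally have "func f \<le> func b" using g(4) by (rule order_trans[rotated])
  then show ?thesis by (simp add: b_def[abs_def])
qed

section \<open>Approximation of bounded densities by continuous ones\<close>

lemma func_le_liminf:
  fixes F :: "nat \<Rightarrow> 'i \<Rightarrow> 'a::euclidean_space \<Rightarrow> real"
  assumes [measurable]: "\<And>n j. j \<in> I \<Longrightarrow> F n j \<in> borel_measurable borel"
    and pos: "\<And>n j x. j \<in> I \<Longrightarrow> 0 \<le> F n j x" "\<And>j x. j \<in> I \<Longrightarrow> 0 \<le> g j x"
    and lim: "\<And>j. j \<in> I \<Longrightarrow> AE x in lborel. (\<lambda>n. F n j x) \<longlonglongrightarrow> g j x"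
  shows "func g \<le> liminf (\<lambda>n. func (F n))"
proof -
  have "AE x in PiM I (\<lambda>_. lborel). (\<lambda>n. F n j (x j)) \<longlonglongrightarrow> g j (x j)" if "j \<in> I" for j
    by (rule AE_PiM_component_sigma_finite[OF lborel_PiM.product_sigma_finite_axioms fin that, where P="\<lambda>x. (\<lambda>n. F n j x) \<longlonglongrightarrow> g j x"])
      (rule lim[OF that])
  then have "AE x in PiM I (\<lambda>_. lborel). \<forall>j\<in>I. (\<lambda>n. F n j (x j)) \<longlonglongrightarrow> g j (x j)"
    using fin by (intro AE_finite_allI) auto
  then have "AE x in PiM I (\<lambda>_. lborel). (\<Prod>j\<in>I. ennreal (g j (x j))) * vol x = liminf (\<lambda>n. (\<Prod>j\<in>I. ennreal (F n j (x j))) * vol x)"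
  proof eventually_elim
    case (elim x)
    have "(\<lambda>n. \<Prod>j\<in>I. F n j (x j)) \<longlonglongrightarrow> (\<Prod>j\<in>I. g j (x j))" using elim by (intro tendsto_prod) auto
    then have "(\<lambda>n. vol x * ennreal (\<Prod>j\<in>I. F n j (x j))) \<longlonglongrightarrow> vol x * ennreal (\<Prod>j\<in>I. g j (x j))"
      using vol_finite[of x] by (intro ennreal_tendsto_cmult tendsto_ennrealI) auto
    moreover have "ennreal (\<Prod>j\<in>I. F n j (x j)) = (\<Prod>j\<in>I. ennreal (F n j (x j)))" for n
      using pos by (intro prod_ennreal[symmetric]) auto
    moreover have "ennreal (\<Prod>j\<in>I. g j (x j)) = (\<Prod>j\<in>I. ennreal (g j (x j)))"
      using pos by (intro prod_ennreal[symmetric]) auto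
    ultimately have "(\<lambda>n. (\<Prod>j\<in>I. ennreal (F n j (x j))) * vol x) \<longlonglongrightarrow> (\<Prod>j\<in>I. ennreal (g j (x j))) * vol x"
      by (simp add: mult.commute)
    then show ?case by (intro lim_imp_Liminf[symmetric]) auto
  qed
  then have "func g = (\<integral>\<^sup>+x. liminf (\<lambda>n. (\<Prod>j\<in>I. ennreal (F n j (x j))) * vol x) \<partial>PiM I (\<lambda>_. lborel))"
    unfolding func_def by (rule nn_integral_cong_AE)
  also have "\<dots> \<le> liminf (\<lambda>n. func (F n))" unfolding func_def by (rule nn_integral_liminf) measurable
  finally show ?thesis .
qed

end

text \<open>A measurable function is an almost everywhere limit of continuous ones. Clipping to
  [0, A], a cutoff beyond radius R and division by the mass, where it exceeds 1, preserve the limit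
  and enforce the constraints of \<open>func_cont_supp_le_ball\<close>.\<close>

lemma cont_supp_approximation:
  fixes f :: "'a::euclidean_space \<Rightarrow> real"
  assumes f[measurable]: "f \<in> borel_measurable borel" and f0: "\<And>x. 0 \<le> f x" "\<And>x. f x \<le> A"
    and supp: "\<And>x. R < norm x \<Longrightarrow> f x = 0" and int: "(lint x. ennreal (f x)) \<le> 1"
  shows "\<exists>F. (\<forall>n. cont_supp (R + 1) A (F n) \<and> (lint x. ennreal (F n x)) \<le> 1) \<and> (AE x in lborel. (\<lambda>n. F n x) \<longlonglongrightarrow> f x)"
proof -
  have A0: "0 \<le> A" using f0(1)[of 0] f0(2)[of 0] by linarith
  have "f \<in> borel_measurable lebesgue" using f by (simp add: measurable_completion)
  then have "f measurable_on UNIV" by (rule lebesgue_measurable_imp_measurable_on) simp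
  then obtain N g where N: "negligible N" and gc: "\<And>n. continuous_on UNIV (g n)" and gl: "\<And>x. x \<notin> N \<Longrightarrow> (\<lambda>n. g n x) \<longlonglongrightarrow> f x"
    unfolding measurable_on_def by auto
  define H where "H n x = max 0 (min 1 (R + 1 - norm x)) * max 0 (min A (g n x))" for n x
  have Hc: "cont_supp (R + 1) A (H n)" for n
    unfolding cont_supp_def
  proof (intro conjI allI impI)
    show "continuous_on UNIV (H n)" unfolding H_def by (intro continuous_intros gc)
    fix x
    show "0 \<le> H n x" unfolding H_def by auto
    have "H n x \<le> 1 * A" unfolding H_def using A0 by (intro mult_mono) auto
    then show "H n x \<le> A" by simp
    show "H n x = 0" if "R + 1 < norm x" using that by (simp add: H_def)
  qed
  have Hm[measurable]: "H n \<in> borel_measurable borel" for n by (rule cont_suppD(5)[OF Hc])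
  have Hl: "(\<lambda>n. H n x) \<longlonglongrightarrow> f x" if "x \<notin> N" for x
  proof -
    have "(\<lambda>n. H n x) \<longlonglongrightarrow> max 0 (min 1 (R + 1 - norm x)) * max 0 (min A (f x))"
      unfolding H_def by (intro tendsto_intros gl that)
    also have "max 0 (min 1 (R + 1 - norm x)) * max 0 (min A (f x)) = f x"
      using f0[of x] supp[of x] by (cases "norm x \<le> R") auto
    finally show ?thesis .
  qed
  obtain N' where N': "N \<subseteq> N'" "N' \<in> null_sets lborel"
    using N by (auto simp: negligible_iff_null_sets null_sets_completion_iff2)
  then have ae: "AE x in lborel. x \<notin> N" by (auto intro!: AE_I'[of N'])
  have [measurable]: "cball (0::'a) (R + 1) \<in> sets borel" by (rule borel_closed) simp
  have "(\<lambda>n. \<integral>\<^sup>+x. ennreal (H n x) \<partial>lborel) \<longlonglongrightarrow> (lint x. ennreal (f x))"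
  proof (rule nn_integral_dominated_convergence[where w="\<lambda>x. ennreal A * indicator (cball 0 (R + 1)) x"])
    show "AE x in lborel. ennreal (H n x) \<le> ennreal A * indicator (cball 0 (R + 1)) x" for n
      using cont_suppD(3,4)[OF Hc] by (intro always_eventually allI) (auto simp: indicator_def ennreal_leI not_le)
    show "(lint x. ennreal A * indicator (cball (0::'a) (R + 1)) x) < \<infinity>"
      using emeasure_bounded_finite[of "cball (0::'a) (R + 1)"] by (simp add: nn_integral_cmult_indicator ennreal_mult_less_top)
    show "AE x in lborel. (\<lambda>n. ennreal (H n x)) \<longlonglongrightarrow> ennreal (f x)"
      using ae by eventually_elim (intro tendsto_ennrealI Hl)
  qed measurable
  then have lim: "(\<lambda>n. enn2real (lint x. ennreal (H n x))) \<longlonglongrightarrow> enn2real (lint x. ennreal (f x))"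
    using le_less_trans[OF int, of top] by (intro tendsto_enn2real) auto
  \<comment> \<open>Since c n is at least 1, the division keeps the bound A. By dominated
    convergence the masses tend to a number at most 1, hence c n tends to 1.\<close>
  define c where "c n = max 1 (enn2real (lint x. ennreal (H n x)))" for n
  have c1: "1 \<le> c n" for n by (simp add: c_def)
  have "c \<longlonglongrightarrow> max 1 (enn2real (lint x. ennreal (f x)))" unfolding c_def by (intro tendsto_max tendsto_const lim)
  moreover have "enn2real (lint x. ennreal (f x)) \<le> 1"
    using int enn2real_mono[OF int] by simp
  ultimately have cl: "c \<longlonglongrightarrow> 1" by (simp add: max_def split: if_splits)
  define F where "F n x = H n x / c n" for n x
  have "cont_supp (R + 1) A (F n)" for n
    unfolding cont_supp_def
  proof (intro conjI allI impI)
    show "continuous_on UNIV (F n)" unfolding F_def using cont_suppD(1)[OF Hc] c1[of n] by (intro continuous_intros) auto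
    fix x
    show "0 \<le> F n x" unfolding F_def using cont_suppD(2)[OF Hc] c1[of n] by simp
    have "H n x / c n \<le> H n x / 1" using cont_suppD(2)[OF Hc] c1[of n] by (intro divide_left_mono) auto
    then show "F n x \<le> A" unfolding F_def using cont_suppD(3)[OF Hc, of n x] by simp
    show "F n x = 0" if "R + 1 < norm x" using that cont_suppD(4)[OF Hc] by (simp add: F_def)
  qed
  moreover have "(lint x. ennreal (F n x)) \<le> 1" for n
  proof -
    have finH: "(lint x. ennreal (H n x)) < \<infinity>"
    proof -
      have "(lint x. ennreal (H n x)) \<le> (lint x. ennreal A * indicator (cball (0::'a) (R + 1)) x)"
        using cont_suppD(3,4)[OF Hc] by (intro nn_integral_mono) (auto simp: indicator_def ennreal_leI not_le)
      also have "\<dots> < \<infinity>"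
        using emeasure_bounded_finite[of "cball (0::'a) (R + 1)"] by (simp add: nn_integral_cmult_indicator ennreal_mult_less_top)
      finally show ?thesis .
    qed
    have "(lint x. ennreal (F n x)) = (lint x. ennreal (1 / c n) * ennreal (H n x))"
      unfolding F_def using c1[of n] cont_suppD(2)[OF Hc] by (intro nn_integral_cong) (simp flip: ennreal_mult)
    also have "\<dots> = ennreal (1 / c n) * (lint x. ennreal (H n x))" by (rule nn_integral_cmult) measurable
    also have "\<dots> = ennreal (1 / c n * enn2real (lint x. ennreal (H n x)))"
      using finH c1[of n] by (subst ennreal_mult) auto
    also have "\<dots> \<le> ennreal 1" using c1[of n] by (intro ennreal_leI) (simp add: divide_le_eq, simp add: c_def)
    finally show ?thesis by simp
  qed
  moreover have "AE x in lborel. (\<lambda>n. F n x) \<longlonglongrightarrow> f x"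
    using ae
  proof eventually_elim
    case (elim x)
    have "(\<lambda>n. H n x / c n) \<longlonglongrightarrow> f x / 1" by (intro tendsto_divide Hl elim cl) simp
    then show ?case by (simp add: F_def)
  qed
  ultimately show ?thesis by (intro exI[of _ F]) blast
qed

context region
begin

text \<open>Restriction to balls of radius k gives bounded support, and each restriction is
  approximated by continuous functions. Lower semicontinuity of \<open>func\<close> suffices for
  both limits, as the right-hand side stays fixed.\<close>

theorem func_le_ball:
  fixes f :: "'i \<Rightarrow> 'a::euclidean_space \<Rightarrow> real"
  assumes f[measurable]: "\<And>j. j \<in> I \<Longrightarrow> f j \<in> borel_measurable borel"
    and f0: "\<And>j x. j \<in> I \<Longrightarrow> 0 \<le> f j x" "\<And>j x. j \<in> I \<Longrightarrow> f j x \<le> A j"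
    and int: "\<And>j. j \<in> I \<Longrightarrow> (lint x. ennreal (f j x)) \<le> 1"
    and A: "\<And>j. j \<in> I \<Longrightarrow> ennreal (A j) * emeasure lborel (cball (0::'a) (r j)) = 1" and r: "\<And>j. j \<in> I \<Longrightarrow> 0 \<le> r j"
  shows "func f \<le> func (\<lambda>j x. A j * indicator (cball (0::'a) (r j)) x)" (is "_ \<le> ?R")
proof -
  define fk where "fk k j x = f j x * indicator (cball 0 (real k)) x" for k j x
  have fkm[measurable]: "fk k j \<in> borel_measurable borel" if "j \<in> I" for k j
  proof -
    have [measurable]: "cball (0::'a) (real k) \<in> sets borel" by (rule borel_closed) simp
    show ?thesis unfolding fk_def using f[OF that] by measurable
  qed
  have le: "func (fk k) \<le> ?R" for k
  proof -
    have "\<exists>F. (\<forall>n. cont_supp (real k + 1) (A j) (F n) \<and> (lint x. ennreal (F n x)) \<le> 1) \<and> (AE x in lborel. (\<lambda>n. F n x) \<longlonglongrightarrow> fk k j x)"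
      if j: "j \<in> I" for j
    proof (rule cont_supp_approximation[OF fkm[OF j]])
      show "0 \<le> fk k j x" "fk k j x \<le> A j" for x
        using f0[OF j, of x] by (auto simp: fk_def indicator_def)
      show "fk k j x = 0" if "real k < norm x" for x using that by (auto simp: fk_def)
      have "(lint x. ennreal (fk k j x)) \<le> (lint x. ennreal (f j x))"
        using f0[OF j] by (intro nn_integral_mono ennreal_leI) (auto simp: fk_def indicator_def)
      then show "(lint x. ennreal (fk k j x)) \<le> 1" using int[OF j] by (rule order_trans)
    qed
    then have "\<forall>j\<in>I. \<exists>F. (\<forall>n. cont_supp (real k + 1) (A j) (F n) \<and> (lint x. ennreal (F n x)) \<le> 1) \<and> (AE x in lborel. (\<lambda>n. F n x) \<longlonglongrightarrow> fk k j x)"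
      by blast
    from bchoice[OF this] obtain F where F: "\<And>j n. j \<in> I \<Longrightarrow> cont_supp (real k + 1) (A j) (F j n)" "\<And>j n. j \<in> I \<Longrightarrow> (lint x. ennreal (F j n x)) \<le> 1"
      "\<And>j. j \<in> I \<Longrightarrow> AE x in lborel. (\<lambda>n. F j n x) \<longlonglongrightarrow> fk k j x"
      by blast
    have "func (fk k) \<le> liminf (\<lambda>n. func (\<lambda>j. F j n))"
    proof (rule func_le_liminf)
      show "0 \<le> fk k j x" if "j \<in> I" for j x using f0[OF that] by (auto simp: fk_def indicator_def)
    qed (use F(3) cont_suppD(2,5)[OF F(1)] in auto)
    also have "\<dots> \<le> ?R"
      by (intro Liminf_le always_eventually allI func_cont_supp_le_ball[where R="real k + 1"]) (use F A r in auto)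
    finally show ?thesis .
  qed
  have "func f \<le> liminf (\<lambda>k. func (fk k))"
  proof (rule func_le_liminf)
    fix j assume j: "j \<in> I"
    show "AE x in lborel. (\<lambda>k. fk k j x) \<longlonglongrightarrow> f j x"
    proof (intro always_eventually allI)
      fix x :: 'a
      obtain N :: nat where N: "norm x \<le> real N" using real_arch_simple by blast
      have "\<forall>\<^sub>F k in sequentially. fk k j x = f j x"
        unfolding eventually_sequentially using N by (intro exI[of _ N]) (auto simp: fk_def indicator_def intro: order_trans)
      then show "(\<lambda>k. fk k j x) \<longlonglongrightarrow> f j x" by (rule tendsto_eventually)
    qed
  qed (use f0 in \<open>auto simp: fk_def indicator_def\<close>)
  also have "\<dots> \<le> ?R" by (intro Liminf_le always_eventually allI le) simp
  finally show ?thesis .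
qed

end

subsection \<open>Products of decreasing functions of gauges\<close>

text \<open>Besides y a gauge may depend on \<open>\<beta>\<close>, the norm of u. This covers the
  norm itself, used for radial cutoffs, and the functions sqrt(y i^2 + \<alpha>^2 \<beta>^2) behind
  \<open>I_rad\<close>.\<close>

definition gauge_fun :: "'i set \<Rightarrow> (real \<Rightarrow> ('i \<Rightarrow> real) \<Rightarrow> real) \<Rightarrow> bool" where
  "gauge_fun I g \<longleftrightarrow>
     (\<forall>\<beta>\<ge>0. \<forall>y. 0 \<le> g \<beta> y) \<and>
     (\<forall>\<beta>\<ge>0. \<forall>\<beta>'\<ge>0. \<forall>y y' l. 0 \<le> l \<and> l \<le> 1 \<longrightarrow>
        g ((1 - l) * \<beta> + l * \<beta>') (\<lambda>j. (1 - l) * y j + l * y' j) \<le> (1 - l) * g \<beta> y + l * g \<beta>' y') \<and>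
     (\<forall>\<beta>\<ge>0. \<forall>\<beta>'\<ge>\<beta>. \<forall>y y'. (\<forall>j\<in>I. \<bar>y j\<bar> \<le> \<bar>y' j\<bar>) \<longrightarrow> g \<beta> y \<le> g \<beta>' y') \<and>
     (\<forall>\<beta>\<ge>0. \<forall>y. \<forall>s\<ge>0. g (s * \<beta>) (\<lambda>j. s * y j) = s * g \<beta> y) \<and>
     (\<lambda>p. g (fst p) (snd p)) \<in> borel_measurable (borel \<Otimes>\<^sub>M PiM I (\<lambda>_. borel))"

lemma gauge_funD:
  assumes "gauge_fun I g"
  shows "0 \<le> \<beta> \<Longrightarrow> 0 \<le> g \<beta> y"
    and "0 \<le> \<beta> \<Longrightarrow> 0 \<le> \<beta>' \<Longrightarrow> 0 \<le> l \<Longrightarrow> l \<le> 1 \<Longrightarrow>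
      g ((1 - l) * \<beta> + l * \<beta>') (\<lambda>j. (1 - l) * y j + l * y' j) \<le> (1 - l) * g \<beta> y + l * g \<beta>' y'"
    and "0 \<le> \<beta> \<Longrightarrow> \<beta> \<le> \<beta>' \<Longrightarrow> (\<And>j. j \<in> I \<Longrightarrow> \<bar>y j\<bar> \<le> \<bar>y' j\<bar>) \<Longrightarrow> g \<beta> y \<le> g \<beta>' y'"
    and "0 \<le> \<beta> \<Longrightarrow> 0 \<le> s \<Longrightarrow> g (s * \<beta>) (\<lambda>j. s * y j) = s * g \<beta> y"
    and "(\<lambda>p. g (fst p) (snd p)) \<in> borel_measurable (borel \<Otimes>\<^sub>M PiM I (\<lambda>_. borel))"
proof -
  note a = assms[unfolded gauge_fun_def]
  show "0 \<le> \<beta> \<Longrightarrow> 0 \<le> g \<beta> y" by (rule a[THEN conjunct1, rule_format])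
  show "0 \<le> \<beta> \<Longrightarrow> 0 \<le> \<beta>' \<Longrightarrow> 0 \<le> l \<Longrightarrow> l \<le> 1 \<Longrightarrow>
      g ((1 - l) * \<beta> + l * \<beta>') (\<lambda>j. (1 - l) * y j + l * y' j) \<le> (1 - l) * g \<beta> y + l * g \<beta>' y'"
    by (rule a[THEN conjunct2, THEN conjunct1, rule_format]) auto
  show "0 \<le> \<beta> \<Longrightarrow> \<beta> \<le> \<beta>' \<Longrightarrow> (\<And>j. j \<in> I \<Longrightarrow> \<bar>y j\<bar> \<le> \<bar>y' j\<bar>) \<Longrightarrow> g \<beta> y \<le> g \<beta>' y'"
    by (rule a[THEN conjunct2, THEN conjunct2, THEN conjunct1, rule_format])
  show "0 \<le> \<beta> \<Longrightarrow> 0 \<le> s \<Longrightarrow> g (s * \<beta>) (\<lambda>j. s * y j) = s * g \<beta> y"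
    by (rule a[THEN conjunct2, THEN conjunct2, THEN conjunct2, THEN conjunct1, rule_format])
  show "(\<lambda>p. g (fst p) (snd p)) \<in> borel_measurable (borel \<Otimes>\<^sub>M PiM I (\<lambda>_. borel))"
    by (rule a[THEN conjunct2, THEN conjunct2, THEN conjunct2, THEN conjunct2])
qed

lemma gauge_fun_measurable:
  assumes g: "gauge_fun I g" and [measurable]: "\<beta> \<in> borel_measurable M" "\<And>j. j \<in> I \<Longrightarrow> (\<lambda>p. h p j) \<in> borel_measurable M"
    and b: "\<And>p. 0 \<le> \<beta> p"
  shows "(\<lambda>p. g (\<beta> p) (h p)) \<in> borel_measurable M"
proof -
  have "(\<lambda>p. (\<beta> p, \<lambda>j\<in>I. h p j)) \<in> M \<rightarrow>\<^sub>M (borel \<Otimes>\<^sub>M PiM I (\<lambda>_. borel))"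
    by (intro measurable_Pair measurable_restrict) auto
  from measurable_compose[OF this gauge_funD(5)[OF g]] have "(\<lambda>p. g (\<beta> p) (\<lambda>j\<in>I. h p j)) \<in> borel_measurable M" by simp
  moreover have "g (\<beta> p) (\<lambda>j\<in>I. h p j) = g (\<beta> p) (h p)" for p
    using b by (intro order_antisym gauge_funD(3)[OF g]) auto
  ultimately show ?thesis by simp
qed

abbreviation gauge_at :: "(real \<Rightarrow> ('i \<Rightarrow> real) \<Rightarrow> real) \<Rightarrow> ('i \<Rightarrow> 'a::euclidean_space) \<Rightarrow> 'a \<Rightarrow> real" where
  "gauge_at g x u \<equiv> g (norm u) (\<lambda>j. x j \<bullet> u)"

lemma gauge_at_measurable:
  assumes "gauge_fun I g"
  shows "(\<lambda>p. gauge_at g (fst p) (snd p :: 'a::euclidean_space)) \<in> borel_measurable (PiM I (\<lambda>_. lborel) \<Otimes>\<^sub>M lborel)"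
    and "x \<in> space (PiM I (\<lambda>_. lborel)) \<Longrightarrow> (\<lambda>u::'a. gauge_at g x u) \<in> borel_measurable borel"
  by (rule gauge_fun_measurable[OF assms]; simp)+

lemma gauge_at_nonneg: "gauge_fun I g \<Longrightarrow> 0 \<le> gauge_at g x u"
  by (simp add: gauge_funD(1))

lemma gauge_at_scale:
  assumes "gauge_fun I g" "0 \<le> s" shows "gauge_at g x (s *\<^sub>R u) = s * gauge_at g x u"
  using gauge_funD(4)[OF assms(1), of "norm u" s "\<lambda>j. x j \<bullet> u"] assms(2) by simp

text \<open>A superlevel set of a decreasing function of a gauge is a sublevel set of the gauge:
  convex and stable under shrinking the arguments. Layer cake over all l reduces the product to
  intersections of such sets, which form a \<open>region\<close>.\<close>

lemma integral_gauges_le_ball: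
  fixes f :: "'i \<Rightarrow> 'a::euclidean_space \<Rightarrow> real" and \<phi> :: "'l \<Rightarrow> real \<Rightarrow> ennreal"
  assumes I: "finite I" and L: "finite L" and g: "\<And>l. l \<in> L \<Longrightarrow> gauge_fun I (g l)"
    and \<phi>: "\<And>l a b. l \<in> L \<Longrightarrow> 0 \<le> a \<Longrightarrow> a \<le> b \<Longrightarrow> \<phi> l b \<le> \<phi> l a" and \<phi>m: "\<And>l. l \<in> L \<Longrightarrow> \<phi> l \<in> borel_measurable borel"
    and f: "\<And>j. j \<in> I \<Longrightarrow> f j \<in> borel_measurable borel"
    and f0: "\<And>j x. j \<in> I \<Longrightarrow> 0 \<le> f j x" "\<And>j x. j \<in> I \<Longrightarrow> f j x \<le> A j"
    and int: "\<And>j. j \<in> I \<Longrightarrow> (lint x. ennreal (f j x)) \<le> 1"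
    and A: "\<And>j. j \<in> I \<Longrightarrow> ennreal (A j) * emeasure lborel (cball (0::'a) (r j)) = 1" and r: "\<And>j. j \<in> I \<Longrightarrow> 0 \<le> r j"
  shows "(\<integral>\<^sup>+x. (\<Prod>j\<in>I. ennreal (f j (x j))) * (lint u. (\<Prod>l\<in>L. \<phi> l (gauge_at (g l) x u))) \<partial>PiM I (\<lambda>_. lborel))
    \<le> (\<integral>\<^sup>+x. (\<Prod>j\<in>I. ennreal (A j * indicator (cball 0 (r j)) (x j))) * (\<integral>\<^sup>+u. (\<Prod>l\<in>L. \<phi> l (gauge_at (g l) x u)) \<partial>(lborel :: 'a measure)) \<partial>PiM I (\<lambda>_. lborel))"
proof -
  let ?M = "PiM I (\<lambda>_. lborel :: 'a measure)"
  let ?N = "?M \<Otimes>\<^sub>M (lborel :: 'a measure)"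
  interpret M: sigma_finite_measure ?M by (rule sigma_finite_PiM_lborel[OF I])
  interpret N: pair_sigma_finite ?M "lborel :: 'a measure" ..
  let ?b = "\<lambda>j x. A j * indicator (cball (0::'a) (r j)) x"
  have bm: "?b j \<in> borel_measurable borel" for j
  proof -
    show ?thesis by measurable
  qed
  let ?a = "\<lambda>l p. \<phi> l (gauge_at (g l) (fst p) (snd p))"
  have am[measurable]: "?a l \<in> borel_measurable ?N" if "l \<in> L" for l
    by (rule measurable_compose[OF gauge_at_measurable(1)[OF g[OF that]] \<phi>m[OF that]])
  let ?w = "\<lambda>h p. (\<Prod>j\<in>I. ennreal (h j (fst p j)))"
  have wm: "?w h \<in> borel_measurable ?N" if "\<And>j. j \<in> I \<Longrightarrow> h j \<in> borel_measurable borel" for h :: "'i \<Rightarrow> 'a \<Rightarrow> real"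
    using that by measurable
  have pam: "(\<lambda>p. \<Prod>l\<in>L. ?a l p) \<in> borel_measurable ?N" by measurable
  have prod_eq: "(\<integral>\<^sup>+x. (\<Prod>j\<in>I. ennreal (h j (x j))) * (lint u. (\<Prod>l\<in>L. \<phi> l (gauge_at (g l) x u))) \<partial>?M)
      = (\<integral>\<^sup>+p. ?w h p * (\<Prod>l\<in>L. ?a l p) \<partial>?N)" if h: "\<And>j. j \<in> I \<Longrightarrow> h j \<in> borel_measurable borel" for h :: "'i \<Rightarrow> 'a \<Rightarrow> real"
  proof -
    have "(\<integral>\<^sup>+p. ?w h p * (\<Prod>l\<in>L. ?a l p) \<partial>?N) = (\<integral>\<^sup>+x. \<integral>\<^sup>+u. ?w h (x, u) * (\<Prod>l\<in>L. ?a l (x, u)) \<partial>lborel \<partial>?M)"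
      by (rule lborel.nn_integral_fst[symmetric], rule borel_measurable_times_ennreal[OF wm pam], rule h)
    also have "\<dots> = (\<integral>\<^sup>+x. (\<Prod>j\<in>I. ennreal (h j (x j))) * (lint u. (\<Prod>l\<in>L. \<phi> l (gauge_at (g l) x u))) \<partial>?M)"
    proof (rule nn_integral_cong)
      fix x assume x: "x \<in> space ?M"
      have "(\<lambda>u. \<Prod>l\<in>L. \<phi> l (gauge_at (g l) x u)) \<in> borel_measurable lborel"
        using measurable_compose[OF gauge_at_measurable(2)[OF g x] \<phi>m] by auto
      then show "(lint u. ?w h (x, u) * (\<Prod>l\<in>L. ?a l (x, u))) = (\<Prod>j\<in>I. ennreal (h j (x j))) * (lint u. (\<Prod>l\<in>L. \<phi> l (gauge_at (g l) x u)))"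
        by (simp add: nn_integral_cmult)
    qed
    finally show ?thesis by simp
  qed
  \<comment> \<open>A region must be bounded, so u is first confined to the ball of radius k;
    monotone convergence removes k at the end.\<close>
  let ?k = "\<lambda>h (k::nat) p. ?w h p * (if norm (snd p) \<le> real k then 1 else 0)"
  have km: "?k h k \<in> borel_measurable ?N" if "\<And>j. j \<in> I \<Longrightarrow> h j \<in> borel_measurable borel" for h k
  proof (rule borel_measurable_times_ennreal)
    show "?w h \<in> borel_measurable ?N" by (rule wm) (rule that)
  qed measurable
  have kf: "?k f k \<in> borel_measurable ?N" for k by (rule km) (rule f)
  have kb: "?k ?b k \<in> borel_measurable ?N" for k by (rule km) (rule bm)
  have trunc: "(\<integral>\<^sup>+p. ?k f k p * (\<Prod>l\<in>L. ?a l p) \<partial>?N) \<le> (\<integral>\<^sup>+p. ?k ?b k p * (\<Prod>l\<in>L. ?a l p) \<partial>?N)" for k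
  proof (rule nn_integral_layer_cake_prod_mono[OF L N.sigma_finite_measure_axioms N.sigma_finite_measure_axioms kf am kb am])
    fix c :: "'l \<Rightarrow> real"
    define D where "D \<beta> y \<longleftrightarrow> 0 \<le> \<beta> \<and> \<beta> \<le> real k \<and> (\<forall>l\<in>L. ennreal (c l) < \<phi> l (g l \<beta> y))" for \<beta> and y :: "'i \<Rightarrow> real"
    interpret region I D "real k"
    proof
      fix \<beta> \<beta>' y y' and t :: real
      assume D: "0 \<le> \<beta>" "0 \<le> \<beta>'" "D \<beta> y" "D \<beta>' y'" and t: "0 \<le> t" "t \<le> 1"
      let ?\<beta> = "(1 - t) * \<beta> + t * \<beta>'" and ?y = "\<lambda>j. (1 - t) * y j + t * y' j"
      have "ennreal (c l) < \<phi> l (g l ?\<beta> ?y)" if l: "l \<in> L" for l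
      proof -
        have "g l ?\<beta> ?y \<le> (1 - t) * g l \<beta> y + t * g l \<beta>' y'" using D t by (intro gauge_funD(2)[OF g[OF l]]) auto
        also have "\<dots> \<le> (1 - t) * max (g l \<beta> y) (g l \<beta>' y') + t * max (g l \<beta> y) (g l \<beta>' y')" using t by (intro add_mono mult_left_mono) auto
        finally have "g l ?\<beta> ?y \<le> max (g l \<beta> y) (g l \<beta>' y')" by (simp add: algebra_simps)
        then have "\<phi> l (max (g l \<beta> y) (g l \<beta>' y')) \<le> \<phi> l (g l ?\<beta> ?y)"
          using D t by (intro \<phi>[OF l] gauge_funD(1)[OF g[OF l]]) auto
        moreover have "ennreal (c l) < \<phi> l (max (g l \<beta> y) (g l \<beta>' y'))" using D l by (auto simp: D_def max_def)
        ultimately show ?thesis by (rule less_le_trans[rotated])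
      qed
      moreover have "?\<beta> \<le> (1 - t) * real k + t * real k" using D t by (intro add_mono mult_left_mono) (auto simp: D_def)
      moreover have "0 \<le> ?\<beta>" using D t by (intro add_nonneg_nonneg mult_nonneg_nonneg) auto
      moreover have "(1 - t) * real k + t * real k = real k" by (simp add: algebra_simps)
      ultimately show "D ?\<beta> ?y" unfolding D_def by simp
    next
      fix \<beta> \<beta>' y y' assume D: "D \<beta> y" "0 \<le> \<beta>'" "\<beta>' \<le> \<beta>" "\<And>j. j \<in> I \<Longrightarrow> \<bar>y' j\<bar> \<le> \<bar>y j\<bar>"
      have "\<phi> l (g l \<beta> y) \<le> \<phi> l (g l \<beta>' y')" if "l \<in> L" for l
        using D that by (intro \<phi> gauge_funD(1)[OF g] gauge_funD(3)[OF g]) auto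
      then show "D \<beta>' y'" using D by (auto simp: D_def intro: less_le_trans)
    next
      have m: "(\<lambda>p. \<phi> l (g l (fst p) (snd p))) \<in> borel_measurable (borel \<Otimes>\<^sub>M PiM I (\<lambda>_. borel))" if "l \<in> L" for l
        by (rule measurable_compose[OF gauge_funD(5)[OF g[OF that]] \<phi>m[OF that]])
      show "Measurable.pred (borel \<Otimes>\<^sub>M PiM I (\<lambda>_. borel)) (\<lambda>p. D (fst p) (snd p))"
        unfolding D_def using L m by measurable
    qed (auto simp: D_def I)
    have eq: "(\<integral>\<^sup>+p. ?k h k p * (\<Prod>l\<in>L. if ennreal (c l) < ?a l p then 1 else 0) \<partial>?N) = func h"
      if h: "\<And>j. j \<in> I \<Longrightarrow> h j \<in> borel_measurable borel" for h :: "'i \<Rightarrow> 'a \<Rightarrow> real"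
    proof -
      have "?k h k p * (\<Prod>l\<in>L. if ennreal (c l) < ?a l p then 1 else 0) = ?w h p * ker (fst p) (snd p)" for p
        using L by (simp add: prod_of_bool ker_def D_def)
      then have "(\<integral>\<^sup>+p. ?k h k p * (\<Prod>l\<in>L. if ennreal (c l) < ?a l p then 1 else 0) \<partial>?N) = (\<integral>\<^sup>+p. ?w h p * ker (fst p) (snd p) \<partial>?N)" by simp
      also have "\<dots> = (\<integral>\<^sup>+x. \<integral>\<^sup>+u. ?w h (x, u) * ker x u \<partial>lborel \<partial>?M)"
      proof (subst lborel.nn_integral_fst[symmetric])
        have "?w h \<in> borel_measurable ?N" by (rule wm) (rule h)
        then show "(\<lambda>p. ?w h p * ker (fst p) (snd p)) \<in> borel_measurable ?N"
          using ker_measurable' by (intro borel_measurable_times_ennreal) (auto simp: case_prod_beta')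
      qed simp
      also have "\<dots> = func h"
        unfolding func_def vol_def
      proof (rule nn_integral_cong)
        fix x assume x: "x \<in> space ?M"
        have "(\<lambda>u. ker x u) \<in> borel_measurable lborel" by (rule ker_measurable) auto
        then show "(lint u. ?w h (x, u) * ker x u) = (\<Prod>j\<in>I. ennreal (h j (x j))) * (lint u. ker x u)"
          by (simp add: nn_integral_cmult)
      qed
      finally show ?thesis .
    qed
    show "(\<integral>\<^sup>+p. ?k f k p * (\<Prod>l\<in>L. if ennreal (c l) < ?a l p then 1 else 0) \<partial>?N)
      \<le> (\<integral>\<^sup>+p. ?k ?b k p * (\<Prod>l\<in>L. if ennreal (c l) < ?a l p then 1 else 0) \<partial>?N)"
      unfolding eq[OF bm] by (subst eq[OF f], assumption, rule func_le_ball[OF f f0 int A r])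
  qed
  have "(\<integral>\<^sup>+p. ?w f p * (\<Prod>l\<in>L. ?a l p) \<partial>?N) = (\<integral>\<^sup>+p. (SUP k. ?k f k p * (\<Prod>l\<in>L. ?a l p)) \<partial>?N)"
  proof (rule nn_integral_cong)
    fix p :: "('i \<Rightarrow> 'a) \<times> 'a"
    obtain k :: nat where "norm (snd p) \<le> real k" using real_arch_simple by blast
    then have "?w f p * (\<Prod>l\<in>L. ?a l p) \<le> (SUP k. ?k f k p * (\<Prod>l\<in>L. ?a l p))"
      by (intro SUP_upper2[of k]) auto
    moreover have "(SUP k. ?k f k p * (\<Prod>l\<in>L. ?a l p)) \<le> ?w f p * (\<Prod>l\<in>L. ?a l p)"
      by (intro SUP_least) auto
    ultimately show "?w f p * (\<Prod>l\<in>L. ?a l p) = (SUP k. ?k f k p * (\<Prod>l\<in>L. ?a l p))" by (rule order_antisym)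
  qed
  also have "\<dots> = (SUP k. \<integral>\<^sup>+p. ?k f k p * (\<Prod>l\<in>L. ?a l p) \<partial>?N)"
  proof (rule nn_integral_monotone_convergence_SUP)
    show "incseq (\<lambda>k p. ?k f k p * (\<Prod>l\<in>L. ?a l p))"
      by (intro incseq_SucI le_funI mult_right_mono mult_left_mono) auto
    show "(\<lambda>p. ?k f k p * (\<Prod>l\<in>L. ?a l p)) \<in> borel_measurable ?N" for k
      by (rule borel_measurable_times_ennreal[OF kf pam])
  qed
  also have "\<dots> \<le> (\<integral>\<^sup>+p. ?w ?b p * (\<Prod>l\<in>L. ?a l p) \<partial>?N)"
  proof (rule SUP_least)
    fix k
    have "(\<integral>\<^sup>+p. ?k ?b k p * (\<Prod>l\<in>L. ?a l p) \<partial>?N) \<le> (\<integral>\<^sup>+p. ?w ?b p * (\<Prod>l\<in>L. ?a l p) \<partial>?N)"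
      by (intro nn_integral_mono) auto
    then show "(\<integral>\<^sup>+p. ?k f k p * (\<Prod>l\<in>L. ?a l p) \<partial>?N) \<le> (\<integral>\<^sup>+p. ?w ?b p * (\<Prod>l\<in>L. ?a l p) \<partial>?N)"
      using trunc[of k] by (rule order_trans[rotated])
  qed
  finally show ?thesis unfolding prod_eq[OF bm] by (subst prod_eq[OF f])
qed

subsection \<open>Completed measures\<close>

lemma sigma_finite_lebesgue: "sigma_finite_measure (lebesgue :: 'a::euclidean_space measure)"
proof
  have "\<exists>A::'a set set. countable A \<and> A \<subseteq> sets lborel \<and> \<Union>A = space lborel \<and> (\<forall>a\<in>A. emeasure lborel a \<noteq> \<infinity>)"
    by (rule lborel.sigma_finite_countable)
  then obtain A :: "'a set set" where A': "countable A \<and> A \<subseteq> sets lborel \<and> \<Union>A = space lborel \<and> (\<forall>a\<in>A. emeasure lborel a \<noteq> \<infinity>)" ..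
  note A = A'[THEN conjunct1] A'[THEN conjunct2, THEN conjunct1] A'[THEN conjunct2, THEN conjunct2, THEN conjunct1]
    A'[THEN conjunct2, THEN conjunct2, THEN conjunct2, THEN bspec]
  have "emeasure lebesgue a \<noteq> \<infinity>" if "a \<in> A" for a
    using A(4)[OF that] subsetD[OF A(2) that] by simp
  moreover have "A \<subseteq> sets lebesgue" using A(2) sets_completionI_sets by blast
  moreover have "\<Union>A = space lebesgue" using A(3) by simp
  ultimately show "\<exists>A::'a set set. countable A \<and> A \<subseteq> sets lebesgue \<and> \<Union>A = space lebesgue \<and> (\<forall>a\<in>A. emeasure lebesgue a \<noteq> \<infinity>)"
    using A(1) by blast
qed

interpretation lebesgue_PiM: product_sigma_finite "\<lambda>_. lebesgue"
  by (simp add: product_sigma_finite_def sigma_finite_lebesgue)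

text \<open>The volumes are defined with products of completed measures. On functions measurable for
  the product of Borel measures both products integrate alike, since they agree on boxes.\<close>

lemma measurable_PiM_lebesgue:
  assumes "finite I" "G \<in> borel_measurable (PiM I (\<lambda>_. lborel :: 'a::euclidean_space measure))"
  shows "G \<in> borel_measurable (PiM I (\<lambda>_. lebesgue))"
    and "(\<integral>\<^sup>+x. G x \<partial>PiM I (\<lambda>_. lebesgue)) = (\<integral>\<^sup>+x. G x \<partial>PiM I (\<lambda>_. lborel))"
proof -
  let ?L = "PiM I (\<lambda>_. lebesgue :: 'a measure)" and ?B = "PiM I (\<lambda>_. lborel :: 'a measure)"
  have id: "(\<lambda>x. x) \<in> ?L \<rightarrow>\<^sub>M ?B"
  proof (rule measurable_PiM_single')
    show "(\<lambda>x. x i) \<in> ?L \<rightarrow>\<^sub>M lborel" if "i \<in> I" for i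
      using measurable_component_singleton[OF that, of "\<lambda>_. lebesgue :: 'a measure"] by (rule measurable_compose) (auto simp: measurable_def sets_completionI_sets)
  qed (auto simp: space_PiM)
  then show Gm: "G \<in> borel_measurable ?L" using measurable_compose[OF id assms(2)] by simp
  have "distr ?L ?B (\<lambda>x. x) = ?B"
  proof (rule lborel_PiM.PiM_eqI[OF assms(1)])
    fix A :: "'b \<Rightarrow> 'a set" assume A: "\<And>i. i \<in> I \<Longrightarrow> A i \<in> sets lborel"
    have P: "PiE I A \<in> sets ?B" using A assms(1) by (intro sets_PiM_I_finite) auto
    have "emeasure (distr ?L ?B (\<lambda>x. x)) (PiE I A) = emeasure ?L (PiE I A \<inter> space ?L)"
      using P id by (simp add: emeasure_distr)
    also have "PiE I A \<inter> space ?L = PiE I A" by (auto simp: space_PiM)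
    also have "emeasure ?L (PiE I A) = (\<Prod>i\<in>I. emeasure lebesgue (A i))"
      using A assms(1) by (intro lebesgue_PiM.emeasure_PiM) (auto intro: sets_completionI_sets)
    also have "\<dots> = (\<Prod>i\<in>I. emeasure lborel (A i))" using A by (intro prod.cong) auto
    finally show "emeasure (distr ?L ?B (\<lambda>x. x)) (PiE I A) = (\<Prod>i\<in>I. emeasure lborel (A i))" .
  qed simp
  then show "(\<integral>\<^sup>+x. G x \<partial>?L) = (\<integral>\<^sup>+x. G x \<partial>?B)"
    using nn_integral_distr[OF id, of G] assms(2) by simp
qed

lemma nn_integral_PiM_lebesgue_densities:
  fixes f f' :: "'i \<Rightarrow> 'a::euclidean_space \<Rightarrow> real"
  assumes I: "finite I" and H: "H \<in> borel_measurable (PiM I (\<lambda>_. lborel))"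
    and f'[measurable]: "\<And>j. j \<in> I \<Longrightarrow> f' j \<in> borel_measurable borel" and ae: "\<And>j. j \<in> I \<Longrightarrow> AE x in lebesgue. f j x = f' j x"
  shows "(\<integral>\<^sup>+x. H x * (\<Prod>j\<in>I. ennreal (f j (x j))) \<partial>PiM I (\<lambda>_. lebesgue)) = (\<integral>\<^sup>+x. H x * (\<Prod>j\<in>I. ennreal (f' j (x j))) \<partial>PiM I (\<lambda>_. lborel))"
proof -
  have "AE x in PiM I (\<lambda>_. lebesgue). f j (x j) = f' j (x j)" if "j \<in> I" for j
    by (rule AE_PiM_component_sigma_finite[OF lebesgue_PiM.product_sigma_finite_axioms I that, where P="\<lambda>x. f j x = f' j x"]) (rule ae[OF that])
  then have "AE x in PiM I (\<lambda>_. lebesgue). \<forall>j\<in>I. f j (x j) = f' j (x j)" using I by (intro AE_finite_allI) auto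
  then have "(\<integral>\<^sup>+x. H x * (\<Prod>j\<in>I. ennreal (f j (x j))) \<partial>PiM I (\<lambda>_. lebesgue)) = (\<integral>\<^sup>+x. H x * (\<Prod>j\<in>I. ennreal (f' j (x j))) \<partial>PiM I (\<lambda>_. lebesgue))"
    by (intro nn_integral_cong_AE) auto
  also have "\<dots> = (\<integral>\<^sup>+x. H x * (\<Prod>j\<in>I. ennreal (f' j (x j))) \<partial>PiM I (\<lambda>_. lborel))"
    by (intro measurable_PiM_lebesgue(2)[OF I] borel_measurable_times_ennreal H) measurable
  finally show ?thesis .
qed

text \<open>A Borel version of f is clipped to [0, linf_norm f], which turns the essential bound
  into a pointwise one and changes f on a null set only.\<close>

lemma in_Pn_borel_version:
  fixes f :: "'a::euclidean_space \<Rightarrow> real"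
  assumes f: "in_Pn f" and g1: "(\<integral>\<^sup>+x. ennreal (ball_rearr f r x) \<partial>lebesgue) = 1"
  obtains f' where "f' \<in> borel_measurable borel" "\<And>x. 0 \<le> f' x" "\<And>x. f' x \<le> linf_norm f"
    "(lint x. ennreal (f' x)) = 1" "AE x in lebesgue. f x = f' x"
    "ennreal (linf_norm f) * emeasure lborel (cball (0::'a) r) = 1" "0 \<le> linf_norm f"
proof -
  let ?A = "linf_norm f" and ?E = "esssup lebesgue (\<lambda>x. ereal (f x))"
  have fm: "f \<in> borel_measurable lebesgue" and f0: "\<And>x. 0 \<le> f x" and f1: "(\<integral>\<^sup>+x. ennreal (f x) \<partial>lebesgue) = 1" and E: "?E < \<infinity>"
    using f by (auto simp: in_Pn_def)
  have "(\<integral>\<^sup>+x. ennreal (ball_rearr f r x) \<partial>lebesgue) = (lint x. ennreal ?A * indicator (cball (0::'a) r) x)"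
    unfolding nn_integral_completion ball_rearr_def by (intro nn_integral_cong) (auto simp: indicator_def)
  then have A1: "ennreal ?A * emeasure lborel (cball (0::'a) r) = 1" using g1 by (simp add: nn_integral_cmult_indicator)
  \<comment> \<open>A nonpositive value would make the ball density integrate to 0. Positivity also
    excludes the default that \<open>real_of_ereal\<close> returns at -\<infinity>.\<close>
  have A0: "0 < ?A"
  proof (rule ccontr)
    assume "\<not> 0 < ?A"
    then have "ennreal ?A = 0" by (simp add: ennreal_neg)
    then show False using A1 by simp
  qed
  then have "?E = ereal ?A" unfolding linf_norm_def using E by (cases ?E) auto
  then have aeA: "AE x in lebesgue. f x \<le> ?A" using esssup_AE[of "\<lambda>x. ereal (f x)" lebesgue] by simp
  obtain g where g: "g \<in> borel_measurable lborel" "AE x in lborel. f x = g x" using completion_ex_borel_measurable_real[OF fm] by blast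
  define f' where "f' x = max 0 (min ?A (g x))" for x
  have "AE x in lebesgue. f x = g x" using g(2) by (rule AE_completion)
  then have ae: "AE x in lebesgue. f x = f' x" using aeA
  proof eventually_elim
    case (elim x) then show ?case using f0[of x] by (auto simp: f'_def max_def min_def)
  qed
  have "(lint x. ennreal (f' x)) = (\<integral>\<^sup>+x. ennreal (f' x) \<partial>lebesgue)"
    by (rule nn_integral_completion[symmetric])
  also have "\<dots> = (\<integral>\<^sup>+x. ennreal (f x) \<partial>lebesgue)" using ae by (intro nn_integral_cong_AE) auto
  finally have "(lint x. ennreal (f' x)) = (\<integral>\<^sup>+x. ennreal (f x) \<partial>lebesgue)" .
  with f1 have int: "(lint x. ennreal (f' x)) = 1" by simp
  have fm': "f' \<in> borel_measurable borel" unfolding f'_def using g(1) by simp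
  have fb: "0 \<le> f' x" "f' x \<le> ?A" for x using A0 by (auto simp: f'_def)
  show ?thesis by (rule that[OF fm' fb int ae A1 less_imp_le[OF A0]])
qed

theorem integral_gauges_le_ball_rearr:
  fixes f :: "'i \<Rightarrow> 'a::euclidean_space \<Rightarrow> real" and \<phi> :: "'l \<Rightarrow> real \<Rightarrow> ennreal"
  assumes I: "finite I" and L: "finite L" and g: "\<And>l. l \<in> L \<Longrightarrow> gauge_fun I (g l)"
    and \<phi>: "\<And>l a b. l \<in> L \<Longrightarrow> 0 \<le> a \<Longrightarrow> a \<le> b \<Longrightarrow> \<phi> l b \<le> \<phi> l a" and \<phi>m: "\<And>l. l \<in> L \<Longrightarrow> \<phi> l \<in> borel_measurable borel"
    and f: "\<And>j. j \<in> I \<Longrightarrow> in_Pn (f j)" and r: "\<And>j. j \<in> I \<Longrightarrow> 0 < r j"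
    and r1: "\<And>j. j \<in> I \<Longrightarrow> (\<integral>\<^sup>+x. ennreal (ball_rearr (f j) (r j) x) \<partial>lebesgue) = 1"
  shows "(\<integral>\<^sup>+x. (lint u. (\<Prod>l\<in>L. \<phi> l (gauge_at (g l) x u))) * (\<Prod>j\<in>I. ennreal (f j (x j))) \<partial>PiM I (\<lambda>_. lebesgue))
    \<le> (\<integral>\<^sup>+x. (lint u. (\<Prod>l\<in>L. \<phi> l (gauge_at (g l) x u))) * (\<Prod>j\<in>I. ennreal (ball_rearr (f j) (r j) (x j))) \<partial>PiM I (\<lambda>_. lebesgue))"
proof -
  have "\<forall>j\<in>I. \<exists>f'. f' \<in> borel_measurable borel \<and> (\<forall>x. 0 \<le> f' x \<and> f' x \<le> linf_norm (f j)) \<and> (lint x. ennreal (f' x)) = 1 \<and> (AE x in lebesgue. f j x = f' x)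
     \<and> ennreal (linf_norm (f j)) * emeasure lborel (cball (0::'a) (r j)) = 1"
  proof
    fix j assume j: "j \<in> I"
    show "\<exists>f'. f' \<in> borel_measurable borel \<and> (\<forall>x. 0 \<le> f' x \<and> f' x \<le> linf_norm (f j)) \<and> (lint x. ennreal (f' x)) = 1 \<and> (AE x in lebesgue. f j x = f' x)
     \<and> ennreal (linf_norm (f j)) * emeasure lborel (cball (0::'a) (r j)) = 1"
      by (rule in_Pn_borel_version[OF f[OF j] r1[OF j]]) blast
  qed
  from bchoice[OF this] obtain f' where f': "\<And>j. j \<in> I \<Longrightarrow> f' j \<in> borel_measurable borel" "\<And>j x. j \<in> I \<Longrightarrow> 0 \<le> f' j x" "\<And>j x. j \<in> I \<Longrightarrow> f' j x \<le> linf_norm (f j)"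
    "\<And>j. j \<in> I \<Longrightarrow> (lint x. ennreal (f' j x)) = 1" "\<And>j. j \<in> I \<Longrightarrow> AE x in lebesgue. f j x = f' j x"
    "\<And>j. j \<in> I \<Longrightarrow> ennreal (linf_norm (f j)) * emeasure lborel (cball (0::'a) (r j)) = 1" by blast
  let ?H = "\<lambda>x. \<integral>\<^sup>+u. (\<Prod>l\<in>L. \<phi> l (gauge_at (g l) x u)) \<partial>(lborel :: 'a measure)"
  have Hm: "?H \<in> borel_measurable (PiM I (\<lambda>_. lborel))"
  proof -
    have [measurable]: "(\<lambda>p. \<phi> l (gauge_at (g l) (fst p) (snd p :: 'a))) \<in> borel_measurable (PiM I (\<lambda>_. lborel) \<Otimes>\<^sub>M lborel)" if "l \<in> L" for l
      by (rule measurable_compose[OF gauge_at_measurable(1)[OF g[OF that]] \<phi>m[OF that]])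
    have "(\<lambda>p. \<Prod>l\<in>L. \<phi> l (gauge_at (g l) (fst p) (snd p :: 'a))) \<in> borel_measurable (PiM I (\<lambda>_. lborel) \<Otimes>\<^sub>M lborel)"
      by measurable
    then show ?thesis by (intro lborel.borel_measurable_nn_integral) (simp add: case_prod_beta')
  qed
  have bm: "ball_rearr (f j) (r j) \<in> borel_measurable borel" for j
  proof -
    show ?thesis unfolding ball_rearr_def by measurable
  qed
  have "(\<integral>\<^sup>+x. ?H x * (\<Prod>j\<in>I. ennreal (f j (x j))) \<partial>PiM I (\<lambda>_. lebesgue)) = (\<integral>\<^sup>+x. (\<Prod>j\<in>I. ennreal (f' j (x j))) * ?H x \<partial>PiM I (\<lambda>_. lborel))"
    using nn_integral_PiM_lebesgue_densities[OF I Hm f'(1,5)] by (simp add: mult.commute)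
  also have "\<dots> \<le> (\<integral>\<^sup>+x. (\<Prod>j\<in>I. ennreal (linf_norm (f j) * indicator (cball 0 (r j)) (x j))) * ?H x \<partial>PiM I (\<lambda>_. lborel))"
    using f' r by (intro integral_gauges_le_ball[OF I L g \<phi> \<phi>m]) (auto intro: less_imp_le)
  also have "\<dots> = (\<integral>\<^sup>+x. ?H x * (\<Prod>j\<in>I. ennreal (ball_rearr (f j) (r j) (x j))) \<partial>PiM I (\<lambda>_. lebesgue))"
    by (subst nn_integral_PiM_lebesgue_densities[OF I Hm bm]) (auto simp: ball_rearr_def mult.commute)
  finally show ?thesis .
qed

subsection \<open>Extended powers\<close>

lemma epow_pos: "0 < x \<Longrightarrow> epow (ennreal x) q = ennreal (x powr q)"
  by (simp add: epow_def)

lemma epow_0: "q < 0 \<Longrightarrow> epow 0 q = \<infinity>" and epow_0': "0 < q \<Longrightarrow> epow 0 q = 0"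
  and epow_top: "q < 0 \<Longrightarrow> epow top q = 0" and epow_top': "0 < q \<Longrightarrow> epow top q = top"
  by (auto simp: epow_def)

lemma ennreal_cases3:
  obtains "(x::ennreal) = 0" | "x = top" | r where "0 < r" "x = ennreal r"
  by (cases x) (metis antisym_conv1 ennreal_0)

lemma epow_measurable[measurable]: "(\<lambda>x. epow x q) \<in> borel_measurable borel"
  unfolding epow_def by measurable

lemma epow_antimono:
  assumes "q < 0" "x \<le> y" shows "epow y q \<le> epow x q"
proof (cases x rule: ennreal_cases3)
  case (3 r)
  then show ?thesis
  proof (cases y rule: ennreal_cases3)
    case 1 then show ?thesis using 3 assms by simp
  next
    case 2 then show ?thesis using assms by (simp add: epow_top)
  next
    case (3 s)
    then have "r \<le> s" using assms \<open>0 < r\<close> \<open>x = ennreal r\<close> by simp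
    then show ?thesis using 3 \<open>0 < r\<close> \<open>x = ennreal r\<close> assms by (simp add: epow_pos powr_mono2')
  qed
qed (use assms in \<open>auto simp: epow_0 epow_top top_unique\<close>)

lemma epow_eq_0_iff: "q < 0 \<Longrightarrow> epow x q = 0 \<longleftrightarrow> x = top"
  by (cases x rule: ennreal_cases3) (auto simp: epow_0 epow_top epow_pos)

text \<open>Finiteness is essential: for x = 0 and y = \<infinity> the product is 0 and its power
  \<infinity>, whereas the product of the powers is 0.\<close>

lemma epow_mult:
  assumes q: "q < 0" and "x \<noteq> top" "y \<noteq> top"
  shows "epow (x * y) q = epow x q * epow y q"
proof (cases "x = 0 \<or> y = 0")
  case True then show ?thesis using assms by (auto simp: epow_0 epow_eq_0_iff ennreal_top_mult ennreal_mult_top)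
next
  case False
  obtain r where r: "0 < r" "x = ennreal r" using False assms by (cases x rule: ennreal_cases3) auto
  obtain s where s: "0 < s" "y = ennreal s" using False assms by (cases y rule: ennreal_cases3) auto
  have "epow (x * y) q = ennreal ((r * s) powr q)" using r s by (simp add: epow_pos flip: ennreal_mult)
  then show ?thesis using r s by (simp add: epow_pos powr_mult ennreal_mult)
qed

lemma epow_scale:
  assumes "0 < t" shows "epow (ennreal t * x) q = ennreal (t powr q) * epow x q"
proof (cases x rule: ennreal_cases3)
  case (3 r)
  then show ?thesis using assms by (simp add: epow_pos powr_mult ennreal_mult flip: ennreal_mult)
qed (use assms in \<open>auto simp: epow_def ennreal_mult_top\<close>)

lemma epow_prod:
  assumes "finite I" "q < 0" "\<And>i. i \<in> I \<Longrightarrow> x i \<noteq> top"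
  shows "epow (\<Prod>i\<in>I. x i) q = (\<Prod>i\<in>I. epow (x i) q)"
  using assms(1,3)
proof (induction I rule: finite_induct)
  case empty show ?case using epow_pos[of 1 q] by simp
next
  case (insert i I)
  have "(\<Prod>i\<in>I. x i) < top" using insert by (intro prod_less_top) (auto simp: less_top)
  then show ?case using insert assms(2) by (simp add: epow_mult)
qed

lemma epow_power:
  assumes "0 < n" shows "epow x q ^ n = epow x (q * real n)"
proof (cases x rule: ennreal_cases3)
  case (3 r)
  then show ?thesis by (simp add: epow_pos ennreal_power powr_realpow[symmetric] powr_powr)
qed (use assms in \<open>auto simp: epow_def zero_less_mult_iff mult_less_0_iff top_power_ennreal zero_power\<close>)

lemma epow_nat:
  assumes "0 < n" shows "epow x (real n) = x ^ n"
proof (cases x rule: ennreal_cases3)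
  case (3 r)
  then show ?thesis by (simp add: epow_pos ennreal_power powr_realpow)
qed (use assms in \<open>auto simp: epow_def top_power_ennreal zero_power\<close>)

text \<open>The upper limit a may be \<infinity>, because radial functions may be infinite; both
  sides are then infinite.\<close>

lemma nn_integral_powr_below:
  assumes c: "0 < c"
  shows "(lint s. (if 0 < s \<and> ennreal s \<le> a then ennreal (s powr (c - 1)) else 0)) = ennreal (1 / c) * epow a c"
proof -
  have fin: "(lint s. (if 0 < s \<and> s \<le> r then ennreal (s powr (c - 1)) else 0)) = ennreal (r powr c / c)" if r: "0 \<le> r" for r
  proof -
    have "((\<lambda>s. s powr (c - 1)) has_integral (r powr (c - 1 + 1) / (c - 1 + 1))) {0..r}"
      using c r by (intro has_integral_powr_from_0) auto
    then have "((\<lambda>s. s powr (c - 1)) has_integral (r powr c / c)) {0..r}" by simp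
    then have "(lint s. ennreal (indicator {0..r} s * s powr (c - 1))) = ennreal (r powr c / c)"
      by (intro nn_integral_has_integral_lebesgue) auto
    moreover have "(lint s. ennreal (indicator {0..r} s * s powr (c - 1))) = (lint s. (if 0 < s \<and> s \<le> r then ennreal (s powr (c - 1)) else 0))"
      by (intro nn_integral_cong) (auto simp: indicator_def)
    ultimately show ?thesis by simp
  qed
  show ?thesis
  proof (cases a)
    case (real r)
    have "epow a c = ennreal (r powr c)" using real c by (cases "r = 0") (auto simp: epow_pos epow_0')
    moreover have "(lint s. (if 0 < s \<and> ennreal s \<le> a then ennreal (s powr (c - 1)) else 0)) = ennreal (r powr c / c)"
      using fin[OF real(1)] real by (auto intro!: nn_integral_cong simp flip: fin[OF real(1)])
    ultimately show ?thesis using c by (simp flip: ennreal_mult)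
  next
    case top
    have large: "ennreal B \<le> (lint s. (if 0 < s \<and> ennreal s \<le> a then ennreal (s powr (c - 1)) else 0))" if B: "0 < B" for B
    proof -
      define r where "r = (c * B) powr (1 / c)"
      have "r powr c / c = B" using B c by (simp add: r_def powr_powr)
      then have "ennreal B = (lint s. (if 0 < s \<and> s \<le> r then ennreal (s powr (c - 1)) else 0))" using fin[of r] by (simp add: r_def)
      also have "\<dots> \<le> (lint s. (if 0 < s \<and> ennreal s \<le> a then ennreal (s powr (c - 1)) else 0))"
        using top by (intro nn_integral_mono) auto
      finally show ?thesis .
    qed
    have "(lint s. (if 0 < s \<and> ennreal s \<le> a then ennreal (s powr (c - 1)) else 0)) = top"
    proof (rule ccontr)
      let ?X = "\<integral>\<^sup>+s. (if 0 < s \<and> ennreal s \<le> a then ennreal (s powr (c - 1)) else 0) \<partial>lborel"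
      assume "?X \<noteq> top"
      then obtain n :: nat where "?X < of_nat n" using ennreal_Ex_less_of_nat less_top by blast
      also have "of_nat n \<le> ennreal (real n + 1)" by (simp add: ennreal_of_nat_eq_real_of_nat ennreal_leI)
      also have "\<dots> \<le> ?X" using large[of "real n + 1"] by simp
      finally show False by simp
    qed
    then show ?thesis using top c by (simp add: epow_top' ennreal_mult_top)
  qed
qed

section \<open>The exponential on [0, \<infinity>] and its radial integral\<close>

definition expm :: "ennreal \<Rightarrow> ennreal" where
  "expm S = (if S = top then 0 else ennreal (exp (- enn2real S)))"

lemma expm_measurable[measurable]: "expm \<in> borel_measurable borel"
  unfolding expm_def by measurable

text \<open>This is Gamma(n / p) / p for n, p > 0; the volume formula divides by it, so it must be
  positive and finite.\<close>

definition exp_const :: "nat \<Rightarrow> real \<Rightarrow> ennreal" where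
  "exp_const n p = (lint s. (if 0 < s then ennreal (s ^ (n - 1) * exp (- (s powr p))) else 0))"

lemma exp_const:
  assumes p: "0 < p" and n: "0 < n"
  shows "exp_const n p \<noteq> 0" "exp_const n p \<noteq> top"
proof -
  show "exp_const n p \<noteq> 0"
  proof
    assume "exp_const n p = 0"
    then have "AE s in lborel. (if 0 < s then ennreal (s ^ (n - 1) * exp (- (s powr p))) else 0) = 0"
      unfolding exp_const_def by (subst (asm) nn_integral_0_iff_AE) auto
    then obtain s :: real where s: "s \<in> {0<..<1}" "(if 0 < s then ennreal (s ^ (n - 1) * exp (- (s powr p))) else 0) = 0"
      using AE_lborel_open_ex[OF _ open_greaterThanLessThan[of 0 1]] by fastforce
    have pos: "0 < s ^ (n - 1) * exp (- (s powr p))" using s(1) by simp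
    have "ennreal (s ^ (n - 1) * exp (- (s powr p))) = 0" using s by simp
    then show False using pos by (metis ennreal_eq_0_iff leD)
  qed
  \<comment> \<open>k makes p k at least n + 1. Then exp(x) \<ge> (x / k)^k with x = s^p bounds the
    integrand by K s^(-2) for s \<ge> 1.\<close>
  obtain k :: nat where k: "(real n + 1) / p \<le> real k" using real_arch_simple by blast
  have pk: "real n + 1 \<le> p * real k" using k p by (simp add: field_simps)
  then have k0: "0 < k" by (cases k) auto
  define K where "K = real k ^ k"
  have K: "0 < K" using k0 by (simp add: K_def)
  have bd: "s ^ (n - 1) * exp (- (s powr p)) \<le> K * s powr (-2)" if s: "1 \<le> s" for s
  proof -
    let ?x = "s powr p"
    have x: "0 < ?x" using s by simp
    have "(?x / real k) ^ k \<le> exp (?x / real k) ^ k"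
    proof (rule power_mono)
      show "?x / real k \<le> exp (?x / real k)" using exp_ge_add_one_self[of "?x / real k"] by linarith
    qed (use x in simp)
    also have "\<dots> = exp ?x" using k0 by (simp flip: exp_of_nat_mult)
    finally have "exp (- ?x) \<le> inverse ((?x / real k) ^ k)"
      using x k0 by (simp add: exp_minus le_imp_inverse_le)
    also have "\<dots> = K * s powr (- p * real k)"
      using s k0 by (simp add: K_def power_divide powr_realpow[symmetric] powr_powr powr_minus field_simps)
    finally have "s ^ (n - 1) * exp (- ?x) \<le> s powr (real n - 1) * (K * s powr (- p * real k))"
      using s n by (intro mult_mono) (auto simp: powr_realpow[symmetric] of_nat_diff K less_imp_le)
    also have "\<dots> = K * s powr (real n - 1 + - p * real k)" by (simp only: powr_add mult_ac)
    also have "\<dots> \<le> K * s powr (-2)" using s pk K by (intro mult_left_mono powr_mono) auto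
    finally show ?thesis .
  qed
  have "((\<lambda>s. s powr (-2)) has_integral - (1 powr (-2 + 1)) / (-2 + 1)) {1::real..}"
    by (rule has_integral_powr_to_inf) auto
  then have I1: "(lint s. ennreal (indicator {1..} s * s powr (-2))) = ennreal (- (1 powr (-2 + 1)) / (-2 + 1))"
    by (intro nn_integral_has_integral_lebesgue) auto
  have "exp_const n p \<le> (lint s. indicator {0..1} s + ennreal K * ennreal (indicator {1..} s * s powr (-2)))"
    unfolding exp_const_def
  proof (rule nn_integral_mono)
    fix s :: real
    show "(if 0 < s then ennreal (s ^ (n - 1) * exp (- (s powr p))) else 0) \<le> indicator {0..1} s + ennreal K * ennreal (indicator {1..} s * s powr (-2))"
    proof (cases "1 \<le> s")
      case True
      have "ennreal (s ^ (n - 1) * exp (- (s powr p))) \<le> ennreal (K * s powr (-2))" by (rule ennreal_leI[OF bd[OF True]])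
      also have "\<dots> = ennreal K * ennreal (indicator {1..} s * s powr (-2))" using True K by (simp add: ennreal_mult)
      also have "\<dots> \<le> indicator {0..1} s + \<dots>" by simp
      finally show ?thesis using True by simp
    next
      case False
      have "s ^ (n - 1) * exp (- (s powr p)) \<le> 1 * 1" if "0 < s"
        using False that by (intro mult_mono power_le_one) auto
      then show ?thesis using False by (auto simp: indicator_def)
    qed
  qed
  also have "\<dots> = emeasure lborel {0..1::real} + ennreal K * (lint s. ennreal (indicator {1..} s * s powr (-2)))"
    by (subst nn_integral_add) (auto simp: nn_integral_cmult)
  also have "\<dots> < top" unfolding I1 by (simp add: ennreal_mult_less_top)
  finally show "exp_const n p \<noteq> top" by simp
qed

subsection \<open>Integration along rays\<close>

text \<open>An annulus in place of the unit sphere: every ray meets it in measure ln 2 with respect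
  to ds / s, so polar integration can be done with Lebesgue measure on the space alone.\<close>

definition ann :: "'a::euclidean_space \<Rightarrow> ennreal" where
  "ann v = (if 1 \<le> norm v \<and> norm v \<le> 2 then 1 else 0)"

lemma ann_measurable[measurable]: "ann \<in> borel_measurable borel"
  unfolding ann_def by measurable

lemma nn_integral_lborel_scale:
  fixes g :: "'a::euclidean_space \<Rightarrow> ennreal"
  assumes [measurable]: "g \<in> borel_measurable borel" and s: "0 < s"
  shows "(lint u. g u) = ennreal (s ^ DIM('a)) * (lint v. g (s *\<^sub>R v))"
proof -
  have "(lint u. g u) = (\<integral>\<^sup>+u. g u \<partial>density (distr lborel borel (\<lambda>x. 0 + s *\<^sub>R x)) (\<lambda>_. ennreal (\<bar>s\<bar> ^ DIM('a))))"
    using s by (subst lborel_affine[of s 0]) auto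
  also have "\<dots> = ennreal (s ^ DIM('a)) * (lint v. g (s *\<^sub>R v))"
    using s by (simp add: nn_integral_density nn_integral_distr nn_integral_cmult)
  finally show ?thesis .
qed

text \<open>Away from the origin, 1 equals 1 / ln 2 times the integral of ann(u / s) ds / s.
  Inserting this, exchanging the integrals and substituting u = s v turns s^n / s into the factor
  s^(n - 1).\<close>

lemma nn_integral_rays:
  fixes F :: "'a::euclidean_space \<Rightarrow> ennreal"
  assumes [measurable]: "F \<in> borel_measurable borel"
  shows "(lint u. F u) = ennreal (1 / ln 2) *
    (lint v. ann v * (lint s. (if 0 < s then ennreal (s ^ (DIM('a) - 1)) * F (s *\<^sub>R v) else 0)))"
proof -
  let ?k = "\<lambda>u s. if 0 < s then ennreal (1 / s) * ann ((1 / s) *\<^sub>R u) else 0"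
  have one: "(lint s. ?k u s) = ennreal (ln 2)" if u: "u \<noteq> 0" for u :: 'a
  proof -
    let ?r = "norm u"
    have r: "0 < ?r" using u by simp
    have "(lint s. ?k u s) = (lint s. ennreal (1 / s) * indicator {?r / 2 .. ?r} s)"
    proof (rule nn_integral_cong)
      fix s :: real
      show "?k u s = ennreal (1 / s) * indicator {?r / 2 .. ?r} s"
      proof (cases "0 < s")
        case True
        then have "(1 \<le> norm ((1 / s) *\<^sub>R u) \<and> norm ((1 / s) *\<^sub>R u) \<le> 2) \<longleftrightarrow> s \<in> {?r / 2 .. ?r}"
          by (auto simp: field_simps)
        then show ?thesis using True by (simp add: ann_def indicator_def)
      next
        case False
        then have "s \<notin> {?r / 2 .. ?r}" unfolding atLeastAtMost_iff using r by linarith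
        then show ?thesis using False by simp
      qed
    qed
    also have "\<dots> = ennreal (ln ?r - ln (?r / 2))"
    proof (rule nn_integral_FTC_Icc)
      fix s assume "s \<in> {?r / 2 .. ?r}"
      then have "0 < s" unfolding atLeastAtMost_iff using r by linarith
      then show "DERIV ln s :> 1 / s" "0 \<le> 1 / s" by (auto intro: DERIV_ln_divide)
    qed (use r in auto)
    also have "ln ?r - ln (?r / 2) = ln 2" using r by (simp add: ln_div)
    finally show ?thesis .
  qed
  have l2: "(0::real) < ln 2" by simp
  have "ennreal (ln 2) * (lint u. F u) = (lint u. F u * (lint s. ?k u s))"
  proof -
    have "AE u in lborel. u \<noteq> (0::'a)" by (rule AE_lborel_singleton)
    then have "AE u in lborel. F u * (lint s. ?k u s) = ennreal (ln 2) * F u"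
    proof eventually_elim
      case (elim u) show ?case unfolding one[OF elim] by (rule mult.commute)
    qed
    then have "(lint u. F u * (lint s. ?k u s)) = (lint u. ennreal (ln 2) * F u)" by (rule nn_integral_cong_AE)
    then show ?thesis by (simp add: nn_integral_cmult)
  qed
  also have "\<dots> = (lint u. \<integral>\<^sup>+s. F u * ?k u s \<partial>lborel)"
    by (intro nn_integral_cong nn_integral_cmult[symmetric]) measurable
  also have "\<dots> = (lint s. \<integral>\<^sup>+u. F u * ?k u s \<partial>lborel)"
    by (rule lborel_pair.Fubini'[symmetric]) measurable
  also have "\<dots> = (lint s. \<integral>\<^sup>+v. ann v * (if 0 < s then ennreal (s ^ (DIM('a) - 1)) * F (s *\<^sub>R v) else 0) \<partial>lborel)"
  proof (rule nn_integral_cong)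
    fix s :: real
    show "(lint u. F u * ?k u s) = (lint v. ann v * (if 0 < s then ennreal (s ^ (DIM('a) - 1)) * F (s *\<^sub>R v) else 0))"
    proof (cases "0 < s")
      case True
      have "(lint u. F u * ?k u s) = ennreal (s ^ DIM('a)) * (lint v. F (s *\<^sub>R v) * ?k (s *\<^sub>R v) s)"
        by (rule nn_integral_lborel_scale) (use True in measurable)
      also have "\<dots> = (lint v. ennreal (s ^ DIM('a)) * (F (s *\<^sub>R v) * ?k (s *\<^sub>R v) s))"
        by (rule nn_integral_cmult[symmetric]) measurable
      also have "\<dots> = (lint v. ann v * (if 0 < s then ennreal (s ^ (DIM('a) - 1)) * F (s *\<^sub>R v) else 0))"
      proof (rule nn_integral_cong)
        fix v :: 'a
        have "s ^ DIM('a) = s ^ (DIM('a) - 1) * s" using DIM_positive[where 'a='a] by (metis power_minus_mult)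
        then have "ennreal (s ^ DIM('a)) * ennreal (1 / s) = ennreal (s ^ (DIM('a) - 1))"
          using True by (simp flip: ennreal_mult)
        then have "ennreal (s ^ DIM('a)) * (F (s *\<^sub>R v) * (ennreal (1 / s) * ann v)) = ann v * (ennreal (s ^ (DIM('a) - 1)) * F (s *\<^sub>R v))"
          by (metis mult.assoc mult.commute)
        then show "ennreal (s ^ DIM('a)) * (F (s *\<^sub>R v) * ?k (s *\<^sub>R v) s) = ann v * (if 0 < s then ennreal (s ^ (DIM('a) - 1)) * F (s *\<^sub>R v) else 0)"
          using True by simp
      qed
      finally show ?thesis .
    qed simp
  qed
  also have "\<dots> = (lint v. \<integral>\<^sup>+s. ann v * (if 0 < s then ennreal (s ^ (DIM('a) - 1)) * F (s *\<^sub>R v) else 0) \<partial>lborel)"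
    by (rule lborel_pair.Fubini') measurable
  also have "\<dots> = (lint v. ann v * (lint s. (if 0 < s then ennreal (s ^ (DIM('a) - 1)) * F (s *\<^sub>R v) else 0)))" (is "_ = ?X")
    by (intro nn_integral_cong nn_integral_cmult) measurable
  finally have "ennreal (ln 2) * (lint u. F u) = ?X" .
  then have "ennreal (1 / ln 2) * ?X = (ennreal (1 / ln 2) * ennreal (ln 2)) * (lint u. F u)" by (simp add: mult.assoc)
  also have "ennreal (1 / ln 2) * ennreal (ln 2) = 1" by (simp flip: ennreal_mult)
  finally show ?thesis by simp
qed

lemma star_set_eq:
  fixes \<rho> :: "'a::euclidean_space \<Rightarrow> ennreal"
  shows "star_set \<rho> = {x. x = 0 \<or> ennreal (norm x) \<le> \<rho> ((1 / norm x) *\<^sub>R x)}"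
proof (intro equalityI subsetI)
  fix x assume "x \<in> star_set \<rho>"
  then obtain t u where tu: "x = t *\<^sub>R u" "norm u = 1" "0 \<le> t" "ennreal t \<le> \<rho> u" by (auto simp: star_set_def)
  then show "x \<in> {x. x = 0 \<or> ennreal (norm x) \<le> \<rho> ((1 / norm x) *\<^sub>R x)}" by (cases "t = 0") auto
next
  fix x assume x: "x \<in> {x. x = 0 \<or> ennreal (norm x) \<le> \<rho> ((1 / norm x) *\<^sub>R x)}"
  show "x \<in> star_set \<rho>"
  proof (cases "x = 0")
    case True
    obtain b :: 'a where "b \<in> Basis" using SOME_Basis by blast
    then show ?thesis using True by (auto simp: star_set_def intro!: exI[of _ 0] exI[of _ b])
  next
    case False
    then show ?thesis using x by (auto simp: star_set_def intro!: exI[of _ "norm x"] exI[of _ "(1 / norm x) *\<^sub>R x"])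
  qed
qed

lemma star_vol_rays:
  fixes \<rho> :: "'a::euclidean_space \<Rightarrow> ennreal"
  assumes [measurable]: "\<rho> \<in> borel_measurable borel"
  shows "star_vol \<rho> = ennreal (1 / (real DIM('a) * ln 2)) * (lint v. ann v * (ennreal (1 / norm v) * \<rho> ((1 / norm v) *\<^sub>R v)) ^ DIM('a))"
proof -
  let ?n = "DIM('a)"
  let ?S = "{x. x = 0 \<or> ennreal (norm x) \<le> \<rho> ((1 / norm x) *\<^sub>R x)}"
  have [measurable]: "?S \<in> sets borel" by measurable
  have "star_vol \<rho> = (lint u. indicator ?S u)" by (simp add: star_vol_def star_set_eq)
  also have "\<dots> = ennreal (1 / ln 2) * (lint v. ann v * (lint s. (if 0 < s then ennreal (s ^ (?n - 1)) * indicator ?S (s *\<^sub>R v) else 0)))"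
    by (rule nn_integral_rays) measurable
  also have "(lint v. ann v * (lint s. (if 0 < s then ennreal (s ^ (?n - 1)) * indicator ?S (s *\<^sub>R v) else 0)))
    = (lint v. ennreal (1 / real ?n) * (ann v * (ennreal (1 / norm v) * \<rho> ((1 / norm v) *\<^sub>R v)) ^ ?n))"
  proof (rule nn_integral_cong)
    fix v :: 'a
    show "ann v * (lint s. (if 0 < s then ennreal (s ^ (?n - 1)) * indicator ?S (s *\<^sub>R v) else 0))
      = ennreal (1 / real ?n) * (ann v * (ennreal (1 / norm v) * \<rho> ((1 / norm v) *\<^sub>R v)) ^ ?n)"
    proof (cases "ann v = 0")
      case False
      then have v: "1 \<le> norm v" "v \<noteq> 0" by (auto simp: ann_def split: if_splits)
      let ?a = "ennreal (1 / norm v) * \<rho> ((1 / norm v) *\<^sub>R v)"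
      have "(if 0 < s then ennreal (s ^ (?n - 1)) * indicator ?S (s *\<^sub>R v) else 0) = (if 0 < s \<and> ennreal s \<le> ?a then ennreal (s powr (real ?n - 1)) else 0)" for s
      proof (cases "0 < s")
        case True
        have "s *\<^sub>R v \<in> ?S \<longleftrightarrow> ennreal (norm v) * ennreal s \<le> \<rho> ((1 / norm v) *\<^sub>R v)"
          using True v by (simp add: mult.commute flip: ennreal_mult)
        also have "\<dots> \<longleftrightarrow> ennreal (norm v) * ennreal s \<le> ennreal (norm v) * ?a"
        proof -
          have "ennreal (norm v) * ?a = (ennreal (norm v) * ennreal (1 / norm v)) * \<rho> ((1 / norm v) *\<^sub>R v)" by (simp add: mult.assoc)
          also have "ennreal (norm v) * ennreal (1 / norm v) = 1" using v by (simp flip: ennreal_mult)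
          finally show ?thesis by simp
        qed
        also have "\<dots> \<longleftrightarrow> ennreal s \<le> ?a" using v by (subst ennreal_mult_le_mult_iff) auto
        finally have "s *\<^sub>R v \<in> ?S \<longleftrightarrow> ennreal s \<le> ?a" .
        moreover have "s ^ (?n - 1) = s powr (real ?n - 1)"
          using True DIM_positive[where 'a='a] by (simp add: powr_realpow[symmetric] of_nat_diff)
        ultimately show ?thesis using True by (simp add: indicator_def)
      qed simp
      then have "(lint s. (if 0 < s then ennreal (s ^ (?n - 1)) * indicator ?S (s *\<^sub>R v) else 0)) = ennreal (1 / real ?n) * epow ?a (real ?n)"
        by (simp only: nn_integral_powr_below of_nat_0_less_iff DIM_positive)
      also have "epow ?a (real ?n) = ?a ^ ?n" by (rule epow_nat) simp
      finally show ?thesis by (simp only: mult_ac)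
    qed simp
  qed
  also have "\<dots> = ennreal (1 / real ?n) * (lint v. ann v * (ennreal (1 / norm v) * \<rho> ((1 / norm v) *\<^sub>R v)) ^ ?n)"
    by (rule nn_integral_cmult) measurable
  also have "ennreal (1 / ln 2) * (ennreal (1 / real ?n) * (lint v. ann v * (ennreal (1 / norm v) * \<rho> ((1 / norm v) *\<^sub>R v)) ^ ?n))
     = ennreal (1 / (real ?n * ln 2)) * (lint v. ann v * (ennreal (1 / norm v) * \<rho> ((1 / norm v) *\<^sub>R v)) ^ ?n)"
    by (simp add: mult.assoc[symmetric] mult.commute[of "ln 2"] flip: ennreal_mult)
  finally show ?thesis .
qed

text \<open>A radial function extended off the sphere with degree -1 can be evaluated directly on
  the annulus, without normalising v.\<close>

lemma star_vol_homogeneous: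
  fixes \<rho> :: "'a::euclidean_space \<Rightarrow> ennreal"
  assumes [measurable]: "\<rho> \<in> borel_measurable borel" and hom: "\<And>t u. 0 < t \<Longrightarrow> \<rho> (t *\<^sub>R u) = ennreal (1 / t) * \<rho> u"
  shows "star_vol \<rho> = ennreal (1 / (real DIM('a) * ln 2)) * (lint v. ann v * \<rho> v ^ DIM('a))"
  unfolding star_vol_rays[OF assms(1)]
proof (rule arg_cong2[where f="(*)"], rule refl, rule nn_integral_cong)
  fix v :: 'a
  show "ann v * (ennreal (1 / norm v) * \<rho> ((1 / norm v) *\<^sub>R v)) ^ DIM('a) = ann v * \<rho> v ^ DIM('a)"
  proof (cases "ann v = 0")
    case False
    then have v: "0 < norm v" by (auto simp: ann_def split: if_splits)
    have "ennreal (1 / norm v) * \<rho> ((1 / norm v) *\<^sub>R v) = (ennreal (1 / norm v) * ennreal (norm v)) * \<rho> v"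
      using hom[of "1 / norm v" v] v by (simp add: mult.assoc)
    also have "ennreal (1 / norm v) * ennreal (norm v) = 1" using v by (simp flip: ennreal_mult)
    finally show ?thesis by simp
  qed simp
qed

definition cut_pow :: "real \<Rightarrow> nat \<Rightarrow> real \<Rightarrow> ennreal" where
  "cut_pow a l t = (if l = 0 then (if t \<le> 1 then 1 else 0) else epow (ennreal t) (- a))"

lemma cut_pow_measurable[measurable]: "cut_pow a l \<in> borel_measurable borel"
proof -
  have [measurable]: "(\<lambda>t. epow (ennreal t) (- a)) \<in> borel_measurable borel"
    by (rule measurable_compose[OF measurable_ennreal epow_measurable])
  show ?thesis unfolding cut_pow_def by measurable
qed

lemma cut_pow_antimono: "0 < a \<Longrightarrow> s \<le> t \<Longrightarrow> cut_pow a l t \<le> cut_pow a l s"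
  by (auto simp: cut_pow_def intro!: epow_antimono ennreal_leI)

text \<open>The truncated factor \<open>l = 0\<close> makes the right-hand side integrable over the whole space while all
  its factors stay decreasing.\<close>

lemma annulus_prod_eq:
  fixes h :: "nat \<Rightarrow> 'a::euclidean_space \<Rightarrow> real"
  assumes k: "0 < k" and a: "0 < a" and ka: "real k * a = real DIM('a)"
    and hm[measurable]: "\<And>l. l < k \<Longrightarrow> h l \<in> borel_measurable borel" and h0: "\<And>l u. l < k \<Longrightarrow> 0 \<le> h l u"
    and hom: "\<And>l t u. l < k \<Longrightarrow> 0 \<le> t \<Longrightarrow> h l (t *\<^sub>R u) = t * h l u"
  shows "(lint v. ann v * (\<Prod>l<k. epow (ennreal (h l v)) (- a))) = ennreal (a * ln 2) * (lint u. (\<Prod>l<k. cut_pow a l (h l u)))"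
proof -
  let ?n = "DIM('a)" and ?L = "{1..<k}"
  have kL: "{..<k} = insert 0 ?L" using k by auto
  have pm[measurable]: "(\<lambda>u. \<Prod>l<k. cut_pow a l (h l u)) \<in> borel_measurable borel" by measurable
  have "(lint u. (\<Prod>l<k. cut_pow a l (h l u))) = ennreal (1 / ln 2) *
     (lint v. ann v * (lint s. (if 0 < s then ennreal (s ^ (?n - 1)) * (\<Prod>l<k. cut_pow a l (h l (s *\<^sub>R v))) else 0)))"
    by (rule nn_integral_rays) measurable
  also have "(lint v. ann v * (lint s. (if 0 < s then ennreal (s ^ (?n - 1)) * (\<Prod>l<k. cut_pow a l (h l (s *\<^sub>R v))) else 0)))
     = (lint v. ennreal (1 / a) * (ann v * (\<Prod>l<k. epow (ennreal (h l v)) (- a))))"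
  proof (rule nn_integral_cong)
    fix v :: 'a
    let ?P = "\<Prod>l\<in>?L. epow (ennreal (h l v)) (- a)" and ?b = "epow (ennreal (h 0 v)) (- 1)"
    \<comment> \<open>On the ray the factors with l > 0 contribute s^(-a (k - 1)). Together with
      s^(n - 1) and k a = n this leaves s^(a - 1), integrated over 0 < s \<le> 1 / h 0 v by the
      truncated factor; the integral supplies h 0 v to the power -a, the missing factor, divided by
      a.\<close>
    have "(if 0 < s then ennreal (s ^ (?n - 1)) * (\<Prod>l<k. cut_pow a l (h l (s *\<^sub>R v))) else 0)
       = ?P * (if 0 < s \<and> ennreal s \<le> ?b then ennreal (s powr (a - 1)) else 0)" for s
    proof (cases "0 < s")
      case True
      have "(\<Prod>l\<in>?L. cut_pow a l (h l (s *\<^sub>R v))) = (\<Prod>l\<in>?L. ennreal (s powr (- a)) * epow (ennreal (h l v)) (- a))"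
        using True h0 hom by (intro prod.cong refl) (auto simp: cut_pow_def ennreal_mult epow_scale)
      also have "\<dots> = ennreal (s powr (- a)) ^ card ?L * ?P" by (simp add: prod.distrib)
      also have "ennreal (s powr (- a)) ^ card ?L = ennreal (s powr (- a * (real k - 1)))"
        using True k by (simp add: ennreal_power powr_realpow[symmetric] powr_powr of_nat_diff)
      finally have 1: "(\<Prod>l\<in>?L. cut_pow a l (h l (s *\<^sub>R v))) = ennreal (s powr (- a * (real k - 1))) * ?P" .
      have "h 0 (s *\<^sub>R v) \<le> 1 \<longleftrightarrow> ennreal s \<le> ?b"
      proof (cases "h 0 v = 0")
        case True then show ?thesis using hom[of 0 s v] k \<open>0 < s\<close> by (simp add: epow_0)
      next
        case False
        then have "0 < h 0 v" using h0[of 0 v] k by auto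
        then show ?thesis using hom[of 0 s v] k \<open>0 < s\<close> by (simp add: epow_pos powr_minus field_simps)
      qed
      then have 2: "cut_pow a 0 (h 0 (s *\<^sub>R v)) = (if ennreal s \<le> ?b then 1 else 0)" by (simp add: cut_pow_def)
      have "s ^ (?n - 1) = s powr (real ?n - 1)" using True DIM_positive[where 'a='a] by (simp add: powr_realpow[symmetric] of_nat_diff)
      then have "s ^ (?n - 1) * s powr (- a * (real k - 1)) = s powr (real ?n - 1 + - a * (real k - 1))" using True by (simp only: powr_add)
      also have "real ?n - 1 + - a * (real k - 1) = a - 1" using ka by (simp add: algebra_simps)
      finally have 3: "ennreal (s ^ (?n - 1)) * ennreal (s powr (- a * (real k - 1))) = ennreal (s powr (a - 1))"
        using True by (simp flip: ennreal_mult)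
      have "ennreal (s ^ (?n - 1)) * (\<Prod>l<k. cut_pow a l (h l (s *\<^sub>R v))) = (ennreal (s ^ (?n - 1)) * ennreal (s powr (- a * (real k - 1)))) * ?P * (if ennreal s \<le> ?b then 1 else 0)"
      proof -
        have "(\<Prod>l<k. cut_pow a l (h l (s *\<^sub>R v))) = cut_pow a 0 (h 0 (s *\<^sub>R v)) * (\<Prod>l\<in>?L. cut_pow a l (h l (s *\<^sub>R v)))"
          unfolding kL by (rule prod.insert) auto
        then show ?thesis by (simp only: 1 2 mult_ac)
      qed
      then show ?thesis unfolding 3 using True by (simp add: mult.commute)
    qed (simp)
    then have "(lint s. (if 0 < s then ennreal (s ^ (?n - 1)) * (\<Prod>l<k. cut_pow a l (h l (s *\<^sub>R v))) else 0))
      = ?P * (lint s. (if 0 < s \<and> ennreal s \<le> ?b then ennreal (s powr (a - 1)) else 0))"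
      by (simp only:) (rule nn_integral_cmult, measurable)
    also have "\<dots> = ?P * (ennreal (1 / a) * epow ?b a)" by (simp only: nn_integral_powr_below[OF a])
    also have "epow ?b a = epow (ennreal (h 0 v)) (- a)"
    proof (cases "h 0 v = 0")
      case True then show ?thesis using a by (simp add: epow_0 epow_top')
    next
      case False
      then have "0 < h 0 v" using h0[of 0 v] k by auto
      then show ?thesis by (simp add: epow_pos powr_minus_divide powr_divide)
    qed
    finally show "ann v * (lint s. (if 0 < s then ennreal (s ^ (?n - 1)) * (\<Prod>l<k. cut_pow a l (h l (s *\<^sub>R v))) else 0))
      = ennreal (1 / a) * (ann v * (\<Prod>l<k. epow (ennreal (h l v)) (- a)))"
      unfolding kL by (simp add: mult_ac)
  qed
  also have "\<dots> = ennreal (1 / a) * (lint v. ann v * (\<Prod>l<k. epow (ennreal (h l v)) (- a)))" (is "_ = _ * ?X")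
    by (rule nn_integral_cmult) measurable
  finally have "ennreal (a * ln 2) * (lint u. (\<Prod>l<k. cut_pow a l (h l u))) = (ennreal (a * ln 2) * ennreal (1 / ln 2) * ennreal (1 / a)) * ?X"
    by (simp add: mult.assoc)
  also have "ennreal (a * ln 2) * ennreal (1 / ln 2) * ennreal (1 / a) = 1" using a by (simp flip: ennreal_mult)
  finally show ?thesis by simp
qed

text \<open>On each ray the integral of s^(n - 1) exp(-s^p T) is a constant times T^(-n / p), also
  at T = 0 and T = \<infinity>.\<close>

lemma annulus_exp_eq:
  fixes S :: "'a::euclidean_space \<Rightarrow> ennreal"
  assumes p: "0 < p" and [measurable]: "S \<in> borel_measurable borel" and hom: "\<And>t u. 0 < t \<Longrightarrow> S (t *\<^sub>R u) = ennreal (t powr p) * S u"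
  shows "(lint u. expm (S u)) = ennreal (1 / ln 2) * exp_const DIM('a) p * (lint v. ann v * epow (S v) (- real DIM('a) / p))"
proof -
  let ?n = "DIM('a)"
  have main: "(lint s. (if 0 < s then ennreal (s ^ (?n - 1)) * expm (ennreal (s powr p) * T) else 0)) = exp_const ?n p * epow T (- real ?n / p)" for T
  proof (cases T rule: ennreal_cases3)
    case 1
    have "(lint s. (if 0 < s then ennreal (s ^ (?n - 1)) * expm (ennreal (s powr p) * T) else 0))
       = (lint s. (if 0 < s \<and> ennreal s \<le> top then ennreal (s powr (real ?n - 1)) else 0))"
      using 1 DIM_positive[where 'a='a] by (intro nn_integral_cong) (auto simp: expm_def powr_realpow[symmetric] of_nat_diff)
    also have "\<dots> = top" by (subst nn_integral_powr_below) (auto simp: epow_top' ennreal_mult_top)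
    finally show ?thesis using 1 p exp_const(1)[OF p DIM_positive[where 'a='a]] by (simp add: epow_0 ennreal_mult_top)
  next
    case 2
    have "(lint s. (if 0 < s then ennreal (s ^ (?n - 1)) * expm (ennreal (s powr p) * T) else 0)) = (\<integral>\<^sup>+s. 0 \<partial>(lborel :: real measure))"
      using 2 by (intro nn_integral_cong) (auto simp: expm_def ennreal_mult_top)
    then show ?thesis using 2 p by (simp add: epow_top)
  next
    case (3 r)
    \<comment> \<open>Chosen so that c^p r = 1: the substitution of c s for s removes r from the
      exponent and leaves c^n = r^(-n / p) in front.\<close>
    define c where "c = r powr (- 1 / p)"
    have c: "0 < c" using 3 by (simp add: c_def)
    have "c powr p = r powr (- 1 / p * p)" by (simp only: c_def powr_powr)
    also have "- 1 / p * p = - 1" using p by simp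
    finally have cp: "c powr p * r = 1" using 3 by (simp add: powr_minus)
    let ?F = "\<lambda>s. if 0 < s then ennreal (s ^ (?n - 1)) * expm (ennreal (s powr p) * T) else 0"
    have "(lint s. ?F s) = ennreal \<bar>c\<bar> * (lint s. ?F (0 + c * s))"
      by (rule nn_integral_real_affine) (use c in auto)
    also have "\<dots> = ennreal c * (lint s. ennreal (c ^ (?n - 1)) * (if 0 < s then ennreal (s ^ (?n - 1) * exp (- (s powr p))) else 0))"
    proof -
      have "?F (0 + c * s) = ennreal (c ^ (?n - 1)) * (if 0 < s then ennreal (s ^ (?n - 1) * exp (- (s powr p))) else 0)" for s
      proof (cases "0 < s")
        case True
        have "(c * s) powr p * r = s powr p" using True c cp by (simp add: powr_mult)
        then have "ennreal ((c * s) powr p) * T = ennreal (s powr p)" using 3 by (simp flip: ennreal_mult)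
        then show ?thesis using True c by (simp add: expm_def power_mult_distrib mult.assoc flip: ennreal_mult)
      qed (use c in \<open>auto simp: zero_less_mult_iff\<close>)
      then show ?thesis using c by simp
    qed
    also have "\<dots> = ennreal c * (ennreal (c ^ (?n - 1)) * exp_const ?n p)"
      unfolding exp_const_def by (subst nn_integral_cmult) auto
    also have "\<dots> = exp_const ?n p * ennreal (c * c ^ (?n - 1))" using c by (simp add: ennreal_mult mult_ac)
    also have "c * c ^ (?n - 1) = c powr real ?n" using c DIM_positive[where 'a='a] by (simp add: powr_realpow power_eq_if)
    also have "c powr real ?n = r powr (- real ?n / p)" using 3 by (simp add: c_def powr_powr)
    finally show ?thesis using 3 by (simp add: epow_pos)
  qed
  have "(lint u. expm (S u)) = ennreal (1 / ln 2) *
     (lint v. ann v * (lint s. (if 0 < s then ennreal (s ^ (?n - 1)) * expm (S (s *\<^sub>R v)) else 0)))"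
    by (rule nn_integral_rays) measurable
  also have "(lint v. ann v * (lint s. (if 0 < s then ennreal (s ^ (?n - 1)) * expm (S (s *\<^sub>R v)) else 0)))
    = (lint v. exp_const ?n p * (ann v * epow (S v) (- real ?n / p)))"
  proof (rule nn_integral_cong)
    fix v :: 'a
    have "(lint s. (if 0 < s then ennreal (s ^ (?n - 1)) * expm (S (s *\<^sub>R v)) else 0))
      = (lint s. (if 0 < s then ennreal (s ^ (?n - 1)) * expm (ennreal (s powr p) * S v) else 0))"
      by (intro nn_integral_cong) (simp add: hom)
    also have "\<dots> = exp_const ?n p * epow (S v) (- real ?n / p)" by (rule main)
    finally have eq: "(lint s. (if 0 < s then ennreal (s ^ (?n - 1)) * expm (S (s *\<^sub>R v)) else 0)) = exp_const ?n p * epow (S v) (- real ?n / p)" .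
    show "ann v * (lint s. (if 0 < s then ennreal (s ^ (?n - 1)) * expm (S (s *\<^sub>R v)) else 0)) = exp_const ?n p * (ann v * epow (S v) (- real ?n / p))"
      unfolding eq by (simp only: mult_ac)
  qed
  also have "\<dots> = exp_const ?n p * (lint v. ann v * epow (S v) (- real ?n / p))"
  proof (rule nn_integral_cmult)
    have [measurable]: "(\<lambda>v. epow (S v) (- real ?n / p)) \<in> borel_measurable borel" by (rule measurable_compose[OF assms(2) epow_measurable])
    show "(\<lambda>v. ann v * epow (S v) (- real ?n / p)) \<in> borel_measurable lborel" by measurable
  qed
  finally show ?thesis by (simp add: mult.assoc)
qed

lemma annulus_exp_eq':
  fixes S :: "'a::euclidean_space \<Rightarrow> ennreal"
  assumes p: "0 < p" and "S \<in> borel_measurable borel" "\<And>t u. 0 < t \<Longrightarrow> S (t *\<^sub>R u) = ennreal (t powr p) * S u"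
  shows "(lint v. ann v * epow (S v) (- real DIM('a) / p)) = ennreal (ln 2 / enn2real (exp_const DIM('a) p)) * (lint u. expm (S u))"
proof -
  define c where "c = enn2real (exp_const DIM('a) p)"
  have cc: "exp_const DIM('a) p = ennreal c" and c: "0 < c"
    using exp_const[OF p DIM_positive[where 'a='a]] by (auto simp: c_def enn2real_positive_iff less_top zero_less_iff_neq_zero)
  have eq: "(lint u. expm (S u)) = ennreal (1 / ln 2) * exp_const DIM('a) p * (lint v. ann v * epow (S v) (- real DIM('a) / p))"
    by (rule annulus_exp_eq[OF assms])
  have "ennreal (ln 2 / c) * (lint u. expm (S u)) = (ennreal (ln 2 / c) * (ennreal (1 / ln 2) * ennreal c)) * (lint v. ann v * epow (S v) (- real DIM('a) / p))"
    unfolding eq cc by (simp only: mult.assoc)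
  also have "ennreal (ln 2 / c) * (ennreal (1 / ln 2) * ennreal c) = 1" using c by (simp flip: ennreal_mult)
  finally show ?thesis by (simp add: c_def)
qed

lemma star_vol_epow_pos:
  fixes S :: "'a::euclidean_space \<Rightarrow> ennreal"
  assumes p: "0 < p" and S: "S \<in> borel_measurable borel" and hom: "\<And>t u. 0 < t \<Longrightarrow> S (t *\<^sub>R u) = ennreal (t powr p) * S u"
  shows "star_vol (\<lambda>u. epow (S u) (- 1 / p)) =
    ennreal (1 / (real DIM('a) * ln 2)) * ennreal (ln 2 / enn2real (exp_const DIM('a) p)) * (lint u. expm (S u))"
proof -
  have "epow (S (t *\<^sub>R u)) (- 1 / p) = ennreal (1 / t) * epow (S u) (- 1 / p)" if "0 < t" for t u
    using that p by (simp add: hom epow_scale powr_powr powr_minus_divide)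
  from star_vol_homogeneous[OF measurable_compose[OF S epow_measurable] this]
  show ?thesis using annulus_exp_eq'[OF p S hom] by (simp add: epow_power mult.assoc)
qed

text \<open>The n-th power of the radial function is T^(n / q) = T^k; here the integrality of n / q
  enters.\<close>

lemma star_vol_epow_neg:
  fixes T :: "'a::euclidean_space \<Rightarrow> ennreal"
  assumes k: "0 < k" and q: "0 < q" and kq: "real k * q = real DIM('a)"
    and T: "T \<in> borel_measurable borel" and hom: "\<And>t u. 0 < t \<Longrightarrow> T (t *\<^sub>R u) = ennreal (t powr (- q)) * T u"
  shows "star_vol (\<lambda>u. epow (T u) (1 / q)) = ennreal (1 / (real DIM('a) * ln 2)) * (lint v. ann v * T v ^ k)"
proof -
  have "epow (T (t *\<^sub>R u)) (1 / q) = ennreal (1 / t) * epow (T u) (1 / q)" if "0 < t" for t u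
  proof -
    have "(t powr (- q)) powr (1 / q) = t powr (- 1)" using q by (simp add: powr_powr del: powr_minus)
    then show ?thesis using that by (simp only: hom epow_scale powr_gt_zero) (simp add: powr_minus_divide)
  qed
  note star_vol_homogeneous[OF measurable_compose[OF T epow_measurable] this]
  moreover have "1 / q * real DIM('a) = real k" using kq q by (simp add: field_simps)
  ultimately show ?thesis using k by (simp only: epow_power[OF DIM_positive] epow_nat)
qed

subsection \<open>Support functions of unconditional bodies\<close>

context
  fixes m :: nat and C :: "(nat \<Rightarrow> real) set"
  assumes C: "unconditional_body m C"
begin

lemma body_zero_outside: "c \<in> C \<Longrightarrow> m \<le> k \<Longrightarrow> c k = 0"
  using C by (auto simp: unconditional_body_def convex_body_Rm_def in_Rm_def)

lemma body_flip:
  assumes c: "c \<in> C" shows "(\<lambda>k. if k < m \<and> P k then - c k else c k) \<in> C"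
proof -
  have "(\<lambda>k. if k < n \<and> k < m \<and> P k then - c k else c k) \<in> C" for n
  proof (induction n)
    case 0 then show ?case using c by simp
  next
    case (Suc n)
    let ?c = "\<lambda>k. if k < n \<and> k < m \<and> P k then - c k else c k"
    show ?case
    proof (cases "n < m \<and> P n")
      case True
      have "?c(n := - ?c n) \<in> C" using Suc C True unfolding unconditional_body_def by blast
      moreover have "?c(n := - ?c n) = (\<lambda>k. if k < Suc n \<and> k < m \<and> P k then - c k else c k)"
        using True by (auto simp: fun_eq_iff less_Suc_eq)
      ultimately show ?thesis by simp
    next
      case False
      then have "?c = (\<lambda>k. if k < Suc n \<and> k < m \<and> P k then - c k else c k)"
        by (auto simp: fun_eq_iff less_Suc_eq)
      then show ?thesis using Suc by simp
    qed
  qed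
  from this[of m] show ?thesis by (simp cong: conj_cong)
qed

lemma body_bounded: "\<exists>B. \<forall>c\<in>C. \<forall>k. \<bar>c k\<bar> \<le> B"
proof -
  have "\<exists>B. \<forall>c\<in>C. \<bar>c k\<bar> \<le> B" for k
  proof -
    have "compact C" using C by (simp add: unconditional_body_def convex_body_Rm_def)
    then have "compact ((\<lambda>c. c k) ` C)"
      by (intro compact_continuous_image continuous_on_subset[OF continuous_on_product_coordinates]) auto
    then have "bounded ((\<lambda>c. c k) ` C)" by (rule compact_imp_bounded)
    then show ?thesis by (auto simp: bounded_iff)
  qed
  then obtain B where B: "\<And>k c. c \<in> C \<Longrightarrow> \<bar>c k\<bar> \<le> B k" by metis
  have "\<bar>c k\<bar> \<le> (\<Sum>k<m. \<bar>B k\<bar>)" if "c \<in> C" for c k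
  proof (cases "k < m")
    case True
    have "\<bar>c k\<bar> \<le> \<bar>B k\<bar>" using B[OF that, of k] by linarith
    also have "\<dots> \<le> (\<Sum>k<m. \<bar>B k\<bar>)" using True by (intro member_le_sum) auto
    finally show ?thesis .
  next
    case False then show ?thesis using body_zero_outside[OF that] by (simp add: sum_nonneg)
  qed
  then show ?thesis by blast
qed

lemma body_big_coordinate:
  "\<exists>e>0. \<forall>k<m. \<exists>c\<in>C. e \<le> \<bar>c k\<bar>"
proof -
  obtain x e where x: "in_Rm m x" "0 < e" "\<And>y. in_Rm m y \<Longrightarrow> (\<Sum>k<m. (y k - x k)\<^sup>2) < e\<^sup>2 \<Longrightarrow> y \<in> C"
    using C unfolding unconditional_body_def convex_body_Rm_def by blast
  have "\<exists>c\<in>C. e / 2 \<le> \<bar>c k\<bar>" if k: "k < m" for k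
  proof -
    \<comment> \<open>A step of half the inner radius away from 0 in coordinate k stays in the body
      and makes that coordinate large.\<close>
    define d where "d = (if 0 \<le> x k then e / 2 else - e / 2)"
    let ?y = "x(k := x k + d)"
    have "?y \<in> C"
    proof (rule x(3))
      show "in_Rm m ?y" using x(1) k by (auto simp: in_Rm_def)
      have "(\<Sum>j<m. (?y j - x j)\<^sup>2) = (\<Sum>j<m. if j = k then d\<^sup>2 else 0)" by (intro sum.cong) auto
      also have "\<dots> = d\<^sup>2" using k by simp
      also have "d\<^sup>2 < e\<^sup>2" using x(2) by (auto simp: d_def power2_eq_square)
      finally show "(\<Sum>j<m. (?y j - x j)\<^sup>2) < e\<^sup>2" .
    qed
    moreover have "e / 2 \<le> \<bar>?y k\<bar>" using x(2) by (auto simp: d_def)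
    ultimately show ?thesis by blast
  qed
  then show ?thesis using x(2) by (intro exI[of _ "e / 2"]) auto
qed

lemma body_nonempty: "C \<noteq> {}"
proof -
  obtain x e where x: "in_Rm m x" "0 < e" "\<And>y. in_Rm m y \<Longrightarrow> (\<Sum>k<m. (y k - x k)\<^sup>2) < e\<^sup>2 \<Longrightarrow> y \<in> C"
    using C unfolding unconditional_body_def convex_body_Rm_def by blast
  then have "x \<in> C" by simp
  then show ?thesis by blast
qed

lemma supp_bdd: "bdd_above ((\<lambda>c. \<Sum>k<m. c k * y k) ` C)"
proof -
  obtain B where B: "\<And>c k. c \<in> C \<Longrightarrow> \<bar>c k\<bar> \<le> B" using body_bounded by blast
  have "(\<Sum>k<m. c k * y k) \<le> (\<Sum>k<m. B * \<bar>y k\<bar>)" if "c \<in> C" for c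
  proof (rule sum_mono)
    fix k
    have "c k * y k \<le> \<bar>c k\<bar> * \<bar>y k\<bar>" by (metis abs_ge_self abs_mult)
    also have "\<dots> \<le> B * \<bar>y k\<bar>" using B[OF that] by (rule mult_right_mono) simp
    finally show "c k * y k \<le> B * \<bar>y k\<bar>" .
  qed
  then show ?thesis by (auto simp: bdd_above_def)
qed

text \<open>Sign changes of the coordinates of c, allowed in an unconditional body, make every term
  c k * y k nonnegative. Hence h(C, .) depends only on the moduli of the y k and increases with
  them, as a gauge must.\<close>

lemma supp_abs_le:
  assumes c: "c \<in> C" shows "(\<Sum>k<m. \<bar>c k\<bar> * \<bar>y k\<bar>) \<le> supp_fun m C y"
proof -
  let ?c = "\<lambda>k. if k < m \<and> c k * y k < 0 then - c k else c k"
  have "(\<Sum>k<m. \<bar>c k\<bar> * \<bar>y k\<bar>) = (\<Sum>k<m. ?c k * y k)"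
    by (intro sum.cong) (auto simp: abs_of_neg abs_of_nonneg simp flip: abs_mult)
  also have "\<dots> \<le> supp_fun m C y"
    unfolding supp_fun_def by (intro cSup_upper supp_bdd image_eqI[of _ _ ?c] refl body_flip[OF c])
  finally show ?thesis .
qed

lemma supp_le:
  assumes "\<And>c. c \<in> C \<Longrightarrow> (\<Sum>k<m. \<bar>c k\<bar> * \<bar>y k\<bar>) \<le> b"
  shows "supp_fun m C y \<le> b"
  unfolding supp_fun_def
proof (rule cSup_least)
  fix z assume "z \<in> (\<lambda>c. \<Sum>k<m. c k * y k) ` C"
  then obtain c where c: "c \<in> C" "z = (\<Sum>k<m. c k * y k)" by auto
  have "(\<Sum>k<m. c k * y k) \<le> (\<Sum>k<m. \<bar>c k\<bar> * \<bar>y k\<bar>)"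
    by (intro sum_mono) (metis abs_ge_self abs_mult)
  then show "z \<le> b" using assms[OF c(1)] c(2) by linarith
qed (use body_nonempty in auto)

lemma supp_nonneg: "0 \<le> supp_fun m C y"
proof -
  obtain c where "c \<in> C" using body_nonempty by auto
  from supp_abs_le[OF this, of y] show ?thesis by (meson abs_ge_zero mult_nonneg_nonneg order_trans sum_nonneg)
qed

lemma supp_mono: "(\<And>k. k < m \<Longrightarrow> \<bar>y k\<bar> \<le> \<bar>y' k\<bar>) \<Longrightarrow> supp_fun m C y \<le> supp_fun m C y'"
  by (rule supp_le) (auto intro!: order_trans[OF _ supp_abs_le] sum_mono mult_left_mono)

lemma supp_add: "supp_fun m C (\<lambda>k. y k + y' k) \<le> supp_fun m C y + supp_fun m C y'"
proof (rule supp_le)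
  fix c assume c: "c \<in> C"
  have "(\<Sum>k<m. \<bar>c k\<bar> * \<bar>y k + y' k\<bar>) \<le> (\<Sum>k<m. \<bar>c k\<bar> * \<bar>y k\<bar> + \<bar>c k\<bar> * \<bar>y' k\<bar>)"
    by (intro sum_mono) (simp add: mult_left_mono abs_triangle_ineq flip: distrib_left)
  also have "\<dots> \<le> supp_fun m C y + supp_fun m C y'"
    using supp_abs_le[OF c, of y] supp_abs_le[OF c, of y'] by (simp add: sum.distrib)
  finally show "(\<Sum>k<m. \<bar>c k\<bar> * \<bar>y k + y' k\<bar>) \<le> supp_fun m C y + supp_fun m C y'" .
qed

lemma supp_scale_le: "0 \<le> s \<Longrightarrow> supp_fun m C (\<lambda>k. s * y k) \<le> s * supp_fun m C y"
proof (rule supp_le)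
  fix c assume c: "c \<in> C" and s: "0 \<le> s"
  have "(\<Sum>k<m. \<bar>c k\<bar> * \<bar>s * y k\<bar>) = s * (\<Sum>k<m. \<bar>c k\<bar> * \<bar>y k\<bar>)" using s by (simp add: sum_distrib_left abs_mult mult_ac)
  also have "\<dots> \<le> s * supp_fun m C y" using supp_abs_le[OF c] s by (rule mult_left_mono)
  finally show "(\<Sum>k<m. \<bar>c k\<bar> * \<bar>s * y k\<bar>) \<le> s * supp_fun m C y" .
qed

lemma supp_scale: "0 \<le> s \<Longrightarrow> supp_fun m C (\<lambda>k. s * y k) = s * supp_fun m C y"
proof (cases "s = 0")
  case True then show ?thesis using supp_scale_le[of 0 y] supp_nonneg[of "\<lambda>k. 0 * y k"] by simp
next
  case False assume "0 \<le> s"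
  with False have s: "0 < s" by simp
  have "supp_fun m C (\<lambda>k. (1 / s) * (s * y k)) \<le> (1 / s) * supp_fun m C (\<lambda>k. s * y k)" using s by (intro supp_scale_le) simp
  then have "s * supp_fun m C y \<le> supp_fun m C (\<lambda>k. s * y k)" using s by (simp add: field_simps)
  then show ?thesis using supp_scale_le[of s y] s by simp
qed

lemma supp_convex:
  assumes l: "0 \<le> l" "l \<le> 1"
  shows "supp_fun m C (\<lambda>k. (1 - l) * y k + l * y' k) \<le> (1 - l) * supp_fun m C y + l * supp_fun m C y'"
  using supp_add[of "\<lambda>k. (1 - l) * y k" "\<lambda>k. l * y' k"] supp_scale_le[of "1 - l" y] supp_scale_le[of l y'] l by simp

text \<open>Used in \<open>Epow_half_ball\<close>: the bound by one coordinate reduces negative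
  moments of h to those of a single inner product.\<close>

lemma supp_lower: "\<exists>e>0. \<forall>k<m. \<forall>y. e * \<bar>y k\<bar> \<le> supp_fun m C y"
proof -
  obtain e where e: "0 < e" "\<And>k. k < m \<Longrightarrow> \<exists>c\<in>C. e \<le> \<bar>c k\<bar>" using body_big_coordinate by blast
  have "e * \<bar>y k\<bar> \<le> supp_fun m C y" if k: "k < m" for k y
  proof -
    obtain c where c: "c \<in> C" "e \<le> \<bar>c k\<bar>" using e(2)[OF k] by blast
    have "e * \<bar>y k\<bar> \<le> \<bar>c k\<bar> * \<bar>y k\<bar>" using c by (intro mult_right_mono) auto
    also have "\<dots> \<le> (\<Sum>k<m. \<bar>c k\<bar> * \<bar>y k\<bar>)" using k by (intro member_le_sum) auto
    also have "\<dots> \<le> supp_fun m C y" by (rule supp_abs_le[OF c(1)])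
    finally show ?thesis .
  qed
  then show ?thesis using e(1) by blast
qed

lemma supp_upper: "\<exists>B\<ge>0. \<forall>y. supp_fun m C y \<le> B * (\<Sum>k<m. \<bar>y k\<bar>)"
proof -
  obtain B where B: "\<And>c k. c \<in> C \<Longrightarrow> \<bar>c k\<bar> \<le> B" using body_bounded by blast
  have "supp_fun m C y \<le> \<bar>B\<bar> * (\<Sum>k<m. \<bar>y k\<bar>)" for y
  proof (rule supp_le)
    fix c assume "c \<in> C"
    then have "\<bar>c k\<bar> \<le> \<bar>B\<bar>" for k using B[of c k] by linarith
    then show "(\<Sum>k<m. \<bar>c k\<bar> * \<bar>y k\<bar>) \<le> \<bar>B\<bar> * (\<Sum>k<m. \<bar>y k\<bar>)"
      unfolding sum_distrib_left by (intro sum_mono mult_right_mono) auto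
  qed
  then show ?thesis by (intro exI[of _ "\<bar>B\<bar>"]) auto
qed

lemma supp_measurable: "supp_fun m C \<in> borel_measurable borel"
proof (rule borel_measurable_continuous_onI, rule continuous_at_imp_continuous_on, rule ballI)
  fix y0 :: "nat \<Rightarrow> real"
  obtain B where B: "0 \<le> B" "\<And>y. supp_fun m C y \<le> B * (\<Sum>k<m. \<bar>y k\<bar>)" using supp_upper by blast
  have le: "supp_fun m C y \<le> supp_fun m C y' + B * (\<Sum>k<m. \<bar>y k - y' k\<bar>)" for y y'
    using supp_add[of y' "\<lambda>k. y k - y' k"] B(2)[of "\<lambda>k. y k - y' k"] by simp
  have bd: "norm (supp_fun m C y - supp_fun m C y0) \<le> B * (\<Sum>k<m. \<bar>y k - y0 k\<bar>)" for y
    using le[of y y0] le[of y0 y] by (simp add: abs_minus_commute abs_le_iff)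
  have "continuous_on UNIV (\<lambda>y::nat \<Rightarrow> real. B * (\<Sum>k<m. \<bar>y k - y0 k\<bar>))"
    by (intro continuous_intros continuous_on_product_coordinates)
  then have "((\<lambda>y. B * (\<Sum>k<m. \<bar>y k - y0 k\<bar>)) \<longlongrightarrow> B * (\<Sum>k<m. \<bar>y0 k - y0 k\<bar>)) (at y0)"
    unfolding continuous_on_def by blast
  then have "((\<lambda>y. supp_fun m C y - supp_fun m C y0) \<longlongrightarrow> 0) (at y0)"
    by (intro Lim_null_comparison[OF always_eventually[OF allI[OF bd]]]) simp
  then show "isCont (supp_fun m C) y0" unfolding isCont_def by (simp add: LIM_zero_iff)
qed

lemma supp_compose_measurable:
  assumes [measurable]: "\<And>k. k < m \<Longrightarrow> (\<lambda>p. h p k) \<in> borel_measurable M"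
  shows "(\<lambda>p. supp_fun m C (h p)) \<in> borel_measurable M"
proof -
  have "(\<lambda>p k. if k < m then h p k else 0) \<in> borel_measurable M"
  proof (rule measurable_coordinatewise_then_product)
    fix k show "(\<lambda>p. if k < m then h p k else 0) \<in> borel_measurable M" using assms by (cases "k < m") auto
  qed
  from measurable_compose[OF this supp_measurable] have "(\<lambda>p. supp_fun m C (\<lambda>k. if k < m then h p k else 0)) \<in> borel_measurable M" .
  moreover have "supp_fun m C (\<lambda>k. if k < m then h p k else 0) = supp_fun m C (h p)" for p
    by (intro order_antisym supp_mono) auto
  ultimately show ?thesis by simp
qed

text \<open>The map e selects the variables that enter C, so one lemma covers both the bodies of a
  random family and the independent copies of a single body.\<close>

lemma gauge_fun_supp:
  assumes "\<And>j. j < m \<Longrightarrow> e j \<in> I"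
  shows "gauge_fun I (\<lambda>\<beta> y. supp_fun m C (\<lambda>j. y (e j)))"
  unfolding gauge_fun_def
proof (intro conjI allI impI)
  show "(\<lambda>p. supp_fun m C (\<lambda>j. snd p (e j))) \<in> borel_measurable (borel \<Otimes>\<^sub>M PiM I (\<lambda>_. borel))"
    using assms by (intro supp_compose_measurable) measurable
qed (auto simp: supp_nonneg supp_convex supp_scale assms intro!: supp_mono)

end

lemma gauge_fun_norm: "gauge_fun I (\<lambda>\<beta> y. \<beta>)"
  by (auto simp: gauge_fun_def)

lemma gauge_fun_sqrt:
  assumes i: "i \<in> I"
  shows "gauge_fun I (\<lambda>\<beta> y. sqrt ((y i)\<^sup>2 + \<alpha>\<^sup>2 * \<beta>\<^sup>2))"
  unfolding gauge_fun_def
proof (intro conjI allI impI)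
  show "(\<lambda>p. sqrt ((snd p i)\<^sup>2 + \<alpha>\<^sup>2 * (fst p)\<^sup>2)) \<in> borel_measurable (borel \<Otimes>\<^sub>M PiM I (\<lambda>_. borel))"
    using i by measurable
  have eq: "sqrt (a\<^sup>2 + \<alpha>\<^sup>2 * b\<^sup>2) = norm (a, \<alpha> * b)" for a b :: real
    by (simp add: norm_Pair power_mult_distrib)
  fix \<beta> \<beta>' l :: real and y y' :: "'a \<Rightarrow> real"
  { assume l: "0 \<le> l \<and> l \<le> 1"
    have "((1 - l) * y i + l * y' i, \<alpha> * ((1 - l) * \<beta> + l * \<beta>')) = (1 - l) *\<^sub>R (y i, \<alpha> * \<beta>) + l *\<^sub>R (y' i, \<alpha> * \<beta>')"
      by (simp add: algebra_simps)
    then have "norm ((1 - l) * y i + l * y' i, \<alpha> * ((1 - l) * \<beta> + l * \<beta>')) \<le> \<bar>1 - l\<bar> * norm (y i, \<alpha> * \<beta>) + \<bar>l\<bar> * norm (y' i, \<alpha> * \<beta>')"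
      by (simp only: norm_triangle_ineq flip: norm_scaleR)
    then show "sqrt (((1 - l) * y i + l * y' i)\<^sup>2 + \<alpha>\<^sup>2 * ((1 - l) * \<beta> + l * \<beta>')\<^sup>2)
      \<le> (1 - l) * sqrt ((y i)\<^sup>2 + \<alpha>\<^sup>2 * \<beta>\<^sup>2) + l * sqrt ((y' i)\<^sup>2 + \<alpha>\<^sup>2 * \<beta>'\<^sup>2)"
      unfolding eq using l by simp }
  { assume "0 \<le> \<beta>" "\<beta> \<le> \<beta>'" "\<forall>j\<in>I. \<bar>y j\<bar> \<le> \<bar>y' j\<bar>"
    then show "sqrt ((y i)\<^sup>2 + \<alpha>\<^sup>2 * \<beta>\<^sup>2) \<le> sqrt ((y' i)\<^sup>2 + \<alpha>\<^sup>2 * \<beta>'\<^sup>2)"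
      using i by (intro real_sqrt_le_mono add_mono mult_left_mono iffD1[OF abs_le_square_iff]) auto }
  { fix s :: real assume s: "0 \<le> s"
    have "(s * y i)\<^sup>2 + \<alpha>\<^sup>2 * (s * \<beta>)\<^sup>2 = s\<^sup>2 * ((y i)\<^sup>2 + \<alpha>\<^sup>2 * \<beta>\<^sup>2)" by (simp add: power_mult_distrib algebra_simps)
    then show "sqrt ((s * y i)\<^sup>2 + \<alpha>\<^sup>2 * (s * \<beta>)\<^sup>2) = s * sqrt ((y i)\<^sup>2 + \<alpha>\<^sup>2 * \<beta>\<^sup>2)"
      using s by (simp add: real_sqrt_mult) }
qed auto

subsection \<open>Expected volumes of random star bodies\<close>

text \<open>Both sides are linear in V, so it suffices to expand the volume into finitely many
  integrals of products. The expansion has a single term in \<open>expected_vol_pos\<close> and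
  \<open>expected_vol_zero\<close>, and one term per map \<sigma> in
  \<open>expected_vol_neg\<close>.\<close>

lemma expected_le_of_sum:
  fixes f :: "'i \<Rightarrow> 'a::euclidean_space \<Rightarrow> real" and H :: "'s \<Rightarrow> ('i \<Rightarrow> 'a) \<Rightarrow> ennreal"
  assumes I: "finite I" and f: "\<And>j. j \<in> I \<Longrightarrow> in_Pn (f j)" and Sf: "finite S"
    and H: "\<And>\<sigma>. \<sigma> \<in> S \<Longrightarrow> H \<sigma> \<in> borel_measurable (PiM I (\<lambda>_. lborel))"
    and V: "\<And>x. V x = c * (\<Sum>\<sigma>\<in>S. H \<sigma> x)"
    and le: "\<And>\<sigma>. \<sigma> \<in> S \<Longrightarrow> (\<integral>\<^sup>+x. H \<sigma> x * (\<Prod>j\<in>I. ennreal (f j (x j))) \<partial>PiM I (\<lambda>_. lebesgue))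
      \<le> (\<integral>\<^sup>+x. H \<sigma> x * (\<Prod>j\<in>I. ennreal (ball_rearr (f j) (r j) (x j))) \<partial>PiM I (\<lambda>_. lebesgue))"
  shows "(\<integral>\<^sup>+x. V x * (\<Prod>j\<in>I. ennreal (f j (x j))) \<partial>PiM I (\<lambda>_. lebesgue))
      \<le> (\<integral>\<^sup>+x. V x * (\<Prod>j\<in>I. ennreal (ball_rearr (f j) (r j) (x j))) \<partial>PiM I (\<lambda>_. lebesgue))"
proof -
  let ?M = "PiM I (\<lambda>_. lebesgue :: 'a measure)"
  have eq: "(\<integral>\<^sup>+x. V x * (\<Prod>j\<in>I. ennreal (g j (x j))) \<partial>?M) = c * (\<Sum>\<sigma>\<in>S. \<integral>\<^sup>+x. H \<sigma> x * (\<Prod>j\<in>I. ennreal (g j (x j))) \<partial>?M)"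
    if g[measurable]: "\<And>j. j \<in> I \<Longrightarrow> g j \<in> borel_measurable lebesgue" for g :: "'i \<Rightarrow> 'a \<Rightarrow> real"
  proof -
    have [measurable]: "(\<lambda>x. \<Prod>j\<in>I. ennreal (g j (x j))) \<in> borel_measurable ?M" by measurable
    have [measurable]: "H \<sigma> \<in> borel_measurable ?M" if "\<sigma> \<in> S" for \<sigma> by (rule measurable_PiM_lebesgue(1)[OF I H[OF that]])
    have "(\<integral>\<^sup>+x. V x * (\<Prod>j\<in>I. ennreal (g j (x j))) \<partial>?M) = (\<integral>\<^sup>+x. c * (\<Sum>\<sigma>\<in>S. H \<sigma> x * (\<Prod>j\<in>I. ennreal (g j (x j)))) \<partial>?M)"
      unfolding V by (simp add: sum_distrib_right mult.assoc)
    also have "\<dots> = c * (\<integral>\<^sup>+x. (\<Sum>\<sigma>\<in>S. H \<sigma> x * (\<Prod>j\<in>I. ennreal (g j (x j)))) \<partial>?M)" by (rule nn_integral_cmult) measurable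
    also have "(\<integral>\<^sup>+x. (\<Sum>\<sigma>\<in>S. H \<sigma> x * (\<Prod>j\<in>I. ennreal (g j (x j)))) \<partial>?M) = (\<Sum>\<sigma>\<in>S. \<integral>\<^sup>+x. H \<sigma> x * (\<Prod>j\<in>I. ennreal (g j (x j))) \<partial>?M)"
      by (rule nn_integral_sum) measurable
    finally show ?thesis .
  qed
  have fm: "f j \<in> borel_measurable lebesgue" if "j \<in> I" for j using f[OF that] by (simp add: in_Pn_def)
  have bm: "ball_rearr (f j) (r j) \<in> borel_measurable lebesgue" for j
  proof -
    have [measurable]: "cball (0::'a) (r j) \<in> sets lebesgue" by (rule sets_completionI_sets) (simp add: borel_closed)
    show ?thesis unfolding ball_rearr_def by measurable
  qed
  show ?thesis unfolding eq[OF bm] by (subst eq[OF fm], assumption) (intro mult_left_mono sum_mono le, auto)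
qed

section \<open>Expected volumes for finitely many gauges, by the sign of the exponent\<close>

context
  fixes I :: "'i set" and f :: "'i \<Rightarrow> 'a::euclidean_space \<Rightarrow> real" and r :: "'i \<Rightarrow> real" and N :: nat
    and g :: "nat \<Rightarrow> real \<Rightarrow> ('i \<Rightarrow> real) \<Rightarrow> real"
  assumes I: "finite I" and f: "\<And>j. j \<in> I \<Longrightarrow> in_Pn (f j)" and r: "\<And>j. j \<in> I \<Longrightarrow> 0 < r j"
    and r1: "\<And>j. j \<in> I \<Longrightarrow> (\<integral>\<^sup>+x. ennreal (ball_rearr (f j) (r j) x) \<partial>lebesgue) = 1"
    and N: "0 < N" and g: "\<And>i. i < N \<Longrightarrow> gauge_fun I (g i)"
begin

lemma gauge_at_measurable_UNIV: "i < N \<Longrightarrow> (\<lambda>u::'a. gauge_at (g i) x u) \<in> borel_measurable borel"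
  by (rule gauge_fun_measurable[OF g]) auto

lemma gauge_at_scale_ennreal:
  fixes x :: "'i \<Rightarrow> 'a"
  assumes "i < N" "0 < t"
  shows "ennreal (gauge_at (g i) x (t *\<^sub>R u)) = ennreal t * ennreal (gauge_at (g i) x u)"
  unfolding gauge_at_scale[OF g[OF assms(1)] less_imp_le[OF assms(2)]]
  by (rule ennreal_mult[OF less_imp_le[OF assms(2)] gauge_at_nonneg[OF g[OF assms(1)]]])

lemma integral_gauges_measurable:
  assumes "finite L" "\<And>l. l \<in> L \<Longrightarrow> \<sigma> l < N" "\<And>l. l \<in> L \<Longrightarrow> \<phi> l \<in> borel_measurable borel"
  shows "(\<lambda>x. \<integral>\<^sup>+u. (\<Prod>l\<in>L. \<phi> l (gauge_at (g (\<sigma> l)) x (u::'a))) \<partial>lborel) \<in> borel_measurable (PiM I (\<lambda>_. lborel))"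
proof -
  have [measurable]: "(\<lambda>p. \<phi> l (gauge_at (g (\<sigma> l)) (fst p) (snd p :: 'a))) \<in> borel_measurable (PiM I (\<lambda>_. lborel) \<Otimes>\<^sub>M lborel)" if "l \<in> L" for l
    by (rule measurable_compose[OF gauge_at_measurable(1)[OF g[OF assms(2)[OF that]]] assms(3)[OF that]])
  have "(\<lambda>p. \<Prod>l\<in>L. \<phi> l (gauge_at (g (\<sigma> l)) (fst p) (snd p :: 'a))) \<in> borel_measurable (PiM I (\<lambda>_. lborel) \<Otimes>\<^sub>M lborel)"
    by measurable
  then show ?thesis by (intro lborel.borel_measurable_nn_integral) (simp add: case_prod_beta')
qed

text \<open>The exponential of -\<rho>^(-p) turns the sum over i into a product of N decreasing
  functions of single gauges, the shape covered by
  \<open>integral_gauges_le_ball_rearr\<close>.\<close>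

lemma expected_vol_pos:
  assumes p: "0 < p"
  shows "(\<integral>\<^sup>+x. star_vol (\<lambda>u. epow (ennreal (1 / real N) * (\<Sum>i<N. epow (ennreal (gauge_at (g i) x u)) p)) (- 1 / p)) * (\<Prod>j\<in>I. ennreal (f j (x j))) \<partial>PiM I (\<lambda>_. lebesgue))
      \<le> (\<integral>\<^sup>+x. star_vol (\<lambda>u. epow (ennreal (1 / real N) * (\<Sum>i<N. epow (ennreal (gauge_at (g i) x u)) p)) (- 1 / p)) * (\<Prod>j\<in>I. ennreal (ball_rearr (f j) (r j) (x j))) \<partial>PiM I (\<lambda>_. lebesgue))"
proof -
  let ?n = "DIM('a)"
  define \<phi> :: "nat \<Rightarrow> real \<Rightarrow> ennreal" where "\<phi> = (\<lambda>_ t. expm (ennreal (1 / real N) * epow (ennreal t) p))"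
  have \<phi>m: "\<phi> l \<in> borel_measurable borel" for l
  proof -
    have [measurable]: "(\<lambda>t. epow (ennreal t) p) \<in> borel_measurable borel" by (rule measurable_compose[OF measurable_ennreal epow_measurable])
    show ?thesis unfolding \<phi>_def by measurable
  qed
  have \<phi>_eq: "\<phi> l t = ennreal (exp (- (t powr p / real N)))" if "0 \<le> t" for l t
    using that p N by (cases "t = 0") (auto simp: \<phi>_def expm_def epow_0' epow_pos simp flip: ennreal_mult)
  have \<phi>a: "\<phi> l b \<le> \<phi> l a" if "0 \<le> a" "a \<le> b" for l a b
    using that p N by (auto simp: \<phi>_eq intro!: ennreal_leI divide_right_mono powr_mono2)
  have vol: "star_vol (\<lambda>u. epow (ennreal (1 / real N) * (\<Sum>i<N. epow (ennreal (gauge_at (g i) x u)) p)) (- 1 / p))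
     = (ennreal (1 / (real ?n * ln 2)) * ennreal (ln 2 / enn2real (exp_const ?n p))) * (\<Sum>\<sigma>\<in>{()}. \<integral>\<^sup>+u. (\<Prod>i<N. \<phi> i (gauge_at (g i) x u)) \<partial>lborel)" for x :: "'i \<Rightarrow> 'a"
  proof -
    define S where "S u = ennreal (1 / real N) * (\<Sum>i<N. epow (ennreal (gauge_at (g i) x u)) p)" for u
    have [measurable]: "(\<lambda>u. epow (ennreal (gauge_at (g i) x u)) p) \<in> borel_measurable borel" if "i < N" for i
      by (rule measurable_compose[OF measurable_compose[OF gauge_at_measurable_UNIV[OF that] measurable_ennreal] epow_measurable])
    have Sm[measurable]: "S \<in> borel_measurable borel" unfolding S_def by measurable
    have Shom: "S (t *\<^sub>R u) = ennreal (t powr p) * S u" if t: "0 < t" for t u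
    proof -
      have "(\<Sum>i<N. epow (ennreal (gauge_at (g i) x (t *\<^sub>R u))) p) = (\<Sum>i<N. ennreal (t powr p) * epow (ennreal (gauge_at (g i) x u)) p)"
      proof (rule sum.cong[OF refl])
        fix i assume "i \<in> {..<N}"
        then have "ennreal (gauge_at (g i) x (t *\<^sub>R u)) = ennreal t * ennreal (gauge_at (g i) x u)"
          using t by (simp only: lessThan_iff gauge_at_scale_ennreal)
        then show "epow (ennreal (gauge_at (g i) x (t *\<^sub>R u))) p = ennreal (t powr p) * epow (ennreal (gauge_at (g i) x u)) p"
          using t by (simp only: epow_scale)
      qed
      then show ?thesis by (simp only: S_def sum_distrib_left[symmetric] mult_ac)
    qed
    note star_vol_epow_pos[OF p Sm Shom]
    also have "(lint u. expm (S u)) = (lint u. (\<Prod>i<N. \<phi> i (gauge_at (g i) x u)))"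
    proof (rule nn_integral_cong)
      fix u :: 'a
      let ?h = "\<lambda>i. gauge_at (g i) x u"
      have h0: "0 \<le> ?h i" if "i < N" for i using gauge_at_nonneg[OF g[OF that]] .
      have e: "epow (ennreal (?h i)) p = ennreal (?h i powr p)" if "i < N" for i
        using h0[OF that] p by (cases "?h i = 0") (auto simp: epow_0' epow_pos)
      have "S u = ennreal (1 / real N) * (\<Sum>i<N. ennreal (?h i powr p))" unfolding S_def by (simp add: e)
      also have "\<dots> = ennreal ((\<Sum>i<N. ?h i powr p / real N))"
        by (simp add: sum_nonneg sum_divide_distrib[symmetric] flip: ennreal_mult)
      finally have "expm (S u) = ennreal (exp (- (\<Sum>i<N. ?h i powr p / real N)))"
        by (simp add: expm_def sum_nonneg)
      also have "\<dots> = (\<Prod>i<N. ennreal (exp (- (?h i powr p / real N))))"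
        by (subst prod_ennreal) (simp_all add: exp_sum sum_negf[symmetric])
      also have "\<dots> = (\<Prod>i<N. \<phi> i (?h i))" using h0 by (intro prod.cong) (auto simp: \<phi>_eq)
      finally show "expm (S u) = (\<Prod>i<N. \<phi> i (?h i))" .
    qed
    finally show ?thesis by (simp add: S_def)
  qed
  show ?thesis
  proof (rule expected_le_of_sum[OF I f _ _ vol])
    show "(\<lambda>x. \<integral>\<^sup>+u. (\<Prod>i<N. \<phi> i (gauge_at (g i) x (u::'a))) \<partial>lborel) \<in> borel_measurable (PiM I (\<lambda>_. lborel))"
      using \<phi>m by (intro integral_gauges_measurable) auto
    show "(\<integral>\<^sup>+x. (lint u. (\<Prod>i<N. \<phi> i (gauge_at (g i) x u))) * (\<Prod>j\<in>I. ennreal (f j (x j))) \<partial>PiM I (\<lambda>_. lebesgue))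
      \<le> (\<integral>\<^sup>+x. (lint u. (\<Prod>i<N. \<phi> i (gauge_at (g i) x u))) * (\<Prod>j\<in>I. ennreal (ball_rearr (f j) (r j) (x j))) \<partial>PiM I (\<lambda>_. lebesgue))"
      using g \<phi>a \<phi>m f r r1 by (intro integral_gauges_le_ball_rearr[OF I]) auto
  qed auto
qed

lemma annulus_gauges_eq:
  fixes x :: "'i \<Rightarrow> 'a"
  assumes k: "0 < k" and q: "0 < q" and kq: "real k * q = real DIM('a)" and \<sigma>: "\<And>l. l < k \<Longrightarrow> \<sigma> l < N"
  shows "(lint v. ann v * (\<Prod>l<k. epow (ennreal (gauge_at (g (\<sigma> l)) x v)) (- q)))
     = ennreal (q * ln 2) * (lint u. (\<Prod>l<k. cut_pow q l (gauge_at (g (\<sigma> l)) x u)))"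
  by (rule annulus_prod_eq[OF k q kq, of "\<lambda>l. gauge_at (g (\<sigma> l)) x"])
    (rule gauge_at_measurable_UNIV gauge_at_nonneg[OF g] gauge_at_scale[OF g]; (assumption | erule \<sigma>))+

lemma expected_gauges_cut_pow:
  assumes "0 < q" "\<And>l. l < k \<Longrightarrow> \<sigma> l < N"
  shows "(\<integral>\<^sup>+x. (lint u. (\<Prod>l<k. cut_pow q l (gauge_at (g (\<sigma> l)) x u))) * (\<Prod>j\<in>I. ennreal (f j (x j))) \<partial>PiM I (\<lambda>_. lebesgue))
      \<le> (\<integral>\<^sup>+x. (lint u. (\<Prod>l<k. cut_pow q l (gauge_at (g (\<sigma> l)) x u))) * (\<Prod>j\<in>I. ennreal (ball_rearr (f j) (r j) (x j))) \<partial>PiM I (\<lambda>_. lebesgue))"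
  using assms by (intro integral_gauges_le_ball_rearr[OF I _ g _ _ f r r1]) (auto intro: cut_pow_antimono)

text \<open>The k-th power of a sum of N terms runs over all maps \<sigma> from k indices to N. Such
  a map may repeat an index; the rearrangement inequality allows gauges that share
  variables.\<close>

lemma expected_vol_neg:
  assumes k: "0 < k" and q: "0 < q" and kq: "real k * q = real DIM('a)"
  shows "(\<integral>\<^sup>+x. star_vol (\<lambda>u. epow (ennreal (1 / real N) * (\<Sum>i<N. epow (ennreal (gauge_at (g i) x u)) (- q))) (1 / q)) * (\<Prod>j\<in>I. ennreal (f j (x j))) \<partial>PiM I (\<lambda>_. lebesgue))
      \<le> (\<integral>\<^sup>+x. star_vol (\<lambda>u. epow (ennreal (1 / real N) * (\<Sum>i<N. epow (ennreal (gauge_at (g i) x u)) (- q))) (1 / q)) * (\<Prod>j\<in>I. ennreal (ball_rearr (f j) (r j) (x j))) \<partial>PiM I (\<lambda>_. lebesgue))"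
proof -
  let ?n = "DIM('a)" and ?S = "PiE {..<k} (\<lambda>_. {..<N})"
  have \<sigma>: "\<sigma> l < N" if "\<sigma> \<in> ?S" "l < k" for \<sigma> l using that by (auto simp: PiE_iff)
  have vol: "star_vol (\<lambda>u. epow (ennreal (1 / real N) * (\<Sum>i<N. epow (ennreal (gauge_at (g i) x u)) (- q))) (1 / q))
     = (ennreal (1 / (real ?n * ln 2)) * ennreal (1 / real N) ^ k * ennreal (q * ln 2)) * (\<Sum>\<sigma>\<in>?S. \<integral>\<^sup>+u. (\<Prod>l<k. cut_pow q l (gauge_at (g (\<sigma> l)) x u)) \<partial>lborel)" for x :: "'i \<Rightarrow> 'a"
  proof -
    let ?e = "\<lambda>i u. epow (ennreal (gauge_at (g i) x u)) (- q)"
    define T where "T u = ennreal (1 / real N) * (\<Sum>i<N. ?e i u)" for u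
    have em[measurable]: "?e i \<in> borel_measurable borel" if "i < N" for i
      by (rule measurable_compose[OF measurable_compose[OF gauge_at_measurable_UNIV[OF that] measurable_ennreal] epow_measurable])
    have Tm[measurable]: "T \<in> borel_measurable borel" unfolding T_def by measurable
    have Thom: "T (t *\<^sub>R u) = ennreal (t powr (- q)) * T u" if t: "0 < t" for t u
    proof -
      have "(\<Sum>i<N. ?e i (t *\<^sub>R u)) = (\<Sum>i<N. ennreal (t powr (- q)) * ?e i u)"
      proof (rule sum.cong[OF refl])
        fix i assume "i \<in> {..<N}"
        then have "ennreal (gauge_at (g i) x (t *\<^sub>R u)) = ennreal t * ennreal (gauge_at (g i) x u)"
          using t by (simp only: lessThan_iff gauge_at_scale_ennreal)
        then show "?e i (t *\<^sub>R u) = ennreal (t powr (- q)) * ?e i u" using t by (simp only: epow_scale)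
      qed
      then show ?thesis by (simp only: T_def sum_distrib_left[symmetric] mult_ac)
    qed
    note star_vol_epow_neg[OF k q kq Tm Thom]
    also have "(lint v. ann v * T v ^ k) = (lint v. ennreal (1 / real N) ^ k * (\<Sum>\<sigma>\<in>?S. ann v * (\<Prod>l<k. ?e (\<sigma> l) v)))"
    proof (rule nn_integral_cong)
      fix v :: 'a
      have "(\<Sum>i<N. ?e i v) ^ k = (\<Prod>l<k. \<Sum>i<N. ?e i v)" by simp
      also have "\<dots> = (\<Sum>\<sigma>\<in>?S. \<Prod>l<k. ?e (\<sigma> l) v)" by (rule prod_sum_PiE) auto
      finally have "(\<Sum>i<N. ?e i v) ^ k = (\<Sum>\<sigma>\<in>?S. \<Prod>l<k. ?e (\<sigma> l) v)" .
      then have "ann v * T v ^ k = ann v * (ennreal (1 / real N) ^ k * (\<Sum>\<sigma>\<in>?S. \<Prod>l<k. ?e (\<sigma> l) v))"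
        by (simp only: T_def power_mult_distrib)
      then show "ann v * T v ^ k = ennreal (1 / real N) ^ k * (\<Sum>\<sigma>\<in>?S. ann v * (\<Prod>l<k. ?e (\<sigma> l) v))"
        by (simp only: sum_distrib_left[symmetric] mult.left_commute)
    qed
    also have "\<dots> = ennreal (1 / real N) ^ k * (lint v. (\<Sum>\<sigma>\<in>?S. ann v * (\<Prod>l<k. ?e (\<sigma> l) v)))"
      using \<sigma> by (intro nn_integral_cmult borel_measurable_sum borel_measurable_times_ennreal borel_measurable_prod_ennreal) auto
    also have "(lint v. (\<Sum>\<sigma>\<in>?S. ann v * (\<Prod>l<k. ?e (\<sigma> l) v))) = (\<Sum>\<sigma>\<in>?S. \<integral>\<^sup>+v. ann v * (\<Prod>l<k. ?e (\<sigma> l) v) \<partial>lborel)"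
      using \<sigma> by (intro nn_integral_sum borel_measurable_times_ennreal borel_measurable_prod_ennreal) auto
    also have "\<dots> = (\<Sum>\<sigma>\<in>?S. ennreal (q * ln 2) * (lint u. (\<Prod>l<k. cut_pow q l (gauge_at (g (\<sigma> l)) x u))))"
      using \<sigma> by (intro sum.cong refl annulus_gauges_eq[OF k q kq]) auto
    also have "\<dots> = ennreal (q * ln 2) * (\<Sum>\<sigma>\<in>?S. \<integral>\<^sup>+u. (\<Prod>l<k. cut_pow q l (gauge_at (g (\<sigma> l)) x u)) \<partial>lborel)"
      by (simp only: sum_distrib_left)
    finally show ?thesis by (simp only: T_def mult.assoc)
  qed
  show ?thesis
  proof (rule expected_le_of_sum[OF I f _ _ vol])
    show "finite ?S" by (intro finite_PiE) auto
    show "(\<lambda>x. \<integral>\<^sup>+u. (\<Prod>l<k. cut_pow q l (gauge_at (g (\<sigma> l)) x (u::'a))) \<partial>lborel) \<in> borel_measurable (PiM I (\<lambda>_. lborel))" if "\<sigma> \<in> ?S" for \<sigma>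
      using \<sigma>[OF that] by (intro integral_gauges_measurable) auto
  qed (use \<sigma> q expected_gauges_cut_pow in auto)
qed

text \<open>The n-th power of the radial function is already a product, of the powers h^(-n / N)
  over all i. N plays the part of k, and q = n / N satisfies N q = n as
  \<open>annulus_prod_eq\<close> demands.\<close>

lemma expected_vol_zero:
  shows "(\<integral>\<^sup>+x. star_vol (\<lambda>u. epow (\<Prod>i<N. ennreal (gauge_at (g i) x u)) (- 1 / real N)) * (\<Prod>j\<in>I. ennreal (f j (x j))) \<partial>PiM I (\<lambda>_. lebesgue))
      \<le> (\<integral>\<^sup>+x. star_vol (\<lambda>u. epow (\<Prod>i<N. ennreal (gauge_at (g i) x u)) (- 1 / real N)) * (\<Prod>j\<in>I. ennreal (ball_rearr (f j) (r j) (x j))) \<partial>PiM I (\<lambda>_. lebesgue))"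
proof -
  let ?n = "DIM('a)"
  define q where "q = real ?n / real N"
  have q: "0 < q" using N by (simp add: q_def)
  have Nq: "real N * q = real ?n" using N by (simp add: q_def)
  have vol: "star_vol (\<lambda>u. epow (\<Prod>i<N. ennreal (gauge_at (g i) x u)) (- 1 / real N))
     = (ennreal (1 / (real ?n * ln 2)) * ennreal (q * ln 2)) * (\<Sum>\<sigma>\<in>{()}. \<integral>\<^sup>+u. (\<Prod>l<N. cut_pow q l (gauge_at (g l) x u)) \<partial>lborel)" for x :: "'i \<Rightarrow> 'a"
  proof -
    have hm[measurable]: "(\<lambda>u. gauge_at (g i) x u) \<in> borel_measurable borel" if "i < N" for i by (rule gauge_at_measurable_UNIV[OF that])
    have pm: "(\<lambda>u. \<Prod>i<N. ennreal (gauge_at (g i) x u)) \<in> borel_measurable borel" by measurable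
    have "star_vol (\<lambda>u. epow (\<Prod>i<N. ennreal (gauge_at (g i) x u)) (- 1 / real N)) = ennreal (1 / (real ?n * ln 2)) * (lint v. ann v * epow (\<Prod>i<N. ennreal (gauge_at (g i) x v)) (- 1 / real N) ^ ?n)"
    proof (rule star_vol_homogeneous)
      show "(\<lambda>u. epow (\<Prod>i<N. ennreal (gauge_at (g i) x u)) (- 1 / real N)) \<in> borel_measurable borel" by (rule measurable_compose[OF pm epow_measurable])
      fix t :: real and u :: 'a assume t: "0 < t"
      have "(\<Prod>i<N. ennreal (gauge_at (g i) x (t *\<^sub>R u))) = (\<Prod>i<N. ennreal t * ennreal (gauge_at (g i) x u))"
      proof (rule prod.cong[OF refl])
        fix i assume "i \<in> {..<N}"
        then show "ennreal (gauge_at (g i) x (t *\<^sub>R u)) = ennreal t * ennreal (gauge_at (g i) x u)"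
          using t by (simp only: lessThan_iff gauge_at_scale_ennreal)
      qed
      also have "\<dots> = ennreal (t ^ N) * (\<Prod>i<N. ennreal (gauge_at (g i) x u))" using t by (simp add: prod.distrib ennreal_power)
      finally have "epow (\<Prod>i<N. ennreal (gauge_at (g i) x (t *\<^sub>R u))) (- 1 / real N) = ennreal ((t ^ N) powr (- 1 / real N)) * epow (\<Prod>i<N. ennreal (gauge_at (g i) x u)) (- 1 / real N)"
        using t by (simp only: epow_scale zero_less_power)
      also have "(t ^ N) powr (- 1 / real N) = 1 / t" using t N by (simp add: powr_realpow[symmetric] powr_powr powr_minus_divide)
      finally show "epow (\<Prod>i<N. ennreal (gauge_at (g i) x (t *\<^sub>R u))) (- 1 / real N) = ennreal (1 / t) * epow (\<Prod>i<N. ennreal (gauge_at (g i) x u)) (- 1 / real N)" .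
    qed
    also have "(lint v. ann v * epow (\<Prod>i<N. ennreal (gauge_at (g i) x v)) (- 1 / real N) ^ ?n) = (lint v. ann v * (\<Prod>i<N. epow (ennreal (gauge_at (g i) x v)) (- q)))"
    proof -
      have "epow (\<Prod>i<N. ennreal (gauge_at (g i) x v)) (- 1 / real N) ^ ?n = (\<Prod>i<N. epow (ennreal (gauge_at (g i) x v)) (- q))" for v
      proof -
        have "- 1 / real N * real ?n = - q" by (simp add: q_def)
        then have "epow (\<Prod>i<N. ennreal (gauge_at (g i) x v)) (- 1 / real N) ^ ?n = epow (\<Prod>i<N. ennreal (gauge_at (g i) x v)) (- q)"
          by (simp only: epow_power[OF DIM_positive])
        also have "\<dots> = (\<Prod>i<N. epow (ennreal (gauge_at (g i) x v)) (- q))" using q by (intro epow_prod) auto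
        finally show ?thesis .
      qed
      then show ?thesis by simp
    qed
    also have "\<dots> = ennreal (q * ln 2) * (lint u. (\<Prod>l<N. cut_pow q l (gauge_at (g l) x u)))"
      using annulus_gauges_eq[OF N q Nq, of "\<lambda>l. l" x] by simp
    finally show ?thesis by (simp add: mult.assoc)
  qed
  show ?thesis
  proof (rule expected_le_of_sum[OF I f _ _ vol])
    show "(\<lambda>x. \<integral>\<^sup>+u. (\<Prod>l<N. cut_pow q l (gauge_at (g l) x (u::'a))) \<partial>lborel) \<in> borel_measurable (PiM I (\<lambda>_. lborel))"
      by (intro integral_gauges_measurable) auto
  qed (use q expected_gauges_cut_pow[of q N "\<lambda>l. l"] in auto)
qed

end

subsection \<open>Products of independent blocks\<close>

lemma nn_integral_PiM_reindex:
  fixes F :: "('i \<Rightarrow> 'a::euclidean_space) \<Rightarrow> ennreal" and e :: "'i \<Rightarrow> 'j"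
  assumes A: "finite A" and e: "inj_on e A" and F: "F \<in> borel_measurable (PiM A (\<lambda>_. lborel))"
  shows "(\<integral>\<^sup>+x. F (\<lambda>i\<in>A. x (e i)) \<partial>PiM (e ` A) (\<lambda>_. lborel)) = (\<integral>\<^sup>+x. F x \<partial>PiM A (\<lambda>_. lborel))"
proof -
  let ?M = "PiM (e ` A) (\<lambda>_. lborel :: 'a measure)" and ?T = "\<lambda>x::'j \<Rightarrow> 'a. \<lambda>i\<in>A. x (e i)"
  have T[measurable]: "?T \<in> ?M \<rightarrow>\<^sub>M PiM A (\<lambda>_. lborel)" by (rule measurable_restrict) auto
  have "distr ?M (PiM A (\<lambda>_. lborel)) ?T = PiM A (\<lambda>_. lborel)"
  proof (rule lborel_PiM.PiM_eqI[OF A])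
    fix B :: "'i \<Rightarrow> 'a set" assume B: "\<And>i. i \<in> A \<Longrightarrow> B i \<in> sets lborel"
    have "emeasure (distr ?M (PiM A (\<lambda>_. lborel)) ?T) (Pi\<^sub>E A B) = emeasure ?M (?T -` Pi\<^sub>E A B \<inter> space ?M)"
      using B A by (intro emeasure_distr T sets_PiM_I_finite) auto
    also have "?T -` Pi\<^sub>E A B \<inter> space ?M = Pi\<^sub>E (e ` A) (\<lambda>j. B (the_inv_into A e j))"
      using e by (auto simp: space_PiM PiE_iff the_inv_into_f_f)
    also have "emeasure ?M \<dots> = (\<Prod>j\<in>e ` A. emeasure lborel (B (the_inv_into A e j)))"
      using A B e by (intro lborel_PiM.emeasure_PiM) (auto simp: the_inv_into_f_f)
    also have "\<dots> = (\<Prod>i\<in>A. emeasure lborel (B i))"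
      using e by (simp add: prod.reindex the_inv_into_f_f)
    finally show "emeasure (distr ?M (PiM A (\<lambda>_. lborel)) ?T) (Pi\<^sub>E A B) = (\<Prod>i\<in>A. emeasure lborel (B i))" .
  qed simp
  then have "(\<integral>\<^sup>+x. F x \<partial>PiM A (\<lambda>_. lborel)) = (\<integral>\<^sup>+x. F x \<partial>distr ?M (PiM A (\<lambda>_. lborel)) ?T)" by simp
  also have "\<dots> = (\<integral>\<^sup>+x. F (?T x) \<partial>?M)" by (rule nn_integral_distr[OF T]) (use F in simp)
  finally show ?thesis by simp
qed

lemma finite_idx: "finite (idx N m)" by (auto simp: idx_def)

text \<open>The index (l, j) is the j-th variable of the l-th copy; splitting off the last copy
  shows by induction that independent copies factor.\<close>

lemma nn_integral_blocks:
  fixes G :: "nat \<Rightarrow> (nat \<Rightarrow> 'a::euclidean_space) \<Rightarrow> ennreal"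
  assumes "\<And>l. l < k \<Longrightarrow> G l \<in> borel_measurable (PiM {..<m} (\<lambda>_. lborel))"
  shows "(\<integral>\<^sup>+x. (\<Prod>l<k. G l (\<lambda>j\<in>{..<m}. x (l, j))) \<partial>PiM (idx k (\<lambda>_. m)) (\<lambda>_. lborel)) = (\<Prod>l<k. \<integral>\<^sup>+x. G l x \<partial>PiM {..<m} (\<lambda>_. lborel))"
  using assms
proof (induction k)
  case 0
  have "idx 0 (\<lambda>_. m) = {}" by (auto simp: idx_def)
  then show ?case by (simp add: PiM_empty nn_integral_count_space_finite)
next
  case (Suc k)
  let ?A = "idx k (\<lambda>_. m)" and ?B = "Pair k ` {..<m}"
  let ?b = "\<lambda>l (x :: nat \<times> nat \<Rightarrow> 'a). \<lambda>j\<in>{..<m}. x (l, j)"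
  have split: "idx (Suc k) (\<lambda>_. m) = ?A \<union> ?B" by (auto simp: idx_def less_Suc_eq)
  have disj: "?A \<inter> ?B = {}" by (auto simp: idx_def)
  have bm: "?b l \<in> PiM J (\<lambda>_. lborel) \<rightarrow>\<^sub>M PiM {..<m} (\<lambda>_. lborel)" if "\<And>j. j < m \<Longrightarrow> (l, j) \<in> J" for l J
    using that by (intro measurable_restrict) auto
  have Gm: "(\<lambda>x. G l (?b l x)) \<in> borel_measurable (PiM J (\<lambda>_. lborel))" if "l < Suc k" "\<And>j. j < m \<Longrightarrow> (l, j) \<in> J" for l J
    by (rule measurable_compose[OF bm Suc.prems]) (use that in auto)
  have "(\<integral>\<^sup>+x. (\<Prod>l<Suc k. G l (?b l x)) \<partial>PiM (idx (Suc k) (\<lambda>_. m)) (\<lambda>_. lborel))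
    = (\<integral>\<^sup>+x. \<integral>\<^sup>+y. (\<Prod>l<Suc k. G l (?b l (merge ?A ?B (x, y)))) \<partial>PiM ?B (\<lambda>_. lborel) \<partial>PiM ?A (\<lambda>_. lborel))"
    unfolding split
  proof (rule lborel_PiM.product_nn_integral_fold[OF disj finite_idx])
    show "(\<lambda>x. \<Prod>l<Suc k. G l (?b l x)) \<in> borel_measurable (PiM (?A \<union> ?B) (\<lambda>_. lborel))"
      by (intro borel_measurable_prod_ennreal Gm) (auto simp: idx_def less_Suc_eq)
  qed simp
  also have "\<dots> = (\<integral>\<^sup>+x. (\<Prod>l<k. G l (?b l x)) * (\<integral>\<^sup>+x. G k x \<partial>PiM {..<m} (\<lambda>_. lborel)) \<partial>PiM ?A (\<lambda>_. lborel))"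
  proof (rule nn_integral_cong)
    fix x
    have 1: "?b l (merge ?A ?B (x, y)) = ?b l x" if "l < k" for l y
      using that by (auto simp: merge_def idx_def fun_eq_iff)
    have 2: "?b k (merge ?A ?B (x, y)) = (\<lambda>j\<in>{..<m}. y (k, j))" for y
      by (auto simp: merge_def idx_def fun_eq_iff)
    have "(\<integral>\<^sup>+y. (\<Prod>l<Suc k. G l (?b l (merge ?A ?B (x, y)))) \<partial>PiM ?B (\<lambda>_. lborel))
      = (\<integral>\<^sup>+y. (\<Prod>l<k. G l (?b l x)) * G k (?b k y) \<partial>PiM ?B (\<lambda>_. lborel))"
      using 1 2 by (intro nn_integral_cong) (simp add: mult.commute)
    also have "\<dots> = (\<Prod>l<k. G l (?b l x)) * (\<integral>\<^sup>+y. G k (?b k y) \<partial>PiM ?B (\<lambda>_. lborel))"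
      by (intro nn_integral_cmult Gm) auto
    also have "(\<integral>\<^sup>+y. G k (?b k y) \<partial>PiM ?B (\<lambda>_. lborel)) = (\<integral>\<^sup>+x. G k x \<partial>PiM {..<m} (\<lambda>_. lborel))"
      using Suc.prems by (intro nn_integral_PiM_reindex) (auto simp: inj_on_def)
    finally show "(\<integral>\<^sup>+y. (\<Prod>l<Suc k. G l (?b l (merge ?A ?B (x, y)))) \<partial>PiM ?B (\<lambda>_. lborel))
      = (\<Prod>l<k. G l (?b l x)) * (\<integral>\<^sup>+x. G k x \<partial>PiM {..<m} (\<lambda>_. lborel))" .
  qed
  also have "\<dots> = (\<integral>\<^sup>+x. (\<Prod>l<k. G l (?b l x)) \<partial>PiM ?A (\<lambda>_. lborel)) * (\<integral>\<^sup>+x. G k x \<partial>PiM {..<m} (\<lambda>_. lborel))"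
    by (intro nn_integral_multc borel_measurable_prod_ennreal Gm) (auto simp: idx_def)
  also have "(\<integral>\<^sup>+x. (\<Prod>l<k. G l (?b l x)) \<partial>PiM ?A (\<lambda>_. lborel)) = (\<Prod>l<k. \<integral>\<^sup>+x. G l x \<partial>PiM {..<m} (\<lambda>_. lborel))"
    by (rule Suc.IH) (simp add: Suc.prems)
  finally show ?case by (simp add: mult.commute)
qed

section \<open>Expectations of functions of h(C, .) over independent copies\<close>

lemma supp_fun_cong: "(\<And>k. k < m \<Longrightarrow> y k = y' k) \<Longrightarrow> supp_fun m C y = supp_fun m C y'"
  by (simp add: supp_fun_def)

definition dens :: "nat \<Rightarrow> ('a::euclidean_space \<Rightarrow> real) \<Rightarrow> (nat \<Rightarrow> 'a) \<Rightarrow> ennreal" where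
  "dens m f x = (\<Prod>j<m. ennreal (f (x j)))"

lemma dens_measurable:
  assumes [measurable]: "f \<in> borel_measurable borel"
  shows "dens m f \<in> borel_measurable (PiM {..<m} (\<lambda>_. lborel))"
  unfolding dens_def by measurable

context
  fixes m :: nat and C :: "(nat \<Rightarrow> real) set"
  assumes C: "unconditional_body m C"
begin

definition hC :: "(nat \<Rightarrow> 'a::euclidean_space) \<Rightarrow> 'a \<Rightarrow> real" where
  "hC x u = supp_fun m C (\<lambda>j. x j \<bullet> u)"

text \<open>The expectation of \<phi>(h(C, .)) at u for independent points x j with density
  f.\<close>

definition EC :: "('a::euclidean_space \<Rightarrow> real) \<Rightarrow> (real \<Rightarrow> ennreal) \<Rightarrow> 'a \<Rightarrow> ennreal" where
  "EC f \<phi> u = (\<integral>\<^sup>+x. \<phi> (hC x u) * dens m f x \<partial>PiM {..<m} (\<lambda>_. lborel))"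

lemma hC_measurable:
  fixes F :: "'b \<Rightarrow> nat \<Rightarrow> 'a::euclidean_space"
  assumes [measurable]: "\<And>j. j < m \<Longrightarrow> (\<lambda>p. F p j) \<in> borel_measurable M" "u \<in> borel_measurable M"
  shows "(\<lambda>p. hC (F p) (u p)) \<in> borel_measurable M"
  unfolding hC_def by (rule supp_compose_measurable[OF C]) measurable

lemma hC_measurable1: "(\<lambda>x. hC x (u :: 'a::euclidean_space)) \<in> borel_measurable (PiM {..<m} (\<lambda>_. lborel))"
  by (rule hC_measurable) auto

lemma hC_nonneg: "0 \<le> hC x u"
  unfolding hC_def by (rule supp_nonneg[OF C])

lemma hC_scale: "0 \<le> t \<Longrightarrow> hC x (t *\<^sub>R u) = t * hC x u"
  unfolding hC_def by (simp add: supp_scale[OF C])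

lemma EC_measurable:
  fixes f :: "'a::euclidean_space \<Rightarrow> real"
  assumes f: "f \<in> borel_measurable borel" and \<phi>: "\<phi> \<in> borel_measurable borel"
  shows "EC f \<phi> \<in> borel_measurable borel"
proof -
  interpret P: sigma_finite_measure "PiM {..<m} (\<lambda>_. lborel :: 'a measure)" by (rule sigma_finite_PiM_lborel) simp
  have [measurable]: "dens m f \<in> borel_measurable (PiM {..<m} (\<lambda>_. lborel))" by (rule dens_measurable[OF f])
  have "(\<lambda>p. hC (snd p) (fst p)) \<in> borel_measurable (borel \<Otimes>\<^sub>M PiM {..<m} (\<lambda>_. lborel :: 'a measure))"
    by (rule hC_measurable) auto
  from measurable_compose[OF this \<phi>] have [measurable]: "(\<lambda>p. \<phi> (hC (snd p) (fst p))) \<in> borel_measurable (borel \<Otimes>\<^sub>M PiM {..<m} (\<lambda>_. lborel :: 'a measure))" .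
  show ?thesis unfolding EC_def by (rule P.borel_measurable_nn_integral[of "\<lambda>u x. \<phi> (hC x u) * dens m f x" borel, unfolded case_prod_beta']) measurable
qed

text \<open>A product of expectations is one expectation over independent copies, and Tonelli brings
  the integral over u inside. This turns powers of \<open>EC\<close> into the functionals of the
  rearrangement inequality.\<close>

lemma nn_integral_prod_EC:
  fixes f :: "'a::euclidean_space \<Rightarrow> real"
  assumes f[measurable]: "f \<in> borel_measurable borel" and \<phi>: "\<And>l. l < k \<Longrightarrow> \<phi> l \<in> borel_measurable borel"
    and w[measurable]: "w \<in> borel_measurable borel"
  shows "(lint u. w u * (\<Prod>l<k. EC f (\<phi> l) u))
    = (\<integral>\<^sup>+x. (\<Prod>ij\<in>idx k (\<lambda>_. m). ennreal (f (x ij))) * (lint u. w u * (\<Prod>l<k. \<phi> l (hC (\<lambda>j. x (l, j)) u))) \<partial>PiM (idx k (\<lambda>_. m)) (\<lambda>_. lborel))"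
proof -
  let ?I = "idx k (\<lambda>_. m)" and ?M = "PiM (idx k (\<lambda>_. m)) (\<lambda>_. lborel :: 'a measure)"
  interpret P: sigma_finite_measure ?M by (rule sigma_finite_PiM_lborel[OF finite_idx])
  interpret PP: pair_sigma_finite ?M "lborel :: 'a measure" ..
  let ?D = "\<lambda>x. \<Prod>ij\<in>?I. ennreal (f (x ij))" and ?H = "\<lambda>x u. \<Prod>l<k. \<phi> l (hC (\<lambda>j. x (l, j)) u)"
  have Dm[measurable]: "?D \<in> borel_measurable ?M" by measurable
  have Hm[measurable]: "(\<lambda>p. ?H (fst p) (snd p)) \<in> borel_measurable (?M \<Otimes>\<^sub>M lborel)"
  proof (rule borel_measurable_prod_ennreal)
    fix l assume l: "l \<in> {..<k}"
    have c: "(\<lambda>x. x (l, j)) \<in> borel_measurable ?M" if "j < m" for j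
      using measurable_component_singleton[of "(l, j)" ?I "\<lambda>_. lborel :: 'a measure"] l that by (auto simp: idx_def)
    have [measurable]: "(\<lambda>p. fst p (l, j)) \<in> borel_measurable (?M \<Otimes>\<^sub>M (lborel :: 'a measure))" if "j < m" for j
      by (rule measurable_compose[OF measurable_fst c[OF that]])
    have "(\<lambda>p. hC (\<lambda>j. fst p (l, j)) (snd p)) \<in> borel_measurable (?M \<Otimes>\<^sub>M (lborel :: 'a measure))"
      by (rule hC_measurable) auto
    from measurable_compose[OF this \<phi>] l
    show "(\<lambda>p. \<phi> l (hC (\<lambda>j. fst p (l, j)) (snd p))) \<in> borel_measurable (?M \<Otimes>\<^sub>M (lborel :: 'a measure))" by simp
  qed
  have "(\<Prod>l<k. EC f (\<phi> l) u) = (\<integral>\<^sup>+x. ?D x * ?H x u \<partial>?M)" for u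
  proof -
    have "(\<Prod>l<k. EC f (\<phi> l) u) = (\<integral>\<^sup>+x. (\<Prod>l<k. \<phi> l (hC (\<lambda>j\<in>{..<m}. x (l, j)) u) * dens m f (\<lambda>j\<in>{..<m}. x (l, j))) \<partial>?M)"
      unfolding EC_def
    proof (rule nn_integral_blocks[symmetric])
      fix l assume "l < k"
      then show "(\<lambda>x. \<phi> l (hC x u) * dens m f x) \<in> borel_measurable (PiM {..<m} (\<lambda>_. lborel))"
        by (intro borel_measurable_times_ennreal dens_measurable f measurable_compose[OF hC_measurable1 \<phi>])
    qed
    also have "\<dots> = (\<integral>\<^sup>+x. ?D x * ?H x u \<partial>?M)"
    proof (rule nn_integral_cong)
      fix x :: "nat \<times> nat \<Rightarrow> 'a"
      have "?D x = (\<Prod>l<k. dens m f (\<lambda>j\<in>{..<m}. x (l, j)))" by (simp add: dens_def idx_def prod.Sigma case_prod_beta')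
      moreover have "hC (\<lambda>j\<in>{..<m}. x (l, j)) u = hC (\<lambda>j. x (l, j)) u" for l unfolding hC_def by (rule supp_fun_cong) simp
      ultimately show "(\<Prod>l<k. \<phi> l (hC (\<lambda>j\<in>{..<m}. x (l, j)) u) * dens m f (\<lambda>j\<in>{..<m}. x (l, j))) = ?D x * ?H x u"
        by (simp only: prod.distrib mult.commute)
    qed
    finally show ?thesis .
  qed
  then have "(lint u. w u * (\<Prod>l<k. EC f (\<phi> l) u)) = (lint u. (\<integral>\<^sup>+x. ?D x * (w u * ?H x u) \<partial>?M))"
  proof (intro nn_integral_cong, simp only: mult.left_commute)
    fix u :: 'a
    have "(\<lambda>x. ?H x u) \<in> borel_measurable ?M" using measurable_compose[OF measurable_Pair2'[of u] Hm] by simp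
    then show "w u * (\<integral>\<^sup>+x. ?D x * ?H x u \<partial>?M) = (\<integral>\<^sup>+x. w u * (?D x * ?H x u) \<partial>?M)" by (intro nn_integral_cmult[symmetric] borel_measurable_times_ennreal Dm)
  qed
  also have "\<dots> = (\<integral>\<^sup>+x. (lint u. ?D x * (w u * ?H x u)) \<partial>?M)"
    by (rule PP.Fubini') measurable
  also have "\<dots> = (\<integral>\<^sup>+x. ?D x * (lint u. w u * ?H x u) \<partial>?M)"
  proof (intro nn_integral_cong nn_integral_cmult)
    fix x assume "x \<in> space ?M"
    from measurable_compose[OF measurable_Pair1'[OF this] Hm] show "(\<lambda>u. w u * ?H x u) \<in> borel_measurable lborel" by simp
  qed
  finally show ?thesis .
qed

lemma gauge_fun_hC: "l < k \<Longrightarrow> gauge_fun (idx k (\<lambda>_. m)) (\<lambda>\<beta> y. supp_fun m C (\<lambda>j. y (l, j)))"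
  by (rule gauge_fun_supp[OF C]) (auto simp: idx_def)

lemma prod_EC_le_ball:
  fixes f :: "'a::euclidean_space \<Rightarrow> real" and k :: nat
  assumes f: "f \<in> borel_measurable borel" "\<And>x. 0 \<le> f x" "\<And>x. f x \<le> A" "(lint x. ennreal (f x)) \<le> 1"
    and A: "ennreal A * emeasure lborel (cball (0::'a) r) = 1" and r: "0 \<le> r"
    and \<phi>: "\<And>l a b. l < k \<Longrightarrow> 0 \<le> a \<Longrightarrow> a \<le> b \<Longrightarrow> \<phi> l b \<le> \<phi> l a" "\<And>l. l < k \<Longrightarrow> \<phi> l \<in> borel_measurable borel"
    and \<psi>: "\<And>a b. 0 \<le> a \<Longrightarrow> a \<le> b \<Longrightarrow> \<psi> b \<le> \<psi> a" "\<psi> \<in> borel_measurable borel"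
  shows "(lint u. \<psi> (norm u) * (\<Prod>l<k. EC f (\<phi> l) u))
    \<le> (lint u. \<psi> (norm u) * (\<Prod>l<k. EC (\<lambda>x. A * indicator (cball (0::'a) r) x) (\<phi> l) u))"
proof -
  let ?I = "idx k (\<lambda>_. m)"
  \<comment> \<open>Index k carries the gauge norm u, with \<psi> as its function; the indices below
    k carry the copies of C.\<close>
  let ?g = "\<lambda>l. if l = k then (\<lambda>\<beta> y. \<beta>) else (\<lambda>\<beta> y. supp_fun m C (\<lambda>j. y (l, j)))"
  let ?\<phi> = "\<lambda>l. if l = k then \<psi> else \<phi> l"
  have wm: "(\<lambda>u::'a. \<psi> (norm u)) \<in> borel_measurable borel" by (rule measurable_compose[OF _ \<psi>(2)]) simp
  have gm: "(\<lambda>x::'a. A * indicator (cball 0 r) x) \<in> borel_measurable borel" by measurable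
  have eq: "(\<Prod>l\<in>{..<Suc k}. ?\<phi> l (gauge_at (?g l) x u)) = \<psi> (norm u) * (\<Prod>l<k. \<phi> l (hC (\<lambda>j. x (l, j)) u))" for x and u :: 'a
    by (simp add: hC_def mult.commute)
  have "(\<integral>\<^sup>+x. (\<Prod>j\<in>?I. ennreal (f (x j))) * (lint u. (\<Prod>l\<in>{..<Suc k}. ?\<phi> l (gauge_at (?g l) x u))) \<partial>PiM ?I (\<lambda>_. lborel))
    \<le> (\<integral>\<^sup>+x. (\<Prod>j\<in>?I. ennreal (A * indicator (cball 0 r) (x j))) * (\<integral>\<^sup>+u. (\<Prod>l\<in>{..<Suc k}. ?\<phi> l (gauge_at (?g l) x u)) \<partial>(lborel :: 'a measure)) \<partial>PiM ?I (\<lambda>_. lborel))"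
  proof (rule integral_gauges_le_ball[OF finite_idx])
    show "gauge_fun ?I (?g l)" if "l \<in> {..<Suc k}" for l using that gauge_fun_hC gauge_fun_norm by (cases "l = k") auto
    show "?\<phi> l b \<le> ?\<phi> l a" if "l \<in> {..<Suc k}" "0 \<le> a" "a \<le> b" for l a b using that \<phi>(1)[of l a b] \<psi>(1)[of a b] by auto
    show "?\<phi> l \<in> borel_measurable borel" if "l \<in> {..<Suc k}" for l using that \<phi>(2)[of l] \<psi>(2) by (cases "l = k") auto
  qed (use f A r in auto)
  moreover have e: "(lint u. \<psi> (norm u) * (\<Prod>l<k. EC F (\<phi> l) u)) = (\<integral>\<^sup>+x. (\<Prod>ij\<in>?I. ennreal (F (x ij))) *
      (lint u. \<psi> (norm u) * (\<Prod>l<k. \<phi> l (hC (\<lambda>j. x (l, j)) u))) \<partial>PiM ?I (\<lambda>_. lborel))"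
    if "F \<in> borel_measurable borel" for F :: "'a \<Rightarrow> real"
    by (rule nn_integral_prod_EC[OF that _ wm]) (rule \<phi>(2))
  ultimately show ?thesis unfolding eq e[OF f(1)] e[OF gm] by iprover
qed

end

subsection \<open>Negative exponents and random bodies\<close>

lemma I_exp_vol_le:
  fixes f :: "'a::euclidean_space \<Rightarrow> real"
  assumes f: "in_Pn f" and r: "0 < r" and g1: "(\<integral>\<^sup>+x. ennreal (ball_rearr f r x) \<partial>lebesgue) = 1"
    and k: "0 < k" and q: "0 < q" and kq: "real k * q = real DIM('a)" and N: "0 < N"
  shows "I_exp_vol q \<alpha> N f \<le> I_exp_vol q \<alpha> N (ball_rearr f r)"
proof -
  let ?g = "\<lambda>i \<beta> (y::nat \<Rightarrow> real). sqrt ((y i)\<^sup>2 + \<alpha>\<^sup>2 * \<beta>\<^sup>2)"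
  \<comment> \<open>The square root is the homogeneous gauge of degree 1; the exponent changes from
    -q / 2 to -q accordingly.\<close>
  have "epow (ennreal s) (- q / 2) = epow (ennreal (sqrt s)) (- q)" if "0 \<le> s" for s
    using that q by (cases "s = 0") (auto simp: epow_0 epow_pos powr_half_sqrt[symmetric] powr_powr)
  then have eq: "I_rad q \<alpha> N X = (\<lambda>u. epow (ennreal (1 / real N) * (\<Sum>i<N. epow (ennreal (gauge_at (?g i) X u)) (- q))) (1 / q))" for X :: "nat \<Rightarrow> 'a"
    by (simp add: I_rad_def fun_eq_iff del: ennreal_plus)
  show ?thesis unfolding I_exp_vol_def eq
    by (rule expected_vol_neg[OF _ f r g1 N gauge_fun_sqrt k q kq]) auto
qed

lemma ZZ_exp_vol_le:
  fixes F :: "nat \<Rightarrow> nat \<Rightarrow> 'a::euclidean_space \<Rightarrow> real"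
  assumes N: "0 < N"
    and F: "\<And>i j. i < N \<Longrightarrow> j < m i \<Longrightarrow> in_Pn (F i j) \<and> 0 < R i j \<and> (\<integral>\<^sup>+x. ennreal (ball_rearr (F i j) (R i j) x) \<partial>lebesgue) = 1"
    and C: "\<And>i. i < N \<Longrightarrow> unconditional_body (m i) (Cs i)"
    and p: "0 \<le> p \<or> (\<exists>k>0. real k * (- p) = real DIM('a))"
  shows "ZZ_exp_vol p N m Cs F \<le> ZZ_exp_vol p N m Cs (\<lambda>i j. ball_rearr (F i j) (R i j))"
proof -
  let ?I = "idx N m" and ?g = "\<lambda>i (\<beta>::real) y. supp_fun (m i) (Cs i) (\<lambda>j. y (i, j))"
  let ?f = "\<lambda>ij. F (fst ij) (snd ij)" and ?r = "\<lambda>ij. R (fst ij) (snd ij)"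
  have f: "in_Pn (?f ij)" "0 < ?r ij" "(\<integral>\<^sup>+x. ennreal (ball_rearr (?f ij) (?r ij) x) \<partial>lebesgue) = 1" if "ij \<in> ?I" for ij
    using F[of "fst ij" "snd ij"] that by (auto simp: idx_def)
  have g: "gauge_fun ?I (?g i)" if "i < N" for i
    by (rule gauge_fun_supp[OF C[OF that]]) (use that in \<open>auto simp: idx_def\<close>)
  consider "p = 0" | "0 < p" | "p < 0" by linarith
  then show ?thesis
  proof cases
    case 1
    have "ZZ_rad p N m Cs X = (\<lambda>u. epow (\<Prod>i<N. ennreal (gauge_at (?g i) X u)) (- 1 / real N))" for X :: "nat \<times> nat \<Rightarrow> 'a"
      using 1 by (simp add: ZZ_rad_def fun_eq_iff)
    then show ?thesis unfolding ZZ_exp_vol_def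
      by (simp only:) (rule expected_vol_zero[OF finite_idx f N g])
  next
    case 2
    have "ZZ_rad p N m Cs X = (\<lambda>u. epow (ennreal (1 / real N) * (\<Sum>i<N. epow (ennreal (gauge_at (?g i) X u)) p)) (- 1 / p))" for X :: "nat \<times> nat \<Rightarrow> 'a"
      using 2 by (simp add: ZZ_rad_def fun_eq_iff)
    then show ?thesis unfolding ZZ_exp_vol_def
      by (simp only:) (rule expected_vol_pos[OF finite_idx f N g 2])
  next
    case 3
    then obtain k where k: "0 < k" "real k * (- p) = real DIM('a)" using p by auto
    have "ZZ_rad p N m Cs X = (\<lambda>u. epow (ennreal (1 / real N) * (\<Sum>i<N. epow (ennreal (gauge_at (?g i) X u)) (- (- p)))) (1 / (- p)))" for X :: "nat \<times> nat \<Rightarrow> 'a"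
      using 3 by (simp add: ZZ_rad_def fun_eq_iff)
    then show ?thesis unfolding ZZ_exp_vol_def
      by (simp only:) (rule expected_vol_neg[OF finite_idx f N g k(1) _ k(2)], use 3 in auto)
  qed
qed

lemma epow_ennreal_measurable: "(\<lambda>t. epow (ennreal t) p) \<in> borel_measurable borel"
  by (rule measurable_compose[OF measurable_ennreal epow_measurable])

context
  fixes m :: nat and C :: "(nat \<Rightarrow> real) set"
  assumes C: "unconditional_body m C"
begin

abbreviation "hE \<equiv> EC m C"

lemma EC_cong:
  assumes "\<And>t. 0 \<le> t \<Longrightarrow> \<phi> t = \<phi>' t" shows "hE f \<phi> u = hE f \<phi>' u"
  unfolding EC_def[OF C] by (intro nn_integral_cong) (simp add: assms hC_nonneg[OF C])

lemma EC_epow_scale: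
  fixes f :: "'a::euclidean_space \<Rightarrow> real"
  assumes f: "f \<in> borel_measurable borel" and t: "0 < t"
  shows "hE f (\<lambda>t. epow (ennreal t) p) (t *\<^sub>R u) = ennreal (t powr p) * hE f (\<lambda>t. epow (ennreal t) p) u"
proof -
  have "epow (ennreal (hC m C x (t *\<^sub>R u))) p = ennreal (t powr p) * epow (ennreal (hC m C x u)) p" for x
    using t by (simp add: hC_scale[OF C] hC_nonneg[OF C] ennreal_mult epow_scale)
  then have "hE f (\<lambda>t. epow (ennreal t) p) (t *\<^sub>R u) = (\<integral>\<^sup>+x. ennreal (t powr p) * (epow (ennreal (hC m C x u)) p * dens m f x) \<partial>PiM {..<m} (\<lambda>_. lborel))"
    by (simp add: EC_def[OF C] mult.assoc)
  also have "\<dots> = ennreal (t powr p) * hE f (\<lambda>t. epow (ennreal t) p) u" unfolding EC_def[OF C]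
    by (intro nn_integral_cmult borel_measurable_times_ennreal dens_measurable f measurable_compose[OF hC_measurable1[OF C] epow_ennreal_measurable])
  finally show ?thesis .
qed

lemma Z_integral_eq:
  fixes f f' :: "'a::euclidean_space \<Rightarrow> real"
  assumes f': "f' \<in> borel_measurable borel" and ae: "AE x in lebesgue. f x = f' x" and \<phi>: "\<phi> \<in> borel_measurable borel"
  shows "(\<integral>\<^sup>+x. \<phi> (supp_fun m C (\<lambda>k. x k \<bullet> u)) * (\<Prod>k<m. ennreal (f (x k))) \<partial>PiM {..<m} (\<lambda>_. lebesgue)) = hE f' \<phi> u"
  unfolding EC_def[OF C] hC_def[OF C] dens_def
  by (rule nn_integral_PiM_lebesgue_densities[OF _ _ f' ae])
    (auto intro: measurable_compose[OF hC_measurable1[OF C] \<phi>, unfolded hC_def[OF C]])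

lemma Z_rad_eq:
  fixes f f' :: "'a::euclidean_space \<Rightarrow> real"
  assumes "f' \<in> borel_measurable borel" "AE x in lebesgue. f x = f' x" "p \<noteq> 0"
  shows "Z_rad p m C f = (\<lambda>u. epow (hE f' (\<lambda>t. epow (ennreal t) p) u) (- 1 / p))"
  using assms(3) Z_integral_eq[OF assms(1,2) epow_ennreal_measurable] by (simp add: Z_rad_def fun_eq_iff)

text \<open>The k-th power of the expectation is unfolded into independent copies,
  \<open>annulus_prod_eq\<close> is applied for each sample, and the copies are folded back. The
  result is an integral over the whole space of expectations of decreasing functions of h, as in
  \<open>prod_EC_le_ball\<close>.\<close>

lemma star_vol_neg_eq:
  fixes f :: "'a::euclidean_space \<Rightarrow> real"
  assumes f: "f \<in> borel_measurable borel" and k: "0 < k" and q: "0 < q" and kq: "real k * q = real DIM('a)"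
  shows "star_vol (\<lambda>u. epow (hE f (\<lambda>t. epow (ennreal t) (- q)) u) (1 / q))
    = ennreal (1 / (real DIM('a) * ln 2)) * (ennreal (q * ln 2) * (lint u. (\<Prod>l<k. hE f (cut_pow q l) u)))"
proof -
  let ?n = "DIM('a)"
  let ?T = "hE f (\<lambda>t. epow (ennreal t) (- q))" and ?I = "idx k (\<lambda>_. m)" and ?M = "PiM (idx k (\<lambda>_. m)) (\<lambda>_. lborel :: 'a measure)"
  let ?D = "\<lambda>x. \<Prod>ij\<in>?I. ennreal (f (x ij))"
  have Tm: "?T \<in> borel_measurable borel" by (rule EC_measurable[OF C f epow_ennreal_measurable])
  note star_vol_epow_neg[OF k q kq Tm EC_epow_scale[OF f]]
  also have "(lint v. ann v * ?T v ^ k) = (lint v. ann v * (\<Prod>l<k. ?T v))" by simp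
  also have "\<dots> = (\<integral>\<^sup>+x. ?D x * (lint v. ann v * (\<Prod>l<k. epow (ennreal (hC m C (\<lambda>j. x (l, j)) v)) (- q))) \<partial>?M)"
    by (rule nn_integral_prod_EC[OF C f epow_ennreal_measurable ann_measurable])
  also have "\<dots> = (\<integral>\<^sup>+x. ?D x * (ennreal (q * ln 2) * (lint u. 1 * (\<Prod>l<k. cut_pow q l (hC m C (\<lambda>j. x (l, j)) u)))) \<partial>?M)"
  proof (rule nn_integral_cong)
    fix x :: "nat \<times> nat \<Rightarrow> 'a"
    have "(lint v. ann v * (\<Prod>l<k. epow (ennreal (hC m C (\<lambda>j. x (l, j)) v)) (- q)))
       = ennreal (q * ln 2) * (lint u. (\<Prod>l<k. cut_pow q l (hC m C (\<lambda>j. x (l, j)) u)))"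
      by (rule annulus_prod_eq[OF k q kq, where h="\<lambda>l. hC m C (\<lambda>j. x (l, j))"])
        (auto intro!: hC_measurable[OF C] hC_nonneg[OF C] hC_scale[OF C])
    then show "?D x * (lint v. ann v * (\<Prod>l<k. epow (ennreal (hC m C (\<lambda>j. x (l, j)) v)) (- q)))
       = ?D x * (ennreal (q * ln 2) * (lint u. 1 * (\<Prod>l<k. cut_pow q l (hC m C (\<lambda>j. x (l, j)) u))))" by simp
  qed
  also have "\<dots> = (\<integral>\<^sup>+x. ?D x * (lint u. ennreal (q * ln 2) * (\<Prod>l<k. cut_pow q l (hC m C (\<lambda>j. x (l, j)) u))) \<partial>?M)"
  proof (rule nn_integral_cong)
    fix x :: "nat \<times> nat \<Rightarrow> 'a"
    have "(\<lambda>u. \<Prod>l<k. cut_pow q l (hC m C (\<lambda>j. x (l, j)) u)) \<in> borel_measurable lborel"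
      by (intro borel_measurable_prod_ennreal measurable_compose[OF hC_measurable[OF C] cut_pow_measurable]) auto
    then show "?D x * (ennreal (q * ln 2) * (lint u. 1 * (\<Prod>l<k. cut_pow q l (hC m C (\<lambda>j. x (l, j)) u))))
      = ?D x * (lint u. ennreal (q * ln 2) * (\<Prod>l<k. cut_pow q l (hC m C (\<lambda>j. x (l, j)) u)))" by (simp add: nn_integral_cmult)
  qed
  also have "\<dots> = (lint u. ennreal (q * ln 2) * (\<Prod>l<k. hE f (cut_pow q l) u))"
    by (rule nn_integral_prod_EC[OF C f cut_pow_measurable, symmetric]) simp
  also have "\<dots> = ennreal (q * ln 2) * (lint u. (\<Prod>l<k. hE f (cut_pow q l) u))"
    using EC_measurable[OF C f cut_pow_measurable] by (intro nn_integral_cmult borel_measurable_prod_ennreal) simp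
  finally show ?thesis .
qed

lemma star_vol_neg_le:
  fixes f :: "'a::euclidean_space \<Rightarrow> real"
  assumes f: "f \<in> borel_measurable borel" "\<And>x. 0 \<le> f x" "\<And>x. f x \<le> A" "(lint x. ennreal (f x)) \<le> 1"
    and A: "ennreal A * emeasure lborel (cball (0::'a) r) = 1" and r: "0 \<le> r"
    and k: "0 < k" and q: "0 < q" and kq: "real k * q = real DIM('a)"
  shows "star_vol (\<lambda>u. epow (hE f (\<lambda>t. epow (ennreal t) (- q)) u) (1 / q))
    \<le> star_vol (\<lambda>u. epow (hE (\<lambda>x. A * indicator (cball (0::'a) r) x) (\<lambda>t. epow (ennreal t) (- q)) u) (1 / q))"
proof -
  have gm: "(\<lambda>x::'a. A * indicator (cball 0 r) x) \<in> borel_measurable borel" by measurable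
  have "(lint u. 1 * (\<Prod>l<k. hE f (cut_pow q l) u))
    \<le> (lint u. 1 * (\<Prod>l<k. hE (\<lambda>x. A * indicator (cball (0::'a) r) x) (cut_pow q l) u))"
    by (rule prod_EC_le_ball[OF C f A r, where \<psi>="\<lambda>_. 1"]) (use q in \<open>auto intro: cut_pow_antimono\<close>)
  then show ?thesis unfolding star_vol_neg_eq[OF f(1) k q kq] star_vol_neg_eq[OF gm k q kq] by (auto intro!: mult_left_mono)
qed

end

subsection \<open>Exponential moments and the cases p > 0 and p = 0\<close>

text \<open>Second-order control of exp for \<open>exp_integral_ge\<close>: the remainder is y^2 for
  y < 0 and carries exp y only for y \<ge> 0, so it can be integrated when Y is bounded on one
  side.\<close>

lemma exp_le_quadratic: "exp y \<le> 1 + y + y\<^sup>2 * exp (max 0 y)" for y :: real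
proof (cases "0 \<le> y")
  case True
  have "1 + (- y) \<le> exp (- y)" by (rule exp_ge_add_one_self)
  then have "(1 - y) * exp y \<le> exp (- y) * exp y" by (intro mult_right_mono) auto
  also have "exp (- y) * exp y = 1" by (simp add: exp_minus)
  finally have 1: "exp y - 1 \<le> y * exp y" by (simp add: left_diff_distrib)
  then have "y * (exp y - 1) \<le> y * (y * exp y)" using True by (rule mult_left_mono)
  then show ?thesis using 1 True by (simp add: power2_eq_square algebra_simps max_def)
next
  case False
  define z where "z = - y"
  have z: "0 < z" using False by (simp add: z_def)
  \<comment> \<open>The product equals 1 + z^3.\<close>
  have "1 \<le> (1 - z + z\<^sup>2) * (1 + z)" using z by (simp add: algebra_simps power2_eq_square)
  also have "\<dots> \<le> (1 - z + z\<^sup>2) * exp z"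
  proof (rule mult_left_mono[OF exp_ge_add_one_self])
    have "1 - z + z\<^sup>2 = (z - 1/2)\<^sup>2 + 3/4" by (simp add: power2_eq_square field_simps)
    then show "0 \<le> 1 - z + z\<^sup>2" by simp
  qed
  finally have "exp (- z) * 1 \<le> exp (- z) * ((1 - z + z\<^sup>2) * exp z)" by (rule mult_left_mono) simp
  also have "exp (- z) * ((1 - z + z\<^sup>2) * exp z) = (1 - z + z\<^sup>2) * (exp (- z) * exp z)" by (simp only: mult_ac)
  also have "exp (- z) * exp z = 1" by (simp add: exp_minus)
  finally have "exp (- z) \<le> 1 - z + z\<^sup>2" by simp
  then show ?thesis using False by (simp add: z_def max_def)
qed

text \<open>Jensen's inequality, from the tangent line to exp at the mean.\<close>

lemma (in prob_space) exp_integral_le: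
  fixes Y :: "'a \<Rightarrow> real"
  assumes Y: "integrable M Y"
  shows "ennreal (exp (\<integral>x. Y x \<partial>M)) \<le> (\<integral>\<^sup>+x. ennreal (exp (Y x)) \<partial>M)"
proof (cases "(\<integral>\<^sup>+x. ennreal (exp (Y x)) \<partial>M) = \<infinity>")
  case False
  let ?c = "\<integral>x. Y x \<partial>M"
  have i: "integrable M (\<lambda>x. exp (Y x))" using False Y by (intro integrableI_nonneg) (auto simp: less_top)
  have "exp ?c * (1 + (?c - ?c)) = (\<integral>x. exp ?c * (1 + (Y x - ?c)) \<partial>M)" using Y by (simp add: prob_space)
  also have "\<dots> \<le> (\<integral>x. exp (Y x) \<partial>M)"
  proof (rule integral_mono[OF _ i])
    fix x
    have "exp ?c * (1 + (Y x - ?c)) \<le> exp ?c * exp (Y x - ?c)" by (intro mult_left_mono exp_ge_add_one_self) simp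
    then show "exp ?c * (1 + (Y x - ?c)) \<le> exp (Y x)" by (simp only: mult_exp_exp) simp
  qed (use Y in simp)
  finally have "exp ?c \<le> (\<integral>x. exp (Y x) \<partial>M)" by simp
  then show ?thesis using i by (subst nn_integral_eq_integral) (auto intro: ennreal_leI)
qed simp

text \<open>A converse of Jensen's inequality with error s^2 D in the exponent. Raised to the power
  1 / s the error is s D, which vanishes as s tends to 0 from above.\<close>

lemma (in prob_space) exp_integral_ge:
  fixes Y :: "'a \<Rightarrow> real"
  assumes Y: "integrable M Y" and D: "(\<integral>\<^sup>+x. ennreal ((Y x)\<^sup>2 * exp (max 0 (s * Y x))) \<partial>M) \<le> ennreal D" "0 \<le> D"
  shows "(\<integral>\<^sup>+x. ennreal (exp (s * Y x)) \<partial>M) \<le> ennreal (exp (s * (\<integral>x. Y x \<partial>M) + s\<^sup>2 * D))"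
proof -
  let ?W = "\<lambda>x. (Y x)\<^sup>2 * exp (max 0 (s * Y x))"
  have [measurable]: "Y \<in> borel_measurable M" using Y by auto
  have W: "integrable M ?W" using D(1) by (intro integrableI_nonneg) (auto simp: less_top[symmetric] top_unique)
  have "ennreal (\<integral>x. ?W x \<partial>M) \<le> ennreal D" using D(1) W by (subst (asm) nn_integral_eq_integral) auto
  then have WD: "(\<integral>x. ?W x \<partial>M) \<le> D" using D(2) by simp
  have le: "exp (s * Y x) \<le> 1 + s * Y x + s\<^sup>2 * ?W x" for x
    using exp_le_quadratic[of "s * Y x"] by (simp add: power_mult_distrib mult.assoc)
  have i: "integrable M (\<lambda>x. 1 + s * Y x + s\<^sup>2 * ?W x)" using Y W by simp
  have "(\<integral>\<^sup>+x. ennreal (exp (s * Y x)) \<partial>M) \<le> (\<integral>\<^sup>+x. ennreal (1 + s * Y x + s\<^sup>2 * ?W x) \<partial>M)"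
    by (intro nn_integral_mono ennreal_leI le)
  also have "\<dots> = ennreal (\<integral>x. 1 + s * Y x + s\<^sup>2 * ?W x \<partial>M)"
    by (rule nn_integral_eq_integral[OF i]) (use le order_trans[OF exp_ge_zero] in blast)
  also have "(\<integral>x. 1 + s * Y x + s\<^sup>2 * ?W x \<partial>M) = 1 + (s * (\<integral>x. Y x \<partial>M) + s\<^sup>2 * (\<integral>x. ?W x \<partial>M))" using Y W by (simp add: prob_space)
  also have "\<dots> \<le> exp (s * (\<integral>x. Y x \<partial>M) + s\<^sup>2 * (\<integral>x. ?W x \<partial>M))" by (rule exp_ge_add_one_self)
  also have "\<dots> \<le> exp (s * (\<integral>x. Y x \<partial>M) + s\<^sup>2 * D)" using WD by (simp add: mult_left_mono)
  finally show ?thesis by (simp add: ennreal_leI)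
qed

lemma le_of_exp_perturbation:
  fixes X V :: ennreal
  assumes "\<And>N::nat. N0 < N \<Longrightarrow> X \<le> ennreal (exp (c / real N)) * V"
  shows "X \<le> V"
proof (cases V)
  case (real v)
  have "((\<lambda>N. ennreal (exp (c / real N) * v)) \<longlongrightarrow> ennreal (exp 0 * v)) sequentially"
    by (intro tendsto_ennrealI tendsto_mult tendsto_exp tendsto_const lim_const_over_n)
  then have "X \<le> ennreal (exp 0 * v)"
    by (rule tendsto_lowerbound) (use assms real in \<open>auto simp: eventually_at_top_dense ennreal_mult[symmetric] intro!: exI[of _ N0]\<close>)
  then show ?thesis using real by simp
qed simp

lemma epow_mono:
  assumes "0 < q" "x \<le> y" shows "epow x q \<le> epow y q"
proof (cases x rule: ennreal_cases3)
  case (3 r)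
  then show ?thesis using assms
    by (cases y rule: ennreal_cases3) (auto simp: epow_top' epow_pos intro!: ennreal_leI powr_mono2)
qed (use assms in \<open>auto simp: epow_0' epow_top' top_unique\<close>)

lemma star_vol_mono_scale:
  fixes \<rho> \<rho>' :: "'a::euclidean_space \<Rightarrow> ennreal"
  assumes [measurable]: "\<rho> \<in> borel_measurable borel" "\<rho>' \<in> borel_measurable borel"
    and le: "\<And>u. norm u = 1 \<Longrightarrow> \<rho> u \<le> ennreal c * \<rho>' u"
  shows "star_vol \<rho> \<le> ennreal c ^ DIM('a) * star_vol \<rho>'"
proof -
  let ?n = "DIM('a)" and ?e = "\<lambda>\<rho> v. ann v * (ennreal (1 / norm v) * \<rho> ((1 / norm v) *\<^sub>R v)) ^ DIM('a)"
  have "(lint v. ?e \<rho> v) \<le> (lint v. ennreal c ^ ?n * ?e \<rho>' v)"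
  proof (rule nn_integral_mono)
    fix v :: 'a
    show "?e \<rho> v \<le> ennreal c ^ ?n * ?e \<rho>' v"
    proof (cases "v = 0")
      case False
      then have "?e \<rho> v \<le> ann v * (ennreal (1 / norm v) * (ennreal c * \<rho>' ((1 / norm v) *\<^sub>R v))) ^ ?n"
        by (intro mult_left_mono power_mono le) auto
      also have "\<dots> = ennreal c ^ ?n * ?e \<rho>' v" by (simp only: power_mult_distrib mult_ac)
      finally show ?thesis .
    qed (simp add: ann_def)
  qed
  also have "\<dots> = ennreal c ^ ?n * (lint v. ?e \<rho>' v)" by (rule nn_integral_cmult) measurable
  finally show ?thesis unfolding star_vol_rays[OF assms(1)] star_vol_rays[OF assms(2)]
    by (subst mult.left_commute) (intro mult_left_mono, auto)
qed

text \<open>The law of m independent points when f is a probability density; it makes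
  \<open>EC\<close> an expectation over a probability space.\<close>

definition PC :: "nat \<Rightarrow> ('a::euclidean_space \<Rightarrow> real) \<Rightarrow> (nat \<Rightarrow> 'a) measure" where
  "PC m f = density (PiM {..<m} (\<lambda>_. lborel)) (dens m f)"

lemma prob_space_PC:
  fixes f :: "'a::euclidean_space \<Rightarrow> real"
  assumes f: "f \<in> borel_measurable borel" "(lint x. ennreal (f x)) = 1"
  shows "prob_space (PC m f)"
proof (rule prob_spaceI)
  have [measurable]: "dens m f \<in> borel_measurable (PiM {..<m} (\<lambda>_. lborel))" by (rule dens_measurable[OF f(1)])
  have "emeasure (PC m f) (space (PC m f)) = (\<integral>\<^sup>+x. dens m f x \<partial>PiM {..<m} (\<lambda>_. lborel))"
    unfolding PC_def by (subst emeasure_density) (auto intro!: nn_integral_cong simp: indicator_def)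
  also have "\<dots> = (\<Prod>j<m. \<integral>\<^sup>+x. ennreal (f x) \<partial>lborel)"
    unfolding dens_def using f(1) by (intro lborel_PiM.product_nn_integral_prod) auto
  finally show "emeasure (PC m f) (space (PC m f)) = 1" using f(2) by simp
qed

lemma PC_component:
  fixes f :: "'a::euclidean_space \<Rightarrow> real"
  assumes f[measurable]: "f \<in> borel_measurable borel" and f1: "(lint x. ennreal (f x)) = 1" and w[measurable]: "w \<in> borel_measurable borel" and m: "0 < m"
  shows "(\<integral>\<^sup>+x. w (x 0) \<partial>PC m f) = (lint x. w x * ennreal (f x))"
proof -
  let ?F = "\<lambda>j x. if j = 0 then w x * ennreal (f x) else ennreal (f x)"
  have z: "{..<m} = insert 0 {1..<m}" using m by auto
  have [measurable]: "dens m f \<in> borel_measurable (PiM {..<m} (\<lambda>_. lborel))" by (rule dens_measurable[OF f])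
  have [measurable]: "(\<lambda>x. x 0) \<in> borel_measurable (PiM {..<m} (\<lambda>_. lborel :: 'a measure))"
    using measurable_component_singleton[of 0 "{..<m}" "\<lambda>_. lborel :: 'a measure"] m by simp
  have "(\<integral>\<^sup>+x. w (x 0) \<partial>PC m f) = (\<integral>\<^sup>+x. dens m f x * w (x 0) \<partial>PiM {..<m} (\<lambda>_. lborel))"
    unfolding PC_def by (rule nn_integral_density) measurable
  also have "\<dots> = (\<integral>\<^sup>+x. (\<Prod>j<m. ?F j (x j)) \<partial>PiM {..<m} (\<lambda>_. lborel))"
    unfolding dens_def z by (intro nn_integral_cong) (simp add: mult_ac)
  also have "\<dots> = (\<Prod>j<m. \<integral>\<^sup>+x. ?F j x \<partial>lborel)"
    by (intro lborel_PiM.product_nn_integral_prod) auto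
  also have "\<dots> = (lint x. w x * ennreal (f x))" unfolding z by (simp add: f1)
  finally show ?thesis .
qed

lemma AE_PC_ball:
  fixes A :: real
  shows "AE x in PC m (\<lambda>x. A * indicator (cball (0::'a::euclidean_space) r) x). \<forall>j<m. norm (x j) \<le> r"
proof -
  have d: "dens m (\<lambda>x. A * indicator (cball (0::'a) r) x) \<in> borel_measurable (PiM {..<m} (\<lambda>_. lborel))"
    by (rule dens_measurable) measurable
  have "norm (x j) \<le> r" if "0 < dens m (\<lambda>x. A * indicator (cball (0::'a) r) x) x" "j < m" for x j
  proof (rule ccontr)
    assume "\<not> norm (x j) \<le> r"
    then have "ennreal (A * indicator (cball (0::'a) r) (x j)) = 0" by simp
    then have "dens m (\<lambda>x. A * indicator (cball (0::'a) r) x) x = 0" unfolding dens_def using that(2) by (intro prod_zero) auto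
    then show False using that(1) by simp
  qed
  then show ?thesis unfolding PC_def by (subst AE_density[OF d]) auto
qed

section \<open>Positive exponents: exponentials of expectations as limits of products\<close>

context
  fixes m :: nat and C :: "(nat \<Rightarrow> real) set"
  assumes C: "unconditional_body m C"
begin

lemma hC_measurable_PC: "(\<lambda>x. hC m C x u) \<in> borel_measurable (PC m f)"
  using hC_measurable1[OF C, of u] unfolding PC_def by simp

lemma EC_PC:
  fixes f :: "'a::euclidean_space \<Rightarrow> real"
  assumes f: "f \<in> borel_measurable borel" and \<phi>: "\<phi> \<in> borel_measurable borel"
  shows "EC m C f \<phi> u = (\<integral>\<^sup>+x. \<phi> (hC m C x u) \<partial>PC m f)"
  unfolding PC_def EC_def[OF C]
  by (subst nn_integral_density[OF dens_measurable[OF f] measurable_compose[OF hC_measurable1[OF C] \<phi>]]) (simp add: mult.commute)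

lemma hC_le_ball: "\<exists>B\<ge>0. \<forall>x u. (\<forall>j<m. norm (x j) \<le> r) \<longrightarrow> hC m C x u \<le> B * norm (u :: 'a::euclidean_space)"
proof -
  obtain B where B: "0 \<le> B" "\<And>y. supp_fun m C y \<le> B * (\<Sum>k<m. \<bar>y k\<bar>)" using supp_upper[OF C] by blast
  have "hC m C x u \<le> (B * (real m * \<bar>r\<bar>)) * norm u" if "\<forall>j<m. norm (x j) \<le> r" for x and u :: 'a
  proof -
    have "\<bar>x j \<bullet> u\<bar> \<le> \<bar>r\<bar> * norm u" if "j < m" for j
      using Cauchy_Schwarz_ineq2[of "x j" u] \<open>\<forall>j<m. norm (x j) \<le> r\<close> that
      by (meson abs_ge_self mult_right_mono norm_ge_zero order_trans)
    then have "(\<Sum>j<m. \<bar>x j \<bullet> u\<bar>) \<le> real m * (\<bar>r\<bar> * norm u)" using sum_bounded_above[of "{..<m}" "\<lambda>j. \<bar>x j \<bullet> u\<bar>" "\<bar>r\<bar> * norm u"] by simp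
    from mult_left_mono[OF this B(1)] B(2)[of "\<lambda>j. x j \<bullet> u"] show ?thesis unfolding hC_def[OF C] by (simp add: mult.assoc)
  qed
  then show ?thesis using B(1) by (intro exI[of _ "B * (real m * \<bar>r\<bar>)"]) auto
qed

abbreviation (input) "Epow p f \<equiv> EC m C f (\<lambda>t. epow (ennreal t) p)"

lemma EC_pow_pos: "0 < p \<Longrightarrow> Epow p f u = EC m C f (\<lambda>t. ennreal (t powr p)) u"
proof (rule EC_cong[OF C])
  fix t :: real assume "0 < p" "0 \<le> t"
  then show "epow (ennreal t) p = ennreal (t powr p)" by (cases "t = 0") (auto simp: epow_0' epow_pos)
qed

abbreviation (input) "Eexp p N f \<equiv> EC m C f (\<lambda>t. ennreal (exp (- (t powr p) / real N)))"

text \<open>Jensen's inequality for -h^p / N. The right-hand side is a product of N expectations of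
  decreasing functions of h, to which \<open>prod_EC_le_ball\<close> applies.\<close>

lemma expm_le_Eexp:
  fixes f :: "'a::euclidean_space \<Rightarrow> real"
  assumes f: "f \<in> borel_measurable borel" "(lint x. ennreal (f x)) = 1" and p: "0 < p" and N: "0 < N"
  shows "expm (Epow p f u) \<le> Eexp p N f u ^ N"
proof -
  interpret prob_space "PC m f" by (rule prob_space_PC[OF f])
  note [measurable] = hC_measurable_PC
  let ?Y = "\<lambda>x. hC m C x u powr p"
  have S: "Epow p f u = (\<integral>\<^sup>+x. ennreal (?Y x) \<partial>PC m f)" unfolding EC_pow_pos[OF p] by (rule EC_PC[OF f(1)]) measurable
  show ?thesis
  proof (cases "Epow p f u = top")
    case False
    then have i: "integrable (PC m f) ?Y" unfolding S by (intro integrableI_nonneg) (auto simp: less_top)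
    have "(\<integral>\<^sup>+x. ennreal (?Y x) \<partial>PC m f) = ennreal (\<integral>x. ?Y x \<partial>PC m f)" using i by (intro nn_integral_eq_integral) auto
    then have "expm (Epow p f u) = ennreal (exp (- (\<integral>x. ?Y x \<partial>PC m f)))" unfolding S by (simp add: expm_def)
    also have "\<dots> = ennreal (exp (\<integral>x. - ?Y x / real N \<partial>PC m f)) ^ N" using N by (simp add: ennreal_power exp_of_nat_mult[symmetric])
    also have "\<dots> \<le> (\<integral>\<^sup>+x. ennreal (exp (- ?Y x / real N)) \<partial>PC m f) ^ N" using i by (intro power_mono exp_integral_le) auto
    also have "\<dots> = Eexp p N f u ^ N" by (subst EC_PC[OF f(1)]) auto
    finally show ?thesis .
  qed (simp add: expm_def)
qed

text \<open>The converse of \<open>expm_le_Eexp\<close>, up to exp(B / N). For points in a ball and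
  u in a bounded set h is bounded, so the second-order error is uniform in u.\<close>

lemma Eexp_ball_le:
  fixes A :: real
  assumes A: "(lint x. ennreal (A * indicator (cball (0::'a::euclidean_space) r) x)) = 1" and p: "0 < p" and \<beta>: "0 \<le> \<beta>"
  shows "\<exists>B. \<forall>N>0. \<forall>u. norm u \<le> \<beta> \<longrightarrow> Eexp p N (\<lambda>x. A * indicator (cball (0::'a) r) x) u ^ N
    \<le> ennreal (exp (B / real N)) * expm (Epow p (\<lambda>x. A * indicator (cball (0::'a) r) x) u)"
proof -
  let ?g = "\<lambda>x. A * indicator (cball (0::'a) r) x"
  have g: "?g \<in> borel_measurable borel" by measurable
  interpret prob_space "PC m ?g" by (rule prob_space_PC[OF g A])
  note [measurable] = hC_measurable_PC
  obtain B0 where B0: "0 \<le> B0" "\<And>x (u::'a). \<forall>j<m. norm (x j) \<le> r \<Longrightarrow> hC m C x u \<le> B0 * norm u" using hC_le_ball[of r] by blast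
  define B where "B = (B0 * \<beta>) powr p"
  have "Eexp p N ?g u ^ N \<le> ennreal (exp (B\<^sup>2 / real N)) * expm (Epow p ?g u)" if N: "0 < N" and u: "norm u \<le> \<beta>" for N u
  proof -
    let ?Y = "\<lambda>x. - (hC m C x u powr p)"
    have Yb: "\<bar>?Y x\<bar> \<le> B" if "\<forall>j<m. norm (x j) \<le> r" for x
    proof -
      have "hC m C x u \<le> B0 * \<beta>" using B0(2)[OF that, of u] mult_left_mono[OF u B0(1)] by linarith
      then show ?thesis using p hC_nonneg[OF C, of x u] by (simp add: B_def powr_mono2)
    qed
    have ae: "AE x in PC m ?g. \<bar>?Y x\<bar> \<le> B" by (rule AE_mp[OF AE_PC_ball]) (use Yb in auto)
    have i: "integrable (PC m ?g) ?Y" using ae by (intro integrable_const_bound[of _ B]) auto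
    have S: "Epow p ?g u = ennreal (- (\<integral>x. ?Y x \<partial>PC m ?g))"
    proof -
      have "Epow p ?g u = (\<integral>\<^sup>+x. ennreal (hC m C x u powr p) \<partial>PC m ?g)" unfolding EC_pow_pos[OF p] by (rule EC_PC[OF g]) measurable
      then show ?thesis using i by (subst (asm) nn_integral_eq_integral) auto
    qed
    have "(\<integral>\<^sup>+x. ennreal ((?Y x)\<^sup>2 * exp (max 0 (1 / real N * ?Y x))) \<partial>PC m ?g) \<le> (\<integral>\<^sup>+x. ennreal (B\<^sup>2) \<partial>PC m ?g)"
    proof (rule nn_integral_mono_AE, rule AE_mp[OF ae], intro AE_I2 impI ennreal_leI)
      fix x assume "\<bar>?Y x\<bar> \<le> B"
      then have "(?Y x)\<^sup>2 \<le> B\<^sup>2" by (meson abs_ge_zero abs_le_square_iff order_trans abs_ge_self)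
      \<comment> \<open>Y is nonpositive, so the exponential factor in the remainder is 1.\<close>
      moreover have "max 0 (1 / real N * ?Y x) = 0" by (rule max_absorb1) simp
      ultimately show "(?Y x)\<^sup>2 * exp (max 0 (1 / real N * ?Y x)) \<le> B\<^sup>2" by simp
    qed
    then have D: "(\<integral>\<^sup>+x. ennreal ((?Y x)\<^sup>2 * exp (max 0 (1 / real N * ?Y x))) \<partial>PC m ?g) \<le> ennreal (B\<^sup>2)" by (simp add: emeasure_space_1)
    have "Eexp p N ?g u = (\<integral>\<^sup>+x. ennreal (exp (1 / real N * ?Y x)) \<partial>PC m ?g)" by (subst EC_PC[OF g]) auto
    also have "\<dots> \<le> ennreal (exp (1 / real N * (\<integral>x. ?Y x \<partial>PC m ?g) + (1 / real N)\<^sup>2 * B\<^sup>2))" by (rule exp_integral_ge[OF i D]) simp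
    finally have "Eexp p N ?g u ^ N \<le> ennreal (exp (1 / real N * (\<integral>x. ?Y x \<partial>PC m ?g) + (1 / real N)\<^sup>2 * B\<^sup>2)) ^ N" by (rule power_mono) simp
    also have "\<dots> = ennreal (exp (B\<^sup>2 / real N + (\<integral>x. ?Y x \<partial>PC m ?g)))"
      using N by (simp add: ennreal_power exp_of_nat_mult[symmetric] algebra_simps power2_eq_square)
    also have "\<dots> = ennreal (exp (B\<^sup>2 / real N)) * expm (Epow p ?g u)"
    proof -
      have "(\<integral>x. ?Y x \<partial>PC m ?g) \<le> 0" by (simp add: integral_nonneg_AE)
      then show ?thesis unfolding S by (simp add: expm_def mult_exp_exp flip: ennreal_mult)
    qed
    finally show ?thesis .
  qed
  then show ?thesis by blast
qed

lemma star_vol_pos_le: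
  fixes f :: "'a::euclidean_space \<Rightarrow> real"
  assumes f: "f \<in> borel_measurable borel" "\<And>x. 0 \<le> f x" "\<And>x. f x \<le> A" "(lint x. ennreal (f x)) = 1"
    and A: "ennreal A * emeasure lborel (cball (0::'a) r) = 1" and A1: "(lint x. ennreal (A * indicator (cball (0::'a) r) x)) = 1"
    and r: "0 \<le> r" and p: "0 < p"
  shows "star_vol (\<lambda>u. epow (Epow p f u) (- 1 / p)) \<le> star_vol (\<lambda>u. epow (Epow p (\<lambda>x. A * indicator (cball (0::'a) r) x) u) (- 1 / p))"
proof -
  let ?g = "\<lambda>x. A * indicator (cball (0::'a) r) x" and ?n = "DIM('a)"
  have g: "?g \<in> borel_measurable borel" by measurable
  have Sm: "Epow p F \<in> borel_measurable borel" if "F \<in> borel_measurable borel" for F :: "'a \<Rightarrow> real"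
    by (rule EC_measurable[OF C that epow_ennreal_measurable])
  have Em: "(\<lambda>u. expm (Epow p F u)) \<in> borel_measurable borel" if "F \<in> borel_measurable borel" for F :: "'a \<Rightarrow> real"
    by (rule measurable_compose[OF Sm[OF that] expm_measurable])
  have vol: "star_vol (\<lambda>u. epow (Epow p F u) (- 1 / p)) = ennreal (1 / (real ?n * ln 2)) * ennreal (ln 2 / enn2real (exp_const ?n p)) * (lint u. expm (Epow p F u))"
    if "F \<in> borel_measurable borel" for F :: "'a \<Rightarrow> real"
    by (rule star_vol_epow_pos[OF p Sm[OF that] EC_epow_scale[OF C that]])
  \<comment> \<open>The error in \<open>Eexp_ball_le\<close> is uniform on bounded sets of u only.
    The cutoff at \<beta> is decreasing in norm u, so the rearrangement inequality carries it along
    until monotone convergence removes it.\<close>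
  have ball: "(lint u. (if norm u \<le> real \<beta> then 1 else 0) * expm (Epow p f u)) \<le> (lint u. expm (Epow p ?g u))" for \<beta> :: nat
  proof -
    let ?\<psi> = "\<lambda>t::real. if t \<le> real \<beta> then 1 else 0 :: ennreal"
    obtain B where B: "\<And>N u. 0 < N \<Longrightarrow> norm u \<le> real \<beta> \<Longrightarrow> Eexp p N ?g u ^ N \<le> ennreal (exp (B / real N)) * expm (Epow p ?g u)"
      using Eexp_ball_le[OF A1 p, of "real \<beta>"] by auto
    show ?thesis
    proof (rule le_of_exp_perturbation[of 0 _ B])
      fix N :: nat assume N: "0 < N"
      have "(lint u. ?\<psi> (norm u) * expm (Epow p f u)) \<le> (lint u. ?\<psi> (norm u) * (\<Prod>l<N. Eexp p N f u))"
        using expm_le_Eexp[OF f(1,4) p N] by (intro nn_integral_mono mult_left_mono) auto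
      also have "\<dots> \<le> (lint u. ?\<psi> (norm u) * (\<Prod>l<N. Eexp p N ?g u))"
        by (rule prod_EC_le_ball[OF C f(1,2,3) _ A r]) (use f(4) p in \<open>auto intro!: ennreal_leI divide_right_mono powr_mono2\<close>)
      also have "\<dots> \<le> (lint u. ennreal (exp (B / real N)) * expm (Epow p ?g u))"
        using B[OF N] by (intro nn_integral_mono) auto
      also have "\<dots> = ennreal (exp (B / real N)) * (lint u. expm (Epow p ?g u))" using Em[OF g] by (intro nn_integral_cmult) simp
      finally show "(lint u. ?\<psi> (norm u) * expm (Epow p f u)) \<le> ennreal (exp (B / real N)) * (lint u. expm (Epow p ?g u))" .
    qed
  qed
  have "(lint u. expm (Epow p f u)) = (lint u. (SUP \<beta>::nat. (if norm u \<le> real \<beta> then 1 else 0) * expm (Epow p f u)))"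
  proof (rule nn_integral_cong, rule antisym)
    fix u :: 'a
    obtain \<beta> :: nat where "norm u \<le> real \<beta>" using real_arch_simple by blast
    then show "expm (Epow p f u) \<le> (SUP \<beta>::nat. (if norm u \<le> real \<beta> then 1 else 0) * expm (Epow p f u))" by (intro SUP_upper2[of \<beta>]) auto
    show "(SUP \<beta>::nat. (if norm u \<le> real \<beta> then 1 else 0) * expm (Epow p f u)) \<le> expm (Epow p f u)" by (rule SUP_least) auto
  qed
  also have "\<dots> = (SUP \<beta>::nat. \<integral>\<^sup>+u. (if norm u \<le> real \<beta> then 1 else 0) * expm (Epow p f u) \<partial>lborel)"
  proof (rule nn_integral_monotone_convergence_SUP)
    show "incseq (\<lambda>\<beta>::nat. \<lambda>u::'a. (if norm u \<le> real \<beta> then 1 else 0) * expm (Epow p f u))"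
      by (rule incseq_SucI) (auto simp: le_fun_def)
    show "(\<lambda>u. (if norm u \<le> real \<beta> then 1 else 0) * expm (Epow p f u)) \<in> borel_measurable lborel" for \<beta> :: nat
      using Em[OF f(1)] by measurable
  qed
  also have "\<dots> \<le> (lint u. expm (Epow p ?g u))" using ball by (rule SUP_least)
  finally show ?thesis unfolding vol[OF f(1)] vol[OF g] by (intro mult_left_mono) auto
qed

section \<open>Logarithmic means as limits of negative power means\<close>

lemma ln_minus_le_epow:
  assumes q: "0 < q" and t: "0 \<le> t"
  shows "ennreal q * (if t = 0 then \<infinity> else ennreal (max 0 (- ln t))) \<le> epow (ennreal t) (- q)"
proof (cases "t = 0")
  case False
  have "1 + q * (- ln t) \<le> exp (q * (- ln t))" by (rule exp_ge_add_one_self)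
  moreover have "exp (q * (- ln t)) = t powr (- q)" using False t by (simp add: powr_def)
  ultimately have "q * (- ln t) \<le> t powr (- q)" by linarith
  then have "q * max 0 (- ln t) \<le> t powr (- q)" by (cases "0 \<le> - ln t") (simp_all add: max_def)
  then show ?thesis using False t q by (simp add: epow_pos ennreal_mult[symmetric] ennreal_leI)
qed (use q in \<open>auto simp: epow_0\<close>)

abbreviation (input) "ELp f \<equiv> EC m C f (\<lambda>t. ennreal (max 0 (ln t)))"
abbreviation (input) "ELm f \<equiv> EC m C f (\<lambda>t. if t = 0 then \<infinity> else ennreal (max 0 (- ln t)))"

lemma Z_rad_zero_eq:
  fixes f f' :: "'a::euclidean_space \<Rightarrow> real"
  assumes f': "f' \<in> borel_measurable borel" and ae: "AE x in lebesgue. f x = f' x"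
  shows "Z_rad 0 m C f = (\<lambda>u. if ELp f' u = \<infinity> \<and> ELm f' u = \<infinity> then 1 else if ELp f' u = \<infinity> then 0
    else if ELm f' u = \<infinity> then \<infinity> else ennreal (exp (enn2real (ELm f' u) - enn2real (ELp f' u))))"
proof -
  have P: "(\<integral>\<^sup>+x. ennreal (max 0 (ln (supp_fun m C (\<lambda>k. x k \<bullet> u)))) * (\<Prod>k<m. ennreal (f (x k))) \<partial>PiM {..<m} (\<lambda>_. lebesgue)) = ELp f' u" for u
    by (rule Z_integral_eq[OF C f' ae]) measurable
  have Q: "(\<integral>\<^sup>+x. (if supp_fun m C (\<lambda>k. x k \<bullet> u) = 0 then \<infinity> else ennreal (max 0 (- ln (supp_fun m C (\<lambda>k. x k \<bullet> u))))) * (\<Prod>k<m. ennreal (f (x k))) \<partial>PiM {..<m} (\<lambda>_. lebesgue)) = ELm f' u" for u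
    by (rule Z_integral_eq[OF C f' ae]) measurable
  show ?thesis unfolding Z_rad_def Let_def P Q by simp
qed

lemma Z_rad_zero_measurable:
  fixes f f' :: "'a::euclidean_space \<Rightarrow> real"
  assumes f': "f' \<in> borel_measurable borel" and ae: "AE x in lebesgue. f x = f' x"
  shows "Z_rad 0 m C f \<in> borel_measurable borel"
proof -
  have [measurable]: "ELp f' \<in> borel_measurable borel" "ELm f' \<in> borel_measurable borel" by (rule EC_measurable[OF C f'], measurable)+
  show ?thesis unfolding Z_rad_zero_eq[OF assms] by measurable
qed

text \<open>The integrand of \<open>ELm\<close> is infinite at h = 0, so its finiteness forces h > 0
  almost surely, and the two parts become the positive and negative part of one integrable
  function.\<close>

lemma log_moments:
  fixes f :: "'a::euclidean_space \<Rightarrow> real"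
  assumes f: "f \<in> borel_measurable borel" and fin: "ELp f u \<noteq> \<infinity>" "ELm f u \<noteq> \<infinity>"
  shows "integrable (PC m f) (\<lambda>x. - ln (hC m C x u))"
    and "(\<integral>x. - ln (hC m C x u) \<partial>PC m f) = enn2real (ELm f u) - enn2real (ELp f u)"
    and "AE x in PC m f. 0 < hC m C x u"
    and "Epow (- q) f u = (\<integral>\<^sup>+x. ennreal (exp (q * - ln (hC m C x u))) \<partial>PC m f)"
proof -
  note hm[measurable] = hC_measurable_PC
  let ?Y = "\<lambda>x. - ln (hC m C x u)"
  have Q: "ELm f u = (\<integral>\<^sup>+x. (if hC m C x u = 0 then \<infinity> else ennreal (max 0 (?Y x))) \<partial>PC m f)" by (rule EC_PC[OF f]) measurable
  have P: "ELp f u = (\<integral>\<^sup>+x. ennreal (- ?Y x) \<partial>PC m f)"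
    by (subst EC_PC[OF f], measurable, rule nn_integral_cong) (simp add: max_def ennreal_neg)
  have "AE x in PC m f. (if hC m C x u = 0 then \<infinity> else ennreal (max 0 (?Y x))) \<noteq> \<infinity>"
    by (rule nn_integral_noteq_infinite) (use fin(2) Q in auto)
  then show ae: "AE x in PC m f. 0 < hC m C x u"
    by (rule AE_mp) (use hC_nonneg[OF C] in \<open>auto simp: less_le\<close>)
  have Q': "ELm f u = (\<integral>\<^sup>+x. ennreal (?Y x) \<partial>PC m f)" unfolding Q
    by (rule nn_integral_cong_AE, rule AE_mp[OF ae]) (auto simp: max_def ennreal_neg)
  show i: "integrable (PC m f) ?Y" using fin P Q' by (auto simp: real_integrable_def)
  show "(\<integral>x. ?Y x \<partial>PC m f) = enn2real (ELm f u) - enn2real (ELp f u)" unfolding P Q' by (rule real_lebesgue_integral_def[OF i])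
  have "Epow (- q) f u = (\<integral>\<^sup>+x. epow (ennreal (hC m C x u)) (- q) \<partial>PC m f)" by (rule EC_PC[OF f epow_ennreal_measurable])
  also have "\<dots> = (\<integral>\<^sup>+x. ennreal (exp (q * ?Y x)) \<partial>PC m f)"
    by (rule nn_integral_cong_AE, rule AE_mp[OF ae]) (auto simp: epow_pos powr_def)
  finally show "Epow (- q) f u = (\<integral>\<^sup>+x. ennreal (exp (q * ?Y x)) \<partial>PC m f)" .
qed

lemma ELm_le:
  fixes f :: "'a::euclidean_space \<Rightarrow> real"
  assumes f: "f \<in> borel_measurable borel" and q: "0 < q"
  shows "ennreal q * ELm f u \<le> Epow (- q) f u"
proof -
  note hC_measurable_PC[measurable]
  have "ennreal q * ELm f u = (\<integral>\<^sup>+x. ennreal q * (if hC m C x u = 0 then \<infinity> else ennreal (max 0 (- ln (hC m C x u)))) \<partial>PC m f)"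
    by (subst EC_PC[OF f], measurable, rule nn_integral_cmult[symmetric]) measurable
  also have "\<dots> \<le> (\<integral>\<^sup>+x. epow (ennreal (hC m C x u)) (- q) \<partial>PC m f)"
    by (intro nn_integral_mono ln_minus_le_epow q hC_nonneg[OF C])
  also have "\<dots> = Epow (- q) f u" by (rule EC_PC[OF f epow_ennreal_measurable, symmetric])
  finally show ?thesis .
qed

text \<open>By Jensen the geometric mean of 1 / h is at most its power mean. Where the negative part
  of ln h has infinite expectation the right-hand side is \<infinity> by \<open>ELm_le\<close>,
  which also covers the default value 1 when both parts diverge.\<close>

lemma Z_rad_zero_le:
  fixes f f' :: "'a::euclidean_space \<Rightarrow> real"
  assumes f: "f' \<in> borel_measurable borel" "(lint x. ennreal (f' x)) = 1" and ae: "AE x in lebesgue. f x = f' x" and q: "0 < q"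
  shows "Z_rad 0 m C f u \<le> epow (Epow (- q) f' u) (1 / q)"
proof -
  interpret prob_space "PC m f'" by (rule prob_space_PC[OF f])
  consider "ELm f' u = \<infinity>" | "ELm f' u \<noteq> \<infinity>" "ELp f' u = \<infinity>" | "ELm f' u \<noteq> \<infinity>" "ELp f' u \<noteq> \<infinity>" by blast
  then show ?thesis
  proof cases
    case 1
    have "Epow (- q) f' u = top" using ELm_le[OF f(1) q, of u] q unfolding 1 by (simp add: ennreal_mult_top top_unique)
    then show ?thesis using q by (simp add: epow_top')
  next
    case 2 then show ?thesis by (simp add: Z_rad_zero_eq[OF f(1) ae])
  next
    case 3
    let ?E = "\<integral>x. - ln (hC m C x u) \<partial>PC m f'"
    note l = log_moments[OF f(1) 3(2,1)]
    have "Z_rad 0 m C f u = epow (ennreal (exp (\<integral>x. q * - ln (hC m C x u) \<partial>PC m f'))) (1 / q)"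
      using 3 q l(1,2) by (simp add: Z_rad_zero_eq[OF f(1) ae] epow_pos powr_def)
    also have "\<dots> \<le> epow (Epow (- q) f' u) (1 / q)" unfolding l(4)
      using l(1) q by (intro epow_mono exp_integral_le) auto
    finally show ?thesis .
  qed
qed

text \<open>The exponent 1/2 is below 1, so |t|^(-1/2) is integrable near 0 and the inner product of
  a single point with u bounds the moment. Reflecting u to a basis vector makes the bound the same
  for all unit vectors u.\<close>

lemma Epow_half_ball:
  fixes A :: real
  assumes A: "(lint x. ennreal (A * indicator (cball (0::'a::euclidean_space) r) x)) = 1" and m: "0 < m"
  shows "\<exists>K\<ge>0. \<forall>u. norm u = 1 \<longrightarrow> Epow (- (1 / 2)) (\<lambda>x. A * indicator (cball (0::'a) r) x) u \<le> ennreal K"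
proof -
  let ?g = "\<lambda>x. A * indicator (cball (0::'a) r) x"
  have g[measurable]: "?g \<in> borel_measurable borel" by measurable
  note hC_measurable_PC[measurable] epow_ennreal_measurable[measurable]
  obtain e where e: "0 < e" "\<And>y. e * \<bar>y 0\<bar> \<le> supp_fun m C y" using supp_lower[OF C] m by blast
  define w where "w t = epow (ennreal (e * \<bar>t\<bar>)) (- (1 / 2))" for t
  have wm[measurable]: "w \<in> borel_measurable borel" unfolding w_def by measurable
  define J where "J u = (lint x. w (x \<bullet> u) * ennreal (?g x))" for u :: 'a
  obtain b :: 'a where b: "b \<in> Basis" using nonempty_Basis by blast
  have "Epow (- (1 / 2)) ?g u \<le> J b" if u: "norm u = 1" for u :: 'a
  proof -
    have "Epow (- (1 / 2)) ?g u = (\<integral>\<^sup>+x. epow (ennreal (hC m C x u)) (- (1 / 2)) \<partial>PC m ?g)" by (rule EC_PC[OF g epow_ennreal_measurable])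
    also have "\<dots> \<le> (\<integral>\<^sup>+x. w (x 0 \<bullet> u) \<partial>PC m ?g)" unfolding w_def hC_def[OF C]
      using e(2) by (intro nn_integral_mono epow_antimono ennreal_leI) auto
    also have "\<dots> = J u" unfolding J_def by (rule PC_component[OF g A _ m, where w="\<lambda>x. w (x \<bullet> u)"]) measurable
    also have "J u = (lint x. w (reflect (u - b) x \<bullet> b) * ennreal (?g (reflect (u - b) x)))"
    proof -
      have "reflect (u - b) u = b" using u b by (intro reflect_swap) simp
      then have "reflect (u - b) x \<bullet> b = x \<bullet> u" for x using reflect_inner[of "u - b" x u] by simp
      then show ?thesis by (simp add: J_def indicator_def norm_reflect)
    qed
    also have "\<dots> = J b" unfolding J_def by (rule nn_integral_reflect) measurable
    finally show ?thesis .
  qed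
  moreover have "J b < top"
  proof -
    let ?c = "\<lambda>t::real. if \<bar>t\<bar> \<le> r then 1 else 0 :: ennreal"
    \<comment> \<open>The ball is enlarged to a cube, over which the majorant factors into
      coordinates and only coordinate b carries the singularity.\<close>
    define F where "F i = (if i = b then (\<lambda>t. w t * ?c t) else ?c)" for i :: 'a
    have Fm: "F i \<in> borel_measurable borel" for i unfolding F_def by (cases "i = b") auto
    define G where "G s = (if 0 < s \<and> ennreal s \<le> ennreal r then ennreal (s powr (1 / 2 - 1)) else 0)" for s
    have Gm[measurable]: "G \<in> borel_measurable borel" unfolding G_def by measurable
    have G: "(lint s. G s) < top"
    proof -
      have "epow (ennreal r) (1 / 2) < top" by (auto simp: epow_def)
      then show ?thesis unfolding G_def by (subst nn_integral_powr_below) (auto simp: ennreal_mult_less_top)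
    qed
    have "(lint t. w t * ?c t) \<le> (lint t. ennreal (e powr (- (1 / 2))) * (G t + G (- t)))"
    proof (rule nn_integral_mono_AE, rule AE_mp[OF AE_lborel_singleton[of 0]], intro AE_I2 impI)
      fix t :: real assume t: "t \<noteq> 0"
      have "w t = ennreal (e powr (- (1 / 2))) * ennreal (\<bar>t\<bar> powr (- (1 / 2)))" using t e(1) by (simp add: w_def epow_pos epow_scale ennreal_mult)
      moreover have "ennreal (\<bar>t\<bar> powr (- (1 / 2))) * ?c t \<le> G t + G (- t)"
        using t by (cases "0 < t") (auto simp: G_def intro: ennreal_leI)
      ultimately show "w t * ?c t \<le> ennreal (e powr (- (1 / 2))) * (G t + G (- t))" by (simp only: mult.assoc) (rule mult_left_mono, auto)
    qed
    also have "\<dots> = ennreal (e powr (- (1 / 2))) * ((lint t. G t) + (lint t. G (- t)))"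
      by (simp add: nn_integral_cmult nn_integral_add)
    also have "(lint t. G (- t)) = (lint t. G t)" using nn_integral_real_affine[of G "-1" 0] by simp
    also have "ennreal (e powr (- (1 / 2))) * ((lint t. G t) + (lint t. G t)) < top" using G by (simp add: ennreal_mult_less_top)
    finally have Fb: "(lint t. w t * ?c t) < top" .
    have "?c = indicator {-r..r}" by (auto simp: fun_eq_iff indicator_def abs_le_iff)
    then have "(lint t. ?c t) = emeasure lborel {-r..r}" by simp
    then have "(lint t. F i t) < top" for i using Fb by (simp add: F_def emeasure_lborel_Icc_eq)
    then have fin: "(\<Prod>i\<in>Basis. \<integral>\<^sup>+t. F i t \<partial>lborel) < top" by (intro prod_less_top) auto
    have "J b \<le> (lint x. ennreal \<bar>A\<bar> * (\<Prod>i\<in>Basis. F i (x \<bullet> i)))" unfolding J_def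
    proof (rule nn_integral_mono)
      fix x :: 'a
      show "w (x \<bullet> b) * ennreal (?g x) \<le> ennreal \<bar>A\<bar> * (\<Prod>i\<in>Basis. F i (x \<bullet> i))"
      proof (cases "norm x \<le> r")
        case True
        then have c: "?c (x \<bullet> i) = 1" if "i \<in> Basis" for i using Basis_le_norm[OF that, of x] by simp
        have "(\<Prod>i\<in>Basis. F i (x \<bullet> i)) = F b (x \<bullet> b) * (\<Prod>i\<in>Basis - {b}. F i (x \<bullet> i))" by (rule prod.remove[OF _ b]) simp
        also have "(\<Prod>i\<in>Basis - {b}. F i (x \<bullet> i)) = 1" by (rule prod.neutral) (use c in \<open>auto simp: F_def\<close>)
        finally have "(\<Prod>i\<in>Basis. F i (x \<bullet> i)) = w (x \<bullet> b)" using c[OF b] by (simp add: F_def)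
        moreover have "w (x \<bullet> b) * ennreal (?g x) \<le> w (x \<bullet> b) * ennreal \<bar>A\<bar>" using True by (intro mult_left_mono ennreal_leI) auto
        ultimately show ?thesis by (simp add: mult.commute)
      qed simp
    qed
    also have "\<dots> = ennreal \<bar>A\<bar> * (lint x. (\<Prod>i\<in>Basis. F i (x \<bullet> i)))"
      by (intro nn_integral_cmult borel_measurable_prod_ennreal measurable_compose[OF _ Fm]) auto
    also have "(lint x. (\<Prod>i\<in>Basis. F i (x \<bullet> i))) = (\<Prod>i\<in>Basis. \<integral>\<^sup>+t. F i t \<partial>lborel)"
      by (rule nn_integral_lborel_prod[OF Fm]) simp
    finally show ?thesis using fin by (simp add: ennreal_mult_less_top order_le_less_trans)
  qed
  ultimately show ?thesis by (intro exI[of _ "enn2real (J b)"]) auto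
qed

text \<open>The converse of \<open>Z_rad_zero_le\<close> for the ball density, up to exp(q D) with D
  the same for all unit vectors u. The remainder in \<open>exp_integral_ge\<close> is controlled by
  the moment of order -1/2 where h \<le> 1 and by the upper bound B of ln h elsewhere.\<close>

lemma Z_rad_zero_ball_ge:
  fixes A :: real
  assumes A: "(lint x. ennreal (A * indicator (cball (0::'a::euclidean_space) r) x)) = 1" and m: "0 < m"
  shows "\<exists>D. \<forall>q u. 0 < q \<and> q \<le> 1 / 4 \<and> norm u = 1 \<longrightarrow> epow (Epow (- q) (\<lambda>x. A * indicator (cball (0::'a) r) x) u) (1 / q)
    \<le> ennreal (exp (q * D)) * Z_rad 0 m C (\<lambda>x. A * indicator (cball (0::'a) r) x) u"
proof -
  let ?g = "\<lambda>x. A * indicator (cball (0::'a) r) x"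
  have g: "?g \<in> borel_measurable borel" by measurable
  interpret prob_space "PC m ?g" by (rule prob_space_PC[OF g A])
  note hC_measurable_PC[measurable] epow_ennreal_measurable[measurable]
  obtain K where K: "0 \<le> K" "\<And>u. norm u = 1 \<Longrightarrow> Epow (- (1 / 2)) ?g u \<le> ennreal K" using Epow_half_ball[OF A m] by blast
  obtain B0 where B0: "0 \<le> B0" "\<And>x (u::'a). \<forall>j<m. norm (x j) \<le> r \<Longrightarrow> hC m C x u \<le> B0 * norm u" using hC_le_ball[of r] by blast
  define B where "B = ln (B0 + 1)"
  have B: "0 \<le> B" using B0(1) by (simp add: B_def)
  \<comment> \<open>For y = - ln h \<ge> 0 one has y^2 \<le> 64 exp(y / 4), so q \<le> 1/4 gives y^2
    exp(q y) \<le> 64 exp(y / 2) = 64 h^(-1/2), with expectation at most 64 K. For y < 0 one has y^2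
    \<le> B^2.\<close>
  define D where "D = 64 * K + B\<^sup>2"
  have "epow (Epow (- q) ?g u) (1 / q) \<le> ennreal (exp (q * D)) * Z_rad 0 m C ?g u" if q: "0 < q" "q \<le> 1 / 4" and u: "norm u = 1" for q and u :: 'a
  proof -
    let ?h = "\<lambda>x. hC m C x u"
    have aeB: "AE x in PC m ?g. ln (?h x) \<le> B"
    proof (rule AE_mp[OF AE_PC_ball], intro AE_I2 impI)
      fix x :: "nat \<Rightarrow> 'a" assume "\<forall>j<m. norm (x j) \<le> r"
      then have "?h x \<le> B0 + 1" using B0(2)[of x u] u by simp
      then show "ln (?h x) \<le> B" using hC_nonneg[OF C, of x u] B by (cases "?h x = 0") (auto simp: B_def less_le)
    qed
    have Q: "ELm ?g u \<noteq> \<infinity>"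
    proof
      assume 1: "ELm ?g u = \<infinity>"
      have "Epow (- (1 / 2)) ?g u = top" using ELm_le[OF g, of "1 / 2" u] unfolding 1 by (simp add: ennreal_mult_top top_unique)
      then show False using K(2)[OF u] by (simp add: top_unique)
    qed
    have "ELp ?g u = (\<integral>\<^sup>+x. ennreal (max 0 (ln (?h x))) \<partial>PC m ?g)" by (rule EC_PC[OF g]) measurable
    also have "\<dots> \<le> (\<integral>\<^sup>+x. ennreal B \<partial>PC m ?g)" by (rule nn_integral_mono_AE, rule AE_mp[OF aeB]) (auto intro: ennreal_leI simp: B)
    finally have P: "ELp ?g u \<noteq> \<infinity>" by (auto simp: emeasure_space_1 top_unique)
    note l = log_moments[OF g P Q]
    have "(\<integral>\<^sup>+x. ennreal ((- ln (?h x))\<^sup>2 * exp (max 0 (q * - ln (?h x)))) \<partial>PC m ?g) \<le> (\<integral>\<^sup>+x. 64 * epow (ennreal (?h x)) (- (1 / 2)) + ennreal (B\<^sup>2) \<partial>PC m ?g)"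
    proof (rule nn_integral_mono_AE, rule AE_mp[OF aeB], rule AE_mp[OF l(3)], intro AE_I2 impI)
      fix x :: "nat \<Rightarrow> 'a" assume h: "0 < ?h x" "ln (?h x) \<le> B"
      define y where "y = - ln (?h x)"
      have hy: "?h x powr (- (1 / 2)) = exp (y / 2)" using h by (simp add: powr_def y_def)
      have "y\<^sup>2 * exp (max 0 (q * y)) \<le> 64 * exp (y / 2) + B\<^sup>2"
      proof (cases "0 \<le> y")
        case True
        have "y / 8 \<le> exp (y / 8)" using exp_ge_add_one_self[of "y / 8"] by linarith
        then have "(y / 8)\<^sup>2 \<le> (exp (y / 8))\<^sup>2" using True by (intro power_mono) auto
        also have "(exp (y / 8))\<^sup>2 = exp (y / 4)" by (simp add: power2_eq_square mult_exp_exp)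
        finally have 1: "y\<^sup>2 \<le> 64 * exp (y / 4)" by (simp add: power_divide)
        have "max 0 (q * y) \<le> y / 4" using True q mult_right_mono[OF q(2) True] by simp
        then have "y\<^sup>2 * exp (max 0 (q * y)) \<le> (64 * exp (y / 4)) * exp (y / 4)" using 1 by (intro mult_mono) auto
        also have "\<dots> = 64 * exp (y / 2)" by (simp add: mult_exp_exp)
        finally show ?thesis by (smt (verit) zero_le_power2)
      next
        case False
        then have "y\<^sup>2 \<le> B\<^sup>2" using h(2) by (intro iffD1[OF abs_le_square_iff]) (simp add: y_def)
        moreover have "max 0 (q * y) = 0" using False q by (simp add: max_def mult_le_0_iff zero_le_mult_iff)
        ultimately show ?thesis by (simp add: add_increasing)
      qed
      then have "ennreal (y\<^sup>2 * exp (max 0 (q * y))) \<le> ennreal (64 * exp (y / 2) + B\<^sup>2)" by (rule ennreal_leI)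
      also have "\<dots> = 64 * epow (ennreal (?h x)) (- (1 / 2)) + ennreal (B\<^sup>2)" using h(1) by (simp add: epow_pos hy ennreal_mult)
      finally show "ennreal ((- ln (?h x))\<^sup>2 * exp (max 0 (q * - ln (?h x)))) \<le> 64 * epow (ennreal (?h x)) (- (1 / 2)) + ennreal (B\<^sup>2)" by (simp only: y_def)
    qed
    also have "\<dots> = 64 * (\<integral>\<^sup>+x. epow (ennreal (?h x)) (- (1 / 2)) \<partial>PC m ?g) + ennreal (B\<^sup>2)"
      by (simp add: nn_integral_add nn_integral_cmult emeasure_space_1)
    also have "(\<integral>\<^sup>+x. epow (ennreal (?h x)) (- (1 / 2)) \<partial>PC m ?g) = Epow (- (1 / 2)) ?g u" by (rule EC_PC[OF g epow_ennreal_measurable, symmetric])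
    also have "64 * Epow (- (1 / 2)) ?g u + ennreal (B\<^sup>2) \<le> 64 * ennreal K + ennreal (B\<^sup>2)" by (intro add_mono mult_left_mono K(2)[OF u]) auto
    also have "\<dots> = ennreal D" using K(1) by (simp add: D_def ennreal_mult)
    finally have "Epow (- q) ?g u \<le> ennreal (exp (q * (\<integral>x. - ln (?h x) \<partial>PC m ?g) + q\<^sup>2 * D))"
      unfolding l(4) using K(1) by (intro exp_integral_ge l(1)) (auto simp: D_def)
    then have "epow (Epow (- q) ?g u) (1 / q) \<le> epow (ennreal (exp (q * (\<integral>x. - ln (?h x) \<partial>PC m ?g) + q\<^sup>2 * D))) (1 / q)"
      using q by (intro epow_mono) auto
    also have "\<dots> = ennreal (exp (q * D + (\<integral>x. - ln (?h x) \<partial>PC m ?g)))"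
      using q by (simp add: epow_pos powr_def field_simps power2_eq_square)
    also have "\<dots> = ennreal (exp (q * D)) * Z_rad 0 m C ?g u"
      using P Q l(2) by (simp add: Z_rad_zero_eq[OF g] exp_add ennreal_mult)
    finally show ?thesis .
  qed
  then show ?thesis by blast
qed

text \<open>The chain is |Z_0(f)| \<le> |Z_(-q)(f)| \<le> |Z_(-q)(g)| \<le> exp(n q D) |Z_0(g)| with
  q = n / k, where g is the ball density and k tends to infinity.\<close>

lemma Z_vol_zero_le:
  fixes f f' :: "'a::euclidean_space \<Rightarrow> real"
  assumes f: "f' \<in> borel_measurable borel" "\<And>x. 0 \<le> f' x" "\<And>x. f' x \<le> A" "(lint x. ennreal (f' x)) = 1"
    and ae: "AE x in lebesgue. f x = f' x"
    and A: "ennreal A * emeasure lborel (cball (0::'a) r) = 1" and A1: "(lint x. ennreal (A * indicator (cball (0::'a) r) x)) = 1"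
    and r: "0 \<le> r" and m: "0 < m"
  shows "Z_vol 0 m C f \<le> Z_vol 0 m C (\<lambda>x. A * indicator (cball (0::'a) r) x)"
proof -
  let ?g = "\<lambda>x. A * indicator (cball (0::'a) r) x" and ?n = "DIM('a)"
  have g: "?g \<in> borel_measurable borel" by measurable
  obtain D where D: "\<And>q u. 0 < q \<Longrightarrow> q \<le> 1 / 4 \<Longrightarrow> norm u = 1 \<Longrightarrow> epow (Epow (- q) ?g u) (1 / q) \<le> ennreal (exp (q * D)) * Z_rad 0 m C ?g u"
    using Z_rad_zero_ball_ge[OF A1 m] by blast
  have Em: "(\<lambda>u. epow (Epow p F u) q) \<in> borel_measurable borel" if "F \<in> borel_measurable borel" for F :: "'a \<Rightarrow> real" and p q
    by (rule measurable_compose[OF EC_measurable[OF C that epow_ennreal_measurable] epow_measurable])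
  show ?thesis unfolding Z_vol_def
  proof (rule le_of_exp_perturbation[of "4 * ?n" _ "real ?n * real ?n * D"])
    fix k assume k: "4 * ?n < k"
    \<comment> \<open>k > 4 n puts q below 1/4, as \<open>Z_rad_zero_ball_ge\<close> asks, and k q =
      n admits the case of negative exponents.\<close>
    define q where "q = real ?n / real k"
    have q: "0 < q" "q \<le> 1 / 4" "real k * q = real ?n" using k by (auto simp: q_def field_simps)
    have "star_vol (Z_rad 0 m C f) \<le> ennreal 1 ^ ?n * star_vol (\<lambda>u. epow (Epow (- q) f' u) (1 / q))"
      using Z_rad_zero_le[OF f(1,4) ae q(1)] by (intro star_vol_mono_scale Z_rad_zero_measurable[OF f(1) ae] Em f(1)) auto
    also have "\<dots> \<le> star_vol (\<lambda>u. epow (Epow (- q) ?g u) (1 / q))"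
      using star_vol_neg_le[OF C f(1,2,3) _ A r _ q(1,3)] f(4) k by simp
    also have "\<dots> \<le> ennreal (exp (q * D)) ^ ?n * star_vol (Z_rad 0 m C ?g)"
      using D[OF q(1,2)] by (intro star_vol_mono_scale Z_rad_zero_measurable[OF g] Em g) auto
    also have "ennreal (exp (q * D)) ^ ?n = ennreal (exp (real ?n * real ?n * D / real k))"
      by (simp add: ennreal_power exp_of_nat_mult[symmetric] q_def mult_ac)
    finally show "star_vol (Z_rad 0 m C f) \<le> ennreal (exp (real ?n * real ?n * D / real k)) * star_vol (Z_rad 0 m C ?g)" .
  qed
qed

end

lemma Z_vol_le:
  fixes f :: "'a::euclidean_space \<Rightarrow> real"
  assumes f: "in_Pn f" and r: "0 < r" and g1: "(\<integral>\<^sup>+x. ennreal (ball_rearr f r x) \<partial>lebesgue) = 1"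
    and C: "unconditional_body m C" and m: "0 < m"
    and p: "0 \<le> p \<or> (\<exists>k>0. real k * (- p) = real DIM('a))"
  shows "Z_vol p m C f \<le> Z_vol p m C (ball_rearr f r)"
proof -
  let ?A = "linf_norm f" and ?g = "\<lambda>x. linf_norm f * indicator (cball (0::'a) r) x"
  obtain f' where f': "f' \<in> borel_measurable borel" "\<And>x. 0 \<le> f' x" "\<And>x. f' x \<le> ?A" "(lint x. ennreal (f' x)) = 1"
    and ae: "AE x in lebesgue. f x = f' x" and A: "ennreal ?A * emeasure lborel (cball (0::'a) r) = 1"
    by (rule in_Pn_borel_version[OF f g1]) (rule that)
  have g: "?g \<in> borel_measurable borel" by measurable
  have A1: "(lint x. ennreal (?g x)) = 1" using g1 unfolding ball_rearr_def nn_integral_completion .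
  have f1: "(lint x. ennreal (f' x)) \<le> 1" using f'(4) by simp
  consider "p = 0" | "0 < p" | "p < 0" by linarith
  then show ?thesis unfolding ball_rearr_def
  proof cases
    case 1 then show "Z_vol p m C f \<le> Z_vol p m C ?g" using Z_vol_zero_le[OF C f' ae A A1 less_imp_le[OF r] m] by simp
  next
    case 2 then show "Z_vol p m C f \<le> Z_vol p m C ?g"
      unfolding Z_vol_def using star_vol_pos_le[OF C f' A A1 less_imp_le[OF r], of p] by (simp add: Z_rad_eq[OF C f'(1) ae] Z_rad_eq[OF C g])
  next
    case 3
    then obtain k where k: "0 < k" "real k * (- p) = real DIM('a)" using p by auto
    have "Z_rad p m C f = (\<lambda>u. epow (EC m C f' (\<lambda>t. epow (ennreal t) (- (- p))) u) (1 / (- p)))"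
      "Z_rad p m C ?g = (\<lambda>u. epow (EC m C ?g (\<lambda>t. epow (ennreal t) (- (- p))) u) (1 / (- p)))"
      using 3 by (simp_all add: Z_rad_eq[OF C f'(1) ae] Z_rad_eq[OF C g])
    then show "Z_vol p m C f \<le> Z_vol p m C ?g"
      unfolding Z_vol_def by (simp only:) (rule star_vol_neg_le[OF C f'(1-3) f1 A less_imp_le[OF r] k(1) _ k(2)], use 3 in simp)
  qed
qed

theorem theorem2p6:
  fixes f :: "'a::euclidean_space \<Rightarrow> real" and r p :: real
  assumes f: "in_Pn f"
    and r: "0 < r"
    and g1: "(\<integral>\<^sup>+x. ennreal (ball_rearr f r x) \<partial>lebesgue) = 1"
    and hp: "(0 \<le> p \<and> p \<le> 1) \<or> (-1 \<le> p \<and> p < 0 \<and> real DIM('a) / \<bar>p\<bar> \<in> \<nat>)"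
  shows
    "(\<forall>m C. 1 \<le> m \<and> unconditional_body m C \<and> -1 < p \<longrightarrow>
        Z_vol p m C f \<le> Z_vol p m C (ball_rearr f r))
     \<and> (\<forall>\<alpha> N. p < 0 \<and> 0 < \<alpha> \<and> DIM('a) + 1 \<le> N \<longrightarrow>
        I_exp_vol \<bar>p\<bar> \<alpha> N f \<le> I_exp_vol \<bar>p\<bar> \<alpha> N (ball_rearr f r))
     \<and> (\<forall>N m F R Cs. DIM('a) < N \<and>
          (\<forall>i<N. \<forall>j<m i. in_Pn (F i j :: 'a \<Rightarrow> real) \<and> 0 < R i j \<and>
              (\<integral>\<^sup>+x. ennreal (ball_rearr (F i j) (R i j) x) \<partial>lebesgue) = 1) \<and>
          (\<forall>i<N. 1 \<le> m i \<and> unconditional_body (m i) (Cs i)) \<and>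
          (p < 0 \<longrightarrow> (\<forall>i<N. DIM('a) + 1 \<le> m i)) \<longrightarrow>
        ZZ_exp_vol p N m Cs F \<le> ZZ_exp_vol p N m Cs (\<lambda>i j. ball_rearr (F i j) (R i j)))"
proof -
  have p: "0 \<le> p \<or> (\<exists>k>0. real k * (- p) = real DIM('a))"
  proof (cases "0 \<le> p")
    case False
    then have "p < 0" "real DIM('a) / \<bar>p\<bar> \<in> \<nat>" using hp by auto
    then obtain k :: nat where k: "real DIM('a) / \<bar>p\<bar> = real k" by (auto elim: Nats_cases)
    then have "real k * (- p) = real DIM('a)" using \<open>p < 0\<close> by (simp add: field_simps)
    moreover from this have "0 < k" by (cases "k = 0") auto
    ultimately show ?thesis by blast
  qed simp
  show ?thesis
  proof (intro conjI allI impI)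
    fix m and C :: "(nat \<Rightarrow> real) set" assume "1 \<le> m \<and> unconditional_body m C \<and> -1 < p"
    then show "Z_vol p m C f \<le> Z_vol p m C (ball_rearr f r)" by (intro Z_vol_le[OF f r g1 _ _ p]) auto
  next
    fix \<alpha> :: real and N assume a: "p < 0 \<and> 0 < \<alpha> \<and> DIM('a) + 1 \<le> N"
    then obtain k where "0 < k" "real k * \<bar>p\<bar> = real DIM('a)" using p by auto
    with a show "I_exp_vol \<bar>p\<bar> \<alpha> N f \<le> I_exp_vol \<bar>p\<bar> \<alpha> N (ball_rearr f r)"
      by (intro I_exp_vol_le[OF f r g1]) auto
  next
    fix N m and F :: "nat \<Rightarrow> nat \<Rightarrow> 'a \<Rightarrow> real" and R Cs
    assume a: "DIM('a) < N \<and>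
      (\<forall>i<N. \<forall>j<m i. in_Pn (F i j) \<and> 0 < R i j \<and> (\<integral>\<^sup>+x. ennreal (ball_rearr (F i j) (R i j) x) \<partial>lebesgue) = 1) \<and>
      (\<forall>i<N. 1 \<le> m i \<and> unconditional_body (m i) (Cs i)) \<and> (p < 0 \<longrightarrow> (\<forall>i<N. DIM('a) + 1 \<le> m i))"
    show "ZZ_exp_vol p N m Cs F \<le> ZZ_exp_vol p N m Cs (\<lambda>i j. ball_rearr (F i j) (R i j))"
      by (rule ZZ_exp_vol_le[OF _ _ _ p]) (use a in auto)
  qed
qed

end
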